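(* Let $m\ge 1$ be an integer, $Q=2m+2$ and $0<\lambda<Q$. For every $p>\frac{2Q}{2Q-\lambda}$, with $p'=p/(p-1)$, the supremum $$\Lambda_p=\sup\left\{\|I_\lambda f\|_{p'} : f\in L^p(\mathbb{S}^{2m+1}),\ \|f\|_p=1\right\}$$ is attained by some nonnegative function. Moreover, if for each such $p$ a nonnegative function $u_p\in L^p(\mathbb{S}^{2m+1})$ with $\|u_p\|_p=1$ and $\|I_\lambda u_p\|_{p'}=\Lambda_p$ is chosen, then $u_p$ converges to a constant function in $L^{\frac{2Q}{2Q-\lambda}}(\mathbb{S}^{2m+1})$ as $p\searrow \frac{2Q}{2Q-\lambda}$.
   Context: $\mathbb{S}^{2m+1}=\{z\in\mathbb{C}^{m+1}:|z|=1\}$ is equipped with its standard (unnormalized) surface measure $d\sigma$; all $L^r$ norms $\|\cdot\|_r$ are with respect to $d\sigma$. For $\xi,\eta\in\mathbb{C}^{m+1}$, $\xi\cdot\overline{\eta}=\sum_i \xi_i\overline{\eta_i}$. The operator $I_\lambda$ is $$I_\lambda f(\xi)=\int_{\mathbb{S}^{2m+1}}\frac{f(\eta)}{|1-\xi\cdot\overline{\eta}|^{\lambda/2}}\,d\sigma(\eta).$$ *)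

theory Defs
  imports "HOL-Analysis.Analysis"
begin

text \<open>
  Surface measure on the unit sphere, in polar coordinates: the measure of a Borel set
  \<open>A\<close> is the dimension of the ambient space times the Lebesgue measure of the cone
  \<open>{r *\<^sub>R x | 0 < r < 1, x \<in> A}\<close>; see the first lemma below.
\<close>

definition sphere_measure :: "'a::euclidean_space measure"
  where "sphere_measure =
    scale_measure (of_nat DIM('a))
      (distr (restrict_space lborel (ball 0 1 - {0}))
             (restrict_space borel (sphere 0 1))
             (\<lambda>x. x /\<^sub>R norm x))"

lemma emeasure_sphere_measure:
  fixes A :: "'a::euclidean_space set"
  assumes "A \<in> sets borel" "A \<subseteq> sphere 0 1"
  shows "emeasure sphere_measure A =
    of_nat DIM('a) * emeasure lborel {r *\<^sub>R x | r x. 0 < r \<and> r < 1 \<and> x \<in> A}"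
proof -
  have meas: "(\<lambda>x::'a. x /\<^sub>R norm x) \<in>
      restrict_space lborel (ball 0 1 - {0}) \<rightarrow>\<^sub>M restrict_space borel (sphere 0 1)"
    by (rule measurable_restrict_space2)
       (auto simp: space_restrict_space intro!: measurable_restrict_space1)
  have A: "A \<in> sets (restrict_space borel (sphere 0 1))"
    using assms by (auto simp: sets_restrict_space)
  have eq: "(\<lambda>x::'a. x /\<^sub>R norm x) -` A \<inter> (ball 0 1 - {0}) =
      {r *\<^sub>R x | r x. 0 < r \<and> r < 1 \<and> x \<in> A}" (is "?L = ?R")
  proof (intro set_eqI iffI)
    fix y assume y: "y \<in> ?L"
    then have "y = norm y *\<^sub>R (y /\<^sub>R norm y)" by auto
    with y show "y \<in> ?R"
      by (simp del: scaleR_scaleR) (metis zero_less_norm_iff)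
  next
    fix y assume "y \<in> ?R"
    then obtain r x where "y = r *\<^sub>R x" "0 < r" "r < 1" "x \<in> A" by auto
    moreover from \<open>x \<in> A\<close> assms(2) have "norm x = 1" by auto
    ultimately show "y \<in> ?L" by auto
  qed
  show ?thesis
    unfolding sphere_measure_def
    by (simp add: emeasure_distr[OF meas A] space_restrict_space eq[symmetric]
        emeasure_restrict_space)
qed

lemma space_sphere_measure [simp]: "space sphere_measure = sphere 0 1"
  by (simp add: sphere_measure_def space_scale_measure space_restrict_space)

lemma sets_sphere_measure [simp, measurable_cong]:
  "sets sphere_measure = sets (restrict_space borel (sphere 0 1))"
  by (simp add: sphere_measure_def)

text \<open>The \<open>L\<^sup>p\<close> norm takes values in \<open>[0, \<infinity>]\<close>; the exponent is meant to be positive and finite.\<close>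

definition Lp_norm :: "'a measure \<Rightarrow> real \<Rightarrow> ('a \<Rightarrow> 'b::real_normed_vector) \<Rightarrow> ennreal"
  where "Lp_norm M p f =
    (let J = \<integral>\<^sup>+ x. ennreal (norm (f x) powr p) \<partial>M
     in if J = \<infinity> then \<infinity> else ennreal (enn2real J powr (1 / p)))"

definition Lp_space :: "'a measure \<Rightarrow> real \<Rightarrow> ('a \<Rightarrow> 'b::real_normed_vector) set"
  where "Lp_space M p = {f \<in> borel_measurable M. Lp_norm M p f < \<infinity>}"

definition hermitian_prod :: "complex ^ 'n \<Rightarrow> complex ^ 'n \<Rightarrow> complex"
  where "hermitian_prod \<xi> \<eta> = (\<Sum>i\<in>UNIV. \<xi> $ i * cnj (\<eta> $ i))"

definition I_op ::
  "real \<Rightarrow> (complex ^ 'n \<Rightarrow> 'b::{banach, second_countable_topology}) \<Rightarrow> complex ^ 'n \<Rightarrow> 'b"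
  where "I_op lam f \<xi> =
    (LINT \<eta>|sphere_measure. f \<eta> /\<^sub>R (cmod (1 - hermitian_prod \<xi> \<eta>) powr (lam / 2)))"

text \<open>The supremum is over complex-valued \<open>f\<close> and is taken in \<open>[0, \<infinity>]\<close>.\<close>

definition I_sup :: "'n::finite itself \<Rightarrow> real \<Rightarrow> real \<Rightarrow> ennreal"
  where "I_sup _ lam p =
    (SUP f \<in> {f :: complex ^ 'n \<Rightarrow> complex.
                f \<in> Lp_space sphere_measure p \<and> Lp_norm sphere_measure p f = 1}.
       Lp_norm sphere_measure (p / (p - 1)) (I_op lam f))"

text \<open>As usual for elements of \<open>L\<^sup>p\<close>, nonnegativity is understood almost everywhere.\<close>

definition nonneg_maximizer :: "real \<Rightarrow> real \<Rightarrow> (complex ^ 'n \<Rightarrow> real) \<Rightarrow> bool"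
  where "nonneg_maximizer lam p u \<longleftrightarrow>
    u \<in> Lp_space sphere_measure p \<and>
    (AE \<xi> in sphere_measure. 0 \<le> u \<xi>) \<and>
    Lp_norm sphere_measure p u = 1 \<and>
    Lp_norm sphere_measure (p / (p - 1)) (I_op lam u) = I_sup TYPE('n) lam p"

end

theory Submission
  imports Defs "HOL-Complex_Analysis.Great_Picard"
begin

text \<open>Let \<open>N = m + 1\<close> and \<open>\<alpha> = \<lambda> / 4\<close>, so that the kernel is \<open>K(w) = \<bar>1 - w\<bar>\<^bsup>-2\<alpha>\<^esup>\<close> with
  \<open>w = \<langle>\<xi>, \<eta>\<rangle>\<close>, the critical exponent is \<open>q = N / (N - \<alpha>)\<close>, and \<open>1 < q < 2\<close>. Write
  \<open>E(f) = \<integral>\<integral> f(\<xi>) f(\<eta>) K\<close>. Expanding \<open>(1 - w)\<^bsup>-\<alpha>\<^esup>\<close> in a binomial series shows that \<open>E\<close> is a positive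
  quadratic form, so by Cauchy-Schwarz and duality the supremum in the theorem is the supremum of
  \<open>E\<close> over the unit ball of \<open>L\<^sup>p\<close> (lemma \<open>I_sup_eq\<close>).

  For \<open>p > q\<close> the kernel is a little better than Young's inequality requires. Therefore \<open>E\<close> is
  approximated, uniformly on the unit ball, by the form of the dilated continuous kernel, and is
  compact there. Along a maximizing sequence \<open>I f\<^sub>n\<close> converges almost everywhere, and the dual
  function of the limit is a maximizer (\<open>exists_maximizer\<close>).

  The convergence rests on two inequalities for a maximizer \<open>u \<ge> 0\<close>, both about
  \<open>G(u) = \<integral>\<integral> u(\<xi>) u(\<eta>) Re w K(w)\<close>. From above: pulling \<open>u\<close> back by the automorphisms of the ball, with the
  Jacobian to the power \<open>1/q\<close>, preserves \<open>E\<close> but changes the \<open>L\<^sup>p\<close> norm when \<open>p > q\<close>. Maximality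
  forces the first moments \<open>\<integral> u\<^sup>p Re \<langle>\<xi>, e\<rangle>\<close> to vanish (\<open>moment_condition\<close>), and then the variations
  \<open>u (1 + \<epsilon> Re \<langle>\<xi>, e\<rangle>)\<close>, summed over a real orthonormal basis, give \<open>G(u) \<le> (p - 1) E(u)\<close>
  (\<open>weighted_energy_le\<close>). From below: for every \<open>f\<close> with mean \<open>c\<close>,
  \<open>G(f) - (q - 1) E(f) \<ge> \<delta> (E(f) - E(c))\<close> with \<open>\<delta> > 0\<close> (\<open>spectral_gap\<close>). Together,
  \<open>\<delta> (E(u\<^sub>p) - E(c\<^sub>p)) \<le> (p - q) E(u\<^sub>p)\<close>, so the mean \<open>c\<^sub>p\<close> of \<open>u\<^sub>p\<close> tends to the largest value that
  Holder's inequality permits, and strict convexity of \<open>t \<mapsto> t\<^sup>q\<close> turns this into convergence in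
  \<open>L\<^sup>q\<close> to the constant (\<open>maximizers_tendsto_constant\<close>).

  The spectral gap avoids the decomposition into spherical harmonics. In terms of the numbers
  \<open>m\<^sub>j\<^sub>k = \<integral>\<integral> f(\<xi>) f(\<eta>) Re (w\<^sup>j (cnj w)\<^sup>k)\<close> both \<open>E\<close> and \<open>G\<close> are explicit series, with coefficients whose
  ratio is \<open>j / (j + \<alpha> - 1)\<close>. On each diagonal \<open>j - k = const\<close> the \<open>m\<^sub>j\<^sub>k\<close>, suitably normalised, increase
  (\<open>kmom_dw_mono\<close>, by positive definiteness of an explicit kernel), the weights
  \<open>j / (j + \<alpha> - 1) - (q - 1)\<close> change sign at most once, and their sums against the coefficients are
  telescoping series; a Chebyshev argument concludes.

  That the automorphisms have the stated Jacobian on the sphere is read off from the Szego kernel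
  \<open>(1 - w)\<^bsup>-N\<^esup>\<close>: the transformed measure integrates products of two such kernels to the same values,
  hence has the same moments (\<open>nn_integral_mob\<close>).\<close>

abbreviation surf :: "'a::euclidean_space measure" where "surf \<equiv> sphere_measure"

section \<open>Invariance of the surface measure under isometries\<close>

lemma linear_isometry_bij:
  fixes T :: "'a::euclidean_space \<Rightarrow> 'a"
  assumes "linear T" "\<And>x. norm (T x) = norm x"
  shows "bij T"
proof -
  have "inj T"
  proof (rule injI)
    fix x y assume "T x = T y"
    then have "norm (x - y) = 0" using assms(2)[of "x - y"] by (simp add: linear_diff[OF assms(1)])
    then show "x = y" by simp
  qed
  then show ?thesis
    by (simp add: assms(1) bij_def linear_injective_imp_surjective)
qed

lemma emeasure_ball_pos: "emeasure lborel (ball (0::'a::euclidean_space) 1) \<noteq> 0"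
  using content_ball_pos[of 1 "0::'a"] by (auto simp: measure_def)

text \<open>The image measure is again translation invariant, so by Fubini it is proportional to Lebesgue measure; the factor is found on the unit ball, which is its own preimage.\<close>
lemma lborel_distr_isometry:
  fixes T :: "'a::euclidean_space \<Rightarrow> 'a"
  assumes lin: "linear T" and iso: "\<And>x. norm (T x) = norm x"
  shows "distr lborel borel T = (lborel :: 'a measure)"
proof -
  have bij: "bij T" by (rule linear_isometry_bij[OF assms])
  have cT: "continuous_on UNIV T" by (simp add: lin linear_continuous_on linear_linear)
  have T[measurable]: "T \<in> borel_measurable borel"
    by (rule borel_measurable_continuous_onI[OF cT])
  define M where "M = distr lborel borel T"
  have sM[simp, measurable_cong]: "sets M = sets borel" "space M = UNIV" by (auto simp: M_def)
  have ball: "emeasure M (ball 0 r) = emeasure lborel (ball (0::'a) r)" for r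
  proof -
    have "T -` ball 0 r = ball 0 r" by (auto simp: iso)
    then show ?thesis by (simp add: M_def emeasure_distr)
  qed
  interpret M: sigma_finite_measure M
  proof
    show "\<exists>A. countable A \<and> A \<subseteq> sets M \<and> \<Union>A = space M \<and> (\<forall>a\<in>A. emeasure M a \<noteq> \<infinity>)"
    proof (intro exI[of _ "range (\<lambda>n::nat. ball 0 (real n))"] conjI)
      have "\<exists>n. x \<in> ball 0 (real n)" for x :: 'a using reals_Archimedean2[of "norm x"] by simp
      then show "\<Union>(range (\<lambda>n::nat. ball (0::'a) (real n))) = space M" by (auto simp del: mem_ball)
      show "\<forall>a\<in>range (\<lambda>n::nat. ball 0 (real n)). emeasure M a \<noteq> \<infinity>"
        unfolding ball_simps ball using emeasure_lborel_ball_finite by (metis less_irrefl)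
    qed auto
  qed
  interpret L: sigma_finite_measure "lborel :: 'a measure" by standard
  interpret P: pair_sigma_finite M "lborel :: 'a measure" by standard
  have shiftL: "(\<integral>\<^sup>+y. f (x + y) \<partial>lborel) = (\<integral>\<^sup>+y. f y \<partial>lborel)"
    if [measurable]: "f \<in> borel_measurable borel" for f :: "'a \<Rightarrow> ennreal" and x
proof -
  have "(\<integral>\<^sup>+y. f y \<partial>lborel) = (\<integral>\<^sup>+y. f y \<partial>(density (distr lborel borel (\<lambda>t. x + 1 *\<^sub>R t)) (\<lambda>_. \<bar>1::real\<bar>^DIM('a))))"
    by (subst lborel_affine[of 1 x]) simp_all
  also have "\<dots> = (\<integral>\<^sup>+y. f (x + y) \<partial>lborel)" by (simp add: nn_integral_density nn_integral_distr)
  finally show ?thesis ..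
qed
  have negL: "(\<integral>\<^sup>+y. f (x - y) \<partial>lborel) = (\<integral>\<^sup>+y. f y \<partial>lborel)"
    if [measurable]: "f \<in> borel_measurable borel" for f :: "'a \<Rightarrow> ennreal" and x
proof -
  have "(\<integral>\<^sup>+y. f y \<partial>lborel) = (\<integral>\<^sup>+y. f y \<partial>(density (distr lborel borel (\<lambda>t. x + (-1) *\<^sub>R t)) (\<lambda>_. \<bar>-1::real\<bar>^DIM('a))))"
    by (subst lborel_affine[of "-1" x]) simp_all
  also have "\<dots> = (\<integral>\<^sup>+y. f (x - y) \<partial>lborel)" by (simp add: nn_integral_density nn_integral_distr)
  finally show ?thesis ..
qed
  have shiftM: "(\<integral>\<^sup>+x. f (x + y) \<partial>M) = (\<integral>\<^sup>+x. f x \<partial>M)"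
    if [measurable]: "f \<in> borel_measurable borel" for f :: "'a \<Rightarrow> ennreal" and y
  proof -
    obtain z where z: "y = T z" using bij by (meson bij_pointE)
    have "(\<integral>\<^sup>+x. f (x + y) \<partial>M) = (\<integral>\<^sup>+x. f (T (z + x)) \<partial>lborel)"
      unfolding M_def by (subst nn_integral_distr) (simp_all add: z linear_add[OF lin] add.commute)
    also have "\<dots> = (\<integral>\<^sup>+x. f (T x) \<partial>lborel)" by (subst shiftL[where f="\<lambda>x. f (T x)"]) simp_all
    finally show ?thesis unfolding M_def by (subst nn_integral_distr) simp_all
  qed
  have key: "emeasure M A * emeasure lborel B = emeasure M B * emeasure lborel A"
    if [measurable]: "A \<in> sets borel" "B \<in> sets borel" for A B :: "'a set"
  proof -
    have "emeasure M A * emeasure lborel B = (\<integral>\<^sup>+x. (\<integral>\<^sup>+y. indicator A x * indicator B (x + y) \<partial>lborel) \<partial>M)"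
    proof -
      have "(\<integral>\<^sup>+y. indicator A x * indicator B (x + y) \<partial>lborel) = indicator A x * emeasure lborel B" for x
        using shiftL[of "indicator B" x] by (subst nn_integral_cmult) simp_all
      then show ?thesis by (simp add: nn_integral_multc)
    qed
    also have "\<dots> = (\<integral>\<^sup>+y. (\<integral>\<^sup>+x. indicator A x * indicator B (x + y) \<partial>M) \<partial>lborel)"
      by (rule P.Fubini'[symmetric]) measurable
    also have "\<dots> = (\<integral>\<^sup>+y. (\<integral>\<^sup>+x. indicator A (x - y) * indicator B x \<partial>M) \<partial>lborel)"
    proof (rule nn_integral_cong)
      fix y :: 'a
      show "(\<integral>\<^sup>+x. indicator A x * indicator B (x + y) \<partial>M) = (\<integral>\<^sup>+x. indicator A (x - y) * indicator B x \<partial>M)"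
        using shiftM[of "\<lambda>x. indicator A (x - y) * indicator B x" y] by simp
    qed
    also have "\<dots> = (\<integral>\<^sup>+x. (\<integral>\<^sup>+y. indicator A (x - y) * indicator B x \<partial>lborel) \<partial>M)"
      by (rule P.Fubini') measurable
    also have "\<dots> = emeasure M B * emeasure lborel A"
    proof -
      have "(\<integral>\<^sup>+y. indicator A (x - y) * indicator B x \<partial>lborel) = indicator B x * emeasure lborel A" for x
        using negL[of "indicator A" x] by (subst nn_integral_multc) (simp_all add: mult.commute)
      then show ?thesis by (simp add: nn_integral_multc)
    qed
    finally show ?thesis .
  qed
  show ?thesis
  proof (rule measure_eqI)
    fix A assume A: "A \<in> sets (distr lborel borel T)"
    have "emeasure lborel (ball (0::'a) 1) * emeasure M A = emeasure lborel (ball (0::'a) 1) * emeasure lborel A"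
      using key[of A "ball 0 1"] A by (simp add: ball mult.commute)
    moreover have "emeasure lborel (ball (0::'a) 1) \<noteq> 0"
      by (rule emeasure_ball_pos)
    moreover have "emeasure lborel (ball (0::'a) 1) \<noteq> \<infinity>"
      using emeasure_lborel_ball_finite[of "0::'a" 1] by auto
    ultimately show "emeasure (distr lborel borel T) A = emeasure lborel A"
      unfolding M_def[symmetric] by (simp add: ennreal_mult_cancel_left)
  qed simp
qed

lemma measurable_sphere_borel: "(\<lambda>x. x) \<in> surf \<rightarrow>\<^sub>M borel"
  by (simp add: measurable_cong_sets[OF sets_sphere_measure refl] measurable_restrict_space1)

lemma emeasure_sphere_space: "emeasure (surf :: 'a::euclidean_space measure) (sphere 0 1)
   = of_nat DIM('a) * emeasure lborel (ball (0::'a) 1)"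
proof -
  have eq: "{r *\<^sub>R x | r x. 0 < r \<and> r < 1 \<and> x \<in> sphere 0 1} = ball (0::'a) 1 - {0}" (is "?L = ?R")
  proof (intro set_eqI iffI)
    fix y assume y: "y \<in> ?R"
    then have "y = norm y *\<^sub>R (y /\<^sub>R norm y)" "0 < norm y" "norm y < 1" "y /\<^sub>R norm y \<in> sphere 0 1" by auto
    then show "y \<in> ?L" by blast
  qed auto
  have "emeasure lborel (ball (0::'a) 1 - {0}) = emeasure lborel (ball (0::'a) 1)"
    by (rule emeasure_Diff_null_set) auto
  then show ?thesis
    using emeasure_sphere_measure[of "sphere (0::'a) 1"] unfolding eq by simp
qed

lemma finite_measure_sphere: "finite_measure (surf :: 'a::euclidean_space measure)"
  by standard (use emeasure_lborel_ball_finite[of "0::'a" 1] in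
    \<open>auto simp: emeasure_sphere_space ennreal_mult_eq_top_iff\<close>)

interpretation sph: finite_measure "surf :: 'a::euclidean_space measure"
  by (rule finite_measure_sphere)

lemma measure_sphere_pos: "0 < measure (surf :: 'a::euclidean_space measure) (sphere 0 1)"
proof -
  have "emeasure (surf :: 'a measure) (sphere 0 1) \<noteq> 0"
    using emeasure_ball_pos[where ?'a='a] by (simp add: emeasure_sphere_space)
  then show ?thesis by (simp add: sph.emeasure_eq_measure zero_less_measure_iff)
qed

lemma sphere_measure_isometry:
  fixes T :: "'a::euclidean_space \<Rightarrow> 'a"
  assumes lin: "linear T" and iso: "\<And>x. norm (T x) = norm x"
  shows "T \<in> surf \<rightarrow>\<^sub>M surf"
    and "distr surf surf T = surf"
proof -
  have cT: "continuous_on UNIV T" by (simp add: lin linear_continuous_on linear_linear)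
  have T[measurable]: "T \<in> borel_measurable borel"
    by (rule borel_measurable_continuous_onI[OF cT])
  show m[measurable]: "T \<in> surf \<rightarrow>\<^sub>M surf"
    unfolding measurable_cong_sets[OF sets_sphere_measure sets_sphere_measure]
    by (rule measurable_restrict_space2) (auto simp: space_restrict_space iso intro!: measurable_restrict_space1)
  show "distr surf surf T = surf"
  proof (rule measure_eqI)
    fix A assume "A \<in> sets (distr surf (surf :: 'a measure) T)"
    then have A[measurable]: "A \<in> sets borel" and As: "A \<subseteq> sphere 0 1" and A': "A \<in> sets (surf :: 'a measure)"
      by (auto simp: sets_restrict_space)
    define cone where "cone A = {r *\<^sub>R x | r x. 0 < r \<and> r < 1 \<and> x \<in> A}" for A :: "'a set"
    have ceq: "cone A = {y \<in> space borel. y /\<^sub>R norm y \<in> A} \<inter> (ball 0 1 - {0})"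
    proof (intro set_eqI iffI)
      fix y assume "y \<in> {y \<in> space borel. y /\<^sub>R norm y \<in> A} \<inter> (ball 0 1 - {0})"
      then have "y = norm y *\<^sub>R (y /\<^sub>R norm y)" "0 < norm y" "norm y < 1" "y /\<^sub>R norm y \<in> A" by auto
      then show "y \<in> cone A" unfolding cone_def by blast
    next
      fix y assume "y \<in> cone A"
      then obtain r x where "y = r *\<^sub>R x" "0 < r" "r < 1" "x \<in> A" by (auto simp: cone_def)
      moreover from \<open>x \<in> A\<close> As have "norm x = 1" by auto
      ultimately show "y \<in> {y \<in> space borel. y /\<^sub>R norm y \<in> A} \<inter> (ball 0 1 - {0})" by auto
    qed
    have [measurable]: "cone A \<in> sets borel" unfolding ceq by measurable
    have vim: "T -` A \<inter> sphere 0 1 = T -` A" using As iso by force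
    have ceqT: "cone (T -` A) = T -` cone A"
    proof (intro set_eqI iffI)
      fix y assume "y \<in> cone (T -` A)"
      then obtain r x where "y = r *\<^sub>R x" "0 < r" "r < 1" "T x \<in> A" by (auto simp: cone_def)
      then show "y \<in> T -` cone A" unfolding cone_def by (auto simp: linear_scale[OF lin])
    next
      fix y assume "y \<in> T -` cone A"
      then obtain r x where rx: "T y = r *\<^sub>R x" "0 < r" "r < 1" "x \<in> A" by (auto simp: cone_def)
      then have "T (y /\<^sub>R r) \<in> A" by (simp add: linear_scale[OF lin])
      moreover have "y = r *\<^sub>R (y /\<^sub>R r)" using rx by simp
      ultimately show "y \<in> cone (T -` A)" using rx unfolding cone_def by blast
    qed
    have "emeasure (distr surf surf T) A = emeasure surf (T -` A)"
      using A' by (subst emeasure_distr) (auto simp: vim)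
    also have "\<dots> = of_nat DIM('a) * emeasure lborel (cone (T -` A))"
      unfolding cone_def
    proof (rule emeasure_sphere_measure)
      show "T -` A \<in> sets borel" using measurable_sets[OF T A] by simp
      show "T -` A \<subseteq> sphere 0 1" using vim by auto
    qed
    also have "emeasure lborel (cone (T -` A)) = emeasure (distr lborel borel T) (cone A)"
      by (simp add: ceqT emeasure_distr)
    also have "of_nat DIM('a) * \<dots> = emeasure surf A"
      unfolding lborel_distr_isometry[OF assms] cone_def
      by (rule emeasure_sphere_measure[symmetric]) (use As in auto)
    finally show "emeasure (distr surf surf T) A = emeasure surf A" .
  qed simp
qed

section \<open>The hermitian product and unitary reflections\<close>

abbreviation hp :: "complex ^ 'n \<Rightarrow> complex ^ 'n \<Rightarrow> complex" where "hp \<equiv> hermitian_prod"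

lemma hp_add_left: "hp (x + y) z = hp x z + hp y z"
  by (simp add: hermitian_prod_def sum.distrib distrib_right)

lemma hp_add_right: "hp z (x + y) = hp z x + hp z y"
  by (simp add: hermitian_prod_def sum.distrib distrib_left)

lemma hp_scale_left: "hp (c *s x) y = c * hp x y"
  by (simp add: hermitian_prod_def sum_distrib_left mult.assoc)

lemma hp_scale_right: "hp x (c *s y) = cnj c * hp x y"
  by (simp add: hermitian_prod_def sum_distrib_left mult_ac)

lemma scaleR_smult: "c *\<^sub>R x = of_real c *s (x :: complex ^ 'n)"
  by (simp add: vec_eq_iff vector_scalar_mult_def scaleR_conv_of_real[where 'a=complex])

lemma hp_scaleR_left: "hp (c *\<^sub>R x) y = of_real c * hp x y"
  by (simp add: scaleR_smult hp_scale_left)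

lemma hp_scaleR_right: "hp x (c *\<^sub>R y) = of_real c * hp x y"
  by (simp add: scaleR_smult hp_scale_right)

lemma hp_diff_left: "hp (x - y) z = hp x z - hp y z"
  by (simp add: hermitian_prod_def sum_subtractf left_diff_distrib)

lemma hp_diff_right: "hp z (x - y) = hp z x - hp z y"
  by (simp add: hermitian_prod_def sum_subtractf right_diff_distrib)

lemma hp_zero [simp]: "hp 0 x = 0" "hp x 0 = 0"
  by (simp_all add: hermitian_prod_def)

lemma cnj_hp: "cnj (hp x y) = hp y x"
  by (simp add: hermitian_prod_def mult.commute)

lemma Re_hp: "Re (hp x y) = inner x y"
  by (simp add: hermitian_prod_def inner_vec_def inner_complex_def)

lemma hp_self: "hp x x = of_real ((norm x)\<^sup>2)"
proof (rule complex_eqI)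
  show "Re (hp x x) = Re (of_real ((norm x)\<^sup>2))" by (simp add: Re_hp power2_norm_eq_inner)
  have "Im (cnj (hp x x)) = Im (hp x x)" by (simp only: cnj_hp)
  then show "Im (hp x x) = Im (of_real ((norm x)\<^sup>2))" by simp
qed

lemma norm_smult: "norm (c *s x) = cmod c * norm (x :: complex ^ 'n)"
proof -
  have "complex_of_real ((norm (c *s x))\<^sup>2) = of_real ((cmod c * norm x)\<^sup>2)"
    unfolding hp_self[symmetric] hp_scale_left hp_scale_right
    using complex_norm_square[of c] by (simp add: hp_self power_mult_distrib mult.commute[of c])
  then show ?thesis by (simp only: of_real_eq_iff power2_eq_iff_nonneg norm_ge_zero mult_nonneg_nonneg)
qed

lemma norm_hp_le: "cmod (hp x y) \<le> norm x * norm y"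
proof (cases "hp x y = 0")
  case False
  define u where "u = cnj (hp x y) / of_real (cmod (hp x y))"
  have u: "cmod u = 1" using False by (simp add: u_def norm_divide)
  have "hp (u *s x) y = of_real (cmod (hp x y))"
    using False by (simp add: u_def hp_scale_left field_simps complex_norm_square[symmetric] power2_eq_square)
  then have "cmod (hp x y) = inner (u *s x) y" by (metis Re_hp Re_complex_of_real)
  also have "\<dots> \<le> norm (u *s x) * norm y" by (rule norm_cauchy_schwarz)
  finally show ?thesis by (simp add: norm_smult u)
qed simp

lemma norm_hp_le_1: "norm x = 1 \<Longrightarrow> norm y = 1 \<Longrightarrow> cmod (hp x y) \<le> 1"
  using norm_hp_le[of x y] by simp

lemma continuous_on_hp [continuous_intros]:
  "continuous_on S f \<Longrightarrow> continuous_on S g \<Longrightarrow> continuous_on S (\<lambda>x. hp (f x) (g x))"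
  unfolding hermitian_prod_def by (intro continuous_intros)

lemma measurable_hp [measurable (raw)]:
  assumes "f \<in> borel_measurable M" "g \<in> borel_measurable M"
  shows "(\<lambda>x. hp (f x) (g x)) \<in> borel_measurable M"
proof -
  have "(\<lambda>p. hp (fst p) (snd p)) \<in> borel_measurable borel"
    by (intro borel_measurable_continuous_onI continuous_intros)
  from measurable_compose[OF borel_measurable_Pair[OF assms] this] show ?thesis by simp
qed

lemma integrable_sphere_continuous:
  fixes g :: "'a::euclidean_space \<Rightarrow> 'b::{banach, second_countable_topology}"
  assumes "continuous_on (sphere 0 1) g"
  shows "integrable surf g"
proof -
  have m: "g \<in> borel_measurable surf"
    unfolding measurable_cong_sets[OF sets_sphere_measure refl]
    by (rule borel_measurable_continuous_on_restrict[OF assms])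
  have "compact (g ` sphere 0 1)" by (intro compact_continuous_image assms) auto
  then obtain B where B: "\<And>x. x \<in> sphere 0 1 \<Longrightarrow> norm (g x) \<le> B"
    using compact_imp_bounded bounded_iff by (metis image_eqI)
  show ?thesis
    by (rule sph.integrable_const_bound[where B=B]) (use B m in \<open>auto intro!: AE_I2\<close>)
qed

lemma integrable_sphere_const [simp]: "integrable surf (\<lambda>_. c :: 'b::{banach, second_countable_topology})"
  by (rule integrable_sphere_continuous) (rule continuous_on_const)

definition refl_map :: "complex ^ 'n \<Rightarrow> complex \<Rightarrow> complex ^ 'n \<Rightarrow> complex ^ 'n"
  where "refl_map w \<mu> x = x + ((\<mu> - 1) * hp x w) *s w"

lemma hp_refl_map:
  assumes "norm w = 1" "cmod \<mu> = 1"
  shows "hp (refl_map w \<mu> x) (refl_map w \<mu> y) = hp x y"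
proof -
  have ww: "hp w w = 1" using assms by (simp add: hp_self)
  define \<nu> where "\<nu> = \<mu> - 1"
  have "\<mu> * cnj \<mu> = 1" using assms by (simp add: complex_norm_square[symmetric])
  then have mm: "\<nu> + cnj \<nu> + \<nu> * cnj \<nu> = 0" by (simp add: \<nu>_def algebra_simps)
  have "hp (refl_map w \<mu> x) (refl_map w \<mu> y)
     = hp x y + (\<nu> + cnj \<nu> + \<nu> * cnj \<nu>) * (hp x w * hp w y)"
    unfolding refl_map_def \<nu>_def[symmetric]
    by (simp add: hp_add_left hp_add_right hp_scale_left hp_scale_right ww cnj_hp distrib_right distrib_left mult_ac)
  then show ?thesis by (simp add: mm)
qed

lemma refl_map_isometry:
  assumes "norm w = 1" "cmod \<mu> = 1"
  shows "linear (refl_map w \<mu>)" "norm (refl_map w \<mu> x) = norm x"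
proof -
  show "linear (refl_map w \<mu>)"
    by (rule linearI)
      (simp_all add: refl_map_def hp_add_left hp_scale_left scaleR_smult vec_eq_iff distrib_left distrib_right mult_ac)
  have "complex_of_real ((norm (refl_map w \<mu> x))\<^sup>2) = of_real ((norm x)\<^sup>2)"
    unfolding hp_self[symmetric] by (rule hp_refl_map[OF assms])
  then show "norm (refl_map w \<mu> x) = norm x"
    by (simp only: of_real_eq_iff power2_eq_iff_nonneg norm_ge_zero)
qed

lemma integral_refl_map:
  fixes g :: "complex ^ 'n \<Rightarrow> 'b::{banach, second_countable_topology}"
  assumes "norm w = 1" "cmod \<mu> = 1" and g: "g \<in> borel_measurable surf"
  shows "(LINT a|surf. g (refl_map w \<mu> a)) = (LINT a|surf. g a)"
proof -
  note T = sphere_measure_isometry[OF refl_map_isometry[OF assms(1,2)]]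
  show ?thesis using integral_distr[OF T(1) g] by (simp add: T(2))
qed

lemma nn_integral_refl_map:
  fixes g :: "complex ^ 'n \<Rightarrow> ennreal"
  assumes "norm w = 1" "cmod \<mu> = 1" and g: "g \<in> borel_measurable surf"
  shows "(\<integral>\<^sup>+a. g (refl_map w \<mu> a) \<partial>surf) = (\<integral>\<^sup>+a. g a \<partial>surf)"
proof -
  note T = sphere_measure_isometry[OF refl_map_isometry[OF assms(1,2)]]
  have g': "g \<in> borel_measurable (distr surf surf (refl_map w \<mu>))"
    using g by simp
  show ?thesis using nn_integral_distr[OF T(1) g'] by (simp add: T(2))
qed

text \<open>For \<open>x \<noteq> y\<close> the direction is \<open>x - y\<close>. A factor \<open>\<mu>\<close> different from \<open>-1\<close> is needed because \<open>\<langle>x, y\<rangle>\<close> may fail to be real.\<close>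
lemma refl_map_transitive:
  assumes "norm x = 1" "norm y = 1"
  obtains w \<mu> where "norm w = 1" "cmod \<mu> = 1" "refl_map w \<mu> x = y"
proof (cases "x = y")
  case True
  then show ?thesis using that[of x 1] assms by (simp add: refl_map_def)
next
  case False
  define z where "z = hp x y"
  define d where "d = norm (x - y)"
  have d: "d > 0" using False by (simp add: d_def)
  have d2: "of_real (d\<^sup>2) = 2 - z - cnj z"
    unfolding d_def hp_self[symmetric] by (simp add: hp_diff_left hp_diff_right z_def cnj_hp) (simp add: hp_self assms)
  have "z \<noteq> 1"
  proof
    assume "z = 1"
    then have "complex_of_real (d\<^sup>2) = 0" using d2 by simp
    then show False using d by simp
  qed
  define w where "w = (1 / d) *\<^sub>R (x - y)"
  define \<mu> where "\<mu> = 1 - of_real (d\<^sup>2) / (1 - z)"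
  have w: "norm w = 1" using d by (simp add: w_def d_def)
  have "\<mu> = - ((1 - cnj z) / (1 - z))"
    unfolding \<mu>_def d2 using \<open>z \<noteq> 1\<close> by (simp add: divide_simps)
  moreover have "cmod (1 - cnj z) = cmod (1 - z)"
    by (metis complex_cnj_diff complex_cnj_one complex_mod_cnj)
  ultimately have m: "cmod \<mu> = 1" using \<open>z \<noteq> 1\<close> by (simp add: norm_divide)
  have "hp x w = of_real (1 / d) * (1 - z)"
    by (simp add: w_def hp_scaleR_right hp_diff_right hp_self assms z_def)
  then have "(\<mu> - 1) * hp x w = - of_real d"
    using \<open>z \<noteq> 1\<close> d by (simp add: \<mu>_def power2_eq_square)
  then have "refl_map w \<mu> x = x + (- of_real d) *s w" by (simp add: refl_map_def)
  also have "\<dots> = x - (x - y)" using d by (simp add: w_def scaleR_smult vec_eq_iff)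
  finally have "refl_map w \<mu> x = y" by simp
  with w m show ?thesis by (rule that)
qed

text \<open>The reflections preserve the measure and act transitively, so the pole does not matter.\<close>
lemma integral_zonal:
  fixes F :: "complex \<Rightarrow> 'b::{banach, second_countable_topology}" and x y :: "complex ^ 'n"
  assumes [measurable]: "F \<in> borel_measurable borel" and "norm x = 1" "norm y = 1"
  shows "(LINT a|surf. F (hp x a)) = (LINT a|surf. F (hp y a))"
proof -
  note [measurable] = measurable_sphere_borel
  obtain w \<mu> where w: "norm w = 1" "cmod \<mu> = 1" and r: "refl_map w \<mu> x = y"
    using refl_map_transitive[OF assms(2,3)] .
  have "(LINT a|surf. F (hp y a)) = (LINT a|surf. F (hp y (refl_map w \<mu> a)))"
    by (rule integral_refl_map[OF w, symmetric]) measurable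
  also have "\<dots> = (LINT a|surf. F (hp x a))"
    by (simp only: r[symmetric] hp_refl_map[OF w])
  finally show ?thesis ..
qed

lemma nn_integral_zonal:
  fixes F :: "complex \<Rightarrow> ennreal" and x y :: "complex ^ 'n"
  assumes [measurable]: "F \<in> borel_measurable borel" and "norm x = 1" "norm y = 1"
  shows "(\<integral>\<^sup>+a. F (hp x a) \<partial>surf) = (\<integral>\<^sup>+a. F (hp y a) \<partial>surf)"
proof -
  note [measurable] = measurable_sphere_borel
  obtain w \<mu> where w: "norm w = 1" "cmod \<mu> = 1" and r: "refl_map w \<mu> x = y"
    using refl_map_transitive[OF assms(2,3)] .
  have "(\<integral>\<^sup>+a. F (hp y a) \<partial>surf) = (\<integral>\<^sup>+a. F (hp y (refl_map w \<mu> a)) \<partial>surf)"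
    by (rule nn_integral_refl_map[OF w, symmetric]) measurable
  also have "\<dots> = (\<integral>\<^sup>+a. F (hp x a) \<partial>surf)"
    by (simp only: r[symmetric] hp_refl_map[OF w])
  finally show ?thesis ..
qed

section \<open>Moments of the surface measure\<close>

lemma infinite_unit_circle: "infinite {\<mu>. cmod \<mu> = 1}"
proof -
  have "inj_on (\<lambda>x. Complex x (sqrt (1 - x\<^sup>2))) {0..1}" by (auto simp: inj_on_def)
  moreover have "(\<lambda>x. Complex x (sqrt (1 - x\<^sup>2))) ` {0..1} \<subseteq> {\<mu>. cmod \<mu> = 1}"
    by (auto simp: cmod_def power_le_one)
  moreover have "infinite {0..1::real}" by (simp add: infinite_Icc)
  ultimately show ?thesis by (meson finite_imageD finite_subset)
qed

lemma polynomial_constant_on_circle: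
  fixes A :: "nat \<Rightarrow> complex"
  assumes "\<And>\<mu>. cmod \<mu> = 1 \<Longrightarrow> (\<Sum>i\<le>n. A i * \<mu> ^ i) = C"
  shows "C = A 0"
proof -
  let ?B = "\<lambda>i. if i = 0 then A 0 - C else A i"
  have e: "(\<Sum>i\<le>n. ?B i * \<mu> ^ i) = (\<Sum>i\<le>n. A i * \<mu> ^ i) - C" for \<mu>
    by (subst (1 2) sum.atMost_shift) simp
  have "{\<mu>. cmod \<mu> = 1} \<subseteq> {\<mu>. (\<Sum>i\<le>n. ?B i * \<mu> ^ i) = 0}"
    unfolding e using assms by auto
  then have "infinite {\<mu>. (\<Sum>i\<le>n. ?B i * \<mu> ^ i) = 0}"
    using infinite_unit_circle finite_subset by blast
  then have "?B 0 = 0"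
    using polyfun_roots_finite[of ?B 0 n] by blast
  then show ?thesis by simp
qed

lemma integrable_hp_monomial [simp]:
  "integrable surf (\<lambda>a. hp x a ^ k * hp a y ^ l)"
  by (intro integrable_sphere_continuous continuous_intros)

definition smom :: "'n::finite itself \<Rightarrow> nat \<Rightarrow> real" where
  "smom _ k = (LINT a|surf. cmod (hp (axis undefined 1 :: complex ^ 'n) a) ^ (2 * k))"

text \<open>Rotating the pole direction by a phase multiplies the integral by that phase to the power \<open>l - k\<close>.\<close>
lemma moment_pole:
  fixes x :: "complex ^ 'n"
  assumes x: "norm x = 1"
  shows "(LINT a|surf. hp x a ^ k * hp a x ^ l)
    = (if k = l then of_real (smom TYPE('n) k) else 0)"
proof (cases "k = l")
  case True
  have sq: "hp x a * hp a x = of_real ((cmod (hp x a))\<^sup>2)" for a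
    by (simp only: complex_norm_square cnj_hp)
  have "(LINT a|surf. hp x a ^ k * hp a x ^ k)
      = (LINT a|surf. complex_of_real (cmod (hp x a) ^ (2 * k)))"
    unfolding power_mult_distrib[symmetric] sq power_mult of_real_power ..
  also have "\<dots> = of_real (LINT a|surf. cmod (hp x a) ^ (2 * k))"
    by (rule integral_complex_of_real)
  also have "(LINT a|surf. cmod (hp x a) ^ (2 * k)) = smom TYPE('n) k"
    unfolding smom_def by (rule integral_zonal) (use x in \<open>auto simp: norm_axis_1\<close>)
  finally show ?thesis using True by simp
next
  case False
  define \<theta> where "\<theta> = pi / (real l - real k)"
  define \<mu> where "\<mu> = cis \<theta>"
  let ?I = "LINT a|surf. hp x a ^ k * hp a x ^ l"
  have m: "cmod \<mu> = 1" by (simp add: \<mu>_def)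
  have xx: "hp x x = 1" using x by (simp add: hp_self)
  have 1: "hp (refl_map x \<mu> a) x = \<mu> * hp a x" for a
    unfolding refl_map_def hp_add_left hp_scale_left xx by (simp add: algebra_simps)
  have 2: "hp x (refl_map x \<mu> a) = cnj \<mu> * hp x a" for a
    by (metis 1 cnj_hp complex_cnj_mult)
  have "?I = (LINT a|surf. hp x (refl_map x \<mu> a) ^ k * hp (refl_map x \<mu> a) x ^ l)"
    by (rule integral_refl_map[OF x m, symmetric])
      (rule borel_measurable_integrable, rule integrable_hp_monomial)
  also have "\<dots> = (LINT a|surf. (cnj \<mu> ^ k * \<mu> ^ l) * (hp x a ^ k * hp a x ^ l))"
    by (simp add: 1 2 power_mult_distrib mult_ac)
  also have "\<dots> = (cnj \<mu> ^ k * \<mu> ^ l) * ?I" by (rule integral_mult_right_zero)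
  also have "cnj \<mu> ^ k * \<mu> ^ l = cis ((real l - real k) * \<theta>)"
  proof -
    have "cnj \<mu> ^ k = cis (- real k * \<theta>)" by (simp add: \<mu>_def cis_cnj Complex.DeMoivre)
    moreover have "\<mu> ^ l = cis (real l * \<theta>)" by (simp add: \<mu>_def Complex.DeMoivre)
    ultimately show ?thesis by (simp add: cis_mult left_diff_distrib)
  qed
  also have "(real l - real k) * \<theta> = pi" using False by (simp add: \<theta>_def)
  finally have "?I = 0" by (simp add: eq_neg_iff_add_eq_0)
  then show ?thesis using False by simp
qed

text \<open>Split \<open>y\<close> into its component along \<open>x\<close> and an orthogonal vector \<open>v\<close>. Rotating the phase of the direction \<open>v\<close> does not change the integral, so the terms that contain \<open>v\<close> drop out.\<close>
lemma moment_unit: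
  fixes x y :: "complex ^ 'n"
  assumes x: "norm x = 1"
  shows "(LINT a|surf. hp x a ^ k * hp a y ^ l)
    = (if k = l then of_real (smom TYPE('n) k) * hp x y ^ k else 0)"
proof -
  define c where "c = hp x y"
  define v where "v = y - cnj c *s x"
  have xx: "hp x x = 1" using x by (simp add: hp_self)
  have xv: "hp x v = 0" by (simp add: v_def hp_diff_right hp_scale_right xx c_def)
  have split: "hp a y = c * hp a x + hp a v" for a
    by (simp add: v_def hp_diff_right hp_scale_right)
  define F where "F \<mu> = (LINT a|surf. hp x a ^ k * (c * hp a x + \<mu> * hp a v) ^ l)" for \<mu>
  define A where "A i = of_nat (l choose i) * (LINT a|surf. hp x a ^ k * (hp a v ^ i * (c * hp a x) ^ (l - i)))" for i
  have F_poly: "F \<mu> = (\<Sum>i\<le>l. A i * \<mu> ^ i)" for \<mu>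
  proof -
    have "hp x a ^ k * (c * hp a x + \<mu> * hp a v) ^ l =
        (\<Sum>i\<le>l. (of_nat (l choose i) * \<mu> ^ i) * (hp x a ^ k * (hp a v ^ i * (c * hp a x) ^ (l - i))))" for a
      unfolding add.commute[of "c * _"] binomial_ring sum_distrib_left
      by (intro sum.cong refl) (simp add: power_mult_distrib mult_ac)
    then have "F \<mu> = (\<Sum>i\<le>l. LINT a|surf. (of_nat (l choose i) * \<mu> ^ i) * (hp x a ^ k * (hp a v ^ i * (c * hp a x) ^ (l - i))))"
      unfolding F_def
      by (simp only:) (intro Bochner_Integration.integral_sum integrable_sphere_continuous continuous_intros)
    also have "\<dots> = (\<Sum>i\<le>l. A i * \<mu> ^ i)"
      unfolding A_def integral_mult_right_zero by (intro sum.cong refl) (simp add: mult_ac)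
    finally show ?thesis .
  qed
  have "F 1 = F \<mu>" if m: "cmod \<mu> = 1" for \<mu>
  proof (cases "v = 0")
    case False
    define w where "w = (1 / norm v) *\<^sub>R v"
    have w: "norm w = 1" using False by (simp add: w_def)
    have xw: "hp x w = 0" by (simp add: w_def hp_scaleR_right xv)
    have xw': "hp w x = 0" by (metis xw cnj_hp complex_cnj_zero)
    have wv: "hp w v * hp a w = hp a v" for a
      using False by (simp add: w_def hp_scaleR_left hp_scaleR_right hp_self field_simps power2_eq_square)
    have 1: "hp x (refl_map w \<mu> a) = hp x a" for a
      by (simp add: refl_map_def hp_add_right hp_scale_right xw)
    have 2: "hp (refl_map w \<mu> a) x = hp a x" for a
      by (simp add: refl_map_def hp_add_left hp_scale_left xw')
    have 3: "hp (refl_map w \<mu> a) v = \<mu> * hp a v" for a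
    proof -
      have "hp (refl_map w \<mu> a) v = hp a v + (\<mu> - 1) * (hp w v * hp a w)"
        by (simp add: refl_map_def hp_add_left hp_scale_left mult_ac)
      then show ?thesis unfolding wv by (simp add: left_diff_distrib)
    qed
    have "F 1 = (LINT a|surf. hp x (refl_map w \<mu> a) ^ k *
        (c * hp (refl_map w \<mu> a) x + 1 * hp (refl_map w \<mu> a) v) ^ l)"
      unfolding F_def
      by (rule integral_refl_map[OF w m, symmetric])
        (intro borel_measurable_integrable integrable_sphere_continuous continuous_intros)
    also have "\<dots> = F \<mu>" unfolding F_def 1 2 3 by simp
    finally show ?thesis .
  qed (simp add: F_def)
  then have "F 1 = A 0"
    unfolding F_poly by (intro polynomial_constant_on_circle[where n=l and A=A]) metis
  also have "A 0 = (LINT a|surf. c ^ l * (hp x a ^ k * hp a x ^ l))"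
    by (simp add: A_def power_mult_distrib mult_ac)
  also have "\<dots> = c ^ l * (if k = l then of_real (smom TYPE('n) k) else 0)"
    unfolding moment_pole[OF x, symmetric] by (rule integral_mult_right_zero)
  finally show ?thesis unfolding F_def split by (simp add: xx xv)
qed

lemma moment:
  fixes x y :: "complex ^ 'n"
  shows "(LINT a|surf. hp x a ^ k * hp a y ^ l)
    = (if k = l then of_real (smom TYPE('n) k) * hp x y ^ k else 0)"
proof (cases "x = 0")
  case True
  show ?thesis
  proof (cases k)
    case 0
    show ?thesis
      using moment_unit[of "axis undefined 1" 0 y l] by (simp add: 0 norm_axis_1)
  qed (use True in simp)
next
  case False
  define u where "u = (1 / norm x) *\<^sub>R x"
  have u: "norm u = 1" using False by (simp add: u_def)
  have xu: "hp x z = of_real (norm x) * hp u z" for z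
    using False by (simp add: u_def hp_scaleR_left)
  have "(LINT a|surf. hp x a ^ k * hp a y ^ l)
     = (LINT a|surf. of_real (norm x) ^ k * (hp u a ^ k * hp a y ^ l))"
    unfolding xu power_mult_distrib mult.assoc ..
  also have "\<dots> = of_real (norm x) ^ k * (LINT a|surf. hp u a ^ k * hp a y ^ l)"
    by (rule integral_mult_right_zero)
  finally show ?thesis unfolding moment_unit[OF u] xu[of y] power_mult_distrib by (auto simp: mult_ac)
qed

text \<open>Polarisation: differentiate the moment formula in a direction.\<close>

lemma DERIV_integral_power:
  fixes A B g :: "'a::euclidean_space \<Rightarrow> complex"
  assumes [continuous_intros]: "continuous_on (sphere 0 1) A" "continuous_on (sphere 0 1) B" "continuous_on (sphere 0 1) g"
  shows "((\<lambda>t. LINT a|surf. g a * (A a + t * B a) ^ n) has_field_derivative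
     of_nat n * (LINT a|surf. g a * (A a ^ (n - 1) * B a))) (at 0)"
proof -
  define C where "C i = of_nat (n choose i) * (LINT a|surf. g a * (B a ^ i * A a ^ (n - i)))" for i
  have eq: "(LINT a|surf. g a * (A a + t * B a) ^ n) = (\<Sum>i\<le>n. C i * t ^ i)" for t
  proof -
    have "g a * (A a + t * B a) ^ n = (\<Sum>i\<le>n. (of_nat (n choose i) * t ^ i) * (g a * (B a ^ i * A a ^ (n - i))))" for a
      unfolding add.commute[of "A a"] binomial_ring sum_distrib_left
      by (intro sum.cong refl) (simp add: power_mult_distrib mult_ac)
    then have "(LINT a|surf. g a * (A a + t * B a) ^ n)
      = (\<Sum>i\<le>n. LINT a|surf. (of_nat (n choose i) * t ^ i) * (g a * (B a ^ i * A a ^ (n - i))))"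
      by (simp only:) (intro Bochner_Integration.integral_sum integrable_sphere_continuous continuous_intros)
    also have "\<dots> = (\<Sum>i\<le>n. C i * t ^ i)"
      unfolding C_def integral_mult_right_zero by (intro sum.cong refl) (simp add: mult_ac)
    finally show ?thesis .
  qed
  have "((\<lambda>t. \<Sum>i\<le>n. C i * t ^ i) has_field_derivative (\<Sum>i\<le>n. C i * (of_nat i * 0 ^ (i - 1)))) (at 0)"
    by (auto intro!: derivative_eq_intros sum.cong simp: mult_ac)
  also have "(\<Sum>i\<le>n. C i * (of_nat i * 0 ^ (i - 1))) = (\<Sum>i\<in>{1} \<inter> {..n}. C i * (of_nat i * 0 ^ (i - 1)))"
    by (rule sum.mono_neutral_right) (auto simp: power_0_left)
  also have "\<dots> = of_nat n * (LINT a|surf. g a * (A a ^ (n - 1) * B a))"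
    by (cases n) (auto simp: C_def mult_ac)
  finally show ?thesis unfolding eq .
qed

lemma moment_polarised_right:
  fixes x y z :: "complex ^ 'n"
  shows "(LINT a|surf. hp x a ^ Suc k * (hp a y ^ k * hp a z))
    = of_real (smom TYPE('n) (Suc k)) * (hp x y ^ k * hp x z)"
proof -
  have e: "hp a (y + cnj t *s z) = hp a y + t * hp a z" for a t
    by (simp add: hp_add_right hp_scale_right)
  have 1: "((\<lambda>t. LINT a|surf. hp x a ^ Suc k * (hp a y + t * hp a z) ^ Suc k) has_field_derivative
     of_nat (Suc k) * (LINT a|surf. hp x a ^ Suc k * (hp a y ^ (Suc k - 1) * hp a z))) (at 0)"
    by (intro DERIV_integral_power continuous_intros)
  have 2: "(LINT a|surf. hp x a ^ Suc k * (hp a y + t * hp a z) ^ Suc k)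
      = of_real (smom TYPE('n) (Suc k)) * (hp x y + t * hp x z) ^ Suc k" for t
    using moment[of x "Suc k" "y + cnj t *s z" "Suc k"] by (simp only: e) simp
  have 3: "((\<lambda>t. of_real (smom TYPE('n) (Suc k)) * (hp x y + t * hp x z) ^ Suc k) has_field_derivative
     of_nat (Suc k) * (of_real (smom TYPE('n) (Suc k)) * (hp x y ^ k * hp x z))) (at 0)"
    by (rule derivative_eq_intros refl | simp)+
  from DERIV_unique[OF 1[unfolded 2] 3] show ?thesis by (simp del: of_nat_Suc)
qed

lemma moment_polarised_both:
  fixes x y z w :: "complex ^ 'n"
  shows "of_nat (Suc k) * (LINT a|surf. (hp a y ^ k * hp a z) * (hp x a ^ k * hp w a))
    = of_real (smom TYPE('n) (Suc k)) * (hp x y ^ k * hp w z + of_nat k * hp x y ^ (k - 1) * hp w y * hp x z)"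
proof -
  have e: "hp (x + t *s w) a = hp x a + t * hp w a" for a t
    by (simp add: hp_add_left hp_scale_left)
  have 1: "((\<lambda>t. LINT a|surf. (hp a y ^ k * hp a z) * (hp x a + t * hp w a) ^ Suc k) has_field_derivative
     of_nat (Suc k) * (LINT a|surf. (hp a y ^ k * hp a z) * (hp x a ^ (Suc k - 1) * hp w a))) (at 0)"
    by (intro DERIV_integral_power continuous_intros)
  have 2: "(LINT a|surf. (hp a y ^ k * hp a z) * (hp x a + t * hp w a) ^ Suc k)
      = of_real (smom TYPE('n) (Suc k)) * ((hp x y + t * hp w y) ^ k * (hp x z + t * hp w z))" for t
    using moment_polarised_right[of "x + t *s w" k y z] by (simp only: e mult.commute)
  have 3: "((\<lambda>t. of_real (smom TYPE('n) (Suc k)) * ((hp x y + t * hp w y) ^ k * (hp x z + t * hp w z))) has_field_derivative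
     of_real (smom TYPE('n) (Suc k)) * (hp x y ^ k * hp w z + of_nat k * hp x y ^ (k - 1) * hp w y * hp x z)) (at 0)"
    by (rule derivative_eq_intros refl | simp add: algebra_simps)+
  from DERIV_unique[OF 1[unfolded 2] 3] show ?thesis by (simp del: of_nat_Suc)
qed

lemma hp_axis: "hp (axis i 1) a = cnj (a $ i)" "hp a (axis i 1) = a $ i"
  by (simp_all add: hermitian_prod_def axis_def if_distrib[of cnj] if_distrib[of "\<lambda>x. _ * x"] if_distrib[of "\<lambda>x. x * _"] cong: if_cong)

lemma sum_hp_axis: "(\<Sum>b\<in>UNIV. hp x (axis b 1) * hp (axis b 1) y) = hp x y"
  by (simp add: hp_axis) (simp add: hermitian_prod_def)

text \<open>Sum the polarised moment formula over an orthonormal basis: on the sphere the squares of the coordinates add up to 1, which lowers the degree.\<close>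
lemma smom_Suc: "(real CARD('n) + real k) * smom TYPE('n::finite) (Suc k) = real (Suc k) * smom TYPE('n) k"
proof -
  define x :: "complex ^ 'n" where "x = axis undefined 1"
  have x: "hp x x = 1" by (simp add: x_def hp_self norm_axis_1)
  have ee: "hp (axis b 1) (axis b 1) = 1" for b :: 'n by (simp add: hp_self norm_axis_1)
  have "of_nat (Suc k) * (\<Sum>b\<in>UNIV. LINT a|surf. (hp a x ^ k * hp a (axis b 1)) * (hp x a ^ k * hp (axis b 1) a))
     = of_real (smom TYPE('n) (Suc k)) * (\<Sum>b\<in>(UNIV::'n set). 1 + of_nat k * (hp x (axis b 1) * hp (axis b 1) x))"
    unfolding sum_distrib_left
    by (intro sum.cong refl, subst moment_polarised_both) (simp add: x ee mult_ac)
  also have "(\<Sum>b\<in>(UNIV::'n set). 1 + of_nat k * (hp x (axis b 1) * hp (axis b 1) x)) = of_nat CARD('n) + of_nat k"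
    unfolding sum.distrib sum_distrib_left[symmetric] sum_hp_axis x by simp
  also have "(\<Sum>b\<in>UNIV. LINT a|surf. (hp a x ^ k * hp a (axis b 1)) * (hp x a ^ k * hp (axis b 1) a))
     = (LINT a|surf. (\<Sum>b\<in>UNIV. (hp a x ^ k * hp a (axis b 1)) * (hp x a ^ k * hp (axis b 1) a)))"
    by (intro Bochner_Integration.integral_sum[symmetric] integrable_sphere_continuous continuous_intros)
  also have "\<dots> = (LINT a|surf. hp x a ^ k * hp a x ^ k)"
  proof (rule Bochner_Integration.integral_cong[OF refl])
    fix a :: "complex ^ 'n" assume "a \<in> space surf"
    then have aa: "hp a a = 1" by (simp add: hp_self)
    have "(\<Sum>b\<in>UNIV. (hp a x ^ k * hp a (axis b 1)) * (hp x a ^ k * hp (axis b 1) a))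
       = (hp a x ^ k * hp x a ^ k) * (\<Sum>b\<in>UNIV. hp a (axis b 1) * hp (axis b 1) a)"
      unfolding sum_distrib_left by (intro sum.cong refl) (simp add: mult_ac)
    then show "(\<Sum>b\<in>UNIV. (hp a x ^ k * hp a (axis b 1)) * (hp x a ^ k * hp (axis b 1) a)) = hp x a ^ k * hp a x ^ k"
      by (simp add: sum_hp_axis aa mult.commute)
  qed
  also have "\<dots> = of_real (smom TYPE('n) k)" by (simp add: moment x)
  finally have "complex_of_real (real (Suc k) * smom TYPE('n) k) = of_real (smom TYPE('n) (Suc k) * (real CARD('n) + real k))"
    by simp
  then show ?thesis by (simp only: of_real_eq_iff mult.commute)
qed

lemma smom_0: "smom TYPE('n::finite) 0 = measure (surf :: (complex ^ 'n) measure) (sphere 0 1)"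
  by (simp add: smom_def)

lemma smom_pos: "smom TYPE('n::finite) k > 0"
proof (induction k)
  case 0
  show ?case using measure_sphere_pos by (simp add: smom_0)
next
  case (Suc k)
  have "(real CARD('n) + real k) * smom TYPE('n) (Suc k) > 0"
    unfolding smom_Suc using Suc by simp
  then show ?case by (simp add: zero_less_mult_iff)
qed

lemma smom_eq: "smom TYPE('n::finite) k = smom TYPE('n) 0 * fact k / pochhammer (real CARD('n)) k"
proof (induction k)
  case (Suc k)
  have n: "real CARD('n) + real k > 0" "pochhammer (real CARD('n)) k > 0"
    by (auto intro!: pochhammer_pos add_pos_nonneg)
  have "smom TYPE('n) (Suc k) = real (Suc k) * smom TYPE('n) k / (real CARD('n) + real k)"
    using smom_Suc[of k, where 'n='n] n by (simp add: field_simps)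
  then show ?case using n unfolding Suc by (simp add: pochhammer_Suc field_simps)
qed simp

section \<open>Positive definite kernels on the sphere\<close>

abbreviation sph2 :: "((complex ^ 'n) \<times> (complex ^ 'n)) measure" where
  "sph2 \<equiv> surf \<Otimes>\<^sub>M surf"

interpretation sph_pair: pair_sigma_finite
  "surf :: 'a::euclidean_space measure" "surf :: 'b::euclidean_space measure"
  by (simp add: pair_sigma_finite_def sph.sigma_finite_measure_axioms)

lemma integrable_product:
  fixes f g :: "_ \<Rightarrow> 'b::{real_normed_field, banach, second_countable_topology}"
  assumes "pair_sigma_finite M1 M2"
  assumes f: "integrable M1 f" and g: "integrable M2 g"
  shows "integrable (M1 \<Otimes>\<^sub>M M2) (\<lambda>p. f (fst p) * g (snd p))"
    and "(\<integral>p. f (fst p) * g (snd p) \<partial>(M1 \<Otimes>\<^sub>M M2)) = (\<integral>x. f x \<partial>M1) * (\<integral>y. g y \<partial>M2)"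
proof -
  interpret pair_sigma_finite M1 M2 by fact
  note [measurable] = borel_measurable_integrable[OF f] borel_measurable_integrable[OF g]
  show i: "integrable (M1 \<Otimes>\<^sub>M M2) (\<lambda>p. f (fst p) * g (snd p))"
  proof (rule Fubini_integrable)
    show "integrable M1 (\<lambda>x. \<integral>y. norm (f (fst (x, y)) * g (snd (x, y))) \<partial>M2)"
      using f by (simp add: norm_mult)
    show "AE x in M1. integrable M2 (\<lambda>y. f (fst (x, y)) * g (snd (x, y)))"
      using g by simp
  qed measurable
  show "(\<integral>p. f (fst p) * g (snd p) \<partial>(M1 \<Otimes>\<^sub>M M2)) = (\<integral>x. f x \<partial>M1) * (\<integral>y. g y \<partial>M2)"
    using integral_fst'[OF i] by simp
qed

lemma integrable_bounded_factor:
  fixes f k :: "_ \<Rightarrow> 'b::{real_normed_field, banach, second_countable_topology}"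
  assumes f: "integrable M f" and [measurable]: "k \<in> borel_measurable M"
    and B: "\<And>x. x \<in> space M \<Longrightarrow> norm (k x) \<le> B"
  shows "integrable M (\<lambda>x. f x * k x)"
proof (rule Bochner_Integration.integrable_bound)
  show "integrable M (\<lambda>x. B * norm (f x))" using f by simp
  show "AE x in M. norm (f x * k x) \<le> norm (B * norm (f x))"
  proof (rule AE_I2)
    fix x assume x: "x \<in> space M"
    have "norm (f x * k x) \<le> norm (f x) * B" unfolding norm_mult by (intro mult_left_mono B x) simp
    also have "\<dots> \<le> norm (B * norm (f x))" by (simp add: mult.commute)
    finally show "norm (f x * k x) \<le> norm (B * norm (f x))" .
  qed
qed (use f in measurable)

lemma space_sph2: "p \<in> space (sph2 :: ((complex ^ 'n) \<times> (complex ^ 'n)) measure) \<Longrightarrow> norm (fst p) = 1 \<and> norm (snd p) = 1"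
  by (auto simp: space_pair_measure)

lemma measurable_fst_borel [measurable]: "fst \<in> (sph2 :: ((complex ^ 'n) \<times> (complex ^ 'n)) measure) \<rightarrow>\<^sub>M borel"
  by (rule measurable_compose[OF measurable_fst measurable_sphere_borel])

lemma measurable_snd_borel [measurable]: "snd \<in> (sph2 :: ((complex ^ 'n) \<times> (complex ^ 'n)) measure) \<rightarrow>\<^sub>M borel"
  by (rule measurable_compose[OF measurable_snd measurable_sphere_borel])

lemma measurable_cnj [measurable (raw)]:
  assumes "f \<in> borel_measurable M" shows "(\<lambda>x. cnj (f x)) \<in> borel_measurable M"
proof -
  have "cnj \<in> borel_measurable borel" by (intro borel_measurable_continuous_onI continuous_intros)
  from measurable_compose[OF assms this] show ?thesis .
qed

lemma integrable_cnj_integral: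
  assumes "integrable M f"
  shows "integrable M (\<lambda>x. cnj (f x))" "(\<integral>x. cnj (f x) \<partial>M) = cnj (\<integral>x. f x \<partial>M)"
  using integrable_bounded_linear[OF bounded_linear_cnj assms] integral_bounded_linear[OF bounded_linear_cnj assms] by auto

lemma finite_measure_sph2: "finite_measure (sph2 :: ((complex ^ 'n) \<times> (complex ^ 'n)) measure)"
  by (rule finite_measure_pair_measure) (rule finite_measure_sphere)+

lemma pair_sigma_finite_sph2: "pair_sigma_finite (sph2 :: ((complex ^ 'n) \<times> (complex ^ 'n)) measure) (surf :: (complex ^ 'n) measure)"
  unfolding pair_sigma_finite_def
  using finite_measure.axioms(1)[OF finite_measure_sph2] sph.sigma_finite_measure_axioms by blast

text \<open>Positivity is tested against integrable functions instead of finitely many points, which is the form needed for energies.\<close>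
definition pd_kernel :: "((complex ^ 'n) \<times> (complex ^ 'n) \<Rightarrow> complex) \<Rightarrow> bool" where
  "pd_kernel k \<longleftrightarrow> k \<in> borel_measurable sph2 \<and> (\<exists>B. \<forall>p\<in>space sph2. cmod (k p) \<le> B) \<and>
    (\<forall>f. integrable surf f \<longrightarrow> 0 \<le> Re (\<integral>p. f (fst p) * cnj (f (snd p)) * k p \<partial>sph2))"

lemma pd_kernelD:
  assumes "pd_kernel k" "integrable surf f"
  shows "integrable sph2 (\<lambda>p. f (fst p) * cnj (f (snd p)) * k p)"
    and "0 \<le> Re (\<integral>p. f (fst p) * cnj (f (snd p)) * k p \<partial>sph2)"
proof -
  from assms obtain B where "\<And>p. p \<in> space sph2 \<Longrightarrow> cmod (k p) \<le> B" by (auto simp: pd_kernel_def)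
  moreover have "integrable sph2 (\<lambda>p. f (fst p) * cnj (f (snd p)))"
    using assms(2) by (intro integrable_product sph_pair.pair_sigma_finite_axioms) auto
  ultimately show "integrable sph2 (\<lambda>p. f (fst p) * cnj (f (snd p)) * k p)"
    by (rule integrable_bounded_factor[rotated 2]) (use assms in \<open>auto simp: pd_kernel_def\<close>)
  show "0 \<le> Re (\<integral>p. f (fst p) * cnj (f (snd p)) * k p \<partial>sph2)"
    using assms by (auto simp: pd_kernel_def)
qed

lemma pd_kernel_cong:
  assumes "\<And>p. p \<in> space sph2 \<Longrightarrow> k p = k' p" "pd_kernel k"
  shows "pd_kernel k'"
proof -
  have "k' \<in> borel_measurable sph2" using assms measurable_cong[of sph2 k k'] by (auto simp: pd_kernel_def)
  moreover have "(\<integral>p. f (fst p) * cnj (f (snd p)) * k' p \<partial>sph2) = (\<integral>p. f (fst p) * cnj (f (snd p)) * k p \<partial>sph2)" for f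
    by (rule Bochner_Integration.integral_cong) (simp_all add: assms(1))
  ultimately show ?thesis using assms by (auto simp: pd_kernel_def)
qed

lemma pd_kernel_scale:
  assumes "pd_kernel k" "0 \<le> (c::real)"
  shows "pd_kernel (\<lambda>p. of_real c * k p)"
proof -
  from assms obtain B where B: "\<And>p. p \<in> space sph2 \<Longrightarrow> cmod (k p) \<le> B" by (auto simp: pd_kernel_def)
  have "\<forall>p\<in>space sph2. cmod (of_real c * k p) \<le> c * B"
    using B assms(2) by (auto simp: norm_mult intro!: mult_left_mono)
  moreover have "(\<lambda>p. of_real c * k p) \<in> borel_measurable sph2" using assms by (auto simp: pd_kernel_def)
  moreover have "0 \<le> Re (\<integral>p. f (fst p) * cnj (f (snd p)) * (of_real c * k p) \<partial>sph2)"
    if f: "integrable surf f" for f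
  proof -
    have "(\<integral>p. f (fst p) * cnj (f (snd p)) * (of_real c * k p) \<partial>sph2)
       = of_real c * (\<integral>p. f (fst p) * cnj (f (snd p)) * k p \<partial>sph2)"
      unfolding integral_mult_right_zero[symmetric] by (simp add: mult_ac)
    then show ?thesis using pd_kernelD(2)[OF assms(1) f] assms(2) by simp
  qed
  ultimately show ?thesis unfolding pd_kernel_def by blast
qed

lemma pd_kernel_rank1:
  fixes v :: "complex ^ 'n \<Rightarrow> complex"
  assumes [measurable]: "v \<in> borel_measurable surf" and B: "\<And>x. norm x = 1 \<Longrightarrow> cmod (v x) \<le> B"
  shows "pd_kernel (\<lambda>p. v (fst p) * cnj (v (snd p)))"
  unfolding pd_kernel_def
proof (intro conjI allI impI)
  have [measurable]: "(\<lambda>p. v (snd p)) \<in> borel_measurable sph2" "(\<lambda>p. v (fst p)) \<in> borel_measurable sph2"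
    by (rule measurable_compose[OF measurable_snd assms(1)] measurable_compose[OF measurable_fst assms(1)])+
  show "(\<lambda>p. v (fst p) * cnj (v (snd p))) \<in> borel_measurable sph2" by measurable
  have "cmod (v (fst p) * cnj (v (snd p))) \<le> B * B" if "p \<in> space sph2" for p
    unfolding norm_mult complex_mod_cnj
    using space_sph2[OF that] B[of "fst p"] B[of "snd p"] by (intro mult_mono) (auto intro: order_trans[OF norm_ge_zero])
  then show "\<exists>B. \<forall>p\<in>space sph2. cmod (v (fst p) * cnj (v (snd p))) \<le> B" by blast
  fix f :: "complex ^ 'n \<Rightarrow> complex" assume f: "integrable surf f"
  have fv: "integrable surf (\<lambda>x. f x * v x)"
    by (rule integrable_bounded_factor[OF f]) (use B in auto)
  have "(\<integral>p. f (fst p) * cnj (f (snd p)) * (v (fst p) * cnj (v (snd p))) \<partial>sph2)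
      = (\<integral>p. (f (fst p) * v (fst p)) * (\<lambda>y. cnj (f y * v y)) (snd p) \<partial>sph2)" by (simp add: mult_ac)
  also have "\<dots> = (\<integral>x. f x * v x \<partial>surf) * (\<integral>y. cnj (f y * v y) \<partial>surf)"
    using integrable_cnj_integral(1)[OF fv] by (intro integrable_product(2) sph_pair.pair_sigma_finite_axioms fv)
  also have "\<dots> = of_real ((cmod (\<integral>x. f x * v x \<partial>surf))\<^sup>2)"
    unfolding integrable_cnj_integral(2)[OF fv] complex_norm_square ..
  finally show "0 \<le> Re (\<integral>p. f (fst p) * cnj (f (snd p)) * (v (fst p) * cnj (v (snd p))) \<partial>sph2)" by simp
qed

lemma pd_kernel_sum:
  fixes k :: "'i \<Rightarrow> (complex ^ 'n) \<times> (complex ^ 'n) \<Rightarrow> complex"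
  assumes "finite I" "\<And>i. i \<in> I \<Longrightarrow> pd_kernel (k i)"
  shows "pd_kernel (\<lambda>p. \<Sum>i\<in>I. k i p)"
  unfolding pd_kernel_def
proof (intro conjI allI impI)
  show "(\<lambda>p. \<Sum>i\<in>I. k i p) \<in> borel_measurable sph2"
    using assms by (intro borel_measurable_sum) (auto simp: pd_kernel_def)
  have "\<forall>i\<in>I. \<exists>B. \<forall>p\<in>space sph2. cmod (k i p) \<le> B" using assms by (auto simp: pd_kernel_def)
  then obtain B where B: "\<And>i p. i \<in> I \<Longrightarrow> p \<in> space sph2 \<Longrightarrow> cmod (k i p) \<le> B i" by metis
  then show "\<exists>B. \<forall>p\<in>space sph2. cmod (\<Sum>i\<in>I. k i p) \<le> B"
    by (intro exI[of _ "\<Sum>i\<in>I. B i"] ballI sum_norm_le) auto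
  fix f :: "complex ^ 'n \<Rightarrow> complex" assume f: "integrable surf f"
  have "(\<integral>p. f (fst p) * cnj (f (snd p)) * (\<Sum>i\<in>I. k i p) \<partial>sph2)
     = (\<Sum>i\<in>I. \<integral>p. f (fst p) * cnj (f (snd p)) * k i p \<partial>sph2)"
    unfolding sum_distrib_left
    by (rule Bochner_Integration.integral_sum) (use pd_kernelD(1)[OF assms(2) f] in auto)
  then show "0 \<le> Re (\<integral>p. f (fst p) * cnj (f (snd p)) * (\<Sum>i\<in>I. k i p) \<partial>sph2)"
    using pd_kernelD(2)[OF assms(2) f] by (simp add: sum_nonneg)
qed

text \<open>Multiplying by a rank-one kernel amounts to changing the test function.\<close>
lemma pd_kernel_mult_rank1:
  fixes v :: "complex ^ 'n \<Rightarrow> complex"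
  assumes k: "pd_kernel k" and [measurable]: "v \<in> borel_measurable surf"
    and B: "\<And>x. norm x = 1 \<Longrightarrow> cmod (v x) \<le> B"
  shows "pd_kernel (\<lambda>p. v (fst p) * cnj (v (snd p)) * k p)"
  unfolding pd_kernel_def
proof (intro conjI allI impI)
  have [measurable]: "k \<in> borel_measurable sph2" using k by (auto simp: pd_kernel_def)
  have [measurable]: "(\<lambda>p. v (snd p)) \<in> borel_measurable sph2" "(\<lambda>p. v (fst p)) \<in> borel_measurable sph2"
    by (rule measurable_compose[OF measurable_snd assms(2)] measurable_compose[OF measurable_fst assms(2)])+
  show "(\<lambda>p. v (fst p) * cnj (v (snd p)) * k p) \<in> borel_measurable sph2" by measurable
  from k obtain C where C: "\<And>p. p \<in> space sph2 \<Longrightarrow> cmod (k p) \<le> C" by (auto simp: pd_kernel_def)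
  have "cmod (v (fst p) * cnj (v (snd p)) * k p) \<le> B * B * C" if "p \<in> space sph2" for p
    unfolding norm_mult complex_mod_cnj
    using space_sph2[OF that] B[of "fst p"] B[of "snd p"] C[OF that]
    by (intro mult_mono mult_nonneg_nonneg) (auto intro: order_trans[OF norm_ge_zero])
  then show "\<exists>B. \<forall>p\<in>space sph2. cmod (v (fst p) * cnj (v (snd p)) * k p) \<le> B" by blast
  fix f :: "complex ^ 'n \<Rightarrow> complex" assume f: "integrable surf f"
  have fv: "integrable surf (\<lambda>x. f x * v x)"
    by (rule integrable_bounded_factor[OF f]) (use B in auto)
  show "0 \<le> Re (\<integral>p. f (fst p) * cnj (f (snd p)) * (v (fst p) * cnj (v (snd p)) * k p) \<partial>sph2)"
    using pd_kernelD(2)[OF k fv] by (simp add: mult_ac)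
qed

text \<open>Fubini: an average of positive definite kernels is positive definite.\<close>
lemma pd_kernel_integral:
  fixes k :: "complex ^ 'n \<Rightarrow> (complex ^ 'n) \<times> (complex ^ 'n) \<Rightarrow> complex"
  assumes pd: "\<And>a. norm a = 1 \<Longrightarrow> pd_kernel (k a)"
    and [measurable]: "(\<lambda>q. k (snd q) (fst q)) \<in> borel_measurable (sph2 \<Otimes>\<^sub>M surf)"
    and B: "\<And>a p. norm a = 1 \<Longrightarrow> p \<in> space sph2 \<Longrightarrow> cmod (k a p) \<le> B"
  shows "pd_kernel (\<lambda>p. \<integral>a. k a p \<partial>surf)"
  unfolding pd_kernel_def
proof (intro conjI allI impI)
  interpret T: pair_sigma_finite "sph2 :: ((complex ^ 'n) \<times> (complex ^ 'n)) measure" "surf :: (complex ^ 'n) measure"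
    by (rule pair_sigma_finite_sph2)
  show m[measurable]: "(\<lambda>p. \<integral>a. k a p \<partial>surf) \<in> borel_measurable sph2"
    using sph.borel_measurable_lebesgue_integrable[of "\<lambda>p a. k a p" sph2] assms(2) by (simp add: case_prod_unfold)
  have "cmod (\<integral>a. k a p \<partial>surf) \<le> measure (surf :: (complex ^ 'n) measure) (sphere 0 1) * B"
    if p: "p \<in> space sph2" for p
  proof -
    have "cmod (\<integral>a. k a p \<partial>surf) \<le> (\<integral>a. cmod (k a p) \<partial>(surf :: (complex ^ 'n) measure))"
      by (rule integral_norm_bound)
    also have "\<dots> \<le> (\<integral>a. B \<partial>(surf :: (complex ^ 'n) measure))"
    proof (rule integral_mono_AE)
      have "(\<lambda>a. k a p) \<in> borel_measurable surf"
        using measurable_compose[OF measurable_Pair1'[OF p] assms(2)] by simp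
      then have "integrable surf (\<lambda>a. k a p)"
        by (rule sph.integrable_const_bound[where B=B, rotated]) (rule AE_I2, rule B, simp, rule p)
      then show "integrable surf (\<lambda>a. cmod (k a p))" by simp
      show "AE a in surf. cmod (k a p) \<le> B" by (rule AE_I2, rule B, simp, rule p)
    qed simp
    finally show ?thesis by simp
  qed
  then show "\<exists>B. \<forall>p\<in>space sph2. cmod (\<integral>a. k a p \<partial>surf) \<le> B" by blast
  fix f :: "complex ^ 'n \<Rightarrow> complex" assume f: "integrable surf f"
  note [measurable] = borel_measurable_integrable[OF f]
  have ff: "integrable sph2 (\<lambda>p. f (fst p) * cnj (f (snd p)))"
    using f by (intro integrable_product sph_pair.pair_sigma_finite_axioms) auto
  have "integrable (sph2 \<Otimes>\<^sub>M (surf :: (complex ^ 'n) measure)) (\<lambda>q. f (fst (fst q)) * cnj (f (snd (fst q))))"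
    using integrable_product(1)[OF T.pair_sigma_finite_axioms ff, of "\<lambda>_. 1"] by simp
  then have int: "integrable (sph2 \<Otimes>\<^sub>M surf) (\<lambda>q. f (fst (fst q)) * cnj (f (snd (fst q))) * k (snd q) (fst q))"
    using B by (intro integrable_bounded_factor[where k="\<lambda>q. k (snd q) (fst q)" and B=B]) (auto simp: space_pair_measure)
  have "(\<integral>p. f (fst p) * cnj (f (snd p)) * (\<integral>a. k a p \<partial>surf) \<partial>sph2)
     = (\<integral>p. (\<integral>a. f (fst p) * cnj (f (snd p)) * k a p \<partial>surf) \<partial>sph2)" by simp
  also have "\<dots> = (\<integral>a. (\<integral>p. f (fst p) * cnj (f (snd p)) * k a p \<partial>sph2) \<partial>surf)"
    using T.Fubini_integral[of "\<lambda>p a. f (fst p) * cnj (f (snd p)) * k a p"] int by (simp add: case_prod_unfold)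
  finally have e: "(\<integral>p. f (fst p) * cnj (f (snd p)) * (\<integral>a. k a p \<partial>surf) \<partial>sph2)
     = (\<integral>a. (\<integral>p. f (fst p) * cnj (f (snd p)) * k a p \<partial>sph2) \<partial>surf)" .
  have ii: "integrable surf (\<lambda>a. (\<integral>p. f (fst p) * cnj (f (snd p)) * k a p \<partial>sph2))"
    using T.integrable_snd[of "\<lambda>p a. f (fst p) * cnj (f (snd p)) * k a p"] int by (simp add: case_prod_unfold)
  show "0 \<le> Re (\<integral>p. f (fst p) * cnj (f (snd p)) * (\<integral>a. k a p \<partial>surf) \<partial>sph2)"
    unfolding e integral_Re[OF ii, symmetric]
    by (rule integral_nonneg_AE) (use pd_kernelD(2)[OF pd f] in auto)
qed

lemma pd_kernel_mult_hp:
  assumes "pd_kernel k"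
  shows "pd_kernel (\<lambda>p. hp (fst p) (snd p) * k p)"
proof -
  have "pd_kernel (\<lambda>p. \<Sum>b\<in>UNIV. (fst p $ b) * cnj (snd p $ b) * k p)"
  proof (rule pd_kernel_sum)
    fix b
    show "pd_kernel (\<lambda>p. (fst p $ b) * cnj (snd p $ b) * k p)"
      by (rule pd_kernel_mult_rank1[OF assms, where v="\<lambda>x. x $ b" and B=1])
        (auto simp: hp_axis(2)[symmetric] norm_axis_1 intro!: measurable_hp measurable_sphere_borel norm_hp_le_1)
  qed simp
  then show ?thesis by (simp add: hermitian_prod_def sum_distrib_right)
qed

lemma pd_kernel_mult_hp_cnj:
  assumes "pd_kernel k"
  shows "pd_kernel (\<lambda>p. hp (snd p) (fst p) * k p)"
proof -
  have "pd_kernel (\<lambda>p. \<Sum>b\<in>UNIV. cnj (fst p $ b) * cnj (cnj (snd p $ b)) * k p)"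
  proof (rule pd_kernel_sum)
    fix b
    show "pd_kernel (\<lambda>p. cnj (fst p $ b) * cnj (cnj (snd p $ b)) * k p)"
      by (rule pd_kernel_mult_rank1[OF assms, where v="\<lambda>x. cnj (x $ b)" and B=1])
        (auto simp: hp_axis(1)[symmetric] norm_axis_1 intro!: measurable_hp measurable_sphere_borel norm_hp_le_1)
  qed simp
  then show ?thesis by (simp add: hermitian_prod_def sum_distrib_right sum_distrib_left mult_ac)
qed

lemma pd_kernel_monomial: "pd_kernel (\<lambda>p. hp (fst p) (snd p) ^ j * hp (snd p) (fst p) ^ k)"
proof (induction k)
  case 0
  show ?case
  proof (induction j)
    case 0
    show ?case using pd_kernel_rank1[of "\<lambda>_. 1" 1] by simp
  next
    case (Suc j)
    from pd_kernel_mult_hp[OF Suc] show ?case by simp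
  qed
next
  case (Suc k)
  from pd_kernel_mult_hp_cnj[OF Suc] show ?case by (simp add: mult_ac)
qed

text \<open>The kernel is, up to a positive factor, the Gram kernel
  \<open>\<Sum>\<^sub>b \<integral> v a b x * cnj (v a b y) da\<close> of the functions \<open>v\<close> below; the moment formulas evaluate the integral. The
  constant \<open>\<kappa>\<close> is the ratio of consecutive moments, which makes the lower order terms collapse.\<close>
lemma pd_kernel_disc:
  fixes j :: nat
  defines "\<kappa> \<equiv> (real j + 1) / (real CARD('n::finite) + real j)"
  shows "pd_kernel (\<lambda>p. hp (fst p) (snd p) ^ Suc j * hp (snd p) (fst p)
      - of_real \<kappa> * hp (fst p) (snd p :: complex ^ 'n) ^ j)"
proof -
  have \<kappa>: "\<kappa> > 0" unfolding \<kappa>_def by (rule divide_pos_pos) (simp, rule add_pos_nonneg, auto)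
  define c where "c = smom TYPE('n) j"
  have c: "c > 0" by (simp add: c_def smom_pos)
  have c': "smom TYPE('n) (Suc j) = \<kappa> * c"
  proof -
    have "real CARD('n) + real j > 0" by (rule add_pos_nonneg) auto
    then show ?thesis using smom_Suc[of j, where 'n='n] by (simp add: \<kappa>_def c_def field_simps)
  qed
  define v where "v a b x = hp x a ^ Suc j * cnj (x $ b) - of_real \<kappa> * cnj (a $ b) * hp x a ^ j" for a x :: "complex ^ 'n" and b
  have vB: "cmod (v a b x) \<le> 1 + \<kappa>" if "norm a = 1" "norm x = 1" for a b x
  proof -
    have h: "cmod (hp x a) \<le> 1" using norm_hp_le_1[OF that(2,1)] .
    have "cmod (v a b x) \<le> cmod (hp x a ^ Suc j * cnj (x $ b)) + cmod (of_real \<kappa> * cnj (a $ b) * hp x a ^ j)"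
      unfolding v_def by (rule norm_triangle_ineq4)
    also have "\<dots> \<le> 1 * 1 + \<kappa> * 1 * 1"
      unfolding norm_mult complex_mod_cnj norm_power norm_of_real
      using h that \<kappa> Finite_Cartesian_Product.norm_nth_le[of x b] Finite_Cartesian_Product.norm_nth_le[of a b]
      by (intro add_mono mult_mono power_le_one) auto
    finally show ?thesis by simp
  qed
  have vm: "v a b \<in> borel_measurable surf" for a b
  proof -
    have "v a b \<in> borel_measurable borel"
      unfolding v_def[abs_def] by (intro borel_measurable_continuous_onI continuous_intros)
    from measurable_compose[OF measurable_sphere_borel this] show ?thesis .
  qed
  define k where "k a p = (\<Sum>b\<in>UNIV. v a b (fst p) * cnj (v a b (snd p)))" for a p
  have "pd_kernel (\<lambda>p. \<integral>a. k a p \<partial>surf)"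
  proof (rule pd_kernel_integral)
    show "pd_kernel (k a)" if "norm a = 1" for a
      unfolding k_def[abs_def] by (intro pd_kernel_sum pd_kernel_rank1[where B="1 + \<kappa>"] vm vB that) auto
    have "continuous_on UNIV (\<lambda>q. k (snd q) (fst q))"
      unfolding k_def v_def by (intro continuous_intros)
    then have "(\<lambda>q. k (snd q) (fst q)) \<in> borel_measurable borel"
      by (rule borel_measurable_continuous_onI)
    moreover have "(\<lambda>q. q) \<in> (sph2 \<Otimes>\<^sub>M surf :: (((complex ^ 'n) \<times> (complex ^ 'n)) \<times> (complex ^ 'n)) measure) \<rightarrow>\<^sub>M borel"
    proof -
      have "(\<lambda>q. ((fst (fst q), snd (fst q)), snd q)) \<in> (sph2 \<Otimes>\<^sub>M surf :: (((complex ^ 'n) \<times> (complex ^ 'n)) \<times> (complex ^ 'n)) measure) \<rightarrow>\<^sub>M borel"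
        using measurable_compose[OF measurable_snd measurable_sphere_borel]
          measurable_compose[OF measurable_fst measurable_fst_borel] measurable_compose[OF measurable_fst measurable_snd_borel]
        by (intro borel_measurable_Pair) auto
      then show ?thesis by simp
    qed
    ultimately show "(\<lambda>q. k (snd q) (fst q)) \<in> borel_measurable (sph2 \<Otimes>\<^sub>M surf)"
      by (rule measurable_compose[rotated])
    show "cmod (k a p) \<le> (\<Sum>b\<in>(UNIV::'n set). (1 + \<kappa>) * (1 + \<kappa>))" if "norm a = 1" "p \<in> space sph2" for a p
      unfolding k_def
    proof (rule sum_norm_le)
      fix b
      show "cmod (v a b (fst p) * cnj (v a b (snd p))) \<le> (1 + \<kappa>) * (1 + \<kappa>)"
        unfolding norm_mult complex_mod_cnj
        by (intro mult_mono vB that(1)) (use space_sph2[OF that(2)] \<kappa> in auto)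
    qed
  qed
  then have pd: "pd_kernel (\<lambda>p. of_real (1 / (\<kappa> * c)) * (\<integral>a. k a p \<partial>surf))"
    by (rule pd_kernel_scale) (use \<kappa> c in simp)
  show ?thesis
  proof (rule pd_kernel_cong[OF _ pd])
    fix p :: "(complex ^ 'n) \<times> (complex ^ 'n)" assume "p \<in> space sph2"
    then obtain x y where p: "p = (x, y)" "norm x = 1" "norm y = 1" using space_sph2[of p] by (cases p) auto
    have xx: "hp x x = 1" and yy: "hp y y = 1" using p by (auto simp: hp_self)
    have kk: "k a p = hp x a ^ Suc j * (hp a y ^ Suc j) * hp y x
         - of_real \<kappa> * (hp x a ^ Suc j * (hp a y ^ j * hp a x))
         - of_real \<kappa> * cnj (hp y a ^ Suc j * (hp a x ^ j * hp a y))
         + of_real (\<kappa>\<^sup>2) * (hp x a ^ j * hp a y ^ j)" if a: "norm a = 1" for a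
    proof -
      have "k a p = (\<Sum>b\<in>UNIV. hp x a ^ Suc j * hp a y ^ Suc j * (hp y (axis b 1) * hp (axis b 1) x)
         - of_real \<kappa> * (hp x a ^ Suc j * hp a y ^ j) * (hp a (axis b 1) * hp (axis b 1) x)
         - of_real \<kappa> * (hp a y ^ Suc j * hp x a ^ j) * (hp y (axis b 1) * hp (axis b 1) a)
         + of_real (\<kappa>\<^sup>2) * (hp x a ^ j * hp a y ^ j) * (hp a (axis b 1) * hp (axis b 1) a))"
        unfolding k_def v_def p fst_conv snd_conv hp_axis
        by (intro sum.cong refl) (simp add: cnj_hp algebra_simps power2_eq_square)
      also have "\<dots> = hp x a ^ Suc j * hp a y ^ Suc j * hp y x
         - of_real \<kappa> * (hp x a ^ Suc j * hp a y ^ j) * hp a x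
         - of_real \<kappa> * (hp a y ^ Suc j * hp x a ^ j) * hp y a
         + of_real (\<kappa>\<^sup>2) * (hp x a ^ j * hp a y ^ j) * hp a a"
        unfolding sum.distrib sum_subtractf sum_distrib_left[symmetric] sum_hp_axis ..
      finally show ?thesis using a by (simp add: hp_self cnj_hp mult_ac)
    qed
    have icnj: "(\<integral>a. cnj (hp y a ^ Suc j * (hp a x ^ j * hp a y)) \<partial>surf)
       = cnj (\<integral>a. hp y a ^ Suc j * (hp a x ^ j * hp a y) \<partial>surf)"
      by (intro integrable_cnj_integral integrable_sphere_continuous continuous_intros)
    have "(\<integral>a. k a p \<partial>surf) = (\<integral>a. hp x a ^ Suc j * (hp a y ^ Suc j) * hp y x
         - of_real \<kappa> * (hp x a ^ Suc j * (hp a y ^ j * hp a x))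
         - of_real \<kappa> * cnj (hp y a ^ Suc j * (hp a x ^ j * hp a y))
         + of_real (\<kappa>\<^sup>2) * (hp x a ^ j * hp a y ^ j) \<partial>surf)"
      by (rule Bochner_Integration.integral_cong[OF refl]) (auto simp only: kk space_sphere_measure mem_sphere_0)
    also have "\<dots> = (\<integral>a. hp x a ^ Suc j * (hp a y ^ Suc j) * hp y x \<partial>surf)
         - (\<integral>a. of_real \<kappa> * (hp x a ^ Suc j * (hp a y ^ j * hp a x)) \<partial>surf)
         - (\<integral>a. of_real \<kappa> * cnj (hp y a ^ Suc j * (hp a x ^ j * hp a y)) \<partial>surf)
         + (\<integral>a. of_real (\<kappa>\<^sup>2) * (hp x a ^ j * hp a y ^ j) \<partial>surf)"
      by (subst Bochner_Integration.integral_add Bochner_Integration.integral_diff;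
          (intro integrable_sphere_continuous continuous_intros)?)+ (rule refl)
    also have "\<dots> = of_real (\<kappa> * c) * (hp x y ^ Suc j * hp y x) - of_real \<kappa> * (of_real (\<kappa> * c) * hp x y ^ j)
        - of_real \<kappa> * cnj (of_real (\<kappa> * c) * hp y x ^ j) + of_real (\<kappa>\<^sup>2) * (of_real c * hp x y ^ j)"
      unfolding integral_mult_right_zero integral_mult_left_zero icnj moment moment_polarised_right xx yy c' c_def[symmetric]
      by (simp add: mult_ac)
    also have "\<dots> = of_real (\<kappa> * c) * (hp x y ^ Suc j * hp y x - of_real \<kappa> * hp x y ^ j)"
      by (simp add: cnj_hp algebra_simps power2_eq_square)
    finally show "of_real (1 / (\<kappa> * c)) * (\<integral>a. k a p \<partial>surf)
       = hp (fst p) (snd p) ^ Suc j * hp (snd p) (fst p) - of_real \<kappa> * hp (fst p) (snd p) ^ j"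
      using \<kappa> c by (simp add: p)
  qed
qed

lemma pd_kernel_disc_mult:
  fixes j k :: nat
  shows "pd_kernel (\<lambda>p. hp (fst p) (snd p) ^ Suc j * hp (snd p) (fst p) ^ Suc k
      - of_real ((real j + 1) / (real CARD('n::finite) + real j)) * (hp (fst p) (snd p :: complex ^ 'n) ^ j * hp (snd p) (fst p) ^ k))"
proof (induction k)
  case 0
  show ?case using pd_kernel_disc[of j, where 'n='n] by simp
next
  case (Suc k)
  from pd_kernel_mult_hp_cnj[OF Suc] show ?case
    by (rule pd_kernel_cong[rotated]) (simp add: algebra_simps)
qed

text \<open>The coefficients of the energy of \<open>f\<close> in the expansion of the kernel into monomials.\<close>
definition kmom :: "(complex ^ 'n \<Rightarrow> real) \<Rightarrow> nat \<Rightarrow> nat \<Rightarrow> real" where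
  "kmom f j k = (\<integral>p. f (fst p) * f (snd p) * Re (hp (fst p) (snd p) ^ j * hp (snd p) (fst p) ^ k) \<partial>sph2)"

lemma pd_kernel_real:
  fixes f :: "complex ^ 'n \<Rightarrow> real"
  assumes "pd_kernel k" "integrable surf f"
  shows "integrable sph2 (\<lambda>p. f (fst p) * f (snd p) * Re (k p))"
    "0 \<le> (\<integral>p. f (fst p) * f (snd p) * Re (k p) \<partial>sph2)"
proof -
  have i: "integrable surf (\<lambda>x. complex_of_real (f x))" using assms by simp
  note D = pd_kernelD[OF assms(1) i]
  have "Re (complex_of_real (f (fst p)) * cnj (complex_of_real (f (snd p))) * k p) = f (fst p) * f (snd p) * Re (k p)" for p
    by simp
  then show "integrable sph2 (\<lambda>p. f (fst p) * f (snd p) * Re (k p))"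
    "0 \<le> (\<integral>p. f (fst p) * f (snd p) * Re (k p) \<partial>sph2)"
    using integrable_Re[OF D(1)] integral_Re[OF D(1)] D(2) by simp_all
qed

lemma integrable_kmom:
  assumes "integrable surf f"
  shows "integrable sph2 (\<lambda>p. f (fst p) * f (snd p) * Re (hp (fst p) (snd p) ^ j * hp (snd p) (fst p) ^ k))"
  by (rule pd_kernel_real[OF pd_kernel_monomial assms])

lemma kmom_nonneg: "integrable surf f \<Longrightarrow> 0 \<le> kmom f j k"
  unfolding kmom_def by (rule pd_kernel_real[OF pd_kernel_monomial])

lemma kmom_Suc_ge:
  fixes f :: "complex ^ 'n::finite \<Rightarrow> real"
  assumes f: "integrable surf f"
  shows "(real j + 1) / (real CARD('n) + real j) * kmom f j k \<le> kmom f (Suc j) (Suc k)"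
proof -
  let ?r = "(real j + 1) / (real CARD('n) + real j)"
  have "(\<integral>p. f (fst p) * f (snd p) * Re (hp (fst p) (snd p) ^ Suc j * hp (snd p) (fst p) ^ Suc k
      - of_real ?r * (hp (fst p) (snd p) ^ j * hp (snd p) (fst p) ^ k)) \<partial>sph2)
    = (\<integral>p. f (fst p) * f (snd p) * Re (hp (fst p) (snd p) ^ Suc j * hp (snd p) (fst p) ^ Suc k)
       - ?r * (f (fst p) * f (snd p) * Re (hp (fst p) (snd p) ^ j * hp (snd p) (fst p) ^ k)) \<partial>sph2)"
  proof -
    have "u * Re (a - of_real r * b) = u * Re a - r * (u * Re b)" for a b r u by (simp add: algebra_simps)
    then show ?thesis by (simp only:)
  qed
  also have "\<dots> = kmom f (Suc j) (Suc k) - ?r * kmom f j k"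
    unfolding kmom_def
    by (subst Bochner_Integration.integral_diff[OF integrable_kmom[OF f] integrable_mult_right[OF integrable_kmom[OF f]]])
      (simp only: integral_mult_right_zero)
  finally show ?thesis using pd_kernel_real(2)[OF pd_kernel_disc_mult[of j k] f] by simp
qed

lemma kmom_commute:
  fixes f :: "complex ^ 'n \<Rightarrow> real"
  assumes f: "integrable surf f"
  shows "kmom f j k = kmom f k j"
proof -
  have "kmom f j k = (\<integral>(x, y). (\<lambda>p. f (fst p) * f (snd p) * Re (hp (fst p) (snd p) ^ j * hp (snd p) (fst p) ^ k)) (y, x) \<partial>sph2)"
    unfolding kmom_def
    by (rule sph_pair.integral_product_swap[symmetric]) (rule borel_measurable_integrable, rule integrable_kmom[OF f])
  then show ?thesis by (simp add: kmom_def case_prod_unfold mult_ac)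
qed

lemma kmom_const:
  "kmom (\<lambda>_ :: complex ^ 'n::finite. c) j k = (if j = k then c\<^sup>2 * smom TYPE('n) 0 * smom TYPE('n) j else 0)"
proof -
  have pd: "integrable sph2 (\<lambda>p. hp (fst p) (snd p :: complex ^ 'n) ^ j * hp (snd p) (fst p) ^ k)"
    using pd_kernelD(1)[OF pd_kernel_monomial[of j k], of "\<lambda>_. 1"] by simp
  have "(\<integral>p. hp (fst p) (snd p :: complex ^ 'n) ^ j * hp (snd p) (fst p) ^ k \<partial>sph2)
     = (\<integral>x. (\<integral>y. hp x (y :: complex ^ 'n) ^ j * hp y x ^ k \<partial>surf) \<partial>surf)"
    using sph_pair.integral_fst'[OF pd] by simp
  also have "\<dots> = (\<integral>x. (if j = k then of_real (smom TYPE('n) j) else 0) \<partial>(surf :: (complex ^ 'n) measure))"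
    by (rule Bochner_Integration.integral_cong) (auto simp: moment hp_self)
  finally have e: "(\<integral>p. hp (fst p) (snd p :: complex ^ 'n) ^ j * hp (snd p) (fst p) ^ k \<partial>sph2)
     = of_real (if j = k then smom TYPE('n) 0 * smom TYPE('n) j else 0)"
    by (auto simp: smom_0 scaleR_conv_of_real)
  show ?thesis
    unfolding kmom_def integral_mult_right_zero integral_Re[OF pd] e by (simp add: power2_eq_square)
qed

section \<open>Telescoping hypergeometric sums\<close>

text \<open>Terms of the Gauss series \<open>F(a, b; n; 1)\<close>.\<close>
definition hyp :: "real \<Rightarrow> real \<Rightarrow> real \<Rightarrow> nat \<Rightarrow> real" where
  "hyp a b n i = pochhammer a i * pochhammer b i / (fact i * pochhammer n i)"

context
  fixes a b n :: real
  assumes a: "0 < a" and b: "0 < b" and n: "a + b < n"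
begin

lemma hyp_pos: "hyp a b n i > 0"
  unfolding hyp_def using a b n by (intro divide_pos_pos mult_pos_pos pochhammer_pos) auto

lemma hyp_Suc: "hyp a b n (Suc i) * (real (Suc i) * (n + i)) = hyp a b n i * ((a + i) * (b + i))"
proof -
  have "n + i > 0" "pochhammer n i > 0" using a b n by (auto intro: pochhammer_pos)
  define s where "s = real (Suc i)"
  have s: "s > 0" "(fact (Suc i) :: real) = s * fact i" by (simp_all add: s_def)
  have "(x * (a + i)) * (y * (b + i)) / (s * f * (z * (n + i))) * (s * (n + i)) = x * y / (f * z) * ((a + i) * (b + i))"
    if "f > 0" "z > 0" for x y z f :: real
    using that s(1) \<open>n + i > 0\<close> by (simp add: divide_simps)
  from this[OF fact_gt_zero \<open>pochhammer n i > 0\<close>] show ?thesis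
    unfolding hyp_def pochhammer_Suc s(2) s_def[symmetric] .
qed

text \<open>Since \<open>i * hyp a b n i\<close> tends to 0, series of this shape can be summed explicitly.\<close>
lemma hyp_telescope:
  "real (Suc i) * hyp a b n (Suc i) - real i * hyp a b n i = hyp a b n i * ((a * b - i * (n - a - b)) / (n + i))"
proof -
  have ni: "n + i > 0" using a b n by auto
  have "real (Suc i) * hyp a b n (Suc i) = hyp a b n i * ((a + i) * (b + i)) / (n + i)"
    using hyp_Suc[of i] ni by (simp add: field_simps)
  then show ?thesis using ni by (simp add: field_simps)
qed

lemma summable_hyp: "summable (hyp a b n)"
proof -
  define g where "g = n - a - b"
  have g: "g > 0" using n by (simp add: g_def)
  have n0: "n > 0" using a b n by simp
  obtain I :: nat where I: "real I \<ge> 2 * (a * b) / g" "real I \<ge> n" "I \<ge> 1"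
  proof -
    obtain I :: nat where "real I \<ge> max (max (2 * (a * b) / g) n) 1" using real_arch_simple by blast
    then show ?thesis using that[of I] by auto
  qed
  have step: "hyp a b n i * (g / 4) \<le> real i * hyp a b n i - real (Suc i) * hyp a b n (Suc i)" if "i \<ge> I" for i
  proof -
    have i: "real i \<ge> real I" using that by simp
    have "2 * (a * b) / g \<le> real i" using I(1) i by linarith
    then have "2 * (a * b) \<le> real i * g" using g by (simp only: pos_divide_le_eq)
    then have "real i * g / 2 \<le> i * g - a * b" by linarith
    moreover have "(n + i) * (g / 4) \<le> real i * g / 2" using I(2) i g by (simp add: field_simps)
    ultimately have "(n + i) * (g / 4) \<le> i * g - a * b" by linarith
    then have "g / 4 \<le> (i * g - a * b) / (n + i)" using n0 by (simp add: le_divide_eq mult.commute)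
    then have "hyp a b n i * (g / 4) \<le> hyp a b n i * ((i * g - a * b) / (n + i))"
      using hyp_pos[of i] by (intro mult_left_mono) auto
    also have "\<dots> = - (hyp a b n i * ((a * b - i * (n - a - b)) / (n + i)))"
    proof -
      have "(i * g - a * b) / (n + i) = - ((a * b - i * (n - a - b)) / (n + i))"
        unfolding minus_divide_left by (simp add: g_def)
      then show ?thesis by simp
    qed
    finally show ?thesis unfolding hyp_telescope[symmetric] by simp
  qed
  have "(\<Sum>i<m. hyp a b n (i + I) * (g / 4)) \<le> real I * hyp a b n I - real (m + I) * hyp a b n (m + I)" for m
  proof (induction m)
    case (Suc m)
    then show ?case using step[of "m + I"] by simp
  qed simp
  moreover have "real (m + I) * hyp a b n (m + I) \<ge> 0" for m using hyp_pos[of "m + I"] by simp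
  ultimately have bd: "(\<Sum>i<m. hyp a b n (i + I) * (g / 4)) \<le> real I * hyp a b n I" for m by (smt (verit))
  have "summable (\<lambda>i. hyp a b n (i + I) * (g / 4))"
    by (rule summableI_nonneg_bounded[where x="real I * hyp a b n I"]) (use bd g less_imp_le[OF hyp_pos] in auto)
  from summable_mult2[OF this, of "4 / g"] have "summable (\<lambda>i. hyp a b n (i + I))" using g by simp
  then show ?thesis using summable_iff_shift by blast
qed

lemma hyp_times_index_tendsto: "(\<lambda>i. real i * hyp a b n i) \<longlonglongrightarrow> 0"
proof -
  have bd: "\<bar>(a * b - i * (n - a - b)) / (n + i)\<bar> \<le> a * b / n + (n - a - b)" for i :: nat
  proof -
    have ni: "n > 0" "n + i > 0" using a b n by auto
    have "\<bar>a * b - i * (n - a - b)\<bar> \<le> a * b + i * (n - a - b)" using a b n by (auto simp: abs_le_iff)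
    also have "\<dots> \<le> (a * b / n + (n - a - b)) * (n + i)"
    proof -
      have "a * b = a * b / n * n" using ni by simp
      also have "\<dots> \<le> a * b / n * (n + i)" using ni a b by (intro mult_left_mono) auto
      finally have "a * b \<le> a * b / n * (n + i)" .
      moreover have "i * (n - a - b) \<le> (n - a - b) * (n + i)" using ni n by (simp add: mult.commute mult_left_mono)
      ultimately show ?thesis by (simp add: distrib_right)
    qed
    finally show ?thesis using ni by (simp add: divide_le_eq)
  qed
  have "summable (\<lambda>i. hyp a b n i * ((a * b - i * (n - a - b)) / (n + i)))"
  proof (rule summable_comparison_test')
    show "summable (\<lambda>i. hyp a b n i * (a * b / n + (n - a - b)))" using summable_hyp by (rule summable_mult2)
    show "norm (hyp a b n i * ((a * b - i * (n - a - b)) / (n + i))) \<le> hyp a b n i * (a * b / n + (n - a - b))" for i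
      using hyp_pos[of i] bd[of i] by (simp only: real_norm_def abs_mult) (intro mult_mono; simp)
  qed
  then obtain L where "(\<lambda>i. hyp a b n i * ((a * b - i * (n - a - b)) / (n + i))) sums L" by (auto simp: summable_def)
  then have "(\<lambda>m. \<Sum>i<m. real (Suc i) * hyp a b n (Suc i) - real i * hyp a b n i) \<longlonglongrightarrow> L"
    unfolding sums_def hyp_telescope .
  moreover have "(\<Sum>i<m. real (Suc i) * hyp a b n (Suc i) - real i * hyp a b n i) = real m * hyp a b n m" for m
    by (subst sum_lessThan_telescope) simp
  ultimately have lim: "(\<lambda>m. real m * hyp a b n m) \<longlonglongrightarrow> L" by simp
  have "L = 0"
  proof (rule ccontr)
    assume "L \<noteq> 0"
    moreover have "L \<ge> 0" by (rule LIMSEQ_le_const[OF lim]) (use less_imp_le[OF hyp_pos] in \<open>auto intro!: exI[of _ 0] mult_nonneg_nonneg\<close>)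
    ultimately have L: "L > 0" by simp
    then have "eventually (\<lambda>m. real m * hyp a b n m > L / 2) sequentially"
      using order_tendstoD(1)[OF lim, of "L/2"] by simp
    then have ev: "eventually (\<lambda>m. norm (inverse (real m)) \<le> hyp a b n m * (2 / L)) sequentially"
      using eventually_gt_at_top[of 0]
    proof eventually_elim
      case (elim m)
      then show ?case using L by (simp add: field_simps)
    qed
    have "summable (\<lambda>m. inverse (real m))"
      by (rule summable_comparison_test_ev[OF ev summable_mult2[OF summable_hyp]])
    then show False using not_summable_harmonic[where 'a=real] by (simp add: inverse_eq_divide)
  qed
  with lim show ?thesis by simp
qed

text \<open>The partial sums of the difference of the two sides are multiples of \<open>i * hyp a b n i\<close>, which tends to 0.\<close>
lemma hyp_sum_weight_a:
  "(\<lambda>i. hyp a b n i * (real i / (real i + a - 1))) sums (b / (n - a) * suminf (hyp a b n))"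
proof -
  define U where "U i = - (real i * hyp a b n i) / (n - a)" for i
  have na: "n - a > 0" using b n by simp
  define s where "s i = hyp a b n i * ((b + i) / (n + i))" for i :: nat
  have sS: "hyp a b n (Suc i) * (real (Suc i) / (real (Suc i) + a - 1)) = s i" for i
  proof -
    have p: "n + i > 0" "a + i > 0" using a b n by auto
    have "hyp a b n (Suc i) * real (Suc i) = hyp a b n i * ((a + i) * (b + i)) / (n + i)"
      using hyp_Suc[of i] p by (simp add: field_simps)
    moreover have "real (Suc i) + a - 1 = a + i" by simp
    ultimately show ?thesis unfolding s_def using p by (simp add: field_simps)
  qed
  have "s i - b / (n - a) * hyp a b n i = U (Suc i) - U i" for i
  proof -
    have p: "n + i > 0" using a b n by auto
    have "U (Suc i) - U i = - (real (Suc i) * hyp a b n (Suc i) - real i * hyp a b n i) / (n - a)"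
      by (simp add: U_def field_simps diff_divide_distrib add_divide_distrib)
    also have "\<dots> = hyp a b n i * (- ((a * b - i * (n - a - b)) / (n + i)) / (n - a))"
      unfolding hyp_telescope by simp
    also have "- ((a * b - i * (n - a - b)) / (n + i)) / (n - a) = (b + i) / (n + i) - b / (n - a)"
      using p na by (simp add: divide_simps) (simp add: algebra_simps)
    finally show ?thesis by (simp add: s_def algebra_simps)
  qed
  moreover have "(\<lambda>i. U (Suc i) - U i) sums (0 - U 0)"
  proof (rule telescope_sums)
    have "(\<lambda>i. - (real i * hyp a b n i) / (n - a)) \<longlonglongrightarrow> - 0 / (n - a)"
      by (intro tendsto_intros hyp_times_index_tendsto) (use na in simp)
    then show "U \<longlonglongrightarrow> 0" unfolding U_def by simp
  qed
  ultimately have "(\<lambda>i. s i - b / (n - a) * hyp a b n i) sums 0" by (simp add: U_def)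
  moreover have "(\<lambda>i. b / (n - a) * hyp a b n i) sums (b / (n - a) * suminf (hyp a b n))"
    using summable_hyp by (intro sums_mult summable_sums)
  ultimately have "(\<lambda>i. (s i - b / (n - a) * hyp a b n i) + b / (n - a) * hyp a b n i) sums (0 + b / (n - a) * suminf (hyp a b n))"
    by (rule sums_add)
  then have "s sums (b / (n - a) * suminf (hyp a b n))" by simp
  then have "(\<lambda>i. hyp a b n (Suc i) * (real (Suc i) / (real (Suc i) + a - 1))) sums (b / (n - a) * suminf (hyp a b n))"
    unfolding sS .
  then show ?thesis by (subst (asm) sums_Suc_iff) simp
qed

lemma hyp_sum_weight_b:
  assumes b1: "b > 1"
  shows "(\<lambda>i. hyp a b n i * (1 / (b + real i - 1))) sums ((n - a - b) / ((b - 1) * (n - b)) * suminf (hyp a b n))"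
proof -
  define V where "V i = (real i * hyp a b n i) * ((n + i - 1) / (b + i - 1)) / ((b - 1) * (n - b))" for i :: nat
  have nb: "n - b > 0" using a n by simp
  have bn: "b + real i - 1 \<noteq> 0" for i using b1 by (smt (verit) of_nat_0_le_iff)
  have bn0: "b - 1 \<noteq> 0" using bn[of 0] by simp
  have VS: "V (Suc i) = hyp a b n i * (a + i) / ((b - 1) * (n - b))" for i
  proof -
    have p: "n + i > 0" "b + i > 0" using a b n by auto
    have "real (Suc i) * hyp a b n (Suc i) = hyp a b n i * ((a + i) * (b + i)) / (n + i)"
      using hyp_Suc[of i] p by (simp add: field_simps)
    then show ?thesis unfolding V_def using p by (simp add: add.commute)
  qed
  have "hyp a b n i * (1 / (b + real i - 1)) - (n - a - b) / ((b - 1) * (n - b)) * hyp a b n i = V (Suc i) - V i" for i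
  proof -
    have "1 / (b + real i - 1) - (n - a - b) / ((b - 1) * (n - b))
      = ((a + i) - real i * ((n + i - 1) / (b + i - 1))) / ((b - 1) * (n - b))"
      using bn[of i] bn0 nb by (simp add: divide_simps) (simp add: algebra_simps)
    then have "hyp a b n i * (1 / (b + real i - 1) - (n - a - b) / ((b - 1) * (n - b)))
      = hyp a b n i * (((a + i) - real i * ((n + i - 1) / (b + i - 1))) / ((b - 1) * (n - b)))" by simp
    also have "\<dots> = V (Suc i) - V i" unfolding VS unfolding V_def by (simp add: diff_divide_distrib right_diff_distrib mult_ac)
    finally show ?thesis by (simp add: right_diff_distrib mult.commute)
  qed
  moreover have "(\<lambda>i. V (Suc i) - V i) sums (0 - V 0)"
  proof (rule telescope_sums)
    have "(\<lambda>i. (n + real i - 1) / (b + real i - 1)) \<longlonglongrightarrow> 1"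
    proof -
      have "(\<lambda>i. 1 + (n - b) * inverse (real i + (b - 1))) \<longlonglongrightarrow> 1 + (n - b) * 0"
        by (intro tendsto_intros tendsto_inverse_0_at_top filterlim_at_top_add_at_top[of real]
           filterlim_tendsto_add_at_top[OF tendsto_const filterlim_real_sequentially, of "b - 1", simplified add.commute])
      moreover have "1 + (n - b) * inverse (real i + (b - 1)) = (n + real i - 1) / (b + real i - 1)" for i
        using bn[of i] by (simp add: field_simps)
      ultimately show ?thesis by simp
    qed
    then have "(\<lambda>i. (real i * hyp a b n i) * ((n + real i - 1) / (b + real i - 1)) / ((b - 1) * (n - b))) \<longlonglongrightarrow> 0 * 1 / ((b - 1) * (n - b))"
      by (intro tendsto_intros hyp_times_index_tendsto) (use bn0 nb in auto)
    then show "V \<longlonglongrightarrow> 0" unfolding V_def[abs_def] by simp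
  qed
  ultimately have "(\<lambda>i. hyp a b n i * (1 / (b + real i - 1)) - (n - a - b) / ((b - 1) * (n - b)) * hyp a b n i) sums 0"
    by (simp add: V_def)
  moreover have "(\<lambda>i. (n - a - b) / ((b - 1) * (n - b)) * hyp a b n i) sums ((n - a - b) / ((b - 1) * (n - b)) * suminf (hyp a b n))"
    using summable_hyp by (intro sums_mult summable_sums)
  ultimately have "(\<lambda>i. (hyp a b n i * (1 / (b + real i - 1)) - (n - a - b) / ((b - 1) * (n - b)) * hyp a b n i)
      + (n - a - b) / ((b - 1) * (n - b)) * hyp a b n i) sums (0 + (n - a - b) / ((b - 1) * (n - b)) * suminf (hyp a b n))"
    by (rule sums_add)
  then show ?thesis by simp
qed

end

section \<open>Power series kernels and their quadratic forms\<close>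

definition bcoef :: "real \<Rightarrow> nat \<Rightarrow> real" where "bcoef \<alpha> k = pochhammer \<alpha> k / fact k"

lemma bcoef_pos: "0 < \<alpha> \<Longrightarrow> 0 < bcoef \<alpha> k"
  by (simp add: bcoef_def pochhammer_pos)

lemma binomial_series_complex:
  assumes "cmod w < 1"
  shows "(\<lambda>k. of_real (bcoef \<alpha> k) * w ^ k) sums ((1 - w) powr (- of_real \<alpha>))"
proof -
  have "((- complex_of_real \<alpha>) gchoose k) * (- w) ^ k = of_real (bcoef \<alpha> k) * w ^ k" for k
  proof -
    have "(- w) ^ k = (- 1) ^ k * w ^ k" by (simp flip: power_mult_distrib)
    moreover have "(- 1) ^ k * (- 1) ^ k = (1 :: complex)" by (simp flip: power_mult_distrib)
    moreover have "pochhammer (complex_of_real \<alpha>) k = of_real (pochhammer \<alpha> k)" by (simp add: pochhammer_of_real)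
    ultimately show ?thesis
      by (simp add: gbinomial_pochhammer bcoef_def mult_ac)
  qed
  moreover have "(\<lambda>k. ((- complex_of_real \<alpha>) gchoose k) * (- w) ^ k) sums ((1 + - w) powr (- of_real \<alpha>))"
    by (rule gen_binomial_complex) (use assms in simp)
  ultimately show ?thesis by simp
qed

lemma norm_powr_real_exponent: "z \<noteq> 0 \<Longrightarrow> cmod (z powr of_real a) = cmod z powr a"
  by (simp add: powr_def norm_exp_eq_Re Re_Ln)

lemma summable_bcoef:
  assumes "0 < \<alpha>" "0 \<le> r" "r < 1"
  shows "summable (\<lambda>k. bcoef \<alpha> k * r ^ k)"
proof -
  have "summable (\<lambda>k. complex_of_real (bcoef \<alpha> k) * (of_real r) ^ k)"
    using binomial_series_complex[of "of_real r" \<alpha>] assms by (auto simp: sums_iff)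
  then have "summable (\<lambda>k. complex_of_real (bcoef \<alpha> k * r ^ k))" by simp
  then show ?thesis by (simp only: summable_of_real_iff)
qed

definition ps :: "(nat \<Rightarrow> real) \<Rightarrow> complex \<Rightarrow> complex" where
  "ps c w = (\<Sum>k. of_real (c k) * w ^ k)"

lemma ps_bcoef:
  assumes "0 \<le> r" "r < 1" "cmod w \<le> 1"
  shows "ps (\<lambda>k. bcoef \<alpha> k * r ^ k) w = (1 - of_real r * w) powr (- of_real \<alpha>)"
proof -
  have "cmod (of_real r * w) < 1"
  proof -
    have "cmod (of_real r * w) \<le> r * 1" unfolding norm_mult using assms by (intro mult_mono) auto
    then show ?thesis using assms by simp
  qed
  from binomial_series_complex[OF this, of \<alpha>] show ?thesis
    by (simp add: ps_def sums_iff power_mult_distrib mult_ac)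
qed

lemma norm_one_minus_pos: "0 \<le> r \<Longrightarrow> r < 1 \<Longrightarrow> cmod w \<le> 1 \<Longrightarrow> 1 - r \<le> cmod (1 - of_real r * w)"
proof -
  assume a: "0 \<le> r" "r < 1" "cmod w \<le> 1"
  have "cmod (of_real r * w) \<le> r * 1" unfolding norm_mult using a by (intro mult_mono) auto
  moreover have "cmod (1 :: complex) - cmod (of_real r * w) \<le> cmod (1 - of_real r * w)" by (rule norm_triangle_ineq2)
  ultimately show ?thesis by simp
qed

lemma norm_ps_bcoef:
  assumes "0 \<le> r" "r < 1" "cmod w \<le> 1"
  shows "(cmod (ps (\<lambda>k. bcoef \<alpha> k * r ^ k) w))\<^sup>2 = cmod (1 - of_real r * w) powr (- (2 * \<alpha>))"
proof -
  have nz: "1 - of_real r * w \<noteq> 0" using norm_one_minus_pos[OF assms] assms by auto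
  have "cmod ((1 - of_real r * w) powr (of_real (- \<alpha>))) = cmod (1 - of_real r * w) powr (- \<alpha>)"
    by (rule norm_powr_real_exponent[OF nz])
  then show ?thesis unfolding ps_bcoef[OF assms]
    by (simp add: power2_eq_square flip: powr_add)
qed

text \<open>Squared moduli of polynomials have nonnegative coefficients in the monomials \<open>w\<^sup>j cnj w\<^sup>k\<close>; this is the source of positivity of all forms below.\<close>
lemma re_monomial_expand:
  "(cmod (\<Sum>k<n. of_real (c k) * w ^ k))\<^sup>2 = (\<Sum>j<n. \<Sum>k<n. c j * c k * Re (w ^ j * cnj w ^ k))"
proof -
  have "complex_of_real ((cmod (\<Sum>k<n. of_real (c k) * w ^ k))\<^sup>2)
     = (\<Sum>j<n. \<Sum>k<n. of_real (c j * c k) * (w ^ j * cnj w ^ k))"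
    unfolding complex_norm_square cnj_sum sum_product by (intro sum.cong refl) (simp add: mult_ac)
  then have "Re (complex_of_real ((cmod (\<Sum>k<n. of_real (c k) * w ^ k))\<^sup>2))
     = (\<Sum>j<n. \<Sum>k<n. Re (of_real (c j * c k) * (w ^ j * cnj w ^ k)))" by (simp only: Re_sum)
  moreover have "Re (of_real r * z) = r * Re z" for r z by simp
  ultimately show ?thesis by (simp only: Re_complex_of_real)
qed

lemma re_monomial_expand':
  "Re w * (cmod (\<Sum>k<n. of_real (c k) * w ^ k))\<^sup>2 = (\<Sum>j<n. \<Sum>k<n. c j * c k * Re (w ^ Suc j * cnj w ^ k))"
proof -
  have "complex_of_real ((cmod (\<Sum>k<n. of_real (c k) * w ^ k))\<^sup>2)
     = (\<Sum>j<n. \<Sum>k<n. of_real (c j * c k) * (w ^ j * cnj w ^ k))"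
    unfolding complex_norm_square cnj_sum sum_product by (intro sum.cong refl) (simp add: mult_ac)
  then have "w * complex_of_real ((cmod (\<Sum>k<n. of_real (c k) * w ^ k))\<^sup>2)
     = (\<Sum>j<n. \<Sum>k<n. of_real (c j * c k) * (w ^ Suc j * cnj w ^ k))"
    by (simp only: sum_distrib_left) (intro sum.cong refl, simp add: mult_ac)
  then have "Re (w * complex_of_real ((cmod (\<Sum>k<n. of_real (c k) * w ^ k))\<^sup>2))
     = (\<Sum>j<n. \<Sum>k<n. Re (of_real (c j * c k) * (w ^ Suc j * cnj w ^ k)))" by (simp only: Re_sum)
  moreover have "Re (of_real r * z) = r * Re z" "Re (z * of_real r) = Re z * r" for r z by simp_all
  ultimately show ?thesis by (simp only:)
qed

lemma ps_square_uniform: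
  assumes c: "summable c" "\<And>k. 0 \<le> c k" and e: "0 < (e::real)"
  obtains M where "\<And>n w. n \<ge> M \<Longrightarrow> cmod w \<le> 1 \<Longrightarrow>
    \<bar>(cmod (ps c w))\<^sup>2 - (cmod (\<Sum>k<n. of_real (c k) * w ^ k))\<^sup>2\<bar> \<le> e"
proof -
  define S where "S = suminf c"
  have S: "S \<ge> 0" unfolding S_def by (rule suminf_nonneg[OF c])
  define d where "d = e / (2 * S + 1)"
  have d: "d > 0" using e S by (simp add: d_def)
  have "(\<lambda>n. \<Sum>k<n. c k) \<longlonglongrightarrow> S" unfolding S_def using summable_LIMSEQ[OF c(1)] .
  then obtain M where M: "\<And>n. n \<ge> M \<Longrightarrow> \<bar>(\<Sum>k<n. c k) - S\<bar> < d"
    using d LIMSEQ_D[of _ S d] by (metis real_norm_def)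
  show ?thesis
  proof (rule that[of M])
    fix n w assume n: "n \<ge> M" and w: "cmod w \<le> (1::real)"
    have nt: "norm (of_real (c k) * w ^ k) \<le> c k" for k
    proof -
      have "norm (of_real (c k) * w ^ k) = c k * cmod w ^ k" using c(2)[of k] by (simp add: norm_mult norm_power)
      also have "\<dots> \<le> c k * 1" by (intro mult_left_mono power_le_one c w) simp
      finally show ?thesis by simp
    qed
    have sm: "summable (\<lambda>k. complex_of_real (c k) * w ^ k)"
      by (rule summable_comparison_test'[OF c(1)]) (rule nt)
    define A where "A = ps c w"
    define B where "B = (\<Sum>k<n. of_real (c k) * w ^ k)"
    have "A - B = (\<Sum>k. of_real (c (k + n)) * w ^ (k + n))"
      unfolding A_def B_def ps_def using suminf_split_initial_segment[OF sm, of n] by simp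
    also have "norm \<dots> \<le> (\<Sum>k. c (k + n))"
      by (rule norm_suminf_le[OF nt]) (use c in \<open>simp add: summable_iff_shift\<close>)
    also have "\<dots> = S - (\<Sum>k<n. c k)" unfolding S_def using suminf_split_initial_segment[OF c(1), of n] by simp
    also have "\<dots> \<le> d" using M[OF n] by linarith
    finally have AB: "norm (A - B) \<le> d" .
    have nA: "norm A \<le> S" unfolding A_def ps_def S_def by (rule norm_suminf_le[OF nt c(1)])
    have "norm B \<le> (\<Sum>k<n. c k)" unfolding B_def by (rule sum_norm_le) (rule nt)
    also have "\<dots> \<le> S" unfolding S_def using c by (intro sum_le_suminf) auto
    finally have nB: "norm B \<le> S" .
    have "\<bar>(cmod A)\<^sup>2 - (cmod B)\<^sup>2\<bar> = \<bar>cmod A - cmod B\<bar> * \<bar>cmod A + cmod B\<bar>"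
      by (simp add: power2_eq_square square_diff_square_factored abs_mult)
    also have "\<dots> \<le> d * (2 * S + 1)"
      using AB nA nB norm_triangle_ineq3[of A B] by (intro mult_mono) auto
    also have "\<dots> = e" using S by (simp add: d_def)
    finally show "\<bar>(cmod (ps c w))\<^sup>2 - (cmod (\<Sum>k<n. of_real (c k) * w ^ k))\<^sup>2\<bar> \<le> e"
      by (simp add: A_def B_def)
  qed
qed

lemma suminf_measurable_ps:
  assumes c: "summable c" "\<And>k. 0 \<le> c k"
  shows "continuous_on (cball 0 1) (ps c)"
proof -
  have "uniform_limit (cball 0 1) (\<lambda>n w. \<Sum>k<n. complex_of_real (c k) * w ^ k) (\<lambda>w. \<Sum>k. of_real (c k) * w ^ k) sequentially"
  proof (rule Weierstrass_m_test[OF _ c(1)])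
    fix k and w :: complex assume "w \<in> cball 0 1"
    then have "cmod w \<le> 1" by simp
    have "norm (of_real (c k) * w ^ k) = c k * cmod w ^ k" using c(2)[of k] by (simp add: norm_mult norm_power)
    also have "\<dots> \<le> c k * 1" by (intro mult_left_mono power_le_one c \<open>cmod w \<le> 1\<close>) simp
    finally show "norm (of_real (c k) * w ^ k) \<le> c k" by simp
  qed
  then show ?thesis unfolding ps_def[abs_def]
    by (rule uniform_limit_theorem[rotated]) (auto intro!: always_eventually continuous_intros)
qed

lemma continuous_on_ps_hp:
  assumes c: "summable c" "\<And>k. 0 \<le> c k"
  shows "continuous_on (sphere 0 1 \<times> sphere 0 1) (\<lambda>p. ps c (hp (fst p) (snd p)))"
  by (rule continuous_on_compose2[OF suminf_measurable_ps[OF c]])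
    (auto intro!: continuous_intros norm_hp_le_1)

lemma measurable_on_sphere_pairs:
  fixes g :: "(complex ^ 'n) \<times> (complex ^ 'n) \<Rightarrow> 'b::topological_space"
  assumes "continuous_on (sphere 0 1 \<times> sphere 0 1) g"
  shows "g \<in> borel_measurable sph2"
proof -
  have "(\<lambda>p. (fst p, snd p)) \<in> sph2 \<rightarrow>\<^sub>M (borel :: ((complex ^ 'n) \<times> (complex ^ 'n)) measure)"
    by (rule borel_measurable_Pair[OF measurable_fst_borel measurable_snd_borel])
  then have "(\<lambda>p. p) \<in> sph2 \<rightarrow>\<^sub>M (restrict_space borel (sphere 0 1 \<times> sphere 0 1) :: ((complex ^ 'n) \<times> (complex ^ 'n)) measure)"
    by (intro measurable_restrict_space2) (auto simp: space_pair_measure)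
  from measurable_compose[OF this borel_measurable_continuous_on_restrict[OF assms]] show ?thesis by simp
qed

definition kform :: "(complex \<Rightarrow> real) \<Rightarrow> (complex ^ 'n \<Rightarrow> real) \<Rightarrow> real" where
  "kform k f = (\<integral>p. f (fst p) * f (snd p) * k (hp (fst p) (snd p)) \<partial>sph2)"

lemma kform_uniform:
  fixes f :: "complex ^ 'n \<Rightarrow> real"
  assumes f: "integrable surf f"
    and m: "(\<lambda>p. k1 (hp (fst p) (snd p :: complex ^ 'n))) \<in> borel_measurable sph2" "(\<lambda>p. k2 (hp (fst p) (snd p :: complex ^ 'n))) \<in> borel_measurable sph2"
    and b: "\<And>w. cmod w \<le> 1 \<Longrightarrow> \<bar>k1 w\<bar> \<le> B" "\<And>w. cmod w \<le> 1 \<Longrightarrow> \<bar>k2 w\<bar> \<le> B'"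
    and e: "\<And>w. cmod w \<le> 1 \<Longrightarrow> \<bar>k1 w - k2 w\<bar> \<le> e"
  shows "\<bar>kform k1 f - kform k2 f\<bar> \<le> e * (\<integral>x. \<bar>f x\<bar> \<partial>surf)\<^sup>2"
proof -
  have hp1: "cmod (hp (fst p) (snd p)) \<le> 1" if "p \<in> space sph2" for p :: "(complex ^ 'n) \<times> (complex ^ 'n)"
    using space_sph2[OF that] by (auto intro: norm_hp_le_1)
  have ff: "integrable sph2 (\<lambda>p. f (fst p) * f (snd p))"
    using f by (intro integrable_product sph_pair.pair_sigma_finite_axioms)
  have aff: "integrable sph2 (\<lambda>p. \<bar>f (fst p)\<bar> * \<bar>f (snd p)\<bar>)"
    "(\<integral>p. \<bar>f (fst p)\<bar> * \<bar>f (snd p)\<bar> \<partial>sph2) = (\<integral>x. \<bar>f x\<bar> \<partial>surf)\<^sup>2"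
    unfolding power2_eq_square using f
    using integrable_product[OF sph_pair.pair_sigma_finite_axioms, of "\<lambda>x. \<bar>f x\<bar>" "\<lambda>x. \<bar>f x\<bar>"] by auto
  have i1: "integrable sph2 (\<lambda>p. f (fst p) * f (snd p) * k1 (hp (fst p) (snd p)))"
    by (rule integrable_bounded_factor[OF ff m(1), of B]) (use b hp1 in auto)
  have i2: "integrable sph2 (\<lambda>p. f (fst p) * f (snd p) * k2 (hp (fst p) (snd p)))"
    by (rule integrable_bounded_factor[OF ff m(2), of B']) (use b hp1 in auto)
  have "kform k1 f - kform k2 f = (\<integral>p. f (fst p) * f (snd p) * k1 (hp (fst p) (snd p)) - f (fst p) * f (snd p) * k2 (hp (fst p) (snd p)) \<partial>sph2)"
    unfolding kform_def by (rule Bochner_Integration.integral_diff[OF i1 i2, symmetric])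
  also have "\<bar>\<dots>\<bar> \<le> (\<integral>p. \<bar>f (fst p) * f (snd p) * k1 (hp (fst p) (snd p)) - f (fst p) * f (snd p) * k2 (hp (fst p) (snd p))\<bar> \<partial>sph2)"
    by (rule integral_abs_bound)
  also have "\<dots> \<le> (\<integral>p. e * (\<bar>f (fst p)\<bar> * \<bar>f (snd p)\<bar>) \<partial>sph2)"
  proof (rule integral_mono)
    fix p :: "(complex ^ 'n) \<times> (complex ^ 'n)" assume p: "p \<in> space sph2"
    have "\<bar>f (fst p) * f (snd p) * k1 (hp (fst p) (snd p)) - f (fst p) * f (snd p) * k2 (hp (fst p) (snd p))\<bar>
      = (\<bar>f (fst p)\<bar> * \<bar>f (snd p)\<bar>) * \<bar>k1 (hp (fst p) (snd p)) - k2 (hp (fst p) (snd p))\<bar>"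
      unfolding right_diff_distrib[symmetric] abs_mult ..
    also have "\<dots> \<le> (\<bar>f (fst p)\<bar> * \<bar>f (snd p)\<bar>) * e" by (intro mult_left_mono e hp1 p) auto
    finally show "\<bar>f (fst p) * f (snd p) * k1 (hp (fst p) (snd p)) - f (fst p) * f (snd p) * k2 (hp (fst p) (snd p))\<bar>
      \<le> e * (\<bar>f (fst p)\<bar> * \<bar>f (snd p)\<bar>)" by (simp add: mult.commute)
  qed (use i1 i2 aff in auto)
  finally show ?thesis by (simp add: aff(2))
qed

lemma kform_monomials:
  fixes f :: "complex ^ 'n \<Rightarrow> real"
  assumes f: "integrable surf f"
  shows "kform (\<lambda>w. \<Sum>j<n. \<Sum>k<n. c j * d k * Re (w ^ (j + i) * cnj w ^ k)) f
     = (\<Sum>j<n. \<Sum>k<n. c j * d k * kmom f (j + i) k)"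
proof -
  note I = integrable_kmom[OF f]
  have "kform (\<lambda>w. \<Sum>j<n. \<Sum>k<n. c j * d k * Re (w ^ (j + i) * cnj w ^ k)) f
     = (\<integral>p. (\<Sum>j<n. \<Sum>k<n. c j * d k * (f (fst p) * f (snd p) * Re (hp (fst p) (snd p) ^ (j + i) * hp (snd p) (fst p) ^ k))) \<partial>sph2)"
    unfolding kform_def sum_distrib_left cnj_hp by (simp only: mult_ac)
  also have "\<dots> = (\<Sum>j<n. \<Sum>k<n. c j * d k * kmom f (j + i) k)"
    unfolding kmom_def
    by (subst Bochner_Integration.integral_sum, (intro Bochner_Integration.integrable_sum integrable_mult_right I),
        intro sum.cong refl, subst Bochner_Integration.integral_sum, (intro integrable_mult_right I),
        simp only: integral_mult_right_zero)
  finally show ?thesis .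
qed

lemma ps_bound:
  assumes c: "summable c" "\<And>k. 0 \<le> c k" and w: "cmod w \<le> 1"
  shows "(cmod (ps c w))\<^sup>2 \<le> (suminf c)\<^sup>2" "(cmod (\<Sum>k<n. of_real (c k) * w ^ k))\<^sup>2 \<le> (suminf c)\<^sup>2"
proof -
  have nt: "norm (of_real (c k) * w ^ k) \<le> c k" for k
  proof -
    have "norm (of_real (c k) * w ^ k) = c k * cmod w ^ k" using c(2)[of k] by (simp add: norm_mult norm_power)
    also have "\<dots> \<le> c k * 1" by (intro mult_left_mono power_le_one c w) simp
    finally show ?thesis by simp
  qed
  show "(cmod (ps c w))\<^sup>2 \<le> (suminf c)\<^sup>2"
    unfolding ps_def by (intro power_mono norm_suminf_le[OF nt c(1)]) simp
  have "norm (\<Sum>k<n. of_real (c k) * w ^ k) \<le> (\<Sum>k<n. c k)" by (rule sum_norm_le) (rule nt)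
  also have "\<dots> \<le> suminf c" using c by (intro sum_le_suminf) auto
  finally show "(cmod (\<Sum>k<n. of_real (c k) * w ^ k))\<^sup>2 \<le> (suminf c)\<^sup>2"
    by (rule power_mono) (rule norm_ge_zero)
qed

lemma measurable_poly_hp [measurable]:
  "(\<lambda>p. (cmod (\<Sum>k<n. of_real (c k) * hp (fst p) (snd p) ^ k))\<^sup>2) \<in> borel_measurable (sph2 :: ((complex ^ 'n) \<times> (complex ^ 'n)) measure)"
  by (rule measurable_on_sphere_pairs) (intro continuous_intros)

lemma measurable_ps_hp:
  assumes c: "summable c" "\<And>k. 0 \<le> c k"
  shows "(\<lambda>p. (cmod (ps c (hp (fst p) (snd p))))\<^sup>2) \<in> borel_measurable (sph2 :: ((complex ^ 'n) \<times> (complex ^ 'n)) measure)"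
  by (rule measurable_on_sphere_pairs) (intro continuous_intros continuous_on_ps_hp[OF c])

text \<open>Uniform approximation on the disc by partial sums; the error is relative to \<open>\<parallel>f\<parallel>\<^sub>1\<^sup>2\<close> and thus uniform over bounded sets of \<open>L\<^sup>1\<close>.\<close>
lemma kform_ps_approx:
  assumes c: "summable c" "\<And>k. 0 \<le> c k" and e: "0 < (e::real)"
  obtains M where "\<And>n (f :: complex ^ 'n \<Rightarrow> real). n \<ge> M \<Longrightarrow> integrable surf f \<Longrightarrow>
    \<bar>kform (\<lambda>w. (cmod (ps c w))\<^sup>2) f - (\<Sum>j<n. \<Sum>k<n. c j * c k * kmom f j k)\<bar> \<le> e * (\<integral>x. \<bar>f x\<bar> \<partial>surf)\<^sup>2"
proof -
  obtain M where M: "\<And>n w. n \<ge> M \<Longrightarrow> cmod w \<le> 1 \<Longrightarrow>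
    \<bar>(cmod (ps c w))\<^sup>2 - (cmod (\<Sum>k<n. of_real (c k) * w ^ k))\<^sup>2\<bar> \<le> e" using ps_square_uniform[OF c e] by blast
  show ?thesis
  proof (rule that[of M])
    fix n and f :: "complex ^ 'n \<Rightarrow> real" assume n: "n \<ge> M" and f: "integrable surf f"
    have "\<bar>kform (\<lambda>w. (cmod (ps c w))\<^sup>2) f - kform (\<lambda>w. (cmod (\<Sum>k<n. of_real (c k) * w ^ k))\<^sup>2) f\<bar> \<le> e * (\<integral>x. \<bar>f x\<bar> \<partial>surf)\<^sup>2"
      by (rule kform_uniform[OF f measurable_ps_hp[OF c] measurable_poly_hp, where B="(suminf c)\<^sup>2" and B'="(suminf c)\<^sup>2"])
        (use ps_bound[OF c] M[OF n] in auto)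
    moreover have "kform (\<lambda>w. (cmod (\<Sum>k<n. of_real (c k) * w ^ k))\<^sup>2) f = (\<Sum>j<n. \<Sum>k<n. c j * c k * kmom f j k)"
      unfolding re_monomial_expand using kform_monomials[OF f, where n=n and c=c and d=c and i=0] by simp
    ultimately show "\<bar>kform (\<lambda>w. (cmod (ps c w))\<^sup>2) f - (\<Sum>j<n. \<Sum>k<n. c j * c k * kmom f j k)\<bar> \<le> e * (\<integral>x. \<bar>f x\<bar> \<partial>surf)\<^sup>2"
      by simp
  qed
qed

lemma kform_ps_Re_approx:
  assumes c: "summable c" "\<And>k. 0 \<le> c k" and e: "0 < (e::real)"
  obtains M where "\<And>n (f :: complex ^ 'n \<Rightarrow> real). n \<ge> M \<Longrightarrow> integrable surf f \<Longrightarrow>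
    \<bar>kform (\<lambda>w. Re w * (cmod (ps c w))\<^sup>2) f - (\<Sum>j<n. \<Sum>k<n. c j * c k * kmom f (Suc j) k)\<bar> \<le> e * (\<integral>x. \<bar>f x\<bar> \<partial>surf)\<^sup>2"
proof -
  obtain M where M: "\<And>n w. n \<ge> M \<Longrightarrow> cmod w \<le> 1 \<Longrightarrow>
    \<bar>(cmod (ps c w))\<^sup>2 - (cmod (\<Sum>k<n. of_real (c k) * w ^ k))\<^sup>2\<bar> \<le> e" using ps_square_uniform[OF c e] by blast
  have Re1: "\<bar>Re w * x\<bar> \<le> B" if "cmod w \<le> 1" "\<bar>x\<bar> \<le> B" for w x B
  proof -
    have "\<bar>Re w\<bar> \<le> 1" using abs_Re_le_cmod[of w] that by simp
    then have "\<bar>Re w * x\<bar> \<le> 1 * B" unfolding abs_mult using that by (intro mult_mono) auto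
    then show ?thesis by simp
  qed
  have mRe: "(\<lambda>p. Re (hp (fst p) (snd p))) \<in> borel_measurable (sph2 :: ((complex ^ 'n) \<times> (complex ^ 'n)) measure)"
    by (rule measurable_on_sphere_pairs) (intro continuous_intros)
  show ?thesis
  proof (rule that[of M])
    fix n and f :: "complex ^ 'n \<Rightarrow> real" assume n: "n \<ge> M" and f: "integrable surf f"
    have "\<bar>kform (\<lambda>w. Re w * (cmod (ps c w))\<^sup>2) f - kform (\<lambda>w. Re w * (cmod (\<Sum>k<n. of_real (c k) * w ^ k))\<^sup>2) f\<bar> \<le> e * (\<integral>x. \<bar>f x\<bar> \<partial>surf)\<^sup>2"
    proof (rule kform_uniform[OF f borel_measurable_times[OF mRe measurable_ps_hp[OF c]] borel_measurable_times[OF mRe measurable_poly_hp],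
          where B="(suminf c)\<^sup>2" and B'="(suminf c)\<^sup>2"])
      fix w assume w: "cmod w \<le> (1::real)"
      show "\<bar>Re w * (cmod (ps c w))\<^sup>2\<bar> \<le> (suminf c)\<^sup>2" "\<bar>Re w * (cmod (\<Sum>k<n. of_real (c k) * w ^ k))\<^sup>2\<bar> \<le> (suminf c)\<^sup>2"
        using ps_bound[OF c w] by (intro Re1 w; simp)+
      show "\<bar>Re w * (cmod (ps c w))\<^sup>2 - Re w * (cmod (\<Sum>k<n. of_real (c k) * w ^ k))\<^sup>2\<bar> \<le> e"
        unfolding right_diff_distrib[symmetric] by (intro Re1 w M n)
    qed
    moreover have "kform (\<lambda>w. Re w * (cmod (\<Sum>k<n. of_real (c k) * w ^ k))\<^sup>2) f = (\<Sum>j<n. \<Sum>k<n. c j * c k * kmom f (Suc j) k)"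
      unfolding re_monomial_expand' using kform_monomials[OF f, where n=n and c=c and d=c and i=1] by simp
    ultimately show "\<bar>kform (\<lambda>w. Re w * (cmod (ps c w))\<^sup>2) f - (\<Sum>j<n. \<Sum>k<n. c j * c k * kmom f (Suc j) k)\<bar> \<le> e * (\<integral>x. \<bar>f x\<bar> \<partial>surf)\<^sup>2"
      by simp
  qed
qed

section \<open>The kernel and its integrability\<close>

definition kern :: "real \<Rightarrow> complex \<Rightarrow> real" where
  "kern \<alpha> w = cmod (1 - w) powr (- (2 * \<alpha>))"

lemma kern_nonneg [simp]: "0 \<le> kern \<alpha> w" by (simp add: kern_def)

lemma measurable_kern [measurable (raw)]:
  assumes "f \<in> borel_measurable M" shows "(\<lambda>x. kern \<alpha> (f x)) \<in> borel_measurable M"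
  unfolding kern_def using assms by measurable

lemma kern_scaled:
  assumes "0 \<le> r" "r < 1" "cmod w \<le> 1"
  shows "kern \<alpha> (of_real r * w) = (cmod (ps (\<lambda>k. bcoef \<alpha> k * r ^ k) w))\<^sup>2"
  unfolding kern_def norm_ps_bcoef[OF assms] ..

text \<open>The ratio \<open>\<bar>1 - w\<bar> / \<bar>1 - r w\<bar>\<close> is at most 2, as \<open>\<bar>w - r w\<bar> \<le> 1 - r \<le> \<bar>1 - r w\<bar>\<close>. It supplies the majorants for all limits \<open>r \<rightarrow> 1\<close>.\<close>
lemma kern_scaled_le:
  assumes "0 \<le> r" "r < 1" "cmod w \<le> 1" "w \<noteq> 1" "0 < \<alpha>"
  shows "kern \<alpha> (of_real r * w) \<le> 2 powr (2 * \<alpha>) * kern \<alpha> w"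
proof -
  have "cmod (1 - w) \<le> cmod (1 - of_real r * w) + cmod (of_real r * w - w)"
    using norm_triangle_ineq[of "1 - of_real r * w" "of_real r * w - w"] by simp
  also have "cmod (of_real r * w - w) = (1 - r) * cmod w"
  proof -
    have "of_real r * w - w = - (of_real (1 - r) * w)" by (simp add: algebra_simps)
    then show ?thesis using assms(2) by (simp add: norm_mult del: of_real_diff)
  qed
  also have "(1 - r) * cmod w \<le> (1 - r) * 1" using assms by (intro mult_left_mono) auto
  also have "1 - r \<le> cmod (1 - of_real r * w)" by (rule norm_one_minus_pos[OF assms(1-3)])
  finally have le: "cmod (1 - w) / 2 \<le> cmod (1 - of_real r * w)" by simp
  have pos: "0 < cmod (1 - w)" using assms(4) by simp
  have "cmod (1 - of_real r * w) powr (- (2 * \<alpha>)) \<le> (cmod (1 - w) / 2) powr (- (2 * \<alpha>))"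
    using le pos assms(5) by (intro powr_mono2') auto
  also have "\<dots> = 2 powr (2 * \<alpha>) * cmod (1 - w) powr (- (2 * \<alpha>))"
    by (simp add: powr_divide powr_minus_divide)
  finally show ?thesis by (simp add: kern_def)
qed

definition rseq :: "nat \<Rightarrow> real" where "rseq i = 1 - 1 / real (Suc (Suc i))"

lemma rseq: "0 \<le> rseq i" "rseq i < 1" "rseq \<longlonglongrightarrow> 1"
proof -
  show "0 \<le> rseq i" "rseq i < 1" by (auto simp: rseq_def)
  have "(\<lambda>i. 1 - 1 / real (Suc (Suc i))) \<longlonglongrightarrow> 1 - 0"
    by (intro tendsto_intros LIMSEQ_Suc[OF LIMSEQ_Suc[OF lim_1_over_n]])
  then show "rseq \<longlonglongrightarrow> 1" by (simp add: rseq_def[abs_def])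
qed

lemma kern_rseq_tendsto:
  assumes "w \<noteq> 1" shows "(\<lambda>i. kern \<alpha> (of_real (rseq i) * w)) \<longlonglongrightarrow> kern \<alpha> w"
proof -
  have "(\<lambda>i. cmod (1 - of_real (rseq i) * w) powr (- (2 * \<alpha>))) \<longlonglongrightarrow> cmod (1 - of_real 1 * w) powr (- (2 * \<alpha>))"
    by (intro tendsto_intros rseq) (use assms in simp)
  then show ?thesis by (simp add: kern_def)
qed

lemma summable_bcoef_smom:
  assumes "0 < \<beta>" "2 * \<beta> < real CARD('n::finite)"
  shows "summable (\<lambda>k. (bcoef \<beta> k)\<^sup>2 * smom TYPE('n) k)"
proof -
  have "(bcoef \<beta> k)\<^sup>2 * smom TYPE('n) k = smom TYPE('n) 0 * hyp \<beta> \<beta> (real CARD('n)) k" for k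
    by (subst smom_eq) (simp add: bcoef_def hyp_def power2_eq_square)
  then show ?thesis using summable_hyp[of \<beta> \<beta> "real CARD('n)"] assms by (simp add: summable_mult)
qed

definition kbound :: "'n::finite itself \<Rightarrow> real \<Rightarrow> real" where
  "kbound T \<beta> = (\<Sum>k. (bcoef \<beta> k)\<^sup>2 * smom TYPE('n) k)"

lemma kbound_nonneg: "0 < \<beta> \<Longrightarrow> 2 * \<beta> < real CARD('n::finite) \<Longrightarrow> 0 \<le> kbound TYPE('n) \<beta>"
  unfolding kbound_def by (intro suminf_nonneg summable_bcoef_smom) (auto intro: mult_nonneg_nonneg less_imp_le[OF smom_pos])

text \<open>Orthogonality of the monomials reduces the integral to \<open>\<Sum>\<^sub>k (bcoef \<beta> k)\<^sup>2 r\<^bsup>2k\<^esup> smom k\<close>, which converges at \<open>r = 1\<close> exactly when \<open>2 \<beta> < N\<close>.\<close>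
lemma kern_scaled_integral:
  fixes x :: "complex ^ 'n::finite"
  assumes \<beta>: "0 < \<beta>" "2 * \<beta> < real CARD('n)" and r: "0 \<le> r" "r < 1" and x: "norm x = 1"
  shows "continuous_on (sphere 0 1) (\<lambda>y. kern \<beta> (of_real r * hp x y))"
    and "(\<integral>y. kern \<beta> (of_real r * hp x y) \<partial>surf) \<le> kbound TYPE('n) \<beta>"
proof -
  define c where "c k = bcoef \<beta> k * r ^ k" for k
  have c: "summable c" "\<And>k. 0 \<le> c k"
    unfolding c_def using summable_bcoef[OF \<beta>(1) r] less_imp_le[OF bcoef_pos[OF \<beta>(1)]] r by auto
  have h1: "cmod (hp x y) \<le> 1" if "norm y = 1" for y using norm_hp_le_1[OF x that] .
  have ke: "kern \<beta> (of_real r * hp x y) = (cmod (ps c (hp x y)))\<^sup>2" if "norm y = 1" for y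
    unfolding c_def by (rule kern_scaled[OF r h1[OF that]])
  have cont: "continuous_on (sphere 0 1) (\<lambda>y. (cmod (ps c (hp x y)))\<^sup>2)"
    by (intro continuous_intros continuous_on_compose2[OF suminf_measurable_ps[OF c]]) (use h1 in auto)
  then show "continuous_on (sphere 0 1) (\<lambda>y. kern \<beta> (of_real r * hp x y))"
    by (rule continuous_on_eq) (simp add: ke)
  let ?\<omega> = "smom TYPE('n) 0"
  show "(\<integral>y. kern \<beta> (of_real r * hp x y) \<partial>surf) \<le> kbound TYPE('n) \<beta>"
  proof (rule field_le_epsilon)
    fix e :: real assume e: "0 < e"
    have w: "?\<omega> > 0" by (rule smom_pos)
    obtain M where M: "\<And>n w. n \<ge> M \<Longrightarrow> cmod w \<le> 1 \<Longrightarrow>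
      \<bar>(cmod (ps c w))\<^sup>2 - (cmod (\<Sum>k<n. of_real (c k) * w ^ k))\<^sup>2\<bar> \<le> e / ?\<omega>"
      using ps_square_uniform[OF c, of "e / ?\<omega>"] e w by auto
    have ci: "integrable surf (\<lambda>y. Re (hp x y ^ j * hp y x ^ k))" for j k
      by (intro integrable_sphere_continuous continuous_intros)
    have P: "(\<integral>y. (cmod (\<Sum>k<M. of_real (c k) * hp x y ^ k))\<^sup>2 \<partial>surf) = (\<Sum>k<M. (c k)\<^sup>2 * smom TYPE('n) k)"
    proof -
      have "(\<integral>y. (cmod (\<Sum>k<M. of_real (c k) * hp x y ^ k))\<^sup>2 \<partial>surf)
        = (\<integral>y. (\<Sum>j<M. \<Sum>k<M. c j * c k * Re (hp x y ^ j * hp y x ^ k)) \<partial>surf)"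
        unfolding re_monomial_expand cnj_hp ..
      also have "\<dots> = (\<Sum>j<M. \<Sum>k<M. c j * c k * (\<integral>y. Re (hp x y ^ j * hp y x ^ k) \<partial>surf))"
        by (subst Bochner_Integration.integral_sum, (intro Bochner_Integration.integrable_sum integrable_mult_right ci),
          intro sum.cong refl, subst Bochner_Integration.integral_sum, (intro integrable_mult_right ci),
          simp only: integral_mult_right_zero)
      also have "\<dots> = (\<Sum>j<M. \<Sum>k<M. c j * c k * (if j = k then smom TYPE('n) j else 0))"
      proof -
        have "(\<integral>y. Re (hp x y ^ j * hp y x ^ k) \<partial>surf) = (if j = k then smom TYPE('n) j else 0)" for j k
          by (subst integral_Re) (auto simp: moment hp_self x)
        then show ?thesis by simp
      qed
      also have "\<dots> = (\<Sum>k<M. (c k)\<^sup>2 * smom TYPE('n) k)"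
        by (simp add: if_distrib[of "\<lambda>x. _ * x"] sum.delta power2_eq_square cong: if_cong)
      finally show ?thesis .
    qed
    have "(\<integral>y. kern \<beta> (of_real r * hp x y) \<partial>surf) = (\<integral>y. (cmod (ps c (hp x y)))\<^sup>2 \<partial>surf)"
      by (rule Bochner_Integration.integral_cong) (auto simp: ke)
    also have "\<dots> \<le> (\<integral>y. (cmod (\<Sum>k<M. of_real (c k) * hp x y ^ k))\<^sup>2 + e / ?\<omega> \<partial>surf)"
    proof (rule integral_mono)
      show "integrable surf (\<lambda>y. (cmod (ps c (hp x y)))\<^sup>2)" by (rule integrable_sphere_continuous[OF cont])
      show "integrable surf (\<lambda>y. (cmod (\<Sum>k<M. of_real (c k) * hp x y ^ k))\<^sup>2 + e / ?\<omega>)"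
        by (intro integrable_sphere_continuous continuous_intros)
      fix y :: "complex ^ 'n" assume "y \<in> space surf"
      then show "(cmod (ps c (hp x y)))\<^sup>2 \<le> (cmod (\<Sum>k<M. of_real (c k) * hp x y ^ k))\<^sup>2 + e / ?\<omega>"
        using M[OF order_refl h1[of y]] by (simp add: abs_le_iff)
    qed
    also have "\<dots> = (\<Sum>k<M. (c k)\<^sup>2 * smom TYPE('n) k) + e"
    proof -
      have "integrable surf (\<lambda>y. (cmod (\<Sum>k<M. of_real (c k) * hp x y ^ k))\<^sup>2)"
        by (intro integrable_sphere_continuous continuous_intros)
      then show ?thesis using w by (simp add: P smom_0)
    qed
    also have "(\<Sum>k<M. (c k)\<^sup>2 * smom TYPE('n) k) \<le> (\<Sum>k<M. (bcoef \<beta> k)\<^sup>2 * smom TYPE('n) k)"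
    proof (intro sum_mono mult_right_mono power_mono)
      fix k show "c k \<le> bcoef \<beta> k"
        unfolding c_def using r bcoef_pos[OF \<beta>(1), of k] by (simp add: mult_left_le power_le_one)
    qed (use c less_imp_le[OF smom_pos] in auto)
    also have "\<dots> \<le> kbound TYPE('n) \<beta>" unfolding kbound_def
      by (rule sum_le_suminf[OF summable_bcoef_smom[OF \<beta>]]) (auto intro: mult_nonneg_nonneg less_imp_le[OF smom_pos])
    finally show "(\<integral>y. kern \<beta> (of_real r * hp x y) \<partial>surf) \<le> kbound TYPE('n) \<beta> + e" by simp
  qed
qed

lemma kern_scaled_nn_integral:
  fixes x :: "complex ^ 'n::finite"
  assumes \<beta>: "0 < \<beta>" "2 * \<beta> < real CARD('n)" and r: "0 \<le> r" "r < 1" and x: "norm x = 1"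
  shows "(\<integral>\<^sup>+y. ennreal (kern \<beta> (of_real r * hp x y)) \<partial>surf) \<le> ennreal (kbound TYPE('n) \<beta>)"
  using kern_scaled_integral[OF assms]
  by (subst nn_integral_eq_integral) (auto intro: integrable_sphere_continuous ennreal_leI)

lemma kern_nn_integral:
  fixes x :: "complex ^ 'n::finite"
  assumes \<beta>: "0 < \<beta>" "2 * \<beta> < real CARD('n)" and x: "norm x = 1"
  shows "(\<integral>\<^sup>+y. ennreal (kern \<beta> (hp x y)) \<partial>surf) \<le> ennreal (kbound TYPE('n) \<beta>)"
proof -
  note [measurable] = measurable_sphere_borel
  have "(\<integral>\<^sup>+y. ennreal (kern \<beta> (hp x y)) \<partial>surf)
     \<le> (\<integral>\<^sup>+y. liminf (\<lambda>i. ennreal (kern \<beta> (of_real (rseq i) * hp x y))) \<partial>surf)"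
  proof (rule nn_integral_mono)
    fix y :: "complex ^ 'n"
    show "ennreal (kern \<beta> (hp x y)) \<le> liminf (\<lambda>i. ennreal (kern \<beta> (of_real (rseq i) * hp x y)))"
    proof (cases "hp x y = 1")
      case False
      have "(\<lambda>i. ennreal (kern \<beta> (of_real (rseq i) * hp x y))) \<longlonglongrightarrow> ennreal (kern \<beta> (hp x y))"
        by (intro tendsto_ennrealI kern_rseq_tendsto False)
      from lim_imp_Liminf[OF _ this] show ?thesis by simp
    qed (simp add: kern_def)
  qed
  also have "\<dots> \<le> liminf (\<lambda>i. (\<integral>\<^sup>+y. ennreal (kern \<beta> (of_real (rseq i) * hp x y)) \<partial>surf))"
    by (rule nn_integral_liminf) measurable
  also have "\<dots> \<le> liminf (\<lambda>i::nat. ennreal (kbound TYPE('n) \<beta>))"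
    by (intro Liminf_mono always_eventually allI kern_scaled_nn_integral assms rseq)
  finally show ?thesis by (simp add: Liminf_const)
qed

lemma hp_eq_1:
  assumes "norm x = 1" "norm y = 1" "hp x y = 1"
  shows "x = y"
proof -
  have "hp y x = 1" using arg_cong[OF assms(3), of cnj] by (simp add: cnj_hp)
  then have "hp (x - y) (x - y) = 0" using assms by (simp add: hp_diff_left hp_diff_right) (simp add: hp_self)
  then show ?thesis by (simp add: hp_self)
qed

text \<open>An atom at \<open>x\<close> would make the integrals of the dilated kernels with pole \<open>x\<close> unbounded.\<close>
lemma sphere_point_null:
  fixes x :: "complex ^ 'n::finite"
  assumes x: "norm x = 1"
  shows "{x} \<in> null_sets surf"
proof -
  define \<beta> where "\<beta> = 1 / (4 :: real)"
  have "real CARD('n) \<ge> 1" by (simp add: Suc_leI)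
  then have \<beta>: "0 < \<beta>" "2 * \<beta> < real CARD('n)" unfolding \<beta>_def by linarith+
  have s: "{x} \<in> sets surf"
    using x by (auto simp: sets_restrict_space intro!: image_eqI[of _ _ "{x}"])
  define m where "m = measure surf {x}"
  have "(1 - rseq i) powr (- (2 * \<beta>)) * m \<le> kbound TYPE('n) \<beta>" for i
  proof -
    have pos: "1 - rseq i > 0" using rseq by simp
    have "ennreal ((1 - rseq i) powr (- (2 * \<beta>))) * emeasure surf {x}
       = (\<integral>\<^sup>+y. ennreal ((1 - rseq i) powr (- (2 * \<beta>))) * indicator {x} y \<partial>surf)"
      using s by (simp add: nn_integral_cmult_indicator)
    also have "\<dots> \<le> (\<integral>\<^sup>+y. ennreal (kern \<beta> (of_real (rseq i) * hp x y)) \<partial>surf)"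
    proof (rule nn_integral_mono)
      fix y
      have "1 - of_real (rseq i) * hp x x = complex_of_real (1 - rseq i)" by (simp add: hp_self x)
      then have "kern \<beta> (of_real (rseq i) * hp x x) = (1 - rseq i) powr (- (2 * \<beta>))"
        unfolding kern_def using pos by (simp only: norm_of_real abs_of_pos)
      then show "ennreal ((1 - rseq i) powr (- (2 * \<beta>))) * indicator {x} y \<le> ennreal (kern \<beta> (of_real (rseq i) * hp x y))"
        by (auto simp: indicator_def)
    qed
    also have "\<dots> \<le> ennreal (kbound TYPE('n) \<beta>)" by (intro kern_scaled_nn_integral \<beta> rseq x)
    finally have "ennreal ((1 - rseq i) powr (- (2 * \<beta>)) * m) \<le> ennreal (kbound TYPE('n) \<beta>)"
      unfolding m_def sph.emeasure_eq_measure by (simp add: ennreal_mult)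
    then show ?thesis using kbound_nonneg[OF \<beta>] by (simp add: ennreal_le_iff)
  qed
  then have le: "m \<le> kbound TYPE('n) \<beta> * (1 - rseq i) powr (2 * \<beta>)" for i
  proof -
    have p: "(1 - rseq i) powr (2 * \<beta>) > 0" using rseq(2)[of i] by simp
    have "m = (1 - rseq i) powr (- (2 * \<beta>)) * m * (1 - rseq i) powr (2 * \<beta>)"
      using p by (simp add: powr_minus field_simps)
    also have "\<dots> \<le> kbound TYPE('n) \<beta> * (1 - rseq i) powr (2 * \<beta>)"
      by (intro mult_right_mono) (use \<open>\<And>i. (1 - rseq i) powr (- (2 * \<beta>)) * m \<le> kbound TYPE('n) \<beta>\<close> p in auto)
    finally show ?thesis .
  qed
  have "(\<lambda>i. kbound TYPE('n) \<beta> * (1 - rseq i) powr (2 * \<beta>)) \<longlonglongrightarrow> kbound TYPE('n) \<beta> * 0"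
  proof (intro tendsto_intros)
    have l: "(\<lambda>i. 1 - rseq i) \<longlonglongrightarrow> 1 - 1" by (intro tendsto_intros rseq)
    show "(\<lambda>i. (1 - rseq i) powr (2 * \<beta>)) \<longlonglongrightarrow> 0"
      by (rule tendsto_zero_powrI[OF _ tendsto_const]) (use l \<beta> less_imp_le[OF rseq(2)] in auto)
  qed
  from LIMSEQ_le_const[OF this] le have "m \<le> 0" by auto
  then have "m = 0" by (simp add: m_def measure_le_0_iff)
  then have "emeasure surf {x} = 0" by (simp add: sph.emeasure_eq_measure m_def)
  then show ?thesis using s by (simp add: null_sets_def)
qed

lemma AE_hp_neq_1: "AE p in (sph2 :: ((complex ^ 'n::finite) \<times> (complex ^ 'n)) measure). hp (fst p) (snd p) \<noteq> 1"
proof (rule sph_pair.AE_pair_measure)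
  show "{p \<in> space (sph2 :: ((complex ^ 'n) \<times> (complex ^ 'n)) measure). hp (fst p) (snd p) \<noteq> 1} \<in> sets sph2"
    by measurable
  show "AE x in (surf :: (complex ^ 'n) measure). AE y in (surf :: (complex ^ 'n) measure). hp (fst (x, y)) (snd (x, y)) \<noteq> 1"
  proof (rule AE_I2)
    fix x :: "complex ^ 'n" assume "x \<in> space surf"
    then have x: "norm x = 1" by simp
    show "AE y in surf. hp (fst (x, y)) (snd (x, y)) \<noteq> 1"
      by (rule AE_I'[OF sphere_point_null[OF x]]) (use hp_eq_1[OF x] in auto)
  qed
qed

section \<open>Series expansion of the energy\<close>

text \<open>For nonnegative terms, Abel summability along a sequence \<open>\<rho> i \<rightarrow> 1\<close> is unconditional summability, by monotone exchange of suprema.\<close>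
lemma has_sum_from_abel:
  fixes e :: "nat \<times> nat \<Rightarrow> real" and \<rho> :: "nat \<Rightarrow> real"
  assumes e: "\<And>p. 0 \<le> e p" and \<rho>: "\<And>i. 0 \<le> \<rho> i" "\<And>i. \<rho> i < 1" "\<rho> \<longlonglongrightarrow> 1"
    and Er: "\<And>i. (\<lambda>n. \<Sum>j<n. \<Sum>k<n. e (j, k) * \<rho> i ^ (j + k)) \<longlonglongrightarrow> Er i"
    and E: "Er \<longlonglongrightarrow> E"
  shows "(e has_sum E) UNIV"
proof -
  have sq: "(\<Sum>j<n. \<Sum>k<n. e (j, k) * \<rho> i ^ (j + k)) = (\<Sum>p\<in>{..<n}\<times>{..<n}. e p * \<rho> i ^ (fst p + snd p))" for n i
    by (simp add: sum.cartesian_product case_prod_unfold)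
  have fin: "sum e F \<le> E" if F: "finite F" for F
  proof -
    have le: "(\<Sum>p\<in>F. e p * \<rho> i ^ (fst p + snd p)) \<le> Er i" for i
    proof -
      define N where "N = Suc (Max (insert 0 (fst ` F \<union> snd ` F)))"
      have sub: "F \<subseteq> {..<n} \<times> {..<n}" if n: "n \<ge> N" for n
      proof
        fix p assume p: "p \<in> F"
        have "fst p \<le> Max (insert 0 (fst ` F \<union> snd ` F))" "snd p \<le> Max (insert 0 (fst ` F \<union> snd ` F))"
          using p F by (auto intro!: Max_ge)
        then show "p \<in> {..<n} \<times> {..<n}" using n by (cases p) (auto simp: N_def)
      qed
      show ?thesis
      proof (rule LIMSEQ_le_const[OF Er[of i]], intro exI[of _ N] allI impI)
        fix n assume "N \<le> n"
        then show "(\<Sum>p\<in>F. e p * \<rho> i ^ (fst p + snd p)) \<le> (\<Sum>j<n. \<Sum>k<n. e (j, k) * \<rho> i ^ (j + k))"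
          unfolding sq using sub[of n] e \<rho> by (intro sum_mono2) auto
      qed
    qed
    have "(\<lambda>i. \<Sum>p\<in>F. e p * \<rho> i ^ (fst p + snd p)) \<longlonglongrightarrow> (\<Sum>p\<in>F. e p * 1 ^ (fst p + snd p))"
      by (intro tendsto_intros \<rho>)
    from LIMSEQ_le[OF this E] le show ?thesis by auto
  qed
  have sm: "e summable_on UNIV"
    by (rule nonneg_bdd_above_summable_on) (use e fin in \<open>auto intro!: bdd_aboveI[of _ E]\<close>)
  have "infsum e UNIV \<le> E"
    by (rule infsum_le_finite_sums[OF sm]) (use fin in auto)
  moreover have "E \<le> infsum e UNIV"
  proof (rule LIMSEQ_le_const2[OF E], intro exI[of _ 0] allI impI)
    fix i
    show "Er i \<le> infsum e UNIV"
    proof (rule LIMSEQ_le_const2[OF Er[of i]], intro exI[of _ 0] allI impI)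
      fix n
      have "(\<Sum>j<n. \<Sum>k<n. e (j, k) * \<rho> i ^ (j + k)) \<le> (\<Sum>p\<in>{..<n}\<times>{..<n}. e p)"
        unfolding sq
      proof (rule sum_mono)
        fix p
        have "\<rho> i ^ (fst p + snd p) \<le> 1" using \<rho>(1)[of i] \<rho>(2)[of i] by (intro power_le_one) auto
        then show "e p * \<rho> i ^ (fst p + snd p) \<le> e p" using e[of p] by (simp add: mult_left_le)
      qed
      also have "\<dots> \<le> infsum e UNIV"
        by (rule finite_sum_le_infsum[OF sm]) (use e in auto)
      finally show "(\<Sum>j<n. \<Sum>k<n. e (j, k) * \<rho> i ^ (j + k)) \<le> infsum e UNIV" .
    qed
  qed
  ultimately show ?thesis using sm by (metis has_sum_infsum antisym)
qed

lemma kform_rseq_tendsto: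
  fixes f :: "complex ^ 'n::finite \<Rightarrow> real"
  assumes f: "f \<in> borel_measurable surf" and \<alpha>: "0 < \<alpha>"
    and ff: "integrable sph2 (\<lambda>p. f (fst p) * f (snd p) * kern \<alpha> (hp (fst p) (snd p)))"
    and g: "continuous_on UNIV g" "\<And>w. cmod w \<le> 1 \<Longrightarrow> \<bar>g w\<bar> \<le> 1"
  shows "(\<lambda>i. kform (\<lambda>w. g w * kern \<alpha> (of_real (rseq i) * w)) f) \<longlonglongrightarrow> kform (\<lambda>w. g w * kern \<alpha> w) f"
  unfolding kform_def
proof (rule integral_dominated_convergence)
  have [measurable]: "(\<lambda>p. f (fst p)) \<in> borel_measurable sph2" "(\<lambda>p. f (snd p)) \<in> borel_measurable sph2"
    by (rule measurable_compose[OF measurable_snd f] measurable_compose[OF measurable_fst f])+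
  have [measurable]: "g \<in> borel_measurable borel" by (rule borel_measurable_continuous_onI[OF g(1)])
  show "(\<lambda>p. f (fst p) * f (snd p) * (g (hp (fst p) (snd p)) * kern \<alpha> (hp (fst p) (snd p)))) \<in> borel_measurable sph2"
    by measurable
  show "(\<lambda>p. f (fst p) * f (snd p) * (g (hp (fst p) (snd p)) * kern \<alpha> (of_real (rseq i) * hp (fst p) (snd p)))) \<in> borel_measurable sph2" for i
    by measurable
  show "integrable sph2 (\<lambda>p. 2 powr (2 * \<alpha>) * \<bar>f (fst p) * f (snd p) * kern \<alpha> (hp (fst p) (snd p))\<bar>)"
    using ff by simp
  show "AE p in sph2. (\<lambda>i. f (fst p) * f (snd p) * (g (hp (fst p) (snd p)) * kern \<alpha> (of_real (rseq i) * hp (fst p) (snd p))))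
     \<longlonglongrightarrow> f (fst p) * f (snd p) * (g (hp (fst p) (snd p)) * kern \<alpha> (hp (fst p) (snd p)))"
    using AE_hp_neq_1 by eventually_elim (intro tendsto_intros kern_rseq_tendsto)
  show "AE p in sph2. norm (f (fst p) * f (snd p) * (g (hp (fst p) (snd p)) * kern \<alpha> (of_real (rseq i) * hp (fst p) (snd p))))
     \<le> 2 powr (2 * \<alpha>) * \<bar>f (fst p) * f (snd p) * kern \<alpha> (hp (fst p) (snd p))\<bar>" for i
    using AE_hp_neq_1 AE_space
  proof eventually_elim
    case (elim p)
    have h: "cmod (hp (fst p) (snd p)) \<le> 1" using space_sph2[OF elim(2)] by (auto intro: norm_hp_le_1)
    have "\<bar>g (hp (fst p) (snd p))\<bar> * kern \<alpha> (of_real (rseq i) * hp (fst p) (snd p)) \<le> 1 * (2 powr (2 * \<alpha>) * kern \<alpha> (hp (fst p) (snd p)))"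
      by (intro mult_mono g(2) h kern_scaled_le rseq \<alpha> elim(1)) auto
    then have "\<bar>f (fst p) * f (snd p)\<bar> * (\<bar>g (hp (fst p) (snd p))\<bar> * kern \<alpha> (of_real (rseq i) * hp (fst p) (snd p)))
       \<le> \<bar>f (fst p) * f (snd p)\<bar> * (2 powr (2 * \<alpha>) * kern \<alpha> (hp (fst p) (snd p)))"
      by (intro mult_left_mono) auto
    then show ?case by (simp add: abs_mult mult_ac)
  qed
qed

lemma bcoef_rseq:
  assumes "0 < \<alpha>"
  shows "summable (\<lambda>k. bcoef \<alpha> k * rseq i ^ k)" "0 \<le> bcoef \<alpha> k * rseq i ^ k"
  using summable_bcoef[OF assms rseq(1,2)] bcoef_pos[OF assms, of k] rseq(1)[of i] by auto

lemma kform_cong: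
  fixes f :: "complex ^ 'n::finite \<Rightarrow> real"
  assumes "\<And>w. cmod w \<le> 1 \<Longrightarrow> k w = k' w"
  shows "kform k f = kform k' f"
  unfolding kform_def
  by (rule Bochner_Integration.integral_cong[OF refl]) (use assms space_sph2 norm_hp_le_1 in \<open>metis\<close>)

text \<open>The dilated kernels are squares of absolutely convergent power series. The moments are nonnegative, so the limit of the dilations may be taken inside the sum.\<close>
lemma kform_kern_has_sum:
  fixes f :: "complex ^ 'n::finite \<Rightarrow> real"
  assumes f: "integrable surf f" and \<alpha>: "0 < \<alpha>"
    and ff: "integrable sph2 (\<lambda>p. f (fst p) * f (snd p) * kern \<alpha> (hp (fst p) (snd p)))"
  shows "((\<lambda>(j, k). bcoef \<alpha> j * bcoef \<alpha> k * kmom f j k) has_sum kform (kern \<alpha>) f) UNIV"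
    and "((\<lambda>(j, k). bcoef \<alpha> j * bcoef \<alpha> k * kmom f (Suc j) k) has_sum kform (\<lambda>w. Re w * kern \<alpha> w) f) UNIV"
proof -
  note c = bcoef_rseq[OF \<alpha>]
  note b0 = less_imp_le[OF bcoef_pos[OF \<alpha>]]
  have lim: "(\<lambda>n. s n) \<longlonglongrightarrow> L" if h1: "\<And>e. e > 0 \<Longrightarrow> \<exists>M. \<forall>n\<ge>M. \<bar>L - s n\<bar> \<le> e * C" and h2: "C \<ge> 0" for s :: "nat \<Rightarrow> real" and L C
  proof (rule LIMSEQ_I)
    fix r :: real assume r: "r > 0"
    obtain M where M: "\<forall>n\<ge>M. \<bar>L - s n\<bar> \<le> (r / (C + 1)) * C" using h1[of "r / (C + 1)"] h2 r by auto
    have "(r / (C + 1)) * C < r" using h2 r by (simp add: field_simps)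
    then show "\<exists>no. \<forall>n\<ge>no. norm (s n - L) < r" using M by (intro exI[of _ M]) (auto simp: abs_minus_commute)
  qed
  show "((\<lambda>(j, k). bcoef \<alpha> j * bcoef \<alpha> k * kmom f j k) has_sum kform (kern \<alpha>) f) UNIV"
  proof (rule has_sum_from_abel[where \<rho>=rseq and Er="\<lambda>i. kform (\<lambda>w. kern \<alpha> (of_real (rseq i) * w)) f"])
    show "0 \<le> (case p of (j, k) \<Rightarrow> bcoef \<alpha> j * bcoef \<alpha> k * kmom f j k)" for p
      using b0 kmom_nonneg[OF f] by (cases p) simp
    show "(\<lambda>i. kform (\<lambda>w. kern \<alpha> (of_real (rseq i) * w)) f) \<longlonglongrightarrow> kform (kern \<alpha>) f"
      using kform_rseq_tendsto[OF borel_measurable_integrable[OF f] \<alpha> ff, of "\<lambda>_. 1"] by simp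
    fix i
    have e: "kform (\<lambda>w. kern \<alpha> (of_real (rseq i) * w)) f = kform (\<lambda>w. (cmod (ps (\<lambda>k. bcoef \<alpha> k * rseq i ^ k) w))\<^sup>2) f"
      by (rule kform_cong) (rule kern_scaled[OF rseq(1,2)])
    show "(\<lambda>n. \<Sum>j<n. \<Sum>k<n. (case (j, k) of (j, k) \<Rightarrow> bcoef \<alpha> j * bcoef \<alpha> k * kmom f j k) * rseq i ^ (j + k)) \<longlonglongrightarrow> kform (\<lambda>w. kern \<alpha> (of_real (rseq i) * w)) f"
    proof (rule lim)
      fix r :: real assume r: "r > 0"
      obtain M where M: "\<And>n (f :: complex ^ 'n \<Rightarrow> real). n \<ge> M \<Longrightarrow> integrable surf f \<Longrightarrow>
         \<bar>kform (\<lambda>w. (cmod (ps (\<lambda>k. bcoef \<alpha> k * rseq i ^ k) w))\<^sup>2) f - (\<Sum>j<n. \<Sum>k<n. (bcoef \<alpha> j * rseq i ^ j) * (bcoef \<alpha> k * rseq i ^ k) * kmom f j k)\<bar> \<le> r * (\<integral>x. \<bar>f x\<bar> \<partial>surf)\<^sup>2"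
        using kform_ps_approx[OF c r] by blast
      show "\<exists>M. \<forall>n\<ge>M. \<bar>kform (\<lambda>w. kern \<alpha> (of_real (rseq i) * w)) f - (\<Sum>j<n. \<Sum>k<n. (case (j, k) of (j, k) \<Rightarrow> bcoef \<alpha> j * bcoef \<alpha> k * kmom f j k) * rseq i ^ (j + k))\<bar> \<le> r * (\<integral>x. \<bar>f x\<bar> \<partial>surf)\<^sup>2"
        unfolding e using M[OF _ f] by (intro exI[of _ M]) (simp add: power_add mult_ac)
    qed simp
  qed (rule rseq)+
  show "((\<lambda>(j, k). bcoef \<alpha> j * bcoef \<alpha> k * kmom f (Suc j) k) has_sum kform (\<lambda>w. Re w * kern \<alpha> w) f) UNIV"
  proof (rule has_sum_from_abel[where \<rho>=rseq and Er="\<lambda>i. kform (\<lambda>w. Re w * kern \<alpha> (of_real (rseq i) * w)) f"])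
    show "0 \<le> (case p of (j, k) \<Rightarrow> bcoef \<alpha> j * bcoef \<alpha> k * kmom f (Suc j) k)" for p
      using b0 kmom_nonneg[OF f] by (cases p) simp
    show "(\<lambda>i. kform (\<lambda>w. Re w * kern \<alpha> (of_real (rseq i) * w)) f) \<longlonglongrightarrow> kform (\<lambda>w. Re w * kern \<alpha> w) f"
      by (rule kform_rseq_tendsto[OF borel_measurable_integrable[OF f] \<alpha> ff])
        (auto intro!: continuous_intros intro: order_trans[OF abs_Re_le_cmod])
    fix i
    have e: "kform (\<lambda>w. Re w * kern \<alpha> (of_real (rseq i) * w)) f = kform (\<lambda>w. Re w * (cmod (ps (\<lambda>k. bcoef \<alpha> k * rseq i ^ k) w))\<^sup>2) f"
      by (rule kform_cong) (simp only: kern_scaled[OF rseq(1,2)])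
    show "(\<lambda>n. \<Sum>j<n. \<Sum>k<n. (case (j, k) of (j, k) \<Rightarrow> bcoef \<alpha> j * bcoef \<alpha> k * kmom f (Suc j) k) * rseq i ^ (j + k)) \<longlonglongrightarrow> kform (\<lambda>w. Re w * kern \<alpha> (of_real (rseq i) * w)) f"
    proof (rule lim)
      fix r :: real assume r: "r > 0"
      obtain M where M: "\<And>n (f :: complex ^ 'n \<Rightarrow> real). n \<ge> M \<Longrightarrow> integrable surf f \<Longrightarrow>
         \<bar>kform (\<lambda>w. Re w * (cmod (ps (\<lambda>k. bcoef \<alpha> k * rseq i ^ k) w))\<^sup>2) f - (\<Sum>j<n. \<Sum>k<n. (bcoef \<alpha> j * rseq i ^ j) * (bcoef \<alpha> k * rseq i ^ k) * kmom f (Suc j) k)\<bar> \<le> r * (\<integral>x. \<bar>f x\<bar> \<partial>surf)\<^sup>2"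
        using kform_ps_Re_approx[OF c r] by blast
      show "\<exists>M. \<forall>n\<ge>M. \<bar>kform (\<lambda>w. Re w * kern \<alpha> (of_real (rseq i) * w)) f - (\<Sum>j<n. \<Sum>k<n. (case (j, k) of (j, k) \<Rightarrow> bcoef \<alpha> j * bcoef \<alpha> k * kmom f (Suc j) k) * rseq i ^ (j + k))\<bar> \<le> r * (\<integral>x. \<bar>f x\<bar> \<partial>surf)\<^sup>2"
        unfolding e using M[OF _ f] by (intro exI[of _ M]) (simp add: power_add mult_ac)
    qed simp
  qed (rule rseq)+
qed

definition wt :: "real \<Rightarrow> nat \<Rightarrow> real" where "wt \<alpha> j = real j / (real j + \<alpha> - 1)"

lemma bcoef_Suc: "0 < \<alpha> \<Longrightarrow> bcoef \<alpha> (Suc j) * wt \<alpha> (Suc j) = bcoef \<alpha> j"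
proof -
  assume \<alpha>: "0 < \<alpha>"
  have "\<alpha> + real j > 0" using \<alpha> by simp
  moreover have "real (Suc j) + \<alpha> - 1 = \<alpha> + real j" by simp
  moreover have "p * x / (s * f) * (s / x) = p / f" if "x > 0" "s > 0" for p x s f :: real
    using that by simp
  ultimately show ?thesis unfolding bcoef_def wt_def pochhammer_Suc fact_Suc of_nat_mult
    by (simp add: add.commute)
qed

text \<open>Shifting the index \<open>j\<close> compares the series of the kernel times \<open>Re w\<close> with that of the kernel itself; the quotient of binomial coefficients is \<open>wt\<close>.\<close>
lemma kform_Re_kern_has_sum:
  fixes f :: "complex ^ 'n::finite \<Rightarrow> real"
  assumes f: "integrable surf f" and \<alpha>: "0 < \<alpha>"
    and ff: "integrable sph2 (\<lambda>p. f (fst p) * f (snd p) * kern \<alpha> (hp (fst p) (snd p)))"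
  shows "((\<lambda>(j, k). bcoef \<alpha> j * bcoef \<alpha> k * wt \<alpha> j * kmom f j k) has_sum kform (\<lambda>w. Re w * kern \<alpha> w) f) UNIV"
proof -
  let ?g = "\<lambda>(j, k). bcoef \<alpha> j * bcoef \<alpha> k * wt \<alpha> j * kmom f j k"
  let ?h = "\<lambda>(j, k). (Suc j, k :: nat)"
  have inj: "inj_on ?h UNIV" by (auto simp: inj_on_def)
  have "((?g \<circ> ?h) has_sum kform (\<lambda>w. Re w * kern \<alpha> w) f) UNIV"
  proof (rule has_sum_cong[THEN iffD1, OF _ kform_kern_has_sum(2)[OF assms]])
    fix p :: "nat \<times> nat"
    obtain j k where p: "p = (j, k)" by (cases p)
    show "(case p of (j, k) \<Rightarrow> bcoef \<alpha> j * bcoef \<alpha> k * kmom f (Suc j) k) = (?g \<circ> ?h) p"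
      using bcoef_Suc[OF \<alpha>, of j] by (simp add: p mult_ac)
  qed
  then have "(?g has_sum kform (\<lambda>w. Re w * kern \<alpha> w) f) (range ?h)"
    using has_sum_reindex[OF inj] by blast
  then show ?thesis
  proof (rule has_sum_cong_neutral[THEN iffD1, rotated -1])
    fix p :: "nat \<times> nat" assume "p \<in> UNIV - range ?h"
    then have "fst p = 0" by (cases p; cases "fst p") (auto simp: image_iff)
    then show "?g p = 0" by (cases p) (simp add: wt_def)
  qed auto
qed

section \<open>Sign arguments along diagonals\<close>

text \<open>Chebyshev-type argument: a sequence of weights that changes sign once, from minus to plus,
  keeps a nonnegative total when multiplied by a nondecreasing nonnegative sequence.\<close>
lemma single_sign_change_sum:
  fixes x q :: "nat \<Rightarrow> real"
  assumes x: "x sums X" "X \<ge> 0" and sgn: "\<And>i i'. i \<le> i' \<Longrightarrow> 0 < x i \<Longrightarrow> 0 \<le> x i'"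
    and q: "mono q" "0 \<le> q 0" and s: "(\<lambda>i. x i * q i) sums Y"
  shows "0 \<le> Y"
proof (cases "\<exists>i. 0 < x i")
  case True
  define i0 where "i0 = (LEAST i. 0 < x i)"
  have i0: "0 < x i0" using True unfolding i0_def by (rule LeastI_ex)
  have lo: "x i \<le> 0" if "i < i0" for i using not_less_Least[OF that[unfolded i0_def]] by simp
  have le: "x i * q i0 \<le> x i * q i" for i
  proof (cases "i < i0")
    case True
    have "q i \<le> q i0" using monoD[OF q(1), of i i0] True by simp
    then show ?thesis using lo[OF True] by (rule mult_left_mono_neg)
  next
    case False
    then have i: "i0 \<le> i" by simp
    show ?thesis by (rule mult_left_mono[OF monoD[OF q(1) i] sgn[OF i i0]])
  qed
  have "X * q i0 \<le> Y" by (rule sums_le[OF le sums_mult2[OF x(1)] s])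
  moreover have "0 \<le> X * q i0" using x(2) q monoD[OF q(1), of 0 i0] by simp
  ultimately show ?thesis by simp
next
  case False
  then have le: "\<And>i. x i \<le> 0" by (simp add: not_less)
  have sm: "(\<lambda>i. - x i) sums (- X)" using x(1) by (rule sums_minus)
  have "- x i \<le> 0" for i
  proof -
    have "sum (\<lambda>i. - x i) {i} \<le> (\<Sum>i. - x i)"
      by (rule sum_le_suminf) (use sm le in \<open>auto simp: sums_iff\<close>)
    then show ?thesis using sm x(2) by (simp add: sums_iff)
  qed
  then have "x i = 0" for i using le[of i] by (metis antisym neg_le_0_iff_le)
  then have "Y = 0" using s by (simp add: sums_iff)
  then show ?thesis by simp
qed

text \<open>Up to constants that depend only on \<open>d\<close>, the products of the two binomial coefficients on the diagonal at distance \<open>d\<close>, with the normalisation \<open>dw\<close> of the moments included.\<close>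
definition dg :: "real \<Rightarrow> real \<Rightarrow> nat \<Rightarrow> nat \<Rightarrow> real" where
  "dg \<alpha> N d i = hyp \<alpha> (\<alpha> + real d) (N + real d) i"

definition crit :: "real \<Rightarrow> real \<Rightarrow> real" where "crit \<alpha> N = \<alpha> / (N - \<alpha>)"

text \<open>The first entry serves the diagonals \<open>(i, d + i)\<close>, the second the diagonals \<open>(d + i, i)\<close>, both with \<open>d \<ge> 1\<close>, the third the main diagonal; the last keeps the weights nonnegative far out.\<close>
definition gap :: "real \<Rightarrow> real \<Rightarrow> real" where
  "gap \<alpha> N = Min {(\<alpha> + 1) / (N + 1 - \<alpha>) - crit \<alpha> N, (1 - crit \<alpha> N) * min 1 (1 / \<alpha>),
     crit \<alpha> N / suminf (dg \<alpha> N 0), 1 - crit \<alpha> N}"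

context
  fixes \<alpha> N :: real
  assumes \<alpha>: "0 < \<alpha>" and N: "2 * \<alpha> < N"
begin

lemma dg_pos: "0 < dg \<alpha> N d i"
  unfolding dg_def by (rule hyp_pos) (use \<alpha> N in auto)

lemma summable_dg: "summable (dg \<alpha> N d)"
  unfolding dg_def[abs_def] using summable_hyp[of \<alpha> "\<alpha> + real d" "N + real d"] \<alpha> N by (simp add: eta_contract_eq)

lemma dg_sum_low: "(\<lambda>i. dg \<alpha> N d i * wt \<alpha> i) sums ((\<alpha> + real d) / (N + real d - \<alpha>) * suminf (dg \<alpha> N d))"
  using hyp_sum_weight_a[of \<alpha> "\<alpha> + real d" "N + real d"] \<alpha> N
  by (simp add: dg_def[abs_def] wt_def)

lemma dg_sum_high:
  assumes d: "d \<ge> 1"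
  shows "(\<lambda>i. dg \<alpha> N d i * wt \<alpha> (d + i)) sums ((1 - (\<alpha> - 1) * (N - 2 * \<alpha>) / ((\<alpha> + real d - 1) * (N - \<alpha>))) * suminf (dg \<alpha> N d))"
proof -
  have b: "\<alpha> + real d > 1" using \<alpha> d by (simp add: add_pos_nonneg add_strict_increasing)
  have 1: "(\<lambda>i. dg \<alpha> N d i * (1 / (\<alpha> + real d + real i - 1))) sums ((N - 2 * \<alpha>) / ((\<alpha> + real d - 1) * (N - \<alpha>)) * suminf (dg \<alpha> N d))"
    using hyp_sum_weight_b[of \<alpha> "\<alpha> + real d" "N + real d"] \<alpha> N b
    by (simp add: dg_def[abs_def] algebra_simps)
  have "(\<lambda>i. dg \<alpha> N d i - (\<alpha> - 1) * (dg \<alpha> N d i * (1 / (\<alpha> + real d + real i - 1)))) sums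
      (suminf (dg \<alpha> N d) - (\<alpha> - 1) * ((N - 2 * \<alpha>) / ((\<alpha> + real d - 1) * (N - \<alpha>)) * suminf (dg \<alpha> N d)))"
    by (intro sums_diff sums_mult 1 summable_sums summable_dg)
  moreover have "dg \<alpha> N d i - (\<alpha> - 1) * (dg \<alpha> N d i * (1 / (\<alpha> + real d + real i - 1))) = dg \<alpha> N d i * wt \<alpha> (d + i)" for i
  proof -
    have nz: "\<alpha> + real d + real i - 1 > 0" using b by simp
    then have "wt \<alpha> (d + i) = 1 - (\<alpha> - 1) * (1 / (\<alpha> + real d + real i - 1))"
      unfolding wt_def by (simp add: field_simps)
    then have "dg \<alpha> N d i * wt \<alpha> (d + i) = dg \<alpha> N d i * (1 - (\<alpha> - 1) * (1 / (\<alpha> + real d + real i - 1)))" by simp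
    also have "\<dots> = dg \<alpha> N d i - (\<alpha> - 1) * (dg \<alpha> N d i * (1 / (\<alpha> + real d + real i - 1)))"
      unfolding right_diff_distrib by (simp only: mult_1_right mult.left_commute)
    finally show ?thesis ..
  qed
  moreover have "suminf (dg \<alpha> N d) - (\<alpha> - 1) * ((N - 2 * \<alpha>) / ((\<alpha> + real d - 1) * (N - \<alpha>)) * suminf (dg \<alpha> N d))
     = (1 - (\<alpha> - 1) * (N - 2 * \<alpha>) / ((\<alpha> + real d - 1) * (N - \<alpha>))) * suminf (dg \<alpha> N d)"
    by (simp add: left_diff_distrib)
  ultimately show ?thesis by (simp only:)
qed

lemma wt_sign:
  assumes \<theta>: "0 < \<theta>" "\<theta> \<le> 1" and j: "j \<le> j'" and le: "\<theta> < wt \<alpha> j"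
  shows "\<theta> \<le> wt \<alpha> j'"
proof -
  have j1: "j \<ge> 1" using le \<theta> by (cases j) (auto simp: wt_def)
  then have p: "real j + \<alpha> - 1 > 0" "real j' + \<alpha> - 1 > 0" using j \<alpha> by auto
  show ?thesis
  proof (cases "\<alpha> \<le> 1")
    case True
    then have "1 \<le> wt \<alpha> j'" using p by (simp add: wt_def le_divide_eq)
    then show ?thesis using \<theta> by simp
  next
    case False
    have "real j * (\<alpha> - 1) \<le> real j' * (\<alpha> - 1)" using False j by (intro mult_right_mono) auto
    then have "wt \<alpha> j \<le> wt \<alpha> j'" unfolding wt_def using p by (simp add: frac_le_eq divide_simps) (simp add: algebra_simps)
    then show ?thesis using le by simp
  qed
qed

lemma crit: "0 < crit \<alpha> N" "crit \<alpha> N < 1"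
  unfolding crit_def using \<alpha> N by (auto simp: divide_less_eq)

lemma suminf_dg_pos: "0 < suminf (dg \<alpha> N d)"
  by (rule suminf_pos[OF summable_dg dg_pos])

lemma gap_pos: "0 < gap \<alpha> N"
proof -
  have "crit \<alpha> N < (\<alpha> + 1) / (N + 1 - \<alpha>)"
  proof -
    have "\<alpha> / (N - \<alpha>) < (\<alpha> + 1) / (N + 1 - \<alpha>)" using \<alpha> N by (simp add: divide_simps) (simp add: algebra_simps)
    then show ?thesis by (simp add: crit_def)
  qed
  moreover have "0 < min 1 (1 / \<alpha>)" using \<alpha> by simp
  ultimately show ?thesis unfolding gap_def using crit suminf_dg_pos[of 0] by simp
qed

lemma gap_le:
  "gap \<alpha> N \<le> (\<alpha> + 1) / (N + 1 - \<alpha>) - crit \<alpha> N" "gap \<alpha> N \<le> (1 - crit \<alpha> N) * min 1 (1 / \<alpha>)" "gap \<alpha> N \<le> crit \<alpha> N / suminf (dg \<alpha> N 0)" "gap \<alpha> N \<le> 1 - crit \<alpha> N"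
  unfolding gap_def by (rule Min_le; simp)+

text \<open>The indices on this diagonal are \<open>(i, d + i)\<close>; the \<open>dg\<close>-average of \<open>wt \<alpha> i\<close> is \<open>(\<alpha> + d) / (N + d - \<alpha>)\<close>, which exceeds \<open>crit\<close> because \<open>d \<ge> 1\<close>.\<close>
lemma dg_low_nonneg:
  assumes d: "d \<ge> 1" and q: "mono q" "0 \<le> q 0" and s: "(\<lambda>i. dg \<alpha> N d i * (wt \<alpha> i - crit \<alpha> N - gap \<alpha> N) * q i) sums Y"
  shows "0 \<le> Y"
proof (rule single_sign_change_sum[OF _ _ _ q s])
  have "(\<lambda>i. dg \<alpha> N d i * wt \<alpha> i - dg \<alpha> N d i * (crit \<alpha> N + gap \<alpha> N)) sums ((\<alpha> + real d) / (N + real d - \<alpha>) * suminf (dg \<alpha> N d) - suminf (dg \<alpha> N d) * (crit \<alpha> N + gap \<alpha> N))"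
    by (intro sums_diff dg_sum_low sums_mult2 summable_sums summable_dg)
  then show "(\<lambda>i. dg \<alpha> N d i * (wt \<alpha> i - crit \<alpha> N - gap \<alpha> N)) sums (((\<alpha> + real d) / (N + real d - \<alpha>) - crit \<alpha> N - gap \<alpha> N) * suminf (dg \<alpha> N d))"
    by (simp add: algebra_simps)
  have "(\<alpha> + 1) / (N + 1 - \<alpha>) \<le> (\<alpha> + real d) / (N + real d - \<alpha>)"
  proof -
    have p: "N + 1 - \<alpha> > 0" "N + real d - \<alpha> > 0" using \<alpha> N by auto
    have "0 \<le> (real d - 1) * (N - 2 * \<alpha>)" using d N by (intro mult_nonneg_nonneg) auto
    then have "(\<alpha> + 1) * (N + real d - \<alpha>) \<le> (\<alpha> + real d) * (N + 1 - \<alpha>)" by (simp add: algebra_simps)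
    then show ?thesis using p by (simp add: divide_simps)
  qed
  then show "0 \<le> ((\<alpha> + real d) / (N + real d - \<alpha>) - crit \<alpha> N - gap \<alpha> N) * suminf (dg \<alpha> N d)"
    using gap_le(1) suminf_dg_pos[of d] by (intro mult_nonneg_nonneg) auto
  fix i i' :: nat assume i: "i \<le> i'" and "0 < dg \<alpha> N d i * (wt \<alpha> i - crit \<alpha> N - gap \<alpha> N)"
  then have "crit \<alpha> N + gap \<alpha> N < wt \<alpha> i" using dg_pos[of d i] by (simp add: zero_less_mult_iff)
  from wt_sign[OF _ _ i this] have "crit \<alpha> N + gap \<alpha> N \<le> wt \<alpha> i'" using gap_le(4) crit gap_pos by simp
  then show "0 \<le> dg \<alpha> N d i' * (wt \<alpha> i' - crit \<alpha> N - gap \<alpha> N)" using dg_pos[of d i'] by simp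
qed

text \<open>Here the indices are \<open>(d + i, i)\<close>, and the average of \<open>wt \<alpha> (d + i)\<close> comes from the second telescoping sum.\<close>
lemma dg_high_nonneg:
  assumes d: "d \<ge> 1" and q: "mono q" "0 \<le> q 0" and s: "(\<lambda>i. dg \<alpha> N d i * (wt \<alpha> (d + i) - crit \<alpha> N - gap \<alpha> N) * q i) sums Y"
  shows "0 \<le> Y"
proof (rule single_sign_change_sum[OF _ _ _ q s])
  let ?R = "1 - (\<alpha> - 1) * (N - 2 * \<alpha>) / ((\<alpha> + real d - 1) * (N - \<alpha>))"
  have "(\<lambda>i. dg \<alpha> N d i * wt \<alpha> (d + i) - dg \<alpha> N d i * (crit \<alpha> N + gap \<alpha> N)) sums (?R * suminf (dg \<alpha> N d) - suminf (dg \<alpha> N d) * (crit \<alpha> N + gap \<alpha> N))"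
    by (intro sums_diff dg_sum_high d sums_mult2 summable_sums summable_dg)
  then show "(\<lambda>i. dg \<alpha> N d i * (wt \<alpha> (d + i) - crit \<alpha> N - gap \<alpha> N)) sums ((?R - crit \<alpha> N - gap \<alpha> N) * suminf (dg \<alpha> N d))"
    by (simp add: algebra_simps)
  have b: "\<alpha> + real d - 1 > 0" using \<alpha> d by (simp add: add_pos_nonneg add_strict_increasing)
  have c1: "1 - crit \<alpha> N = (N - 2 * \<alpha>) / (N - \<alpha>)" using \<alpha> N by (simp add: crit_def field_simps)
  have "?R - crit \<alpha> N = (1 - crit \<alpha> N) * (1 - (\<alpha> - 1) / (\<alpha> + real d - 1))"
  proof -
    have "(\<alpha> - 1) * (N - 2 * \<alpha>) / ((\<alpha> + real d - 1) * (N - \<alpha>)) = (1 - crit \<alpha> N) * ((\<alpha> - 1) / (\<alpha> + real d - 1))"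
      unfolding c1 by (simp add: mult.commute)
    then show ?thesis by (simp add: right_diff_distrib)
  qed
  also have "1 - (\<alpha> - 1) / (\<alpha> + real d - 1) = real d / (\<alpha> + real d - 1)" using b by (simp add: field_simps)
  finally have R: "?R - crit \<alpha> N = (1 - crit \<alpha> N) * (real d / (\<alpha> + real d - 1))" .
  have "min 1 (1 / \<alpha>) \<le> real d / (\<alpha> + real d - 1)"
  proof (cases "\<alpha> \<le> 1")
    case True
    then have "1 \<le> real d / (\<alpha> + real d - 1)" using b by (simp add: le_divide_eq)
    then show ?thesis by simp
  next
    case False
    have "0 \<le> (real d - 1) * (\<alpha> - 1)" using d False by (intro mult_nonneg_nonneg) auto
    then have "1 * (\<alpha> + real d - 1) \<le> real d * \<alpha>" by (simp add: algebra_simps)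
    then have "1 / \<alpha> \<le> real d / (\<alpha> + real d - 1)" using b \<alpha> by (simp add: divide_simps)
    then show ?thesis by simp
  qed
  then have "gap \<alpha> N \<le> ?R - crit \<alpha> N" unfolding R using gap_le(2) crit by (smt (verit) mult_left_mono)
  then show "0 \<le> (?R - crit \<alpha> N - gap \<alpha> N) * suminf (dg \<alpha> N d)"
    using suminf_dg_pos[of d] by (intro mult_nonneg_nonneg) auto
  fix i i' :: nat assume i: "i \<le> i'" and "0 < dg \<alpha> N d i * (wt \<alpha> (d + i) - crit \<alpha> N - gap \<alpha> N)"
  then have "crit \<alpha> N + gap \<alpha> N < wt \<alpha> (d + i)" using dg_pos[of d i] by (simp add: zero_less_mult_iff)
  from wt_sign[OF _ _ _ this, of "d + i'"] have "crit \<alpha> N + gap \<alpha> N \<le> wt \<alpha> (d + i')" using gap_le(4) crit gap_pos i by simp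
  then show "0 \<le> dg \<alpha> N d i' * (wt \<alpha> (d + i') - crit \<alpha> N - gap \<alpha> N)" using dg_pos[of d i'] by simp
qed

lemma dg_crit: "(\<lambda>i. dg \<alpha> N 0 i * (wt \<alpha> i - crit \<alpha> N)) sums 0"
proof -
  have "(\<lambda>i. dg \<alpha> N 0 i * wt \<alpha> i - dg \<alpha> N 0 i * crit \<alpha> N) sums ((\<alpha> + real 0) / (N + real 0 - \<alpha>) * suminf (dg \<alpha> N 0) - suminf (dg \<alpha> N 0) * crit \<alpha> N)"
    by (intro sums_diff dg_sum_low sums_mult2 summable_sums summable_dg)
  then show ?thesis by (simp add: crit_def algebra_simps)
qed

text \<open>On the main diagonal the average of \<open>wt\<close> equals \<open>crit\<close>, without any slack. The slack comes from the term \<open>i = 0\<close>, which is negative and is removed by \<open>q 0 = 0\<close>.\<close>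
lemma dg_zero_nonneg:
  assumes q: "mono q" "q 0 = 0" and s: "(\<lambda>i. dg \<alpha> N 0 i * (wt \<alpha> i - crit \<alpha> N - gap \<alpha> N) * q i) sums Y"
  shows "0 \<le> Y"
proof (rule single_sign_change_sum)
  have "(\<lambda>i. dg \<alpha> N 0 i * (wt \<alpha> i - crit \<alpha> N) - dg \<alpha> N 0 i * gap \<alpha> N) sums (0 - suminf (dg \<alpha> N 0) * gap \<alpha> N)"
    by (intro sums_diff dg_crit sums_mult2 summable_sums summable_dg)
  then have "(\<lambda>i. dg \<alpha> N 0 i * (wt \<alpha> i - crit \<alpha> N - gap \<alpha> N)) sums (- suminf (dg \<alpha> N 0) * gap \<alpha> N)"
    by (simp add: algebra_simps)
  then show "(\<lambda>i. dg \<alpha> N 0 (Suc i) * (wt \<alpha> (Suc i) - crit \<alpha> N - gap \<alpha> N)) sums (- suminf (dg \<alpha> N 0) * gap \<alpha> N + crit \<alpha> N + gap \<alpha> N)"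
    by (subst sums_Suc_iff) (simp add: dg_def hyp_def wt_def)
  show "0 \<le> - suminf (dg \<alpha> N 0) * gap \<alpha> N + crit \<alpha> N + gap \<alpha> N"
    using gap_le(3) suminf_dg_pos[of 0] gap_pos by (simp add: le_divide_eq mult.commute)
  show "mono (\<lambda>i. q (Suc i))" using q(1) by (simp add: mono_def)
  show "0 \<le> q (Suc 0)" using monoD[OF q(1), of 0 "Suc 0"] q(2) by simp
  show "(\<lambda>i. dg \<alpha> N 0 (Suc i) * (wt \<alpha> (Suc i) - crit \<alpha> N - gap \<alpha> N) * q (Suc i)) sums Y"
    using s by (subst sums_Suc_iff) (simp add: q(2))
  fix i i' :: nat assume i: "i \<le> i'" and "0 < dg \<alpha> N 0 (Suc i) * (wt \<alpha> (Suc i) - crit \<alpha> N - gap \<alpha> N)"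
  then have "crit \<alpha> N + gap \<alpha> N < wt \<alpha> (Suc i)" using dg_pos[of 0 "Suc i"] by (simp add: zero_less_mult_iff)
  from wt_sign[OF _ _ _ this, of "Suc i'"] have "crit \<alpha> N + gap \<alpha> N \<le> wt \<alpha> (Suc i')" using gap_le(4) crit gap_pos i by simp
  then show "0 \<le> dg \<alpha> N 0 (Suc i') * (wt \<alpha> (Suc i') - crit \<alpha> N - gap \<alpha> N)" using dg_pos[of 0 "Suc i'"] by simp
qed

end

text \<open>The growth that the moments on a diagonal are guaranteed to have.\<close>
definition dw :: "real \<Rightarrow> nat \<Rightarrow> nat \<Rightarrow> real" where
  "dw N d i = pochhammer (real d + 1) i / pochhammer (N + real d) i"

lemma dw_pos: "0 < N \<Longrightarrow> 0 < dw N d i"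
  unfolding dw_def by (intro divide_pos_pos pochhammer_pos) auto

lemma fact_add_pochhammer: "(fact (d + i) :: real) = fact d * pochhammer (real d + 1) i"
  by (induction i) (auto simp: pochhammer_Suc algebra_simps)

lemma bcoef_dw:
  assumes "0 < N"
  shows "bcoef \<alpha> (d + i) * bcoef \<alpha> i * dw N d i = bcoef \<alpha> d * dg \<alpha> N d i"
proof -
  have p: "pochhammer (real d + 1) i > 0" by (rule pochhammer_pos) simp
  show ?thesis
    unfolding bcoef_def dw_def dg_def hyp_def fact_add_pochhammer pochhammer_product'[of \<alpha> d i]
    using p by (simp add: mult_ac)
qed

text \<open>A restatement of \<open>kmom_Suc_ge\<close>: the factors \<open>(j + 1) / (N + j)\<close> accumulate to \<open>dw\<close>.\<close>
lemma kmom_dw_mono: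
  fixes f :: "complex ^ 'n::finite \<Rightarrow> real"
  assumes f: "integrable surf f"
  shows "mono (\<lambda>i. kmom f (d + i) i / dw (real CARD('n)) d i)"
proof (rule incseq_SucI)
  fix i
  let ?N = "real CARD('n)"
  have N: "?N > 0" by simp
  have p: "?N + real d + real i > 0" by (intro add_pos_nonneg) auto
  have "dw ?N d (Suc i) = dw ?N d i * ((real (d + i) + 1) / (?N + real (d + i)))"
    by (simp add: dw_def pochhammer_Suc add_ac)
  moreover have "(real (d + i) + 1) / (?N + real (d + i)) > 0" using p by (intro divide_pos_pos) auto
  moreover have "(real (d + i) + 1) / (?N + real (d + i)) * kmom f (d + i) i \<le> kmom f (d + Suc i) (Suc i)"
    using kmom_Suc_ge[OF f, of "d + i" i] by simp
  moreover have "a / w \<le> b / (w * r)" if "w > 0" "r > 0" "r * a \<le> b" for a b w r :: real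
    using that by (simp add: field_simps)
  ultimately show "kmom f (d + i) i / dw ?N d i \<le> kmom f (d + Suc i) (Suc i) / dw ?N d (Suc i)"
    using dw_pos[OF N, of d i] by (simp only:)
qed

lemma smom_dw: "smom TYPE('n::finite) i = smom TYPE('n) 0 * dw (real CARD('n)) 0 i"
  by (subst smom_eq) (simp add: dw_def pochhammer_fact)

lemma kmom_0_0:
  fixes f :: "complex ^ 'n::finite \<Rightarrow> real"
  assumes "integrable surf f"
  shows "kmom f 0 0 = (\<integral>x. f x \<partial>surf)\<^sup>2"
  unfolding kmom_def using integrable_product(2)[OF sph_pair.pair_sigma_finite_axioms assms assms]
  by (simp add: power2_eq_square)

section \<open>The spectral gap\<close>

lemma has_sum_minus:
  fixes f g :: "'a \<Rightarrow> real"
  assumes "(f has_sum a) A" "(g has_sum b) A"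
  shows "((\<lambda>x. f x - g x) has_sum (a - b)) A"
  using has_sum_add[OF assms(1), of "\<lambda>x. - g x" "- b"] assms(2) by (simp add: has_sum_uminus)

lemma infsum_nonneg_of_rows:
  fixes W :: "nat \<times> nat \<Rightarrow> real"
  assumes s: "W summable_on UNIV" and row: "\<And>d Y. (\<lambda>i. W (d, i)) sums Y \<Longrightarrow> 0 \<le> Y"
  shows "0 \<le> infsum W UNIV"
proof -
  have row_sm: "(\<lambda>i. W (d, i)) summable_on UNIV" for d
  proof -
    have "W summable_on (Pair d ` UNIV)" by (rule summable_on_subset[OF s]) auto
    then show ?thesis by (subst (asm) summable_on_reindex) (auto simp: inj_on_def o_def)
  qed
  have "infsum W UNIV = (\<Sum>\<^sub>\<infinity>d. \<Sum>\<^sub>\<infinity>i. W (d, i))"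
    using infsum_Sigma_banach[of W UNIV "\<lambda>_. UNIV"] s by simp
  also have "\<dots> \<ge> 0"
  proof (rule infsum_nonneg)
    fix d
    have "(\<lambda>i. W (d, i)) sums (\<Sum>\<^sub>\<infinity>i. W (d, i))" by (intro has_sum_imp_sums has_sum_infsum row_sm)
    then show "0 \<le> (\<Sum>\<^sub>\<infinity>i. W (d, i))" by (rule row)
  qed
  finally show ?thesis by simp
qed

text \<open>Unconditional summation over \<open>\<nat> \<times> \<nat>\<close> may be arranged along diagonals.\<close>
lemma has_sum_nonneg_of_diagonals:
  fixes W :: "nat \<times> nat \<Rightarrow> real"
  assumes s: "(W has_sum S) UNIV"
    and high: "\<And>d Y. (\<lambda>i. W (d + i, i)) sums Y \<Longrightarrow> 0 \<le> Y"
    and low: "\<And>d Y. (\<lambda>i. W (i, Suc d + i)) sums Y \<Longrightarrow> 0 \<le> Y"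
  shows "0 \<le> S"
proof -
  let ?p = "\<lambda>(d, i). (d + i, i :: nat)" and ?r = "\<lambda>(d, i). (i :: nat, Suc d + i)"
  have sW: "W summable_on UNIV" and S: "S = infsum W UNIV" using s by (auto simp: summable_on_def infsumI)
  have injp: "inj ?p" and injr: "inj ?r" by (auto simp: inj_def)
  have p: "(j, k) \<in> range ?p \<longleftrightarrow> k \<le> j" for j k
    by (auto simp: image_iff) (metis le_add_diff_inverse2)
  have r: "(j, k) \<in> range ?r \<longleftrightarrow> j < k" for j k
    by (auto simp: image_iff) (metis add_Suc add.commute less_iff_Suc_add)
  have un: "UNIV = range ?p \<union> range ?r" and dj: "range ?p \<inter> range ?r = {}"
  proof -
    show "UNIV = range ?p \<union> range ?r"
    proof (intro set_eqI iffI UNIV_I)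
      fix x :: "nat \<times> nat"
      obtain j k where x: "x = (j, k)" by (cases x)
      show "x \<in> range ?p \<union> range ?r" unfolding x Un_iff p r by (rule le_less_linear)
    qed
    show "range ?p \<inter> range ?r = {}"
    proof -
      have "\<not> (x \<in> range ?p \<and> x \<in> range ?r)" for x :: "nat \<times> nat"
      proof -
        obtain j k where x: "x = (j, k)" by (cases x)
        show ?thesis unfolding x p r by simp
      qed
      then show ?thesis by blast
    qed
  qed
  have sp: "W summable_on range ?p" "W summable_on range ?r"
    by (rule summable_on_subset[OF sW]; simp)+
  have "infsum W UNIV = infsum W (range ?p \<union> range ?r)"
    by (rule arg_cong[OF un])
  also have "\<dots> = infsum W (range ?p) + infsum W (range ?r)"
    by (rule infsum_Un_disjoint[OF sp dj])
  also have "infsum W (range ?p) = infsum (W \<circ> ?p) UNIV" by (rule infsum_reindex[OF injp])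
  also have "infsum W (range ?r) = infsum (W \<circ> ?r) UNIV" by (rule infsum_reindex[OF injr])
  moreover have "0 \<le> infsum (W \<circ> ?p) UNIV"
    by (rule infsum_nonneg_of_rows) (use sp(1) summable_on_reindex[OF injp] high in auto)
  moreover have "0 \<le> infsum (W \<circ> ?r) UNIV"
    by (rule infsum_nonneg_of_rows) (use sp(2) summable_on_reindex[OF injr] low in auto)
  ultimately show ?thesis by (simp add: S)
qed

lemma integrable_kern_const:
  assumes \<alpha>: "0 < \<alpha>" "2 * \<alpha> < real CARD('n::finite)"
  shows "integrable (sph2 :: ((complex ^ 'n) \<times> (complex ^ 'n)) measure) (\<lambda>p. kern \<alpha> (hp (fst p) (snd p)))"
proof (rule integrableI_nonneg)
  show "(\<lambda>p. kern \<alpha> (hp (fst p) (snd p))) \<in> borel_measurable (sph2 :: ((complex ^ 'n) \<times> (complex ^ 'n)) measure)"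
    by measurable
  have "(\<integral>\<^sup>+p. ennreal (kern \<alpha> (hp (fst p) (snd p))) \<partial>(sph2 :: ((complex ^ 'n) \<times> (complex ^ 'n)) measure))
     = (\<integral>\<^sup>+x. (\<integral>\<^sup>+y. ennreal (kern \<alpha> (hp x (y :: complex ^ 'n))) \<partial>surf) \<partial>surf)"
    using sph.nn_integral_fst[of "\<lambda>p. ennreal (kern \<alpha> (hp (fst p) (snd p :: complex ^ 'n)))" surf] by simp
  also have "\<dots> \<le> (\<integral>\<^sup>+x. ennreal (kbound TYPE('n) \<alpha>) \<partial>(surf :: (complex ^ 'n) measure))"
    by (intro nn_integral_mono kern_nn_integral \<alpha>) simp
  also have "\<dots> < \<infinity>"
  proof -
    have "emeasure surf (sphere 0 1 :: (complex ^ 'n) set) < top"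
      using sph.emeasure_finite[of "sphere 0 1 :: (complex ^ 'n) set"] unfolding infinity_ennreal_def less_top .
    then show ?thesis by (simp add: ennreal_mult_less_top)
  qed
  finally show "(\<integral>\<^sup>+p. ennreal (kern \<alpha> (hp (fst p) (snd p))) \<partial>(sph2 :: ((complex ^ 'n) \<times> (complex ^ 'n)) measure)) < \<infinity>" .
qed auto

lemma integrable_kern_const_form:
  assumes \<alpha>: "0 < \<alpha>" "2 * \<alpha> < real CARD('n::finite)"
  shows "integrable (sph2 :: ((complex ^ 'n) \<times> (complex ^ 'n)) measure)
    (\<lambda>p. (\<lambda>_. c) (fst p) * (\<lambda>_. c) (snd p) * kern \<alpha> (hp (fst p) (snd p)))"
  using integrable_kern_const[OF \<alpha>] by simp

text \<open>Only the main diagonal contributes to a constant, and there the average of \<open>wt\<close> is \<open>crit\<close>. Thus constants are critical for the inequality that follows.\<close>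
lemma kform_const_crit:
  assumes \<alpha>: "0 < \<alpha>" "2 * \<alpha> < real CARD('n::finite)"
  shows "kform (\<lambda>w. Re w * kern \<alpha> w) (\<lambda>_ :: complex ^ 'n. c) = crit \<alpha> (real CARD('n)) * kform (kern \<alpha>) (\<lambda>_ :: complex ^ 'n. c)"
proof -
  let ?N = "real CARD('n)"
  let ?f = "\<lambda>_ :: complex ^ 'n. c"
  have f: "integrable surf ?f" by simp
  note E = kform_kern_has_sum(1)[OF f \<alpha>(1) integrable_kern_const_form[OF \<alpha>]]
  note G = kform_Re_kern_has_sum[OF f \<alpha>(1) integrable_kern_const_form[OF \<alpha>]]
  let ?W = "\<lambda>(j, k). bcoef \<alpha> j * bcoef \<alpha> k * (wt \<alpha> j - crit \<alpha> ?N) * kmom ?f j k"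
  have "((\<lambda>p. (case p of (j, k) \<Rightarrow> bcoef \<alpha> j * bcoef \<alpha> k * wt \<alpha> j * kmom ?f j k)
      - crit \<alpha> ?N * (case p of (j, k) \<Rightarrow> bcoef \<alpha> j * bcoef \<alpha> k * kmom ?f j k)) has_sum
      (kform (\<lambda>w. Re w * kern \<alpha> w) ?f - crit \<alpha> ?N * kform (kern \<alpha>) ?f)) UNIV"
    by (intro has_sum_minus has_sum_cmult_right E G)
  then have W: "(?W has_sum (kform (\<lambda>w. Re w * kern \<alpha> w) ?f - crit \<alpha> ?N * kform (kern \<alpha>) ?f)) UNIV"
    by (rule has_sum_cong[THEN iffD1, rotated]) (auto simp: algebra_simps)
  have "(?W has_sum (kform (\<lambda>w. Re w * kern \<alpha> w) ?f - crit \<alpha> ?N * kform (kern \<alpha>) ?f)) (range (\<lambda>i. (i, i)))"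
    by (rule has_sum_cong_neutral[THEN iffD1, OF _ _ _ W]) (auto simp: kmom_const)
  then have "((?W \<circ> (\<lambda>i. (i, i))) has_sum (kform (\<lambda>w. Re w * kern \<alpha> w) ?f - crit \<alpha> ?N * kform (kern \<alpha>) ?f)) UNIV"
    by (subst (asm) has_sum_reindex) (auto simp: inj_on_def)
  then have s: "(\<lambda>i. bcoef \<alpha> i * bcoef \<alpha> i * (wt \<alpha> i - crit \<alpha> ?N) * kmom ?f i i) sums (kform (\<lambda>w. Re w * kern \<alpha> w) ?f - crit \<alpha> ?N * kform (kern \<alpha>) ?f)"
    using has_sum_imp_sums by (fastforce simp: o_def)
  have "bcoef \<alpha> i * bcoef \<alpha> i * (wt \<alpha> i - crit \<alpha> ?N) * kmom ?f i i
     = (c\<^sup>2 * (smom TYPE('n) 0)\<^sup>2) * (dg \<alpha> ?N 0 i * (wt \<alpha> i - crit \<alpha> ?N))" for i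
  proof -
    have "bcoef \<alpha> i * bcoef \<alpha> i * dw ?N 0 i = dg \<alpha> ?N 0 i"
      using bcoef_dw[of ?N \<alpha> 0 i] by (simp add: bcoef_def)
    then show ?thesis by (simp add: kmom_const smom_dw[of i, where 'n='n] power2_eq_square mult_ac)
  qed
  then have "(\<lambda>i. bcoef \<alpha> i * bcoef \<alpha> i * (wt \<alpha> i - crit \<alpha> ?N) * kmom ?f i i) sums ((c\<^sup>2 * (smom TYPE('n) 0)\<^sup>2) * 0)"
    by (simp only:) (rule sums_mult[OF dg_crit[OF \<alpha>]])
  from sums_unique2[OF s this] show ?thesis by simp
qed

text \<open>Subtract from the series of \<open>f\<close> that of the constant \<open>c\<close>. This changes only the main diagonal, where it removes
  the term \<open>i = 0\<close>; on all diagonals the single sign change lemma then applies.\<close>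
theorem spectral_gap:
  fixes f :: "complex ^ 'n::finite \<Rightarrow> real"
  defines "N \<equiv> real CARD('n)"
  assumes f: "integrable surf f" and \<alpha>: "0 < \<alpha>" "2 * \<alpha> < N"
    and ff: "integrable sph2 (\<lambda>p. f (fst p) * f (snd p) * kern \<alpha> (hp (fst p) (snd p)))"
    and c: "c * smom TYPE('n) 0 = (\<integral>x. f x \<partial>surf)"
  shows "gap \<alpha> N * (kform (kern \<alpha>) f - kform (kern \<alpha>) (\<lambda>_ :: complex ^ 'n. c))
     \<le> kform (\<lambda>w. Re w * kern \<alpha> w) f - crit \<alpha> N * kform (kern \<alpha>) f"
proof -
  let ?c = "\<lambda>_ :: complex ^ 'n. c"
  have \<alpha>': "0 < \<alpha>" "2 * \<alpha> < real CARD('n)" using \<alpha> by (auto simp: N_def)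
  have N: "N > 0" using \<alpha> by simp
  have g: "integrable surf ?c" by simp
  note E = kform_kern_has_sum(1)[OF f \<alpha>(1) ff] and G = kform_Re_kern_has_sum[OF f \<alpha>(1) ff]
  note E' = kform_kern_has_sum(1)[OF g \<alpha>(1) integrable_kern_const_form[OF \<alpha>']]
    and G' = kform_Re_kern_has_sum[OF g \<alpha>(1) integrable_kern_const_form[OF \<alpha>']]
  define \<theta> where "\<theta> = crit \<alpha> N + gap \<alpha> N"
  \<comment> \<open>By \<open>kform_const_crit\<close>, \<open>0 \<le> S\<close> is the claim.\<close>
  define S where "S = (kform (\<lambda>w. Re w * kern \<alpha> w) f - \<theta> * kform (kern \<alpha>) f) - (kform (\<lambda>w. Re w * kern \<alpha> w) ?c - \<theta> * kform (kern \<alpha>) ?c)"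
  define W where "W = (\<lambda>(j, k). bcoef \<alpha> j * bcoef \<alpha> k * (wt \<alpha> j - crit \<alpha> N - gap \<alpha> N) * (kmom f j k - kmom ?c j k))"
  have "((\<lambda>p. ((case p of (j, k) \<Rightarrow> bcoef \<alpha> j * bcoef \<alpha> k * wt \<alpha> j * kmom f j k)
      - \<theta> * (case p of (j, k) \<Rightarrow> bcoef \<alpha> j * bcoef \<alpha> k * kmom f j k))
      - ((case p of (j, k) \<Rightarrow> bcoef \<alpha> j * bcoef \<alpha> k * wt \<alpha> j * kmom ?c j k)
      - \<theta> * (case p of (j, k) \<Rightarrow> bcoef \<alpha> j * bcoef \<alpha> k * kmom ?c j k))) has_sum S) UNIV"
    unfolding S_def by (intro has_sum_minus has_sum_cmult_right E G E' G')
  then have W: "(W has_sum S) UNIV"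
    by (rule has_sum_cong[THEN iffD1, rotated]) (auto simp: W_def \<theta>_def algebra_simps)
  have pos: "0 \<le> S"
  proof (rule has_sum_nonneg_of_diagonals[OF W])
    fix d :: nat and Y assume Y: "(\<lambda>i. W (d + i, i)) sums Y"
    have b: "bcoef \<alpha> d > 0" by (rule bcoef_pos[OF \<alpha>(1)])
    define q where "q i = bcoef \<alpha> d * ((kmom f (d + i) i - kmom ?c (d + i) i) / dw N d i)" for i
    have x: "W (d + i, i) = dg \<alpha> N d i * (wt \<alpha> (d + i) - crit \<alpha> N - gap \<alpha> N) * q i" for i
    proof -
      have "bcoef \<alpha> (d + i) * bcoef \<alpha> i = bcoef \<alpha> d * dg \<alpha> N d i / dw N d i"
        using bcoef_dw[OF N, of \<alpha> d i] dw_pos[OF N, of d i] by (simp add: field_simps)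
      then show ?thesis by (simp add: W_def q_def)
    qed
    show "0 \<le> Y"
    proof (cases "d = 0")
      case True
      have k: "kmom ?c i i = (\<integral>x. f x \<partial>surf)\<^sup>2 * dw N 0 i" for i
        by (simp add: kmom_const smom_dw[of i, where 'n='n] c[symmetric] N_def power2_eq_square mult_ac)
      have q: "q i = kmom f (0 + i) i / dw N 0 i - (\<integral>x. f x \<partial>surf)\<^sup>2" for i
        using dw_pos[OF N, of 0 i] by (simp add: q_def True k bcoef_def diff_divide_distrib)
      have "mono q"
        using kmom_dw_mono[OF f, of 0] unfolding q mono_def N_def by (auto simp: q N_def)
      moreover have "q 0 = 0" by (simp add: q kmom_0_0[OF f] dw_def)
      ultimately show ?thesis
        using dg_zero_nonneg[OF \<alpha>] Y unfolding x by (simp add: True)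
    next
      case False
      then have d: "d \<ge> 1" by simp
      have q: "q i = bcoef \<alpha> d * (kmom f (d + i) i / dw N d i)" for i
        using False by (simp add: q_def kmom_const)
      have m: "mono q"
      proof (rule monoI)
        fix i i' :: nat assume "i \<le> i'"
        from monoD[OF kmom_dw_mono[OF f, of d] this] show "q i \<le> q i'"
          unfolding q N_def using b by (intro mult_left_mono) auto
      qed
      have "0 \<le> q 0" unfolding q using b kmom_nonneg[OF f] dw_pos[OF N, of d 0]
        by (intro mult_nonneg_nonneg divide_nonneg_pos) auto
      from dg_high_nonneg[OF \<alpha> d m this Y[unfolded x]] show ?thesis .
    qed
  next
    fix d' :: nat and Y assume Y: "(\<lambda>i. W (i, Suc d' + i)) sums Y"
    define d where "d = Suc d'"
    have d: "d \<ge> 1" by (simp add: d_def)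
    have b: "bcoef \<alpha> d > 0" by (rule bcoef_pos[OF \<alpha>(1)])
    define q where "q i = bcoef \<alpha> d * (kmom f (d + i) i / dw N d i)" for i
    have x: "W (i, Suc d' + i) = dg \<alpha> N d i * (wt \<alpha> i - crit \<alpha> N - gap \<alpha> N) * q i" for i
    proof -
      have "bcoef \<alpha> (d + i) * bcoef \<alpha> i = bcoef \<alpha> d * dg \<alpha> N d i / dw N d i"
        using bcoef_dw[OF N, of \<alpha> d i] dw_pos[OF N, of d i] by (simp add: field_simps)
      moreover have "kmom ?c i (d + i) = 0" using d by (simp add: kmom_const)
      moreover have "W (i, Suc d' + i) = (bcoef \<alpha> (d + i) * bcoef \<alpha> i) * ((wt \<alpha> i - crit \<alpha> N - gap \<alpha> N) * (kmom f (d + i) i - kmom ?c i (d + i)))"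
        by (simp add: W_def d_def[symmetric] kmom_commute[OF f, of i "d + i"] mult_ac)
      ultimately show ?thesis by (simp add: q_def)
    qed
    have m: "mono q"
    proof (rule monoI)
      fix i i' :: nat assume "i \<le> i'"
      from monoD[OF kmom_dw_mono[OF f, of d] this] show "q i \<le> q i'"
        unfolding q_def N_def using b by (intro mult_left_mono) auto
    qed
    have "0 \<le> q 0" unfolding q_def using b kmom_nonneg[OF f] dw_pos[OF N, of d 0]
      by (intro mult_nonneg_nonneg divide_nonneg_pos) auto
    from dg_low_nonneg[OF \<alpha> d m this Y[unfolded x]] show "0 \<le> Y" .
  qed
  have "kform (\<lambda>w. Re w * kern \<alpha> w) ?c = crit \<alpha> N * kform (kern \<alpha>) ?c"
    unfolding N_def by (rule kform_const_crit[OF \<alpha>'])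
  then show ?thesis using pos by (simp add: S_def \<theta>_def algebra_simps)
qed

text \<open>All terms of the series are nonnegative.\<close>
lemma kform_kern_nonneg:
  fixes f :: "complex ^ 'n::finite \<Rightarrow> real"
  assumes f: "integrable surf f" and \<alpha>: "0 < \<alpha>"
    and ff: "integrable sph2 (\<lambda>p. f (fst p) * f (snd p) * kern \<alpha> (hp (fst p) (snd p)))"
  shows "0 \<le> kform (kern \<alpha>) f"
  by (rule has_sum_nonneg[OF kform_kern_has_sum(1)[OF assms]])
    (use kmom_nonneg[OF f] less_imp_le[OF bcoef_pos[OF \<alpha>]] in auto)

section \<open>Lebesgue spaces on the sphere and the Young inequality\<close>

definition Lr :: "real \<Rightarrow> (complex ^ 'n \<Rightarrow> real) \<Rightarrow> bool" where
  "Lr p f \<longleftrightarrow> f \<in> borel_measurable surf \<and> integrable surf (\<lambda>x. \<bar>f x\<bar> powr p)"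

lemma Lr_measurable: "Lr p f \<Longrightarrow> f \<in> borel_measurable surf"
  by (simp add: Lr_def)

lemma Lr_dominated:
  fixes f g :: "complex ^ 'n \<Rightarrow> real"
  assumes g: "Lr p g" and f: "f \<in> borel_measurable surf" and p: "0 < p"
    and le: "\<And>x. norm x = 1 \<Longrightarrow> \<bar>f x\<bar> \<le> C * \<bar>g x\<bar>"
  shows "Lr p f"
  unfolding Lr_def
proof (rule conjI[OF f], rule Bochner_Integration.integrable_bound)
  show "integrable surf (\<lambda>x. \<bar>C\<bar> powr p * \<bar>g x\<bar> powr p)" using g by (simp add: Lr_def)
  show "AE x in surf. norm (\<bar>f x\<bar> powr p) \<le> norm (\<bar>C\<bar> powr p * \<bar>g x\<bar> powr p)"
  proof (rule AE_I2)
    fix x :: "complex ^ 'n" assume "x \<in> space surf"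
    then have "\<bar>f x\<bar> \<le> \<bar>C\<bar> * \<bar>g x\<bar>"
      using le[of x] mult_right_mono[OF abs_ge_self[of C] abs_ge_zero[of "g x"]] by simp
    then have "\<bar>f x\<bar> powr p \<le> (\<bar>C\<bar> * \<bar>g x\<bar>) powr p" using p by (intro powr_mono2) auto
    then show "norm (\<bar>f x\<bar> powr p) \<le> norm (\<bar>C\<bar> powr p * \<bar>g x\<bar> powr p)" by (simp add: powr_mult)
  qed
qed (use f in measurable)

lemma Lr_add:
  assumes f: "Lr p f" and g: "Lr p g" and p: "0 < p"
  shows "Lr p (\<lambda>x. f x + g x)"
  unfolding Lr_def
proof (rule conjI, goal_cases)
  case 1
  show ?case using Lr_measurable[OF f] Lr_measurable[OF g] by measurable
next
  case 2
  show ?case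
  proof (rule Bochner_Integration.integrable_bound)
  note [measurable] = Lr_measurable[OF f] Lr_measurable[OF g]
  show "(\<lambda>x. \<bar>f x + g x\<bar> powr p) \<in> borel_measurable surf" by measurable
  show "integrable surf (\<lambda>x. 2 powr p * (\<bar>f x\<bar> powr p + \<bar>g x\<bar> powr p))"
    using f g by (intro integrable_mult_right Bochner_Integration.integrable_add) (auto simp: Lr_def)
  show "AE x in surf. norm (\<bar>f x + g x\<bar> powr p) \<le> norm (2 powr p * (\<bar>f x\<bar> powr p + \<bar>g x\<bar> powr p))"
  proof (rule AE_I2)
    fix x
    have "\<bar>f x + g x\<bar> powr p \<le> (2 * max \<bar>f x\<bar> \<bar>g x\<bar>) powr p" using p by (intro powr_mono2) auto
    also have "\<dots> = 2 powr p * (max \<bar>f x\<bar> \<bar>g x\<bar>) powr p" by (simp add: powr_mult)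
    also have "(max \<bar>f x\<bar> \<bar>g x\<bar>) powr p \<le> \<bar>f x\<bar> powr p + \<bar>g x\<bar> powr p" by (auto simp: max_def)
    finally show "norm (\<bar>f x + g x\<bar> powr p) \<le> norm (2 powr p * (\<bar>f x\<bar> powr p + \<bar>g x\<bar> powr p))" by simp
  qed
qed
qed

lemma Lr_scale: "Lr p f \<Longrightarrow> 0 < p \<Longrightarrow> Lr p (\<lambda>x. c * f x)"
  by (rule Lr_dominated[where g=f and C="\<bar>c\<bar>"]) (auto simp: abs_mult Lr_def)

lemma Lr_abs: "Lr p f \<Longrightarrow> Lr p (\<lambda>x. \<bar>f x\<bar>)"
  by (auto simp: Lr_def)

lemma Lr_diff: "Lr p f \<Longrightarrow> Lr p g \<Longrightarrow> 0 < p \<Longrightarrow> Lr p (\<lambda>x. f x - g x)"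
  using Lr_add[of p f "\<lambda>x. - 1 * g x"] Lr_scale[of p g "-1"] by simp

lemma Lr_bounded:
  assumes [measurable]: "f \<in> borel_measurable surf" and B: "\<And>x. norm x = 1 \<Longrightarrow> \<bar>f x\<bar> \<le> B" and p: "0 < p"
  shows "Lr p f"
proof (rule Lr_dominated[where g="\<lambda>_. 1" and C=B])
  show "Lr p (\<lambda>_. 1)" by (simp add: Lr_def)
qed (use B p in auto)

lemma Lr_mult_bounded:
  assumes f: "Lr p f" and g: "g \<in> borel_measurable surf" and B: "\<And>x. norm x = 1 \<Longrightarrow> \<bar>g x\<bar> \<le> B" and p: "0 < p"
  shows "Lr p (\<lambda>x. f x * g x)"
proof (rule Lr_dominated[OF f _ p])
  show "(\<lambda>x. f x * g x) \<in> borel_measurable surf" using Lr_measurable[OF f] g by measurable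
  show "\<bar>f x * g x\<bar> \<le> B * \<bar>f x\<bar>" if "norm x = 1" for x
    using mult_left_mono[OF B[OF that], of "\<bar>f x\<bar>"] by (simp add: abs_mult mult.commute)
qed

lemma powr_le_one_plus: "0 \<le> (a::real) \<Longrightarrow> 0 < q \<Longrightarrow> q \<le> p \<Longrightarrow> a powr q \<le> 1 + a powr p"
proof (cases "a \<le> 1")
  case True
  moreover assume "0 \<le> a" "0 < q"
  ultimately have "a powr q \<le> 1 powr q" by (intro powr_mono2) auto
  then show ?thesis by (simp add: add_increasing2)
next
  case False
  moreover assume "q \<le> p"
  ultimately have "a powr q \<le> a powr p" by (intro powr_mono) auto
  then show ?thesis by simp
qed

lemma Lr_integrable_powr:
  assumes f: "Lr p f" and q: "0 < q" "q \<le> p"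
  shows "integrable surf (\<lambda>x. \<bar>f x\<bar> powr q)"
    "(\<integral>x. \<bar>f x\<bar> powr q \<partial>surf) \<le> smom TYPE('n::finite) 0 + (\<integral>x. \<bar>f (x :: complex ^ 'n)\<bar> powr p \<partial>surf)"
proof -
  note [measurable] = Lr_measurable[OF f]
  have i: "integrable surf (\<lambda>x. 1 + \<bar>f x\<bar> powr p)" using f by (auto simp: Lr_def)
  show 1: "integrable surf (\<lambda>x. \<bar>f x\<bar> powr q)"
    by (rule Bochner_Integration.integrable_bound[OF i]) (use q powr_le_one_plus in \<open>auto intro!: AE_I2\<close>)
  have "(\<integral>x. \<bar>f x\<bar> powr q \<partial>surf) \<le> (\<integral>x. 1 + \<bar>f x\<bar> powr p \<partial>surf)"
    by (rule integral_mono[OF 1 i]) (use q powr_le_one_plus in auto)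
  also have "\<dots> = smom TYPE('n) 0 + (\<integral>x. \<bar>f x\<bar> powr p \<partial>surf)"
    using f by (simp add: Lr_def smom_0)
  finally show "(\<integral>x. \<bar>f x\<bar> powr q \<partial>surf) \<le> smom TYPE('n) 0 + (\<integral>x. \<bar>f x\<bar> powr p \<partial>surf)" .
qed

lemma Lr_integrable:
  assumes "Lr p f" "1 \<le> p"
  shows "integrable surf f"
    "(\<integral>x. \<bar>f x\<bar> \<partial>surf) \<le> smom TYPE('n::finite) 0 + (\<integral>x. \<bar>f (x :: complex ^ 'n)\<bar> powr p \<partial>surf)"
proof -
  have "integrable surf (\<lambda>x. \<bar>f x\<bar>)"
    using Lr_integrable_powr(1)[OF assms(1), of 1] assms(2) by simp
  then show "integrable surf f"
    using Lr_measurable[OF assms(1)] by (subst (asm) integrable_abs_iff) auto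
  show "(\<integral>x. \<bar>f x\<bar> \<partial>surf) \<le> smom TYPE('n) 0 + (\<integral>x. \<bar>f x\<bar> powr p \<partial>surf)"
    using Lr_integrable_powr(2)[OF assms(1), of 1] assms(2) by simp
qed

text \<open>The pointwise inequality behind Young's convolution inequality; the left-hand side is a
  weighted geometric mean of the three summands.\<close>
lemma young_pointwise:
  fixes A B R q :: real
  assumes "0 \<le> A" "0 \<le> B" "0 \<le> R" and q: "1 < q" "q \<le> 2"
  defines "r \<equiv> q / (2 * (q - 1))"
  shows "A * B * R \<le> A powr q * R powr r + B powr q * R powr r + A powr q * B powr q"
proof (cases "A = 0 \<or> B = 0 \<or> R = 0")
  case True
  then show ?thesis by auto
next
  case False
  then have pos: "0 < A" "0 < B" "0 < R" using assms by auto
  define s where "s = (q - 1) / q"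
  have s: "0 < s" "2 * s \<le> 1" using q by (auto simp: s_def field_simps)
  define m where "m = A powr q * R powr r + B powr q * R powr r + A powr q * B powr q"
  have m: "0 < m" unfolding m_def using pos by (intro add_pos_pos mult_pos_pos) auto
  have "q * s = q - 1" using q by (simp add: s_def)
  moreover have "r * s = 1 / 2" using q by (simp add: s_def r_def)
  ultimately have e: "q * s + q * (1 - 2 * s) = 1" "r * s + r * s = 1" by (simp_all add: right_diff_distrib)
  have "A * B * R = (A powr q * R powr r) powr s * (B powr q * R powr r) powr s * (A powr q * B powr q) powr (1 - 2 * s)"
  proof -
    have "(A powr q * R powr r) powr s * (B powr q * R powr r) powr s * (A powr q * B powr q) powr (1 - 2 * s)
       = (A powr (q * s) * A powr (q * (1 - 2 * s))) * (B powr (q * s) * B powr (q * (1 - 2 * s))) * (R powr (r * s) * R powr (r * s))"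
      using pos by (simp add: powr_mult powr_powr)
    also have "\<dots> = A * B * R" unfolding powr_add[symmetric] e using pos by simp
    finally show ?thesis ..
  qed
  also have "\<dots> \<le> m powr s * m powr s * m powr (1 - 2 * s)"
    using pos s by (intro mult_mono powr_mono2) (auto simp: m_def add_nonneg_nonneg)
  also have "\<dots> = m" using m by (simp flip: powr_add)
  finally show ?thesis by (simp add: m_def)
qed

definition yq :: "real \<Rightarrow> real" where "yq p = min p 2"
definition yr :: "real \<Rightarrow> real" where "yr p = yq p / (2 * (yq p - 1))"

lemma subcritical_exponent:
  assumes \<alpha>: "0 < \<alpha>" "2 * \<alpha> < N" and p: "N / (N - \<alpha>) < p"
  shows "1 < p" "1 < yq p" "yq p \<le> 2" "yq p \<le> p" "0 < yr p" "2 * (\<alpha> * yr p) < N"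
proof -
  have "1 < N / (N - \<alpha>)" using \<alpha> by (simp add: less_divide_eq)
  then show p1: "1 < p" using p by simp
  then show q1: "1 < yq p" "yq p \<le> 2" "yq p \<le> p" by (auto simp: yq_def)
  then show "0 < yr p" by (auto simp: yr_def)
  have "N / (N - \<alpha>) < yq p" using p \<alpha> by (auto simp: yq_def divide_less_eq)
  then have "N < yq p * (N - \<alpha>)" using \<alpha> by (simp add: divide_less_eq)
  then have "\<alpha> * yq p < N * (yq p - 1)" by (simp add: algebra_simps)
  then show "2 * (\<alpha> * yr p) < N" using q1 by (simp add: yr_def field_simps)
qed

lemma kern_powr: "kern \<alpha> w powr r = kern (\<alpha> * r) w"
  by (simp add: kern_def powr_powr mult_ac)

lemma kern_cnj: "kern \<alpha> (cnj w) = kern \<alpha> w"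
proof -
  have "cmod (1 - cnj w) = cmod (1 - w)" by (metis complex_cnj_diff complex_cnj_one complex_mod_cnj)
  then show ?thesis by (simp add: kern_def)
qed

definition ybound :: "'n::finite itself \<Rightarrow> real" where
  "ybound T = 2 * (smom TYPE('n) 0 + 1) + (smom TYPE('n) 0 + 1) * (smom TYPE('n) 0 + 1)"

lemma ybound_pos: "0 < ybound TYPE('n::finite)"
  unfolding ybound_def using smom_pos[of 0, where 'n='n] by (intro add_pos_pos mult_pos_pos) auto

text \<open>The pointwise inequality is integrated after rescaling the kernel; each of the three terms is a product of two integrals.\<close>
lemma young_nn_integral:
  fixes f g :: "complex ^ 'n::finite \<Rightarrow> real" and k :: "complex \<Rightarrow> real"
  assumes p: "1 < yq p" and f: "Lr p f" "(\<integral>x. \<bar>f x\<bar> powr p \<partial>surf) \<le> 1"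
    and g: "Lr p g" "(\<integral>x. \<bar>g x\<bar> powr p \<partial>surf) \<le> 1"
    and k: "k \<in> borel_measurable borel" "\<And>w. 0 \<le> k w" "\<And>w. k (cnj w) = k w"
    and M: "0 < M" "\<And>x :: complex ^ 'n. norm x = 1 \<Longrightarrow> (\<integral>\<^sup>+y. ennreal (k (hp x y) powr yr p) \<partial>surf) \<le> ennreal M"
  shows "(\<integral>\<^sup>+p. ennreal (\<bar>f (fst p) * g (snd p)\<bar> * k (hp (fst p) (snd p))) \<partial>sph2) \<le> ennreal (M powr (1 / yr p) * ybound TYPE('n))"
proof -
  note [measurable] = Lr_measurable[OF f(1)] Lr_measurable[OF g(1)] k(1) measurable_sphere_borel
  have [measurable]: "(\<lambda>p. f (fst p)) \<in> borel_measurable sph2" "(\<lambda>p. g (snd p)) \<in> borel_measurable sph2"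
    by (rule measurable_compose[OF measurable_fst Lr_measurable[OF f(1)]] measurable_compose[OF measurable_snd Lr_measurable[OF g(1)]])+
  define q where "q = yq p"
  define r where "r = yr p"
  define \<epsilon> where "\<epsilon> = M powr (1 / r)"
  have q: "1 < q" "q \<le> 2" "q \<le> p" using p by (auto simp: q_def yq_def)
  have r: "0 < r" using q by (auto simp: r_def yr_def q_def)
  have \<epsilon>: "0 < \<epsilon>" using M by (simp add: \<epsilon>_def)
  have \<epsilon>r: "\<epsilon> powr r = M" using M r by (simp add: \<epsilon>_def powr_powr)
  let ?B = "smom TYPE('n) 0 + 1"
  have B0: "?B \<ge> 0" using smom_pos[of 0, where 'n='n] by simp
  have nnq: "(\<integral>\<^sup>+x. ennreal (\<bar>h x\<bar> powr q) \<partial>surf) \<le> ennreal ?B"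
    if h: "Lr p h" "(\<integral>x. \<bar>h x\<bar> powr p \<partial>surf) \<le> 1" for h :: "complex ^ 'n \<Rightarrow> real"
    using Lr_integrable_powr[OF h(1), of q] h(2) q by (subst nn_integral_eq_integral) (auto intro!: ennreal_leI)
  define R where "R = (\<lambda>w. k w / \<epsilon>)"
  have Rr: "R w powr r = k w powr r / M" for w using k(2)[of w] \<epsilon> by (simp add: R_def powr_divide \<epsilon>r)
  have [measurable]: "R \<in> borel_measurable borel" unfolding R_def by measurable
  have R0: "0 \<le> R w" for w using k(2)[of w] \<epsilon> by (simp add: R_def)
  have MR: "(\<integral>\<^sup>+y. ennreal (R (hp x y) powr r) \<partial>surf) \<le> 1" if "norm x = 1" for x :: "complex ^ 'n"
  proof -
    have "(\<integral>\<^sup>+y. ennreal (R (hp x y) powr r) \<partial>surf) = (\<integral>\<^sup>+y. ennreal (1 / M) * ennreal (k (hp x y) powr r) \<partial>surf)"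
      unfolding Rr using M(1) by (intro nn_integral_cong) (simp flip: ennreal_mult)
    also have "\<dots> = ennreal (1 / M) * (\<integral>\<^sup>+y. ennreal (k (hp x y) powr r) \<partial>surf)" by (rule nn_integral_cmult) measurable
    also have "\<dots> \<le> ennreal (1 / M) * ennreal M" using M(2)[OF that] by (intro mult_left_mono) (auto simp: r_def)
    also have "\<dots> = 1" using M(1) by (simp flip: ennreal_mult)
    finally show ?thesis .
  qed
  have MR': "(\<integral>\<^sup>+y. ennreal (R (hp y x) powr r) \<partial>surf) \<le> 1" if "norm x = 1" for x :: "complex ^ 'n"
  proof -
    have "R (hp y x) = R (hp x y)" for y unfolding R_def using k(3)[of "hp x y"] by (simp add: cnj_hp)
    then show ?thesis using MR[OF that] by simp
  qed
  have "(\<integral>\<^sup>+p. ennreal (\<bar>f (fst p) * g (snd p)\<bar> * k (hp (fst p) (snd p))) \<partial>sph2)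
     \<le> (\<integral>\<^sup>+p. ennreal \<epsilon> * (ennreal (\<bar>f (fst p)\<bar> powr q * R (hp (fst p) (snd p)) powr r)
         + ennreal (\<bar>g (snd p)\<bar> powr q * R (hp (fst p) (snd p)) powr r)
         + ennreal (\<bar>f (fst p)\<bar> powr q * \<bar>g (snd p)\<bar> powr q)) \<partial>sph2)"
  proof (rule nn_integral_mono)
    fix z :: "(complex ^ 'n) \<times> (complex ^ 'n)"
    define A where "A = \<bar>f (fst z)\<bar>"
    define B where "B = \<bar>g (snd z)\<bar>"
    define w where "w = hp (fst z) (snd z)"
    have yr: "q / (2 * (q - 1)) = r" by (simp add: r_def yr_def q_def)
    have "A * B * R w \<le> A powr q * R w powr r + B powr q * R w powr r + A powr q * B powr q"
      using young_pointwise[of A B "R w" q] R0[of w] q unfolding yr by (simp add: A_def B_def)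
    then have "\<epsilon> * (A * B * R w) \<le> \<epsilon> * (A powr q * R w powr r + B powr q * R w powr r + A powr q * B powr q)"
      using \<epsilon> by (intro mult_left_mono) auto
    moreover have "\<epsilon> * (A * B * R w) = \<bar>f (fst z) * g (snd z)\<bar> * k w" using \<epsilon> by (simp add: A_def B_def R_def abs_mult)
    ultimately have "ennreal (\<bar>f (fst z) * g (snd z)\<bar> * k w) \<le> ennreal (\<epsilon> * (A powr q * R w powr r + B powr q * R w powr r + A powr q * B powr q))"
      by (intro ennreal_leI) simp
    then show "ennreal (\<bar>f (fst z) * g (snd z)\<bar> * k (hp (fst z) (snd z)))
       \<le> ennreal \<epsilon> * (ennreal (\<bar>f (fst z)\<bar> powr q * R (hp (fst z) (snd z)) powr r)
         + ennreal (\<bar>g (snd z)\<bar> powr q * R (hp (fst z) (snd z)) powr r)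
         + ennreal (\<bar>f (fst z)\<bar> powr q * \<bar>g (snd z)\<bar> powr q))"
      using \<epsilon> unfolding A_def B_def w_def by (simp add: ennreal_mult ennreal_plus)
  qed
  also have "\<dots> = ennreal \<epsilon> * ((\<integral>\<^sup>+p. ennreal (\<bar>f (fst p)\<bar> powr q * R (hp (fst p) (snd p)) powr r) \<partial>sph2)
         + (\<integral>\<^sup>+p. ennreal (\<bar>g (snd p)\<bar> powr q * R (hp (fst p) (snd p)) powr r) \<partial>sph2)
         + (\<integral>\<^sup>+p. ennreal (\<bar>f (fst p)\<bar> powr q * \<bar>g (snd p)\<bar> powr q) \<partial>sph2))"
    by (simp add: nn_integral_cmult nn_integral_add)
  also have "\<dots> \<le> ennreal \<epsilon> * (ennreal ?B + ennreal ?B + ennreal ?B * ennreal ?B)"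
  proof (intro mult_left_mono add_mono)
    have "(\<integral>\<^sup>+p. ennreal (\<bar>f (fst p)\<bar> powr q * R (hp (fst p) (snd p)) powr r) \<partial>sph2)
      = (\<integral>\<^sup>+x. (\<integral>\<^sup>+y. ennreal (\<bar>f x\<bar> powr q * R (hp x y) powr r) \<partial>surf) \<partial>surf)"
      using sph.nn_integral_fst[of "\<lambda>p. ennreal (\<bar>f (fst p)\<bar> powr q * R (hp (fst p) (snd p)) powr r)" surf] by simp
    also have "\<dots> \<le> (\<integral>\<^sup>+x. ennreal (\<bar>f x\<bar> powr q) \<partial>surf)"
    proof (rule nn_integral_mono)
      fix x :: "complex ^ 'n" assume "x \<in> space surf"
      then have x: "norm x = 1" by simp
      have "(\<integral>\<^sup>+y. ennreal (\<bar>f x\<bar> powr q * R (hp x y) powr r) \<partial>surf) = ennreal (\<bar>f x\<bar> powr q) * (\<integral>\<^sup>+y. ennreal (R (hp x y) powr r) \<partial>surf)"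
        by (simp add: ennreal_mult nn_integral_cmult)
      also have "\<dots> \<le> ennreal (\<bar>f x\<bar> powr q) * 1" by (intro mult_left_mono MR x) auto
      finally show "(\<integral>\<^sup>+y. ennreal (\<bar>f x\<bar> powr q * R (hp x y) powr r) \<partial>surf) \<le> ennreal (\<bar>f x\<bar> powr q)" by simp
    qed
    finally show "(\<integral>\<^sup>+p. ennreal (\<bar>f (fst p)\<bar> powr q * R (hp (fst p) (snd p)) powr r) \<partial>sph2) \<le> ennreal ?B"
      using nnq[OF f] by (rule order_trans)
    have "(\<integral>\<^sup>+p. ennreal (\<bar>g (snd p)\<bar> powr q * R (hp (fst p) (snd p)) powr r) \<partial>sph2)
      = (\<integral>\<^sup>+y. (\<integral>\<^sup>+x. ennreal (\<bar>g y\<bar> powr q * R (hp x y) powr r) \<partial>surf) \<partial>surf)"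
      using sph_pair.nn_integral_snd[of "\<lambda>p. ennreal (\<bar>g (snd p)\<bar> powr q * R (hp (fst p) (snd p)) powr r)"] by simp
    also have "\<dots> \<le> (\<integral>\<^sup>+y. ennreal (\<bar>g y\<bar> powr q) \<partial>surf)"
    proof (rule nn_integral_mono)
      fix x :: "complex ^ 'n" assume "x \<in> space surf"
      then have x: "norm x = 1" by simp
      have "(\<integral>\<^sup>+y. ennreal (\<bar>g x\<bar> powr q * R (hp y x) powr r) \<partial>surf) = ennreal (\<bar>g x\<bar> powr q) * (\<integral>\<^sup>+y. ennreal (R (hp y x) powr r) \<partial>surf)"
        by (simp add: ennreal_mult nn_integral_cmult)
      also have "\<dots> \<le> ennreal (\<bar>g x\<bar> powr q) * 1" by (intro mult_left_mono MR' x) auto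
      finally show "(\<integral>\<^sup>+y. ennreal (\<bar>g x\<bar> powr q * R (hp y x) powr r) \<partial>surf) \<le> ennreal (\<bar>g x\<bar> powr q)" by simp
    qed
    finally show "(\<integral>\<^sup>+p. ennreal (\<bar>g (snd p)\<bar> powr q * R (hp (fst p) (snd p)) powr r) \<partial>sph2) \<le> ennreal ?B"
      using nnq[OF g] by (rule order_trans)
    have "(\<integral>\<^sup>+p. ennreal (\<bar>f (fst p)\<bar> powr q * \<bar>g (snd p)\<bar> powr q) \<partial>sph2)
      = (\<integral>\<^sup>+x. (\<integral>\<^sup>+y. ennreal (\<bar>f x\<bar> powr q * \<bar>g y\<bar> powr q) \<partial>surf) \<partial>surf)"
      using sph.nn_integral_fst[of "\<lambda>p. ennreal (\<bar>f (fst p)\<bar> powr q * \<bar>g (snd p)\<bar> powr q)" surf] by simp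
    also have "\<dots> = (\<integral>\<^sup>+x. ennreal (\<bar>f x\<bar> powr q) \<partial>surf) * (\<integral>\<^sup>+y. ennreal (\<bar>g y\<bar> powr q) \<partial>surf)"
      by (simp add: ennreal_mult nn_integral_cmult nn_integral_multc)
    also have "\<dots> \<le> ennreal ?B * ennreal ?B" by (intro mult_mono nnq f g) auto
    finally show "(\<integral>\<^sup>+p. ennreal (\<bar>f (fst p)\<bar> powr q * \<bar>g (snd p)\<bar> powr q) \<partial>sph2) \<le> ennreal ?B * ennreal ?B" .
  qed auto
  also have "\<dots> = ennreal (\<epsilon> * ybound TYPE('n))"
    using B0 \<epsilon> by (simp add: ybound_def flip: ennreal_mult ennreal_plus)
  finally show ?thesis by (simp add: \<epsilon>_def r_def)
qed

section \<open>The energy as a bilinear form in the subcritical range\<close>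

lemma Lp_norm_le:
  assumes p: "0 < p" and c: "0 \<le> c" and le: "(\<integral>\<^sup>+ x. ennreal (norm (f x) powr p) \<partial>M) \<le> ennreal (c powr p)"
  shows "Lp_norm M p f \<le> ennreal c"
proof -
  define J where "J = (\<integral>\<^sup>+ x. ennreal (norm (f x) powr p) \<partial>M)"
  have "J \<noteq> \<infinity>" using le unfolding J_def[symmetric] by (auto simp: top_unique)
  moreover have "enn2real J powr (1 / p) \<le> c"
  proof -
    have "enn2real J \<le> c powr p" using le unfolding J_def[symmetric] by (intro enn2real_leI) auto
    then have "enn2real J powr (1 / p) \<le> (c powr p) powr (1 / p)" using p by (intro powr_mono2) auto
    also have "\<dots> = c" using p c by (simp add: powr_powr)
    finally show ?thesis .
  qed
  ultimately show ?thesis unfolding Lp_norm_def Let_def J_def[symmetric] by (simp add: ennreal_leI)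
qed

lemma Lp_norm_eqI:
  assumes p: "0 < p" and c: "0 \<le> c" and eq: "(\<integral>\<^sup>+ x. ennreal (norm (f x) powr p) \<partial>M) = ennreal (c powr p)"
  shows "Lp_norm M p f = ennreal c"
  unfolding Lp_norm_def Let_def eq using p c by (simp add: powr_powr)

lemma Lp_norm_eqD:
  assumes p: "0 < p" and c: "0 \<le> c" and eq: "Lp_norm M p f = ennreal c"
  shows "(\<integral>\<^sup>+ x. ennreal (norm (f x) powr p) \<partial>M) = ennreal (c powr p)"
proof -
  define J where "J = (\<integral>\<^sup>+ x. ennreal (norm (f x) powr p) \<partial>M)"
  have J: "J \<noteq> \<infinity>" using eq unfolding Lp_norm_def Let_def J_def[symmetric] by (auto split: if_splits)
  then have "enn2real J powr (1 / p) = c" using eq c unfolding Lp_norm_def Let_def J_def[symmetric] by simp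
  then have "c powr p = enn2real J" using p by (auto simp: powr_powr)
  then show ?thesis using J by (simp add: J_def[symmetric] less_top)
qed

locale subcritical =
  fixes n :: "'n::finite itself" and \<alpha> p :: real
  assumes \<alpha>: "0 < \<alpha>" "2 * \<alpha> < real CARD('n)" and pN: "real CARD('n) / (real CARD('n) - \<alpha>) < p"
begin

abbreviation S :: "(complex ^ 'n) measure" where "S \<equiv> surf"

definition p' :: real where "p' = p / (p - 1)"

lemma p1: "1 < p" using subcritical_exponent[OF \<alpha> pN] by simp
lemma p0: "0 < p" using p1 by simp
lemma p'1: "1 < p'" using p1 by (simp add: p'_def less_divide_eq)
lemma p'0: "0 < p'" using p'1 by simp
lemma pp': "1 / p + 1 / p' = 1" using p1 by (simp add: p'_def field_simps)
lemma pp'2: "(p' - 1) * p = p'" "(p - 1) * p' = p" using p1 by (auto simp: p'_def field_simps)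

definition unit_ball :: "(complex ^ 'n \<Rightarrow> real) set" where
  "unit_ball = {f. Lr p f \<and> (\<integral>x. \<bar>f x\<bar> powr p \<partial>S) \<le> 1}"

lemma normalise:
  assumes f: "Lr p f" and c: "0 < c" "(\<integral>x. \<bar>f x\<bar> powr p \<partial>S) \<le> c"
  shows "(\<lambda>x. c powr (- (1 / p)) * f x) \<in> unit_ball"
proof -
  have "(\<integral>x. \<bar>c powr (- (1 / p)) * f x\<bar> powr p \<partial>S) = (\<integral>x. inverse c * \<bar>f x\<bar> powr p \<partial>S)"
  proof -
    have "(c powr (- (1 / p))) powr p = inverse c" using c p0 by (simp add: powr_powr powr_neg_one inverse_eq_divide)
    then show ?thesis by (simp add: abs_mult powr_mult)
  qed
  also have "\<dots> \<le> inverse c * c" unfolding integral_mult_right_zero using c by (intro mult_left_mono) auto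
  finally show ?thesis using c Lr_scale[OF f p0] by (simp add: unit_ball_def)
qed

definition Bil :: "(complex ^ 'n \<Rightarrow> real) \<Rightarrow> (complex ^ 'n \<Rightarrow> real) \<Rightarrow> real" where
  "Bil f g = (\<integral>z. f (fst z) * g (snd z) * kern \<alpha> (hp (fst z) (snd z)) \<partial>sph2)"

lemma Bil_kform: "Bil f f = kform (kern \<alpha>) f"
  by (simp add: Bil_def kform_def)

definition bilbound :: real where
  "bilbound = (kbound TYPE('n) (\<alpha> * yr p) + 1) powr (1 / yr p) * ybound TYPE('n)"

lemma measurable_pair_product:
  fixes f g :: "complex ^ 'n \<Rightarrow> real"
  assumes "f \<in> borel_measurable S" "g \<in> borel_measurable S"
  shows "(\<lambda>z. f (fst z) * g (snd z)) \<in> borel_measurable sph2"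
  by (intro borel_measurable_times measurable_compose[OF measurable_fst assms(1)] measurable_compose[OF measurable_snd assms(2)])

lemma unit_ball_nn:
  assumes f: "f \<in> unit_ball" and g: "g \<in> unit_ball"
  shows "(\<integral>\<^sup>+z. ennreal (\<bar>f (fst z) * g (snd z)\<bar> * kern \<alpha> (hp (fst z) (snd z))) \<partial>sph2) \<le> ennreal bilbound"
  unfolding bilbound_def
proof (rule young_nn_integral)
  note sub = subcritical_exponent[OF \<alpha> pN]
  show "1 < yq p" by (rule sub)
  show "Lr p f" "Lr p g" "(\<integral>x. \<bar>f x\<bar> powr p \<partial>S) \<le> 1" "(\<integral>x. \<bar>g x\<bar> powr p \<partial>S) \<le> 1" using f g by (auto simp: unit_ball_def)
  have \<beta>: "0 < \<alpha> * yr p" "2 * (\<alpha> * yr p) < real CARD('n)" using sub \<alpha> by auto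
  show "0 < kbound TYPE('n) (\<alpha> * yr p) + 1" using kbound_nonneg[OF \<beta>] by simp
  show "(\<integral>\<^sup>+ y. ennreal (kern \<alpha> (hp x y) powr yr p) \<partial>S) \<le> ennreal (kbound TYPE('n) (\<alpha> * yr p) + 1)"
    if "norm x = 1" for x
    unfolding kern_powr by (rule order_trans[OF kern_nn_integral[OF \<beta> that]]) (rule ennreal_leI, simp)
  show "kern \<alpha> \<in> borel_measurable borel" by measurable
qed (auto simp: kern_cnj)

lemma integrable_unit_ball:
  assumes f: "f \<in> unit_ball" and g: "g \<in> unit_ball"
  shows "integrable sph2 (\<lambda>z. f (fst z) * g (snd z) * kern \<alpha> (hp (fst z) (snd z)))" "\<bar>Bil f g\<bar> \<le> bilbound"
proof -
  have b0: "0 \<le> bilbound" unfolding bilbound_def using ybound_pos[where 'n='n] by simp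
  have m[measurable]: "(\<lambda>z. f (fst z) * g (snd z)) \<in> borel_measurable sph2"
    using f g by (intro measurable_pair_product) (auto simp: unit_ball_def Lr_def)
  have e: "ennreal (norm (f (fst z) * g (snd z) * kern \<alpha> (hp (fst z) (snd z)))) = ennreal (\<bar>f (fst z) * g (snd z)\<bar> * kern \<alpha> (hp (fst z) (snd z)))" for z
    by (simp add: abs_mult)
  have fin: "(\<integral>\<^sup>+z. ennreal (norm (f (fst z) * g (snd z) * kern \<alpha> (hp (fst z) (snd z)))) \<partial>sph2) \<le> ennreal bilbound"
    unfolding e by (rule unit_ball_nn[OF f g])
  show i: "integrable sph2 (\<lambda>z. f (fst z) * g (snd z) * kern \<alpha> (hp (fst z) (snd z)))"
    by (rule integrableI_bounded) (measurable, rule le_less_trans[OF fin], simp)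
  have "ennreal \<bar>Bil f g\<bar> \<le> ennreal bilbound"
    unfolding Bil_def using integral_norm_bound_ennreal[OF i] fin by simp
  then show "\<bar>Bil f g\<bar> \<le> bilbound" using b0 by simp
qed

lemma integrable_Bil:
  fixes f g :: "complex ^ 'n \<Rightarrow> real"
  assumes f: "Lr p f" and g: "Lr p g"
  shows "integrable sph2 (\<lambda>z. f (fst z) * g (snd z) * kern \<alpha> (hp (fst z) (snd z)))"
proof -
  define a where "a h = (\<integral>x. \<bar>h x\<bar> powr p \<partial>S) + 1" for h :: "complex ^ 'n \<Rightarrow> real"
  have a: "a h > 0" "(\<integral>x. \<bar>h x\<bar> powr p \<partial>S) \<le> a h" for h by (auto simp: a_def intro: add_nonneg_pos)
  define c where "c h = a h powr (- (1 / p))" for h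
  have c: "c h > 0" for h using a(1)[of h] by (simp add: c_def)
  from integrable_unit_ball(1)[OF normalise[OF f a[of f]] normalise[OF g a[of g]]]
  have i: "integrable sph2 (\<lambda>z. (c f * c g) * (f (fst z) * g (snd z) * kern \<alpha> (hp (fst z) (snd z))))"
    by (simp add: c_def mult_ac)
  have "inverse (c f * c g) * ((c f * c g) * x) = x" for x
    using c[of f] c[of g] by (simp add: field_simps)
  then show ?thesis using integrable_mult_right[OF i, of "inverse (c f * c g)"] by (simp only:)
qed

lemma Bil_commute:
  assumes f: "Lr p f" and g: "Lr p g"
  shows "Bil f g = Bil g f"
proof -
  have "Bil g f = (\<integral>(x, y). (\<lambda>z. g (fst z) * f (snd z) * kern \<alpha> (hp (fst z) (snd z))) (y, x) \<partial>sph2)"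
    unfolding Bil_def by (rule sph_pair.integral_product_swap[symmetric])
      (rule borel_measurable_integrable[OF integrable_Bil[OF g f]])
  also have "\<dots> = Bil f g"
  proof -
    have "kern \<alpha> (hp y x) = kern \<alpha> (hp x y)" for x y :: "complex ^ 'n" using kern_cnj[of \<alpha> "hp x y"] by (simp add: cnj_hp)
    then show ?thesis by (simp add: Bil_def case_prod_unfold mult.commute)
  qed
  finally show ?thesis ..
qed

lemma Bil_add:
  assumes "Lr p f" "Lr p g" "Lr p h"
  shows "Bil (\<lambda>x. f x + g x) h = Bil f h + Bil g h" "Bil h (\<lambda>x. f x + g x) = Bil h f + Bil h g"
  unfolding Bil_def
  using Bochner_Integration.integral_add[OF integrable_Bil[OF assms(1,3)] integrable_Bil[OF assms(2,3)]]
    Bochner_Integration.integral_add[OF integrable_Bil[OF assms(3,1)] integrable_Bil[OF assms(3,2)]]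
  by (simp_all add: distrib_right distrib_left)

lemma Bil_scale: "Bil (\<lambda>x. c * f x) h = c * Bil f h" "Bil h (\<lambda>x. c * f x) = c * Bil h f"
  unfolding Bil_def integral_mult_right_zero[symmetric] by (simp_all add: mult_ac)

lemma Bil_diff:
  assumes "Lr p f" "Lr p g" "Lr p h"
  shows "Bil (\<lambda>x. f x - g x) h = Bil f h - Bil g h" "Bil h (\<lambda>x. f x - g x) = Bil h f - Bil h g"
  using Bil_add[OF assms(1) Lr_scale[OF assms(2) p0, of "-1"] assms(3)]
    Bil_scale[where c="-1" and f=g and h=h]
  by simp_all

lemma Bil_self_nonneg: "Lr p f \<Longrightarrow> 0 \<le> Bil f f"
  unfolding Bil_kform
  by (rule kform_kern_nonneg[OF Lr_integrable(1) \<alpha>(1) integrable_Bil]) (use p1 in auto)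

lemma Bil_quadratic:
  assumes f: "Lr p f" and g: "Lr p g"
  shows "Bil (\<lambda>x. f x + t * g x) (\<lambda>x. f x + t * g x) = Bil f f + 2 * t * Bil f g + t\<^sup>2 * Bil g g"
  using Bil_add[OF f Lr_scale[OF g p0, of t]] Lr_add[OF f Lr_scale[OF g p0, of t] p0] Bil_scale[where c=t and f=g] f g
    Bil_commute[OF f g]
  by (simp add: Lr_scale[OF g p0] power2_eq_square algebra_simps)

text \<open>Cauchy-Schwarz for the positive form, with a parameter in place of the square roots.\<close>
lemma Bil_le:
  assumes f: "Lr p f" and g: "Lr p g" and t: "0 < t"
  shows "2 * \<bar>Bil f g\<bar> \<le> t * Bil f f + Bil g g / t"
proof -
  have "0 \<le> Bil f f + 2 * s * Bil f g + s\<^sup>2 * Bil g g" for s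
    unfolding Bil_quadratic[OF f g, symmetric] by (intro Bil_self_nonneg Lr_add f Lr_scale g p0)
  from this[of "1 / t"] this[of "- (1 / t)"] have "2 / t * \<bar>Bil f g\<bar> \<le> Bil f f + Bil g g / t\<^sup>2"
    by (auto simp: abs_if power_divide)
  then have "t * (2 / t * \<bar>Bil f g\<bar>) \<le> t * (Bil f f + Bil g g / t\<^sup>2)" using t by (intro mult_left_mono) auto
  then show ?thesis using t by (simp add: distrib_left power2_eq_square)
qed

lemma Bil_abs_le:
  assumes f: "Lr p f" and g: "Lr p g"
  shows "\<bar>Bil f g\<bar> \<le> Bil (\<lambda>x. \<bar>f x\<bar>) (\<lambda>x. \<bar>g x\<bar>)"
  unfolding Bil_def using integral_abs_bound[of sph2 "\<lambda>z. f (fst z) * g (snd z) * kern \<alpha> (hp (fst z) (snd z))"]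
  by (simp add: abs_mult)

definition Lam :: real where "Lam = (SUP f\<in>unit_ball. Bil f f)"

lemma bdd: "bdd_above ((\<lambda>f. Bil f f) ` unit_ball)"
  using integrable_unit_ball(2) by (intro bdd_aboveI2[where M=bilbound]) (auto simp: abs_le_iff)

lemma Bil_le_Lam: "f \<in> unit_ball \<Longrightarrow> Bil f f \<le> Lam"
  unfolding Lam_def by (rule cSUP_upper[OF _ bdd])

lemma Bil_le_Lam_scaled:
  assumes f: "Lr p f" and c: "0 < c" "(\<integral>x. \<bar>f x\<bar> powr p \<partial>S) \<le> c"
  shows "Bil f f \<le> Lam * c powr (2 / p)"
proof -
  have "c powr (- (1 / p)) * (c powr (- (1 / p)) * Bil f f) \<le> Lam"
    using Bil_le_Lam[OF normalise[OF f c]] by (simp add: Bil_scale)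
  then have "c powr (1 / p) * c powr (1 / p) * (c powr (- (1 / p)) * (c powr (- (1 / p)) * Bil f f)) \<le> c powr (1 / p) * c powr (1 / p) * Lam"
    by (intro mult_left_mono) auto
  moreover have "x * x * (inverse x * (inverse x * B)) = B" if "x \<noteq> 0" for x B :: real using that by (simp add: field_simps)
  ultimately have "Bil f f \<le> c powr (1 / p) * c powr (1 / p) * Lam" using c by (simp only: powr_minus) simp
  also have "c powr (1 / p) * c powr (1 / p) = c powr (2 / p)" by (simp flip: powr_add)
  finally show ?thesis by (simp add: mult.commute)
qed

lemma Bil_le_Lam2: "f \<in> unit_ball \<Longrightarrow> g \<in> unit_ball \<Longrightarrow> Bil f g \<le> Lam"
  using Bil_le[of f g 1] Bil_le_Lam[of f] Bil_le_Lam[of g] by (auto simp: unit_ball_def)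

lemma Lam_ge_const: "c\<^sup>2 * Bil (\<lambda>_. 1) (\<lambda>_. 1) \<le> Lam" if "c = smom TYPE('n) 0 powr (- (1 / p))"
proof -
  have 1: "Lr p (\<lambda>_ :: complex ^ 'n. 1)" by (simp add: Lr_def)
  have "(\<lambda>x. c * 1) \<in> unit_ball" unfolding that
    by (rule normalise[OF 1 smom_pos]) (simp add: smom_0)
  from Bil_le_Lam[OF this] Bil_scale[where c=c and f="\<lambda>_. 1"] show ?thesis by (simp add: power2_eq_square mult.assoc)
qed

lemma Bil_one_pos: "0 < Bil (\<lambda>_. 1) (\<lambda>_. 1)"
proof -
  have 1: "Lr p (\<lambda>_ :: complex ^ 'n. 1)" by (simp add: Lr_def)
  have i: "integrable sph2 (\<lambda>z. kern \<alpha> (hp (fst z) (snd z :: complex ^ 'n)))" using integrable_Bil[OF 1 1] by simp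
  have "Bil (\<lambda>_. 1) (\<lambda>_. 1) = (\<integral>z. kern \<alpha> (hp (fst z) (snd z :: complex ^ 'n)) \<partial>sph2)" by (simp add: Bil_def)
  also have "\<dots> \<ge> (\<integral>z. 2 powr (- (2 * \<alpha>)) \<partial>(sph2 :: ((complex ^ 'n) \<times> (complex ^ 'n)) measure))"
  proof (rule integral_mono_AE[OF _ i])
    show "integrable (sph2 :: ((complex ^ 'n) \<times> (complex ^ 'n)) measure) (\<lambda>z. 2 powr (- (2 * \<alpha>)))"
      by (rule finite_measure.integrable_const[OF finite_measure_sph2])
    show "AE z in (sph2 :: ((complex ^ 'n) \<times> (complex ^ 'n)) measure). 2 powr (- (2 * \<alpha>)) \<le> kern \<alpha> (hp (fst z) (snd z))"
      using AE_hp_neq_1 AE_space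
    proof eventually_elim
      case (elim z)
      have "cmod (1 - hp (fst z) (snd z)) \<le> cmod 1 + cmod (hp (fst z) (snd z))" by (rule norm_triangle_ineq4)
      also have "\<dots> \<le> 1 + 1" using space_sph2[OF elim(2)] norm_hp_le_1[of "fst z" "snd z"] by simp
      finally show ?case unfolding kern_def using elim(1) \<alpha> by (intro powr_mono2') auto
    qed
  qed
  moreover have "(\<integral>z. 2 powr (- (2 * \<alpha>)) \<partial>(sph2 :: ((complex ^ 'n) \<times> (complex ^ 'n)) measure)) > 0"
  proof -
    have "(\<integral>z. (\<lambda>_. 1 :: real) (fst z) * (\<lambda>_. 1) (snd z) \<partial>(sph2 :: ((complex ^ 'n) \<times> (complex ^ 'n)) measure)) = smom TYPE('n) 0 * smom TYPE('n) 0"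
      by (subst integrable_product(2)[OF sph_pair.pair_sigma_finite_axioms]) (auto simp: smom_0)
    then have "(\<integral>z. 2 powr (- (2 * \<alpha>)) * 1 \<partial>(sph2 :: ((complex ^ 'n) \<times> (complex ^ 'n)) measure)) = 2 powr (- (2 * \<alpha>)) * (smom TYPE('n) 0 * smom TYPE('n) 0)"
      unfolding integral_mult_right_zero by simp
    then show ?thesis using smom_pos[of 0, where 'n='n] by simp
  qed
  ultimately show ?thesis by linarith
qed

lemma Lam_pos: "0 < Lam"
proof -
  have "0 < (smom TYPE('n) 0 powr (- (1 / p)))\<^sup>2 * Bil (\<lambda>_. 1) (\<lambda>_. 1)"
    using smom_pos[of 0, where 'n='n] by (intro mult_pos_pos Bil_one_pos) auto
  then show ?thesis using Lam_ge_const[OF refl] by linarith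
qed

definition Iop :: "(complex ^ 'n \<Rightarrow> real) \<Rightarrow> complex ^ 'n \<Rightarrow> real" where
  "Iop f x = (\<integral>y. f y * kern \<alpha> (hp x y) \<partial>S)"

lemma measurable_Iop:
  assumes "f \<in> borel_measurable S" shows "Iop f \<in> borel_measurable S"
proof -
  have [measurable]: "(\<lambda>p. f (snd p)) \<in> borel_measurable sph2" by (rule measurable_compose[OF measurable_snd assms])
  have "(\<lambda>(x, y). f y * kern \<alpha> (hp x y)) \<in> borel_measurable (S \<Otimes>\<^sub>M S)"
    unfolding case_prod_unfold by measurable
  from sph.borel_measurable_lebesgue_integral[OF this] show ?thesis unfolding Iop_def[abs_def] .
qed

lemma Bil_Iop:
  assumes f: "Lr p f" and g: "Lr p g"
  shows "integrable S (\<lambda>x. g x * Iop f x)" "Bil f g = (\<integral>x. g x * Iop f x \<partial>S)"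
proof -
  have e: "(\<integral>y. g x * f y * kern \<alpha> (hp x y) \<partial>S) = g x * Iop f x" for x
    unfolding Iop_def integral_mult_right_zero[symmetric] by (simp add: mult.assoc)
  note i = integrable_Bil[OF g f]
  show "integrable S (\<lambda>x. g x * Iop f x)" using sph_pair.integrable_fst'[OF i] by (simp add: e)
  show "Bil f g = (\<integral>x. g x * Iop f x \<partial>S)"
    unfolding Bil_commute[OF f g] using sph_pair.integral_fst'[OF i] by (simp add: e Bil_def)
qed

lemma Iop_nonneg: "(\<And>x. norm x = 1 \<Longrightarrow> 0 \<le> f x) \<Longrightarrow> 0 \<le> Iop f x"
  unfolding Iop_def by (intro integral_nonneg_AE AE_I2) auto

text \<open>Test against the dual function of \<open>Iop f\<close>. Truncation makes this function admissible before \<open>Iop f\<close> is known to lie in \<open>L\<^bsup>p'\<^esup>\<close>, and monotone convergence removes the truncation.\<close>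
lemma Iop_bound:
  assumes f: "f \<in> unit_ball" and f0: "\<And>x. norm x = 1 \<Longrightarrow> 0 \<le> f x"
  shows "integrable S (\<lambda>x. Iop f x powr p')" "(\<integral>x. Iop f x powr p' \<partial>S) \<le> Lam powr p'"
proof -
  have fL: "Lr p f" using f by (simp add: unit_ball_def)
  define v where "v = Iop f"
  have v0: "0 \<le> v x" for x unfolding v_def by (rule Iop_nonneg[OF f0])
  have vm[measurable]: "v \<in> borel_measurable S" unfolding v_def by (rule measurable_Iop[OF Lr_measurable[OF fL]])
  have trunc: "(\<integral>x. min (v x) (real i) powr p' \<partial>S) \<le> Lam powr p'" for i :: nat
  proof -
    define w where "w x = min (v x) (real i)" for x
    have w0: "0 \<le> w x" "w x \<le> v x" "w x \<le> i" for x using v0[of x] by (auto simp: w_def)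
    have [measurable]: "w \<in> borel_measurable S" unfolding w_def[abs_def] by measurable
    define J where "J = (\<integral>x. w x powr p' \<partial>S)"
    have J0: "0 \<le> J" by (simp add: J_def)
    have "J \<le> Lam powr p'"
    proof (cases "J = 0")
      case False
      then have J: "0 < J" using J0 by simp
      define g where "g x = w x powr (p' - 1)" for x
      have gL: "Lr p g"
      proof (rule Lr_bounded[OF _ _ p0])
        show "g \<in> borel_measurable S" unfolding g_def[abs_def] by measurable
        show "\<bar>g x\<bar> \<le> real i powr (p' - 1)" for x unfolding g_def using w0[of x] p'1 by (auto intro: powr_mono2)
      qed
      have gp: "(\<integral>x. \<bar>g x\<bar> powr p \<partial>S) = J"
        unfolding J_def g_def by (simp add: powr_powr pp'2)
      have "J \<le> (\<integral>x. g x * v x \<partial>S)"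
        unfolding J_def
      proof (rule integral_mono_AE)
        show "integrable S (\<lambda>x. w x powr p')"
          using Lr_bounded[of w "real i" p'] w0 p'0 by (auto simp: Lr_def)
        show "integrable S (\<lambda>x. g x * v x)" unfolding v_def by (rule Bil_Iop(1)[OF fL gL])
        show "AE x in S. w x powr p' \<le> g x * v x"
        proof (rule AE_I2)
          fix x
          have "w x powr p' = w x powr (p' - 1 + 1)" by simp
          also have "\<dots> = w x powr (p' - 1) * w x powr 1" by (rule powr_add)
          also have "\<dots> = w x powr (p' - 1) * w x" using w0[of x] by simp
          also have "\<dots> \<le> g x * v x" unfolding g_def using w0[of x] by (intro mult_left_mono) auto
          finally show "w x powr p' \<le> g x * v x" .
        qed
      qed
      also have "\<dots> = Bil f g" unfolding v_def by (rule Bil_Iop(2)[OF fL gL, symmetric])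
      finally have "J powr (- (1 / p)) * J \<le> J powr (- (1 / p)) * Bil f g" by (intro mult_left_mono) auto
      also have "\<dots> = Bil f (\<lambda>x. J powr (- (1 / p)) * g x)" by (simp add: Bil_scale)
      also have "\<dots> \<le> Lam" by (intro Bil_le_Lam2 f normalise gL J) (simp add: gp)
      finally have "J powr (- (1 / p)) * J powr 1 \<le> Lam" using J by simp
      moreover have "- (1 / p) + 1 = 1 / p'" using pp' by simp
      ultimately have "J powr (1 / p') \<le> Lam" by (simp only: powr_add[symmetric])
      then have "(J powr (1 / p')) powr p' \<le> Lam powr p'" using p'0 by (intro powr_mono2) auto
      then show ?thesis using J p'0 by (simp add: powr_powr)
    qed simp
    then show ?thesis by (simp add: J_def w_def)
  qed
  have nn: "(\<integral>\<^sup>+x. ennreal (v x powr p') \<partial>S) \<le> ennreal (Lam powr p')"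
  proof -
    have "(\<integral>\<^sup>+x. ennreal (v x powr p') \<partial>S) \<le> (\<integral>\<^sup>+x. liminf (\<lambda>i. ennreal (min (v x) (real i) powr p')) \<partial>S)"
    proof (rule nn_integral_mono)
      fix x
      obtain i0 :: nat where "v x \<le> real i0" using real_arch_simple by blast
      then have "eventually (\<lambda>i. min (v x) (real i) powr p' = v x powr p') sequentially"
        by (intro eventually_sequentiallyI[of i0]) (auto simp: min_def)
      then have "(\<lambda>i. ennreal (min (v x) (real i) powr p')) \<longlonglongrightarrow> ennreal (v x powr p')"
        by (intro tendsto_ennrealI tendsto_eventually)
      from lim_imp_Liminf[OF _ this] show "ennreal (v x powr p') \<le> liminf (\<lambda>i. ennreal (min (v x) (real i) powr p'))" by simp
    qed
    also have "\<dots> \<le> liminf (\<lambda>i. (\<integral>\<^sup>+x. ennreal (min (v x) (real i) powr p') \<partial>S))"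
      by (rule nn_integral_liminf) measurable
    also have "\<dots> \<le> liminf (\<lambda>i::nat. ennreal (Lam powr p'))"
    proof (intro Liminf_mono always_eventually allI)
      fix i :: nat
      have "Lr p' (\<lambda>x. min (v x) (real i))"
        by (rule Lr_bounded[where B="real i"]) (use v0 p'0 in auto)
      then have "integrable S (\<lambda>x. min (v x) (real i) powr p')" using v0 by (auto simp: Lr_def)
      then show "(\<integral>\<^sup>+x. ennreal (min (v x) (real i) powr p') \<partial>S) \<le> ennreal (Lam powr p')"
        using trunc[of i] by (subst nn_integral_eq_integral) (auto intro: ennreal_leI)
    qed
    finally show ?thesis by (simp add: Liminf_const)
  qed
  show i: "integrable S (\<lambda>x. Iop f x powr p')"
    unfolding v_def[symmetric] by (rule integrableI_nonneg) (use nn in \<open>auto intro: le_less_trans\<close>)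
  show "(\<integral>x. Iop f x powr p' \<partial>S) \<le> Lam powr p'"
    using nn unfolding nn_integral_eq_integral[OF i[folded v_def] AE_I2[OF powr_ge_zero]] by (simp add: v_def)
qed

text \<open>Young's inequality, integrated.\<close>
lemma holder:
  assumes f: "f \<in> unit_ball" "\<And>x. norm x = 1 \<Longrightarrow> 0 \<le> f x" and v: "\<And>x. 0 \<le> v x" "integrable S (\<lambda>x. v x powr p')"
    and s: "0 < s" "(\<integral>x. v x powr p' \<partial>S) \<le> s powr p'" and i: "integrable S (\<lambda>x. f x * v x)"
  shows "(\<integral>x. f x * v x \<partial>S) \<le> s"
proof -
  have fp: "integrable S (\<lambda>x. \<bar>f x\<bar> powr p)" "(\<integral>x. \<bar>f x\<bar> powr p \<partial>S) \<le> 1" using f(1) by (auto simp: unit_ball_def Lr_def)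
  have "(\<integral>x. f x * (v x / s) \<partial>S) \<le> (\<integral>x. \<bar>f x\<bar> powr p / p + v x powr p' / s powr p' / p' \<partial>S)"
  proof (rule integral_mono)
    show "integrable S (\<lambda>x. f x * (v x / s))" using i by simp
    show "integrable S (\<lambda>x. \<bar>f x\<bar> powr p / p + v x powr p' / s powr p' / p')" using fp v(2) by simp
    fix x assume "x \<in> space S"
    then have "0 \<le> f x" using f(2) by simp
    then show "f x * (v x / s) \<le> \<bar>f x\<bar> powr p / p + v x powr p' / s powr p' / p'"
      using Youngs_inequality[OF p1 p'1 pp', of "f x" "v x / s"] v(1)[of x] s by (simp add: powr_divide)
  qed
  also have "\<dots> = (\<integral>x. \<bar>f x\<bar> powr p \<partial>S) / p + (\<integral>x. v x powr p' \<partial>S) / s powr p' / p'"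
    using fp v(2) by simp
  also have "\<dots> \<le> 1 / p + 1 / p'"
    using fp s p0 p'0 by (intro add_mono divide_right_mono) (auto simp: divide_le_eq)
  finally have "(\<integral>x. f x * v x \<partial>S) / s \<le> 1" using pp' by simp
  then show ?thesis using s by (simp add: divide_le_eq)
qed

end

section \<open>The supremum as a maximal energy\<close>

context subcritical
begin

lemma I_op_real:
  fixes f :: "complex ^ 'n \<Rightarrow> real"
  shows "I_op (4 * \<alpha>) f x = Iop f x"
proof -
  have "f y /\<^sub>R (cmod (1 - hp x y) powr (4 * \<alpha> / 2)) = f y * kern \<alpha> (hp x y)" for y
    by (simp add: kern_def powr_minus mult.commute)
  then show ?thesis unfolding I_op_def Iop_def by (simp only:)
qed

lemma I_op_of_real:
  fixes f :: "complex ^ 'n \<Rightarrow> real"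
  shows "I_op (4 * \<alpha>) (\<lambda>x. complex_of_real (f x)) x = of_real (Iop f x)"
proof -
  have "complex_of_real (f y) /\<^sub>R (cmod (1 - hp x y) powr (4 * \<alpha> / 2)) = of_real (f y * kern \<alpha> (hp x y))" for y
    by (simp add: kern_def powr_minus mult.commute scaleR_conv_of_real)
  then show ?thesis unfolding I_op_def Iop_def by (simp only: integral_complex_of_real)
qed

lemma norm_I_op_le:
  fixes f :: "complex ^ 'n \<Rightarrow> complex"
  shows "cmod (I_op (4 * \<alpha>) f x) \<le> Iop (\<lambda>y. cmod (f y)) x"
proof -
  have "cmod (I_op (4 * \<alpha>) f x) \<le> (\<integral>y. cmod (f y /\<^sub>R (cmod (1 - hp x y) powr (4 * \<alpha> / 2))) \<partial>S)"
    unfolding I_op_def by (rule integral_norm_bound)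
  also have "\<dots> = Iop (\<lambda>y. cmod (f y)) x"
    unfolding Iop_def by (simp add: kern_def powr_minus mult.commute)
  finally show ?thesis .
qed

lemma nn_Iop_le:
  assumes f: "f \<in> unit_ball" and f0: "\<And>x. norm x = 1 \<Longrightarrow> 0 \<le> f x"
  shows "(\<integral>\<^sup>+x. ennreal (Iop f x powr p') \<partial>S) \<le> ennreal (Lam powr p')"
  using Iop_bound[OF assms] by (subst nn_integral_eq_integral) (auto intro: ennreal_leI)

lemma Bil_nonpos_of_null:
  assumes f: "Lr p f" and z: "(\<integral>x. \<bar>f x\<bar> powr p \<partial>S) = 0"
  shows "Bil f f \<le> 0"
proof (rule ccontr)
  assume "\<not> ?thesis"
  then have b: "0 < Bil f f" by simp
  define c where "c = (Bil f f / (2 * Lam)) powr (p / 2)"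
  have c: "0 < c" using b Lam_pos by (simp add: c_def)
  have "Bil f f \<le> Lam * c powr (2 / p)" by (rule Bil_le_Lam_scaled[OF f c]) (use z c in simp)
  also have "c powr (2 / p) = Bil f f / (2 * Lam)" unfolding c_def using b Lam_pos p0 by (simp add: powr_powr)
  finally show False using b Lam_pos by simp
qed

lemma Bil_le_Iop_norm:
  assumes f: "f \<in> unit_ball" and f0: "\<And>x. norm x = 1 \<Longrightarrow> 0 \<le> f x"
  shows "Bil f f \<le> (\<integral>x. Iop f x powr p' \<partial>S) powr (1 / p')"
proof -
  have fL: "Lr p f" using f by (simp add: unit_ball_def)
  define V where "V = (\<integral>x. Iop f x powr p' \<partial>S)"
  have V0: "0 \<le> V" by (simp add: V_def)
  have le: "Bil f f \<le> s" if s: "0 < s" "V \<le> s powr p'" for s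
    unfolding Bil_Iop(2)[OF fL fL]
    by (rule holder[OF f f0 Iop_nonneg[OF f0] Iop_bound(1)[OF f f0] s(1) s(2)[unfolded V_def] Bil_Iop(1)[OF fL fL]])
  show ?thesis
  proof (cases "V = 0")
    case True
    have "Bil f f \<le> 0"
    proof (rule field_le_epsilon)
      fix e :: real assume "0 < e"
      then show "Bil f f \<le> 0 + e" using le[of e] True by simp
    qed
    then show ?thesis using True by (simp add: V_def[symmetric])
  next
    case False
    then show ?thesis using le[of "V powr (1 / p')"] V0 p'0 by (simp add: powr_powr V_def[symmetric])
  qed
qed

lemma Lp_norm_Iop:
  assumes f: "f \<in> unit_ball" and f0: "\<And>x. norm x = 1 \<Longrightarrow> 0 \<le> f x"
  shows "Lp_norm S p' (Iop f) = ennreal ((\<integral>x. Iop f x powr p' \<partial>S) powr (1 / p'))"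
proof (rule Lp_norm_eqI[OF p'0])
  have "(\<integral>\<^sup>+x. ennreal (Iop f x powr p') \<partial>S) = ennreal (\<integral>x. Iop f x powr p' \<partial>S)"
    by (rule nn_integral_eq_integral[OF Iop_bound(1)[OF assms]]) auto
  then show "(\<integral>\<^sup>+x. ennreal (norm (Iop f x) powr p') \<partial>S) = ennreal (((\<integral>x. Iop f x powr p' \<partial>S) powr (1 / p')) powr p')"
    using p'0 Iop_nonneg[OF f0] by (simp add: powr_powr)
qed simp

text \<open>The bound from above is \<open>Iop_bound\<close> for \<open>\<bar>f\<bar>\<close>; the bound from below is Holder applied to \<open>E(f) = \<integral> f I f\<close>.\<close>
theorem I_sup_eq: "I_sup TYPE('n) (4 * \<alpha>) p = ennreal Lam"
proof -
  have upper: "I_sup TYPE('n) (4 * \<alpha>) p \<le> ennreal Lam"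
    unfolding I_sup_def
  proof (rule SUP_least)
    fix f :: "complex ^ 'n \<Rightarrow> complex"
    assume "f \<in> {f \<in> Lp_space surf p. Lp_norm surf p f = 1}"
    then have fm[measurable]: "f \<in> borel_measurable S" and fn: "Lp_norm S p f = ennreal 1"
      by (auto simp: Lp_space_def)
    have nn: "(\<integral>\<^sup>+x. ennreal (cmod (f x) powr p) \<partial>S) = 1"
      using Lp_norm_eqD[OF p0 _ fn] by simp
    have i: "integrable S (\<lambda>x. cmod (f x) powr p)"
      by (rule integrableI_nonneg) (use nn in auto)
    have F: "(\<lambda>x. cmod (f x)) \<in> unit_ball"
      using nn nn_integral_eq_integral[OF i] i by (auto simp: unit_ball_def Lr_def)
    have "(\<integral>\<^sup>+x. ennreal (norm (I_op (4 * \<alpha>) f x) powr p') \<partial>S) \<le> (\<integral>\<^sup>+x. ennreal (Iop (\<lambda>y. cmod (f y)) x powr p') \<partial>S)"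
      using p'0 by (intro nn_integral_mono ennreal_leI powr_mono2 norm_I_op_le) auto
    also have "\<dots> \<le> ennreal (Lam powr p')" by (rule nn_Iop_le[OF F]) simp
    finally show "Lp_norm surf (p / (p - 1)) (I_op (4 * \<alpha>) f) \<le> ennreal Lam"
      unfolding p'_def[symmetric] using Lam_pos by (intro Lp_norm_le p'0) auto
  qed
  then obtain s where s: "I_sup TYPE('n) (4 * \<alpha>) p = ennreal s" "0 \<le> s"
    by (cases "I_sup TYPE('n) (4 * \<alpha>) p") (auto simp: top_unique)
  have "Lam \<le> s"
    unfolding Lam_def
  proof (rule cSUP_least)
    show "unit_ball \<noteq> {}"
    proof -
      have "(\<lambda>_. 0) \<in> unit_ball" by (simp add: unit_ball_def Lr_def)
      then show ?thesis by blast
    qed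
    fix f assume f: "f \<in> unit_ball"
    then have fL: "Lr p f" by (simp add: unit_ball_def)
    define a where "a = (\<integral>x. \<bar>f x\<bar> powr p \<partial>S)"
    have a: "0 \<le> a" "a \<le> 1" using f by (auto simp: a_def unit_ball_def)
    show "Bil f f \<le> s"
    proof (cases "a = 0")
      case True
      then show ?thesis using Bil_nonpos_of_null[OF fL] s(2) by (simp add: a_def)
    next
      case False
      then have a0: "0 < a" using a by simp
      define F where "F x = a powr (- (1 / p)) * \<bar>f x\<bar>" for x
      have F: "F \<in> unit_ball" unfolding F_def[abs_def] by (rule normalise[OF Lr_abs[OF fL] a0]) (simp add: a_def)
      have F0: "0 \<le> F x" for x by (simp add: F_def)
      have "(a powr (- (1 / p))) powr p = inverse a" using a0 p0 by (simp add: powr_powr powr_neg_one inverse_eq_divide)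
      then have F1: "(\<integral>x. \<bar>F x\<bar> powr p \<partial>S) = 1"
        using a0 by (simp add: F_def abs_mult powr_mult a_def[symmetric])
      have "1 \<le> a powr (- (1 / p))" using a a0 p0 by (simp add: powr_minus one_le_inverse_iff powr_le1)
      then have "1 * 1 \<le> a powr (- (1 / p)) * a powr (- (1 / p))" by (intro mult_mono) auto
      then have "1 * Bil (\<lambda>x. \<bar>f x\<bar>) (\<lambda>x. \<bar>f x\<bar>) \<le> (a powr (- (1 / p)) * a powr (- (1 / p))) * Bil (\<lambda>x. \<bar>f x\<bar>) (\<lambda>x. \<bar>f x\<bar>)"
        using Bil_self_nonneg[OF Lr_abs[OF fL]] by (intro mult_right_mono) auto
      also have "\<dots> = Bil F F" unfolding F_def by (simp add: Bil_scale)
      finally have "Bil f f \<le> Bil F F" using Bil_abs_le[OF fL fL] by (simp add: abs_le_iff)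
      also have "Bil F F \<le> (\<integral>x. Iop F x powr p' \<partial>S) powr (1 / p')" by (rule Bil_le_Iop_norm[OF F F0])
      also have "\<dots> \<le> s"
      proof -
        have Fm: "F \<in> borel_measurable S" using F by (simp add: unit_ball_def Lr_def)
        have "(\<integral>\<^sup>+x. ennreal (norm (complex_of_real (F x)) powr p) \<partial>S) = ennreal (1 powr p)"
        proof -
          have i: "integrable S (\<lambda>x. \<bar>F x\<bar> powr p)" using F by (simp add: unit_ball_def Lr_def)
          show ?thesis using nn_integral_eq_integral[OF i] F1 by simp
        qed
        then have 1: "Lp_norm S p (\<lambda>x. complex_of_real (F x)) = 1"
          using Lp_norm_eqI[OF p0, where c=1 and f="\<lambda>x. complex_of_real (F x)" and M=S] by simp
        have mem: "(\<lambda>x. complex_of_real (F x)) \<in> {f :: complex ^ 'n \<Rightarrow> complex. f \<in> Lp_space surf p \<and> Lp_norm surf p f = 1}"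
          using 1 Fm by (simp add: Lp_space_def)
        have "Lp_norm surf (p / (p - 1)) (I_op (4 * \<alpha>) (\<lambda>x. complex_of_real (F x))) \<le> ennreal s"
          unfolding s(1)[symmetric] I_sup_def by (rule SUP_upper[OF mem])
        moreover have "Lp_norm surf (p / (p - 1)) (I_op (4 * \<alpha>) (\<lambda>x. complex_of_real (F x))) = Lp_norm S p' (Iop F)"
          unfolding p'_def[symmetric] Lp_norm_def I_op_of_real by simp
        ultimately show ?thesis using s(2) by (simp add: Lp_norm_Iop[OF F F0])
      qed
      finally show ?thesis .
    qed
  qed
  then show ?thesis using upper s by (simp add: antisym)
qed

lemma nonneg_maximizerI:
  assumes u: "Lr p u" "\<And>x. 0 \<le> u x" "(\<integral>x. \<bar>u x\<bar> powr p \<partial>S) = 1" "Bil u u = Lam"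
  shows "nonneg_maximizer (4 * \<alpha>) p u"
  unfolding nonneg_maximizer_def
proof (intro conjI)
  have ub: "u \<in> unit_ball" using u by (simp add: unit_ball_def)
  have i: "integrable S (\<lambda>x. \<bar>u x\<bar> powr p)" using u by (simp add: Lr_def)
  have 1: "Lp_norm S p u = ennreal 1"
    by (rule Lp_norm_eqI[OF p0]) (use nn_integral_eq_integral[OF i] u(3) in auto)
  then show "Lp_norm surf p u = 1" by simp
  then show "u \<in> Lp_space surf p" using u by (simp add: Lp_space_def Lr_def)
  show "AE \<xi> in surf. 0 \<le> u \<xi>" using u(2) by simp
  define V where "V = (\<integral>x. Iop u x powr p' \<partial>S)"
  have "V powr (1 / p') \<le> (Lam powr p') powr (1 / p')"
    using Iop_bound(2)[OF ub u(2)] p'0 by (intro powr_mono2) (auto simp: V_def)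
  also have "\<dots> = Lam" using p'0 Lam_pos by (simp add: powr_powr)
  finally have "V powr (1 / p') \<le> Lam" .
  moreover have "Lam \<le> V powr (1 / p')" using Bil_le_Iop_norm[OF ub u(2)] u(4) by (simp add: V_def)
  ultimately have "V powr (1 / p') = Lam" by simp
  then have "Lp_norm S p' (Iop u) = ennreal Lam" using Lp_norm_Iop[OF ub u(2)] by (simp add: V_def)
  then show "Lp_norm surf (p / (p - 1)) (I_op (4 * \<alpha>) u) = I_sup TYPE('n) (4 * \<alpha>) p"
    unfolding p'_def[symmetric] I_sup_eq Lp_norm_def I_op_real by simp
qed

text \<open>The extremal function of the duality between \<open>L\<^sup>p\<close> and \<open>L\<^sup>p\<^sup>'\<close>.\<close>
lemma dual_function:
  fixes v :: "complex ^ 'n \<Rightarrow> real"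
  assumes v0: "\<And>x. 0 \<le> v x" and vm[measurable]: "v \<in> borel_measurable S"
    and vi: "integrable S (\<lambda>x. v x powr p')" and V: "(\<integral>x. v x powr p' \<partial>S) = Lam powr p'"
  defines "g \<equiv> \<lambda>x. Lam powr (- (p' - 1)) * v x powr (p' - 1)"
  shows "Lr p g" "\<And>x. 0 \<le> g x" "(\<integral>x. \<bar>g x\<bar> powr p \<partial>S) = 1" "(\<integral>x. g x * v x \<partial>S) = Lam" "g \<in> unit_ball"
proof -
  define b where "b = Lam powr (- (p' - 1))"
  have b0: "0 \<le> b" by (simp add: b_def)
  have bp: "b powr p = Lam powr (- p')" unfolding b_def by (metis powr_powr minus_mult_left pp'2(1))
  have gp: "\<bar>g x\<bar> powr p = Lam powr (- p') * v x powr p'" for x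
  proof -
    have "\<bar>g x\<bar> = b * v x powr (p' - 1)" by (simp add: g_def b_def)
    then show ?thesis using b0 by (simp only: powr_mult powr_ge_zero bp powr_powr pp'2)
  qed
  show gL: "Lr p g"
    unfolding Lr_def gp using vi by (auto simp: g_def)
  show "0 \<le> g x" for x by (simp add: g_def)
  show g1: "(\<integral>x. \<bar>g x\<bar> powr p \<partial>S) = 1"
    using Lam_pos by (simp add: gp V powr_add[symmetric])
  show "g \<in> unit_ball" using gL g1 by (simp add: unit_ball_def)
  have "(\<integral>x. g x * v x \<partial>S) = (\<integral>x. b * v x powr p' \<partial>S)"
  proof (rule Bochner_Integration.integral_cong[OF refl])
    fix x
    have "v x powr p' = v x powr (p' - 1 + 1)" by simp
    also have "\<dots> = v x powr (p' - 1) * v x powr 1" by (rule powr_add)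
    finally show "g x * v x = b * v x powr p'" using v0[of x] by (simp add: g_def b_def)
  qed
  also have "\<dots> = b * Lam powr p'" by (simp add: V)
  also have "\<dots> = Lam powr (- (p' - 1) + p')" unfolding b_def powr_add ..
  also have "\<dots> = Lam" using Lam_pos by simp
  finally show "(\<integral>x. g x * v x \<partial>S) = Lam" .
qed

text \<open>The energy of \<open>u\<close> is read off by duality: the dual function of \<open>I u\<close> pairs with \<open>u\<close> to the value \<open>Lam\<close>. By Cauchy-Schwarz this is possible only if both have energy \<open>Lam\<close>.\<close>
lemma nonneg_maximizerD:
  assumes "nonneg_maximizer (4 * \<alpha>) p u"
  shows "Lr p u" "AE x in S. 0 \<le> u x" "(\<integral>x. \<bar>u x\<bar> powr p \<partial>S) = 1" "Bil u u = Lam"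
proof -
  have um[measurable]: "u \<in> borel_measurable S" and ae: "AE x in S. 0 \<le> u x" and n1: "Lp_norm S p u = ennreal 1"
    and mx: "Lp_norm S p' (I_op (4 * \<alpha>) u) = ennreal Lam"
    using assms by (auto simp: nonneg_maximizer_def Lp_space_def p'_def[symmetric] I_sup_eq)
  show "AE x in S. 0 \<le> u x" by (rule ae)
  have nn: "(\<integral>\<^sup>+x. ennreal (\<bar>u x\<bar> powr p) \<partial>S) = 1" using Lp_norm_eqD[OF p0 _ n1] by simp
  have i: "integrable S (\<lambda>x. \<bar>u x\<bar> powr p)"
    by (rule integrableI_nonneg) (use nn in auto)
  then show uL: "Lr p u" by (simp add: Lr_def)
  show u1: "(\<integral>x. \<bar>u x\<bar> powr p \<partial>S) = 1"
    using nn nn_integral_eq_integral[OF i] by (simp add: ennreal_eq_1)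
  define w where "w x = \<bar>u x\<bar>" for x
  have wm[measurable]: "w \<in> borel_measurable S" unfolding w_def[abs_def] by measurable
  have wL: "Lr p w" unfolding w_def[abs_def] by (rule Lr_abs[OF uL])
  have w0: "0 \<le> w x" for x by (simp add: w_def)
  have wub: "w \<in> unit_ball" using wL u1 by (simp add: unit_ball_def w_def)
  have uw: "AE x in S. u x = w x" using ae by eventually_elim (simp add: w_def)
  have Iuw: "Iop u x = Iop w x" for x
    unfolding Iop_def
  proof (rule integral_cong_AE)
    have [measurable]: "(\<lambda>y. kern \<alpha> (hp x y)) \<in> borel_measurable S"
      using measurable_sphere_borel by measurable
    show "(\<lambda>y. u y * kern \<alpha> (hp x y)) \<in> borel_measurable S" "(\<lambda>y. w y * kern \<alpha> (hp x y)) \<in> borel_measurable S" by measurable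
    show "AE y in S. u y * kern \<alpha> (hp x y) = w y * kern \<alpha> (hp x y)" using uw by eventually_elim simp
  qed
  define v where "v = Iop w"
  have v0: "0 \<le> v x" for x unfolding v_def by (rule Iop_nonneg) (rule w0)
  have [measurable]: "v \<in> borel_measurable S" unfolding v_def by (rule measurable_Iop[OF wm])
  have vi: "integrable S (\<lambda>x. v x powr p')" unfolding v_def by (rule Iop_bound(1)[OF wub w0])
  have "Lp_norm S p' v = ennreal Lam"
    using mx unfolding Lp_norm_def I_op_real Iuw v_def by simp
  from Lp_norm_eqD[OF p'0 less_imp_le[OF Lam_pos] this]
  have V: "(\<integral>x. v x powr p' \<partial>S) = Lam powr p'"
    using nn_integral_eq_integral[OF vi] v0 by (simp add: ennreal_inj)
  define g where "g x = Lam powr (- (p' - 1)) * v x powr (p' - 1)" for x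
  note g = dual_function[OF v0 _ vi V, folded g_def]
  have gL: "Lr p g" and gub: "g \<in> unit_ball" by (rule g, measurable)+
  have "(\<integral>x. g x * v x \<partial>S) = Lam" by (rule g) measurable
  then have "Bil w g = Lam" unfolding v_def using Bil_Iop(2)[OF wL gL] by simp
  then have "2 * Lam \<le> Bil w w + Bil g g" using Bil_le[OF wL gL, of 1] Lam_pos by simp
  then have "Bil w w = Lam" using Bil_le_Lam[OF gub] Bil_le_Lam[OF wub] by simp
  moreover have "Bil u u = Bil w w"
    unfolding Bil_Iop(2)[OF uL uL] Bil_Iop(2)[OF wL wL] Iuw
  proof (rule integral_cong_AE)
    show "(\<lambda>x. u x * Iop w x) \<in> borel_measurable S" "(\<lambda>x. w x * Iop w x) \<in> borel_measurable S"
      unfolding v_def[symmetric] by measurable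
    show "AE x in S. u x * Iop w x = w x * Iop w x" using uw by eventually_elim simp
  qed
  ultimately show "Bil u u = Lam" by simp
qed

end

section \<open>Compactness of the energy\<close>

context subcritical
begin

lemma kern_scaled_upper:
  assumes "0 \<le> r" "r < 1" "cmod w \<le> 1"
  shows "kern \<alpha> (of_real r * w) \<le> (1 - r) powr (- (2 * \<alpha>))"
  unfolding kern_def
  using norm_one_minus_pos[OF assms] assms \<alpha> by (intro powr_mono2') auto

lemma measurable_scaled_pair [measurable]:
  "(\<lambda>z. kern \<alpha> (of_real r * hp (fst z) (snd z))) \<in> borel_measurable (sph2 :: ((complex ^ 'n) \<times> (complex ^ 'n)) measure)"
  by measurable

lemma integrable_scaled:
  fixes f g :: "complex ^ 'n \<Rightarrow> real"
  assumes f: "integrable S f" and g: "integrable S g" and r: "0 \<le> r" "r < 1"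
  shows "integrable sph2 (\<lambda>z. f (fst z) * g (snd z) * kern \<alpha> (of_real r * hp (fst z) (snd z)))"
proof (rule integrable_bounded_factor[where B="(1 - r) powr (- (2 * \<alpha>))"])
  show "integrable sph2 (\<lambda>z. f (fst z) * g (snd z))"
    by (rule integrable_product(1)[OF sph_pair.pair_sigma_finite_axioms f g])
  fix z :: "(complex ^ 'n) \<times> (complex ^ 'n)" assume "z \<in> space sph2"
  then have "cmod (hp (fst z) (snd z)) \<le> 1" using space_sph2[of z] norm_hp_le_1 by blast
  from kern_scaled_upper[OF r this] show "norm (kern \<alpha> (of_real r * hp (fst z) (snd z))) \<le> (1 - r) powr (- (2 * \<alpha>))" by simp
qed measurable

text \<open>By the Young inequality it suffices that the difference of the kernels tends to 0 in \<open>L\<^bsup>r\<^esup>\<close>, uniformly in the pole; this is dominated convergence for a single pole.\<close>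
lemma kern_approx:
  assumes e: "0 < e"
  obtains i where "\<And>f. f \<in> unit_ball \<Longrightarrow> \<bar>Bil f f - kform (\<lambda>w. kern \<alpha> (of_real (rseq i) * w)) f\<bar> \<le> e"
proof -
  note sub = subcritical_exponent[OF \<alpha> pN]
  note [measurable] = measurable_sphere_borel
  define r where "r = yr p"
  have r: "0 < r" using sub by (simp add: r_def)
  define D where "D i w = \<bar>kern \<alpha> w - kern \<alpha> (of_real (rseq i) * w)\<bar>" for i w
  define x0 :: "complex ^ 'n" where "x0 = axis undefined 1"
  have x0: "norm x0 = 1" by (simp add: x0_def norm_axis_1)
  have Dm[measurable]: "D i \<in> borel_measurable borel" for i unfolding D_def[abs_def] by measurable
  define C where "C = 1 + 2 powr (2 * \<alpha>)"
  have AEx: "AE y in S. hp x0 y \<noteq> 1"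
    by (rule AE_I'[OF sphere_point_null[OF x0]]) (use hp_eq_1[OF x0] in auto)
  have \<beta>: "0 < \<alpha> * r" "2 * (\<alpha> * r) < real CARD('n)" using sub \<alpha> by (auto simp: r_def)
  have lim: "(\<lambda>i. \<integral>\<^sup>+y. ennreal (D i (hp x0 y) powr r) \<partial>S) \<longlonglongrightarrow> (\<integral>\<^sup>+y. 0 \<partial>S)"
  proof (rule nn_integral_dominated_convergence[where w="\<lambda>y. ennreal (C powr r) * ennreal (kern (\<alpha> * r) (hp x0 y))"])
    show "AE y in S. ennreal (D i (hp x0 y) powr r) \<le> ennreal (C powr r) * ennreal (kern (\<alpha> * r) (hp x0 y))" for i
      using AEx AE_space
    proof eventually_elim
      case (elim y)
      have h: "cmod (hp x0 y) \<le> 1" using elim(2) x0 by (intro norm_hp_le_1) auto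
      have "D i (hp x0 y) \<le> kern \<alpha> (hp x0 y) + kern \<alpha> (of_real (rseq i) * hp x0 y)"
        unfolding D_def using kern_nonneg[of \<alpha> "hp x0 y"] kern_nonneg[of \<alpha> "of_real (rseq i) * hp x0 y"] by (simp add: abs_le_iff)
      also have "\<dots> \<le> C * kern \<alpha> (hp x0 y)"
        using kern_scaled_le[OF rseq(1,2) h elim(1) \<alpha>(1), of i] by (simp add: C_def algebra_simps)
      finally have "D i (hp x0 y) powr r \<le> (C * kern \<alpha> (hp x0 y)) powr r" using r by (intro powr_mono2) (auto simp: D_def)
      also have "\<dots> = C powr r * kern (\<alpha> * r) (hp x0 y)" by (simp add: powr_mult kern_powr C_def add_nonneg_nonneg)
      finally show ?case by (simp flip: ennreal_mult add: ennreal_leI)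
    qed
    have "(\<integral>\<^sup>+y. ennreal (C powr r) * ennreal (kern (\<alpha> * r) (hp x0 y)) \<partial>S)
       \<le> ennreal (C powr r) * ennreal (kbound TYPE('n) (\<alpha> * r))"
      by (subst nn_integral_cmult) (auto intro!: mult_left_mono kern_nn_integral \<beta> x0)
    also have "\<dots> < \<infinity>" by (simp flip: ennreal_mult')
    finally show "(\<integral>\<^sup>+y. ennreal (C powr r) * ennreal (kern (\<alpha> * r) (hp x0 y)) \<partial>S) < \<infinity>" .
    show "AE y in S. (\<lambda>i. ennreal (D i (hp x0 y) powr r)) \<longlonglongrightarrow> 0"
      using AEx
    proof eventually_elim
      case (elim y)
      have "(\<lambda>i. \<bar>kern \<alpha> (hp x0 y) - kern \<alpha> (of_real (rseq i) * hp x0 y)\<bar>) \<longlonglongrightarrow> \<bar>kern \<alpha> (hp x0 y) - kern \<alpha> (hp x0 y)\<bar>"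
        by (intro tendsto_intros kern_rseq_tendsto elim)
      then have "(\<lambda>i. D i (hp x0 y)) \<longlonglongrightarrow> 0" by (simp add: D_def)
      then have "(\<lambda>i. D i (hp x0 y) powr r) \<longlonglongrightarrow> 0"
        by (rule tendsto_zero_powrI[OF _ tendsto_const _ r]) (simp add: D_def)
      then show ?case using tendsto_ennrealI by fastforce
    qed
  qed measurable
  define M where "M = (e / ybound TYPE('n)) powr r"
  have M: "0 < M" using e ybound_pos[where 'n='n] by (simp add: M_def)
  have "eventually (\<lambda>i. (\<integral>\<^sup>+y. ennreal (D i (hp x0 y) powr r) \<partial>S) < ennreal M) sequentially"
    by (rule order_tendstoD(2)[OF lim]) (use M in simp)
  then obtain i where i: "(\<integral>\<^sup>+y. ennreal (D i (hp x0 y) powr r) \<partial>S) < ennreal M"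
    using eventually_happens'[OF sequentially_bot] by blast
  have Mx: "(\<integral>\<^sup>+y. ennreal (D i (hp x y) powr yr p) \<partial>S) \<le> ennreal M" if x: "norm x = 1" for x
  proof -
    have "(\<integral>\<^sup>+y. ennreal (D i (hp x y) powr r) \<partial>S) = (\<integral>\<^sup>+y. ennreal (D i (hp x0 y) powr r) \<partial>S)"
      by (rule nn_integral_zonal[where F="\<lambda>w. ennreal (D i w powr r)", OF _ x x0]) measurable
    then show ?thesis using i by (simp add: r_def)
  qed
  show ?thesis
  proof (rule that[of i])
    fix f assume f: "f \<in> unit_ball"
    then have fL: "Lr p f" and f1: "(\<integral>x. \<bar>f x\<bar> powr p \<partial>S) \<le> 1" by (auto simp: unit_ball_def)
    have fi: "integrable S f" using Lr_integrable(1)[OF fL] p1 by simp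
    have D_cnj: "D i (cnj w) = D i w" for w
      unfolding D_def using kern_cnj[of \<alpha> w] kern_cnj[of \<alpha> "of_real (rseq i) * w"] by simp
    have nn: "(\<integral>\<^sup>+z. ennreal (\<bar>f (fst z) * f (snd z)\<bar> * D i (hp (fst z) (snd z))) \<partial>sph2) \<le> ennreal (M powr (1 / yr p) * ybound TYPE('n))"
      by (rule young_nn_integral[OF sub(2) fL f1 fL f1 Dm _ D_cnj M Mx]) (simp_all add: D_def)
    have Me: "M powr (1 / yr p) * ybound TYPE('n) = e"
      using r e ybound_pos[where 'n='n] by (simp add: M_def r_def powr_powr)
    note i1 = integrable_Bil[OF fL fL] and i2 = integrable_scaled[OF fi fi rseq(1,2), of i]
    have "ennreal \<bar>Bil f f - kform (\<lambda>w. kern \<alpha> (of_real (rseq i) * w)) f\<bar>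
       \<le> (\<integral>\<^sup>+z. ennreal (norm (f (fst z) * f (snd z) * kern \<alpha> (hp (fst z) (snd z)) - f (fst z) * f (snd z) * kern \<alpha> (of_real (rseq i) * hp (fst z) (snd z)))) \<partial>sph2)"
      unfolding Bil_def kform_def Bochner_Integration.integral_diff[OF i1 i2, symmetric]
      using integral_norm_bound_ennreal[OF Bochner_Integration.integrable_diff[OF i1 i2]] by simp
    also have "\<dots> = (\<integral>\<^sup>+z. ennreal (\<bar>f (fst z) * f (snd z)\<bar> * D i (hp (fst z) (snd z))) \<partial>sph2)"
      unfolding D_def right_diff_distrib[symmetric] by (simp only: real_norm_def abs_mult)
    also have "\<dots> \<le> ennreal e" using nn unfolding Me .
    finally show "\<bar>Bil f f - kform (\<lambda>w. kern \<alpha> (of_real (rseq i) * w)) f\<bar> \<le> e" using e by simp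
  qed
qed

lemma unit_ball_L1:
  assumes "f \<in> unit_ball"
  shows "integrable S f" "(\<integral>x. \<bar>f x\<bar> \<partial>S) \<le> smom TYPE('n) 0 + 1"
  using assms Lr_integrable[of p f] p1 by (auto simp: unit_ball_def)

text \<open>An Ehrling-type inequality: up to an arbitrarily small error the form is controlled by the form
  of the smooth kernel \<open>\<bar>1 - w/2\<bar>\<^bsup>-2\<alpha>\<^esup>\<close>, because only finitely many moments matter.\<close>
lemma ehrling:
  assumes e: "0 < e"
  obtains C where "0 \<le> C" "\<And>f. f \<in> unit_ball \<Longrightarrow> Bil f f \<le> e + C * kform (\<lambda>w. kern \<alpha> (of_real (1 / 2) * w)) f"
proof -
  define B where "B = smom TYPE('n) 0 + 1"
  have B: "B > 0" using smom_pos[of 0, where 'n='n] by (simp add: B_def)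
  obtain i where i: "\<And>f. f \<in> unit_ball \<Longrightarrow> \<bar>Bil f f - kform (\<lambda>w. kern \<alpha> (of_real (rseq i) * w)) f\<bar> \<le> e / 2"
    using kern_approx[of "e / 2"] e by auto
  define c where "c k = bcoef \<alpha> k * rseq i ^ k" for k
  define d where "d k = bcoef \<alpha> k * (1 / 2) ^ k" for k
  have c: "summable c" "0 \<le> c k" for k unfolding c_def by (rule bcoef_rseq[OF \<alpha>(1)])+
  have d: "summable d" "0 \<le> d k" for k
    unfolding d_def using summable_bcoef[OF \<alpha>(1), of "1/2"] bcoef_pos[OF \<alpha>(1), of k] by auto
  have dpos: "0 < d k" for k unfolding d_def using bcoef_pos[OF \<alpha>(1), of k] by simp
  have e': "0 < e / 2 / B\<^sup>2" using e B by simp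
  obtain M where M: "\<And>n (f :: complex ^ 'n \<Rightarrow> real). n \<ge> M \<Longrightarrow> integrable surf f \<Longrightarrow>
    \<bar>kform (\<lambda>w. (cmod (ps c w))\<^sup>2) f - (\<Sum>j<n. \<Sum>k<n. c j * c k * kmom f j k)\<bar> \<le> e / 2 / B\<^sup>2 * (\<integral>x. \<bar>f x\<bar> \<partial>surf)\<^sup>2"
    using kform_ps_approx[OF c e'] by blast
  define C where "C = (\<Sum>j<M. \<Sum>k<M. c j * c k / (d j * d k))"
  have C0: "0 \<le> C" unfolding C_def using c(2) d(2) by (intro sum_nonneg divide_nonneg_nonneg mult_nonneg_nonneg)
  show ?thesis
  proof (rule that[OF C0])
    fix f assume f: "f \<in> unit_ball"
    note fi = unit_ball_L1[OF f, folded B_def]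
    let ?K = "kform (\<lambda>w. kern \<alpha> (of_real (1 / 2) * w)) f"
    have Kd: "?K = kform (\<lambda>w. (cmod (ps d w))\<^sup>2) f"
      unfolding d_def by (rule kform_cong) (rule kern_scaled, auto)
    have mom: "d j * d k * kmom f j k \<le> ?K" for j k
    proof (rule field_le_epsilon)
      fix t :: real assume t: "0 < t"
      have t': "0 < t / B\<^sup>2" using t B by simp
      obtain N where N: "\<And>n (f :: complex ^ 'n \<Rightarrow> real). n \<ge> N \<Longrightarrow> integrable surf f \<Longrightarrow>
        \<bar>kform (\<lambda>w. (cmod (ps d w))\<^sup>2) f - (\<Sum>j<n. \<Sum>k<n. d j * d k * kmom f j k)\<bar> \<le> t / B\<^sup>2 * (\<integral>x. \<bar>f x\<bar> \<partial>surf)\<^sup>2"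
        using kform_ps_approx[OF d t'] by blast
      define n where "n = max N (Suc (max j k))"
      have nn: "0 \<le> d a * d b * kmom f a b" for a b using d(2) kmom_nonneg[OF fi(1)] by simp
      have "d j * d k * kmom f j k \<le> (\<Sum>b<n. d j * d b * kmom f j b)"
        by (rule member_le_sum) (use nn in \<open>auto simp: n_def\<close>)
      also have "\<dots> \<le> (\<Sum>a<n. \<Sum>b<n. d a * d b * kmom f a b)"
        by (rule member_le_sum[where f="\<lambda>a. \<Sum>b<n. d a * d b * kmom f a b"]) (use nn in \<open>auto simp: n_def intro!: sum_nonneg\<close>)
      also have "\<dots> \<le> ?K + t / B\<^sup>2 * (\<integral>x. \<bar>f x\<bar> \<partial>surf)\<^sup>2"
        using N[OF _ fi(1), of n] unfolding Kd by (simp add: n_def abs_le_iff)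
      also have "t / B\<^sup>2 * (\<integral>x. \<bar>f x\<bar> \<partial>surf)\<^sup>2 \<le> t / B\<^sup>2 * B\<^sup>2"
        using fi(2) t' by (intro mult_left_mono power_mono) auto
      also have "\<dots> = t" using B by simp
      finally show "d j * d k * kmom f j k \<le> ?K + t" by simp
    qed
    have "Bil f f \<le> e / 2 + kform (\<lambda>w. kern \<alpha> (of_real (rseq i) * w)) f" using i[OF f] by linarith
    also have "kform (\<lambda>w. kern \<alpha> (of_real (rseq i) * w)) f = kform (\<lambda>w. (cmod (ps c w))\<^sup>2) f"
      unfolding c_def by (rule kform_cong) (rule kern_scaled[OF rseq(1,2)])
    also have "\<dots> \<le> (\<Sum>j<M. \<Sum>k<M. c j * c k * kmom f j k) + e / 2 / B\<^sup>2 * (\<integral>x. \<bar>f x\<bar> \<partial>surf)\<^sup>2"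
      using M[OF order_refl fi(1)] by (simp add: abs_le_iff)
    also have "e / 2 / B\<^sup>2 * (\<integral>x. \<bar>f x\<bar> \<partial>surf)\<^sup>2 \<le> e / 2 / B\<^sup>2 * B\<^sup>2"
      using fi(2) e' by (intro mult_left_mono power_mono) auto
    also have "\<dots> = e / 2" using B by simp
    also have "(\<Sum>j<M. \<Sum>k<M. c j * c k * kmom f j k) \<le> (\<Sum>j<M. \<Sum>k<M. c j * c k / (d j * d k) * ?K)"
    proof (intro sum_mono)
      fix j k
      have "c j * c k * kmom f j k = c j * c k / (d j * d k) * (d j * d k * kmom f j k)"
        using dpos[of j] dpos[of k] by simp
      also have "\<dots> \<le> c j * c k / (d j * d k) * ?K"
        by (intro mult_left_mono mom divide_nonneg_nonneg mult_nonneg_nonneg c d)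
      finally show "c j * c k * kmom f j k \<le> c j * c k / (d j * d k) * ?K" .
    qed
    also have "\<dots> = C * ?K" by (simp add: C_def sum_distrib_right)
    finally show "Bil f f \<le> e + C * ?K" by simp
  qed
qed

text \<open>Compactness: along a subsequence the smoothed functions converge uniformly, hence the form of the
  differences tends to zero.\<close>
lemma Bil_precompact:
  fixes f :: "nat \<Rightarrow> complex ^ 'n \<Rightarrow> real"
  assumes f: "\<And>n. f n \<in> unit_ball"
  obtains s :: "nat \<Rightarrow> nat" where "strict_mono s"
    "\<And>e. 0 < e \<Longrightarrow> \<exists>N. \<forall>m\<ge>N. \<forall>n\<ge>N. Bil (\<lambda>x. f (s m) x - f (s n) x) (\<lambda>x. f (s m) x - f (s n) x) \<le> e"
proof -
  define B where "B = smom TYPE('n) 0 + 1"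
  have B: "B > 0" using smom_pos[of 0, where 'n='n] by (simp add: B_def)
  note fi = unit_ball_L1[OF f, folded B_def]
  let ?k = "\<lambda>x y. kern \<alpha> (of_real (1 / 2) * hp x y)"
  define F where "F n x = (\<integral>y. f n y * ?k x y \<partial>S)" for n x
  have cont: "continuous_on (sphere 0 1 \<times> sphere 0 1) (\<lambda>z. ?k (fst z) (snd z :: complex ^ 'n))"
    unfolding kern_def
  proof (intro continuous_intros ballI)
    fix z :: "(complex ^ 'n) \<times> (complex ^ 'n)" assume "z \<in> sphere 0 1 \<times> sphere 0 1"
    then have "cmod (hp (fst z) (snd z)) \<le> 1" by (intro norm_hp_le_1) auto
    from norm_one_minus_pos[OF _ _ this, of "1/2"] show "cmod (1 - of_real (1 / 2) * hp (fst z) (snd z)) \<noteq> 0" by auto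
  qed
  have uc: "uniformly_continuous_on (sphere 0 1 \<times> sphere 0 1) (\<lambda>z. ?k (fst z) (snd z :: complex ^ 'n))"
    by (rule compact_uniformly_continuous[OF cont]) (intro compact_Times; simp)
  have km: "(\<lambda>y. ?k x y) \<in> borel_measurable S" for x using measurable_sphere_borel by measurable
  have kb: "\<bar>?k x y\<bar> \<le> (1 / 2) powr (- (2 * \<alpha>))" if "norm x = 1" "norm y = 1" for x y :: "complex ^ 'n"
    using kern_scaled_upper[of "1/2" "hp x y"] norm_hp_le_1[OF that] by simp
  have Fi: "integrable S (\<lambda>y. f n y * ?k x y)" if "norm x = 1" for n x
    by (rule integrable_bounded_factor[OF fi(1) km]) (use kb[OF that] in auto)
  have diff: "\<bar>F n x - F n x'\<bar> \<le> e * B"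
    if x: "norm x = 1" "norm x' = 1" and e: "\<And>y. norm y = 1 \<Longrightarrow> \<bar>?k x y - ?k x' y\<bar> \<le> e" "0 \<le> e" for n x x' e
  proof -
    have "F n x - F n x' = (\<integral>y. f n y * ?k x y - f n y * ?k x' y \<partial>S)"
      unfolding F_def by (rule Bochner_Integration.integral_diff[OF Fi[OF x(1)] Fi[OF x(2)], symmetric])
    also have "\<bar>\<dots>\<bar> \<le> (\<integral>y. \<bar>f n y * ?k x y - f n y * ?k x' y\<bar> \<partial>S)" by (rule integral_abs_bound)
    also have "\<dots> \<le> (\<integral>y. e * \<bar>f n y\<bar> \<partial>S)"
    proof (rule integral_mono)
      show "integrable S (\<lambda>y. \<bar>f n y * ?k x y - f n y * ?k x' y\<bar>)"
        by (intro integrable_abs Bochner_Integration.integrable_diff Fi x)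
      show "integrable S (\<lambda>y. e * \<bar>f n y\<bar>)" using fi(1) by simp
      fix y assume "y \<in> space S"
      then have "\<bar>f n y\<bar> * \<bar>?k x y - ?k x' y\<bar> \<le> \<bar>f n y\<bar> * e" by (intro mult_left_mono e) auto
      then show "\<bar>f n y * ?k x y - f n y * ?k x' y\<bar> \<le> e * \<bar>f n y\<bar>"
        by (simp only: right_diff_distrib[symmetric] abs_mult mult.commute)
    qed
    also have "\<dots> \<le> e * B" using fi(2)[of n] e(2) by (simp add: mult_left_mono)
    finally show ?thesis .
  qed
  have bd: "norm (F n x) \<le> (1 / 2) powr (- (2 * \<alpha>)) * B" if x: "x \<in> sphere 0 1" for n x
  proof -
    have x1: "norm x = 1" using x by simp
    have "\<bar>F n x\<bar> \<le> (\<integral>y. \<bar>f n y * ?k x y\<bar> \<partial>S)" unfolding F_def by (rule integral_abs_bound)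
    also have "\<dots> \<le> (\<integral>y. (1 / 2) powr (- (2 * \<alpha>)) * \<bar>f n y\<bar> \<partial>S)"
    proof (rule integral_mono)
      show "integrable S (\<lambda>y. \<bar>f n y * ?k x y\<bar>)" by (intro integrable_abs Fi x1)
      show "integrable S (\<lambda>y. (1 / 2) powr (- (2 * \<alpha>)) * \<bar>f n y\<bar>)" using fi(1) by simp
      fix y assume "y \<in> space S"
      then have "\<bar>f n y\<bar> * \<bar>?k x y\<bar> \<le> \<bar>f n y\<bar> * (1 / 2) powr (- (2 * \<alpha>))" by (intro mult_left_mono kb x1) auto
      then show "\<bar>f n y * ?k x y\<bar> \<le> (1 / 2) powr (- (2 * \<alpha>)) * \<bar>f n y\<bar>" by (simp only: abs_mult mult.commute)
    qed
    also have "\<dots> \<le> (1 / 2) powr (- (2 * \<alpha>)) * B" unfolding integral_mult_right_zero using fi(2)[of n] by (intro mult_left_mono) auto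
    finally show ?thesis by simp
  qed
  have equi: "\<exists>d>0. \<forall>n y. y \<in> sphere 0 1 \<and> norm (x - y) < d \<longrightarrow> norm (F n x - F n y) < e"
    if x: "x \<in> sphere 0 1" and e: "0 < e" for x e
  proof -
    have e': "0 < e / (2 * B)" using e B by simp
    obtain d where d: "0 < d" "\<forall>z\<in>sphere 0 1 \<times> sphere 0 1. \<forall>z'\<in>sphere 0 1 \<times> sphere 0 1. dist z' z < d \<longrightarrow>
        dist (?k (fst z') (snd z' :: complex ^ 'n)) (?k (fst z) (snd z)) < e / (2 * B)"
      using uc[unfolded uniformly_continuous_on_def, THEN spec, THEN mp, OF e'] by blast
    show ?thesis
    proof (intro exI[of _ d] conjI d(1) allI impI, elim conjE)
      fix n y assume y: "y \<in> sphere 0 1" "norm (x - y) < d"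
      have "\<bar>F n x - F n y\<bar> \<le> e / (2 * B) * B"
      proof (rule diff)
        fix w :: "complex ^ 'n" assume w: "norm w = 1"
        have "dist (x, w) (y, w) < d" using y by (simp add: dist_norm norm_Pair)
        from d(2)[THEN bspec, THEN bspec, THEN mp, OF _ _ this] show "\<bar>?k x w - ?k y w\<bar> \<le> e / (2 * B)" using x y w by (simp add: dist_real_def)
      qed (use x y e' in auto)
      also have "\<dots> < e" using e B by simp
      finally show "norm (F n x - F n y) < e" by simp
    qed
  qed
  obtain G s where s: "strict_mono (s :: nat \<Rightarrow> nat)" and conv: "\<And>e. 0 < e \<Longrightarrow> \<exists>N. \<forall>n x. n \<ge> N \<and> x \<in> sphere 0 1 \<longrightarrow> norm (F (s n) x - G x) < e"
    using Arzela_Ascoli[of "sphere 0 1" F "(1 / 2) powr (- (2 * \<alpha>)) * B"] bd equi by (metis compact_sphere)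
  have small: "\<exists>N. \<forall>m\<ge>N. \<forall>n\<ge>N. kform (\<lambda>w. kern \<alpha> (of_real (1 / 2) * w)) (\<lambda>x. f (s m) x - f (s n) x) \<le> e" if e: "0 < e" for e
  proof -
    have e': "0 < e / (4 * B)" using e B by simp
    obtain N where N: "\<And>n x. n \<ge> N \<Longrightarrow> x \<in> sphere 0 1 \<Longrightarrow> norm (F (s n) x - G x) < e / (4 * B)"
      using conv[OF e'] by blast
    show ?thesis
    proof (intro exI[of _ N] allI impI)
      fix m n assume mn: "N \<le> m" "N \<le> n"
      define h where "h x = f (s m) x - f (s n) x" for x
      have hi: "integrable S h" unfolding h_def[abs_def] using fi(1) by (intro Bochner_Integration.integrable_diff)
      have "(\<integral>x. \<bar>h x\<bar> \<partial>S) \<le> (\<integral>x. \<bar>f (s m) x\<bar> + \<bar>f (s n) x\<bar> \<partial>S)"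
        by (rule integral_mono) (use hi fi(1) in \<open>auto simp: h_def\<close>)
      also have "\<dots> \<le> 2 * B" using fi(1) fi(2)[of "s m"] fi(2)[of "s n"] by simp
      finally have h1: "(\<integral>x. \<bar>h x\<bar> \<partial>S) \<le> 2 * B" .
      have inner: "(\<integral>y. h x * h y * ?k x y \<partial>S) = h x * (F (s m) x - F (s n) x)" if "norm x = 1" for x
      proof -
        have "(\<integral>y. h x * h y * ?k x y \<partial>S) = (\<integral>y. h x * (f (s m) y * ?k x y - f (s n) y * ?k x y) \<partial>S)"
          by (simp add: h_def algebra_simps)
        also have "\<dots> = h x * (F (s m) x - F (s n) x)"
          unfolding integral_mult_right_zero F_def Bochner_Integration.integral_diff[OF Fi[OF that] Fi[OF that]] ..
        finally show ?thesis .
      qed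
      note hk = integrable_scaled[OF hi hi, of "1/2"]
      have hk1: "integrable S (\<lambda>x. (\<integral>y. h x * h y * ?k x y \<partial>S))" using sph_pair.integrable_fst'[OF hk] by simp
      have "kform (\<lambda>w. kern \<alpha> (of_real (1 / 2) * w)) h = (\<integral>x. (\<integral>y. h x * h y * ?k x y \<partial>S) \<partial>S)"
        unfolding kform_def using sph_pair.integral_fst'[OF hk] by simp
      also have "\<dots> \<le> (\<integral>x. \<bar>h x\<bar> * (e / (2 * B)) \<partial>S)"
      proof (rule integral_mono[OF hk1])
        show "integrable S (\<lambda>x. \<bar>h x\<bar> * (e / (2 * B)))" using hi by simp
        fix x assume "x \<in> space S"
        then have x: "x \<in> sphere 0 1" "norm x = 1" by auto
        have "\<bar>F (s m) x - F (s n) x\<bar> \<le> e / (2 * B)"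
        proof -
          have "e / (2 * B) = 2 * (e / (4 * B))" by simp
          then show ?thesis using N[OF mn(1) x(1)] N[OF mn(2) x(1)] unfolding real_norm_def by linarith
        qed
        then have "\<bar>h x\<bar> * \<bar>F (s m) x - F (s n) x\<bar> \<le> \<bar>h x\<bar> * (e / (2 * B))" by (intro mult_left_mono) auto
        then show "(\<integral>y. h x * h y * ?k x y \<partial>S) \<le> \<bar>h x\<bar> * (e / (2 * B))"
          unfolding inner[OF x(2)] abs_mult[symmetric] by (rule order_trans[OF abs_ge_self])
      qed
      also have "\<dots> = (\<integral>x. \<bar>h x\<bar> \<partial>S) * (e / (2 * B))" by simp
      also have "\<dots> \<le> 2 * B * (e / (2 * B))" using e B by (intro mult_right_mono h1) auto
      also have "\<dots> = e" using B by simp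
      finally show "kform (\<lambda>w. kern \<alpha> (of_real (1 / 2) * w)) (\<lambda>x. f (s m) x - f (s n) x) \<le> e" by (simp add: h_def[abs_def])
    qed
  qed
  show ?thesis
  proof (rule that[OF s])
    fix e :: real assume e: "0 < e"
    define A where "A = 2 powr p * 2"
    have A: "0 < A" by (simp add: A_def)
    define t where "t = A powr (- (1 / p))"
    have t: "0 < t" using A by (simp add: t_def)
    have ub: "(\<lambda>x. t * (f m x - f n x)) \<in> unit_ball" for m n
      unfolding t_def
    proof (rule normalise[OF _ A])
      have Lf: "Lr p (f k)" "(\<integral>x. \<bar>f k x\<bar> powr p \<partial>S) \<le> 1" for k using f by (auto simp: unit_ball_def)
      show "Lr p (\<lambda>x. f m x - f n x)" by (intro Lr_diff Lf p0)
      then have i: "integrable S (\<lambda>x. \<bar>f m x - f n x\<bar> powr p)" by (simp add: Lr_def)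
      have i2: "integrable S (\<lambda>x. \<bar>f k x\<bar> powr p)" for k using Lf by (simp add: Lr_def)
      have "(\<integral>x. \<bar>f m x - f n x\<bar> powr p \<partial>S) \<le> (\<integral>x. 2 powr p * (\<bar>f m x\<bar> powr p + \<bar>f n x\<bar> powr p) \<partial>S)"
      proof (rule integral_mono[OF i])
        show "integrable S (\<lambda>x. 2 powr p * (\<bar>f m x\<bar> powr p + \<bar>f n x\<bar> powr p))" using i2 by simp
        fix x
        have "\<bar>f m x - f n x\<bar> powr p \<le> (2 * max \<bar>f m x\<bar> \<bar>f n x\<bar>) powr p" using p0 by (intro powr_mono2) auto
        also have "\<dots> = 2 powr p * (max \<bar>f m x\<bar> \<bar>f n x\<bar>) powr p" by (simp add: powr_mult)
        also have "(max \<bar>f m x\<bar> \<bar>f n x\<bar>) powr p \<le> \<bar>f m x\<bar> powr p + \<bar>f n x\<bar> powr p" by (auto simp: max_def)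
        finally show "\<bar>f m x - f n x\<bar> powr p \<le> 2 powr p * (\<bar>f m x\<bar> powr p + \<bar>f n x\<bar> powr p)" by simp
      qed
      also have "\<dots> = 2 powr p * ((\<integral>x. \<bar>f m x\<bar> powr p \<partial>S) + (\<integral>x. \<bar>f n x\<bar> powr p \<partial>S))" using i2 by simp
      also have "\<dots> \<le> 2 powr p * 2" using Lf(2)[of m] Lf(2)[of n] by (intro mult_left_mono) auto
      finally show "(\<integral>x. \<bar>f m x - f n x\<bar> powr p \<partial>S) \<le> A" by (simp add: A_def)
    qed
    obtain C where C: "0 \<le> C" "\<And>f. f \<in> unit_ball \<Longrightarrow> Bil f f \<le> t\<^sup>2 * (e / 2) + C * kform (\<lambda>w. kern \<alpha> (of_real (1 / 2) * w)) f"
      using ehrling[of "t\<^sup>2 * (e / 2)"] e t by auto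
    have e2: "0 < e / 2 / (C + 1)" using e C by simp
    obtain N where N: "\<And>m n. m \<ge> N \<Longrightarrow> n \<ge> N \<Longrightarrow> kform (\<lambda>w. kern \<alpha> (of_real (1 / 2) * w)) (\<lambda>x. f (s m) x - f (s n) x) \<le> e / 2 / (C + 1)"
      using small[OF e2] by blast
    show "\<exists>N. \<forall>m\<ge>N. \<forall>n\<ge>N. Bil (\<lambda>x. f (s m) x - f (s n) x) (\<lambda>x. f (s m) x - f (s n) x) \<le> e"
    proof (intro exI[of _ N] allI impI)
      fix m n assume mn: "N \<le> m" "N \<le> n"
      let ?h = "\<lambda>x. f (s m) x - f (s n) x"
      have "t\<^sup>2 * Bil ?h ?h = Bil (\<lambda>x. t * ?h x) (\<lambda>x. t * ?h x)" by (simp add: Bil_scale power2_eq_square)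
      also have "\<dots> \<le> t\<^sup>2 * (e / 2) + C * kform (\<lambda>w. kern \<alpha> (of_real (1 / 2) * w)) (\<lambda>x. t * ?h x)" by (rule C(2)[OF ub])
      also have "kform (\<lambda>w. kern \<alpha> (of_real (1 / 2) * w)) (\<lambda>x. t * ?h x) = t\<^sup>2 * kform (\<lambda>w. kern \<alpha> (of_real (1 / 2) * w)) ?h"
        unfolding kform_def integral_mult_right_zero[symmetric] by (simp add: power2_eq_square mult_ac)
      also have "t\<^sup>2 * (e / 2) + C * (t\<^sup>2 * kform (\<lambda>w. kern \<alpha> (of_real (1 / 2) * w)) ?h) = t\<^sup>2 * (e / 2 + C * kform (\<lambda>w. kern \<alpha> (of_real (1 / 2) * w)) ?h)"
        by (simp add: algebra_simps)
      finally have "Bil ?h ?h \<le> e / 2 + C * kform (\<lambda>w. kern \<alpha> (of_real (1 / 2) * w)) ?h" using t by simp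
      also have "C * kform (\<lambda>w. kern \<alpha> (of_real (1 / 2) * w)) ?h \<le> C * (e / 2 / (C + 1))" by (intro mult_left_mono N mn C)
      also have "\<dots> \<le> e / 2" using C e by (simp add: field_simps)
      finally show "Bil ?h ?h \<le> e" by simp
    qed
  qed
qed

end

section \<open>Existence of maximizers\<close>

context subcritical
begin

text \<open>Cauchy-Schwarz for the energy, tested with \<open>w\<close> times the sign of the difference.\<close>
lemma weighted_L1_distance:
  fixes f g w :: "complex ^ 'n \<Rightarrow> real"
  assumes f: "Lr p f" and g: "Lr p g" and w: "Lr p w" "\<And>x. 0 \<le> w x" and t: "0 < t"
  shows "integrable S (\<lambda>x. w x * \<bar>Iop f x - Iop g x\<bar>)"
    "2 * (\<integral>x. w x * \<bar>Iop f x - Iop g x\<bar> \<partial>S) \<le> t * Bil (\<lambda>x. f x - g x) (\<lambda>x. f x - g x) + Bil w w / t"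
proof -
  note [measurable] = measurable_Iop[OF Lr_measurable[OF f]] measurable_Iop[OF Lr_measurable[OF g]]
  define \<sigma> where "\<sigma> x = sgn (Iop f x - Iop g x)" for x
  have \<sigma>m: "\<sigma> \<in> borel_measurable S" unfolding \<sigma>_def[abs_def] by measurable
  have w\<sigma>: "Lr p (\<lambda>x. w x * \<sigma> x)"
    by (rule Lr_mult_bounded[OF w(1) \<sigma>m _ p0, of 1]) (simp add: \<sigma>_def sgn_if)
  note I = Bil_Iop[OF f w\<sigma>] Bil_Iop[OF g w\<sigma>]
  have e: "w x * \<bar>Iop f x - Iop g x\<bar> = w x * \<sigma> x * Iop f x - w x * \<sigma> x * Iop g x" for x
    by (simp add: \<sigma>_def sgn_if algebra_simps)
  show "integrable S (\<lambda>x. w x * \<bar>Iop f x - Iop g x\<bar>)" unfolding e by (intro Bochner_Integration.integrable_diff I)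
  have "(\<integral>x. w x * \<bar>Iop f x - Iop g x\<bar> \<partial>S) = Bil f (\<lambda>x. w x * \<sigma> x) - Bil g (\<lambda>x. w x * \<sigma> x)"
    unfolding e I(2) I(4) by (rule Bochner_Integration.integral_diff[OF I(1) I(3)])
  also have "\<dots> = Bil (\<lambda>x. f x - g x) (\<lambda>x. w x * \<sigma> x)" by (rule Bil_diff(1)[OF f g w\<sigma>, symmetric])
  finally have "2 * (\<integral>x. w x * \<bar>Iop f x - Iop g x\<bar> \<partial>S) \<le> t * Bil (\<lambda>x. f x - g x) (\<lambda>x. f x - g x) + Bil (\<lambda>x. w x * \<sigma> x) (\<lambda>x. w x * \<sigma> x) / t"
    using Bil_le[OF Lr_diff[OF f g p0] w\<sigma> t] by simp
  also have "Bil (\<lambda>x. w x * \<sigma> x) (\<lambda>x. w x * \<sigma> x) \<le> Bil w w"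
    unfolding Bil_def
  proof (rule integral_mono[OF integrable_Bil[OF w\<sigma> w\<sigma>] integrable_Bil[OF w(1) w(1)]])
    fix z
    have "\<bar>\<sigma> x\<bar> \<le> 1" for x by (simp add: \<sigma>_def sgn_if)
    then have "\<bar>\<sigma> (fst z)\<bar> * \<bar>\<sigma> (snd z)\<bar> \<le> 1 * 1" by (intro mult_mono) auto
    then have "\<sigma> (fst z) * \<sigma> (snd z) \<le> 1" by (metis abs_le_D1 abs_mult mult_1)
    then have "(w (fst z) * w (snd z) * kern \<alpha> (hp (fst z) (snd z))) * (\<sigma> (fst z) * \<sigma> (snd z)) \<le> (w (fst z) * w (snd z) * kern \<alpha> (hp (fst z) (snd z))) * 1"
      using w(2) by (intro mult_left_mono) auto
    then show "w (fst z) * \<sigma> (fst z) * (w (snd z) * \<sigma> (snd z)) * kern \<alpha> (hp (fst z) (snd z)) \<le> w (fst z) * w (snd z) * kern \<alpha> (hp (fst z) (snd z))"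
      by (simp add: mult_ac)
  qed
  finally show "2 * (\<integral>x. w x * \<bar>Iop f x - Iop g x\<bar> \<partial>S) \<le> t * Bil (\<lambda>x. f x - g x) (\<lambda>x. f x - g x) + Bil w w / t"
    using t by (simp add: divide_right_mono)
qed

lemma weighted_L1_Cauchy:
  fixes g :: "nat \<Rightarrow> complex ^ 'n \<Rightarrow> real"
  assumes g: "\<And>n. Lr p (g n)" and c: "\<And>e. 0 < e \<Longrightarrow> \<exists>N. \<forall>m\<ge>N. \<forall>n\<ge>N. Bil (\<lambda>x. g m x - g n x) (\<lambda>x. g m x - g n x) \<le> e"
    and e: "0 < e" and B: "0 < B"
  shows "\<exists>N. \<forall>m\<ge>N. \<forall>n\<ge>N. \<forall>w. Lr p w \<longrightarrow> (\<forall>x. 0 \<le> w x) \<longrightarrow> Bil w w \<le> B \<longrightarrow> (\<integral>x. w x * \<bar>Iop (g m) x - Iop (g n) x\<bar> \<partial>S) \<le> e"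
proof -
  have t: "0 < B / e" using e B by simp
  obtain N where N: "\<forall>m\<ge>N. \<forall>n\<ge>N. Bil (\<lambda>x. g m x - g n x) (\<lambda>x. g m x - g n x) \<le> e / (B / e)"
    using c[of "e / (B / e)"] e t by (meson divide_pos_pos)
  show ?thesis
  proof (intro exI[of _ N] allI impI)
    fix m n w assume mn: "N \<le> m" "N \<le> n" and w: "Lr p w" "\<forall>x. 0 \<le> w x" "Bil w w \<le> B"
    have "2 * (\<integral>x. w x * \<bar>Iop (g m) x - Iop (g n) x\<bar> \<partial>S) \<le> (B / e) * Bil (\<lambda>x. g m x - g n x) (\<lambda>x. g m x - g n x) + Bil w w / (B / e)"
      by (rule weighted_L1_distance(2)[OF g g w(1) _ t]) (use w in auto)
    also have "\<dots> \<le> (B / e) * (e / (B / e)) + B / (B / e)"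
      using N mn w t by (intro add_mono mult_left_mono divide_right_mono) auto
    also have "\<dots> = 2 * e" using e B by simp
    finally show "(\<integral>x. w x * \<bar>Iop (g m) x - Iop (g n) x\<bar> \<partial>S) \<le> e" by simp
  qed
qed

text \<open>The maximizing sequence itself need not converge, but its images \<open>Iop (g n)\<close> do, almost everywhere
  along a subsequence. Their limit \<open>v\<close> satisfies \<open>\<integral> v\<^bsup>p'\<^esup> \<le> Lam\<^bsup>p'\<^esup>\<close> by Fatou, and its normalised dual function is
  the maximizer.\<close>
theorem exists_maximizer: "\<exists>u :: complex ^ 'n \<Rightarrow> real. nonneg_maximizer (4 * \<alpha>) p u"
proof -
  have "\<exists>f. f \<in> unit_ball \<and> (\<forall>x. 0 \<le> f x) \<and> Lam - 1 / real (Suc n) < Bil f f" for n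
  proof -
    have ne: "unit_ball \<noteq> {}"
    proof -
      have "(\<lambda>_. 0) \<in> unit_ball" by (simp add: unit_ball_def Lr_def)
      then show ?thesis by blast
    qed
    have "Lam - 1 / real (Suc n) < Lam" by simp
    then obtain f where f: "f \<in> unit_ball" "Lam - 1 / real (Suc n) < Bil f f"
      unfolding Lam_def less_cSUP_iff[OF ne bdd] by blast
    then have fL: "Lr p f" by (simp add: unit_ball_def)
    have "(\<lambda>x. \<bar>f x\<bar>) \<in> unit_ball" using f by (auto simp: unit_ball_def Lr_def)
    moreover have "Lam - 1 / real (Suc n) < Bil (\<lambda>x. \<bar>f x\<bar>) (\<lambda>x. \<bar>f x\<bar>)" using f(2) Bil_abs_le[OF fL fL] by linarith
    ultimately show ?thesis by (intro exI[of _ "\<lambda>x. \<bar>f x\<bar>"]) auto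
  qed
  then obtain f where f: "\<And>n. f n \<in> unit_ball" "\<And>n x. 0 \<le> f n x" "\<And>n. Lam - 1 / real (Suc n) < Bil (f n) (f n)" by metis
  obtain s :: "nat \<Rightarrow> nat" where s: "strict_mono s"
    "\<And>e. 0 < e \<Longrightarrow> \<exists>N. \<forall>m\<ge>N. \<forall>n\<ge>N. Bil (\<lambda>x. f (s m) x - f (s n) x) (\<lambda>x. f (s m) x - f (s n) x) \<le> e"
    using Bil_precompact[of f] f(1) by blast
  define g where "g n = f (s n)" for n
  have g: "g n \<in> unit_ball" "0 \<le> g n x" for n x using f by (auto simp: g_def)
  have gL: "Lr p (g n)" for n using g(1) by (simp add: unit_ball_def)
  have gc: "\<And>e. 0 < e \<Longrightarrow> \<exists>N. \<forall>m\<ge>N. \<forall>n\<ge>N. Bil (\<lambda>x. g m x - g n x) (\<lambda>x. g m x - g n x) \<le> e"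
    using s(2) by (simp add: g_def)
  have glow: "Lam - 1 / real (Suc n) < Bil (g n) (g n)" for n
  proof -
    have "n \<le> s n" by (rule strict_mono_imp_increasing[OF s(1)])
    then have "1 / real (Suc (s n)) \<le> 1 / real (Suc n)" by (simp add: frac_le)
    then show ?thesis using f(3)[of "s n"] by (simp add: g_def)
  qed
  define h where "h n = Iop (g n)" for n
  have h0: "0 \<le> h n x" for n x unfolding h_def by (rule Iop_nonneg) (rule g)
  have hm[measurable]: "h n \<in> borel_measurable S" for n unfolding h_def by (rule measurable_Iop[OF Lr_measurable[OF gL]])
  have one: "Lr p (\<lambda>_ :: complex ^ 'n. 1)" by (simp add: Lr_def)
  have hi: "integrable S (h n)" for n using Bil_Iop(1)[OF gL one, of n] by (simp add: h_def)
  have L1: "\<exists>N. \<forall>i\<ge>N. \<forall>j\<ge>N. (\<integral>x. norm (h i x - h j x) \<partial>S) < e" if e: "0 < e" for e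
  proof -
    obtain N where N: "\<forall>m\<ge>N. \<forall>n\<ge>N. \<forall>w. Lr p w \<longrightarrow> (\<forall>x. 0 \<le> w x) \<longrightarrow> Bil w w \<le> Bil (\<lambda>_. 1) (\<lambda>_. 1) \<longrightarrow> (\<integral>x. w x * \<bar>Iop (g m) x - Iop (g n) x\<bar> \<partial>S) \<le> e / 2"
      using weighted_L1_Cauchy[OF gL gc _ Bil_one_pos, of "e / 2"] e by auto
    show ?thesis
    proof (intro exI[of _ N] allI impI)
      fix i j assume ij: "N \<le> i" "N \<le> j"
      have "(\<integral>x. 1 * \<bar>Iop (g i) x - Iop (g j) x\<bar> \<partial>S) \<le> e / 2" using N[rule_format, OF ij one] by simp
      then show "(\<integral>x. norm (h i x - h j x) \<partial>S) < e" using e by (simp add: h_def)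
    qed
  qed
  obtain r where r: "strict_mono (r :: nat \<Rightarrow> nat)" "AE x in S. Cauchy (\<lambda>i. h (r i) x)"
    using cauchy_L1_AE_cauchy_subseq[OF hi L1] by blast
  define v where "v x = \<bar>lim (\<lambda>i. h (r i) x)\<bar>" for x
  have v0: "0 \<le> v x" for x by (simp add: v_def)
  have vm[measurable]: "v \<in> borel_measurable S" unfolding v_def[abs_def] by measurable
  have conv: "AE x in S. (\<lambda>i. h (r i) x) \<longlonglongrightarrow> v x"
    using r(2)
  proof eventually_elim
    case (elim x)
    then have "(\<lambda>i. h (r i) x) \<longlonglongrightarrow> lim (\<lambda>i. h (r i) x)" by (simp only: Cauchy_convergent_iff convergent_LIMSEQ_iff)
    from tendsto_rabs[OF this] show ?case using h0 by (simp add: v_def)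
  qed
  have fatou: "(\<integral>\<^sup>+x. ennreal (F x (v x)) \<partial>S) \<le> ennreal B"
    if le: "eventually (\<lambda>i. (\<integral>\<^sup>+x. ennreal (F x (h (r i) x)) \<partial>S) \<le> ennreal B) sequentially"
    and cF: "\<And>x. continuous_on {0..} (F x)" and m: "\<And>k. k \<in> borel_measurable S \<Longrightarrow> (\<lambda>x. F x (k x)) \<in> borel_measurable S" for F B
  proof -
    have "(\<integral>\<^sup>+x. ennreal (F x (v x)) \<partial>S) \<le> (\<integral>\<^sup>+x. liminf (\<lambda>i. ennreal (F x (h (r i) x))) \<partial>S)"
    proof (rule nn_integral_mono_AE, use conv in eventually_elim)
      fix x assume c: "(\<lambda>i. h (r i) x) \<longlonglongrightarrow> v x"
      have "(\<lambda>i. F x (h (r i) x)) \<longlonglongrightarrow> F x (v x)"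
        by (rule continuous_on_tendsto_compose[OF cF c]) (use v0 h0 in auto)
      then have "(\<lambda>i. ennreal (F x (h (r i) x))) \<longlonglongrightarrow> ennreal (F x (v x))" by (rule tendsto_ennrealI)
      from lim_imp_Liminf[OF _ this] show "ennreal (F x (v x)) \<le> liminf (\<lambda>i. ennreal (F x (h (r i) x)))" by simp
    qed
    also have "\<dots> \<le> liminf (\<lambda>i. (\<integral>\<^sup>+x. ennreal (F x (h (r i) x)) \<partial>S))"
      by (rule nn_integral_liminf) (use m[OF hm] in measurable)
    also have "\<dots> \<le> liminf (\<lambda>i::nat. ennreal B)" by (rule Liminf_mono[OF le])
    finally show ?thesis by (simp add: Liminf_const)
  qed
  have pc: "continuous_on {0..} (\<lambda>y::real. y powr p')" using p'0 by (intro continuous_on_powr' continuous_intros) auto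
  have nnV: "(\<integral>\<^sup>+x. ennreal (v x powr p') \<partial>S) \<le> ennreal (Lam powr p')"
    using nn_Iop_le[OF g(1)] g(2) by (intro fatou[of "\<lambda>_ y. y powr p'"] pc) (auto simp: h_def intro!: always_eventually)
  have vi: "integrable S (\<lambda>x. v x powr p')"
    by (rule integrableI_nonneg) (use nnV in \<open>auto intro: le_less_trans\<close>)
  define V where "V = (\<integral>x. v x powr p' \<partial>S)"
  have V0: "0 \<le> V" by (simp add: V_def)
  have Vle: "V \<le> Lam powr p'" using nnV unfolding nn_integral_eq_integral[OF vi AE_I2[OF powr_ge_zero]] by (simp add: V_def)
  have key: "Lam \<le> t" if t: "0 < t" "V \<le> t powr p'" for t
  proof (rule field_le_epsilon)
    fix e :: real assume e: "0 < e"
    obtain N where N: "\<forall>m\<ge>N. \<forall>n\<ge>N. \<forall>w. Lr p w \<longrightarrow> (\<forall>x. 0 \<le> w x) \<longrightarrow> Bil w w \<le> Lam \<longrightarrow> (\<integral>x. w x * \<bar>Iop (g m) x - Iop (g n) x\<bar> \<partial>S) \<le> e / 2"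
      using weighted_L1_Cauchy[OF gL gc _ Lam_pos, of "e / 2"] e by auto
    obtain N' :: nat where N': "1 / (e / 2) < real N'" using reals_Archimedean2 by blast
    define n where "n = max N N'"
    have n1: "1 / real (Suc n) \<le> e / 2"
    proof -
      have "1 / (e / 2) \<le> real (Suc n)" using N' by (simp add: n_def)
      then show ?thesis using e by (simp add: field_simps)
    qed
    have "(\<integral>\<^sup>+x. ennreal (g n x * \<bar>h n x - v x\<bar>) \<partial>S) \<le> ennreal (e / 2)"
    proof (rule fatou[of "\<lambda>x y. g n x * \<bar>h n x - y\<bar>"])
      show "continuous_on {0..} (\<lambda>y. g n x * \<bar>h n x - y\<bar>)" for x by (intro continuous_intros)
      show "(\<lambda>x. g n x * \<bar>h n x - k x\<bar>) \<in> borel_measurable S" if "k \<in> borel_measurable S" for k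
        using that Lr_measurable[OF gL] by measurable
      show "eventually (\<lambda>i. (\<integral>\<^sup>+x. ennreal (g n x * \<bar>h n x - h (r i) x\<bar>) \<partial>S) \<le> ennreal (e / 2)) sequentially"
      proof (rule eventually_sequentiallyI[of N])
        fix i assume "N \<le> i"
        then have ri: "N \<le> r i" using strict_mono_imp_increasing[OF r(1), of i] by simp
        have "(\<integral>x. g n x * \<bar>Iop (g n) x - Iop (g (r i)) x\<bar> \<partial>S) \<le> e / 2"
          using N ri gL g(2) Bil_le_Lam[OF g(1)] by (simp add: n_def)
        then show "(\<integral>\<^sup>+x. ennreal (g n x * \<bar>h n x - h (r i) x\<bar>) \<partial>S) \<le> ennreal (e / 2)"
          unfolding h_def using weighted_L1_distance(1)[OF gL gL gL g(2) zero_less_one] g(2)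
          by (subst nn_integral_eq_integral) (auto intro: ennreal_leI)
      qed
    qed
    note nn = this
    have di: "integrable S (\<lambda>x. g n x * \<bar>h n x - v x\<bar>)"
      by (rule integrableI_nonneg) (use nn Lr_measurable[OF gL] g(2) in \<open>auto intro: le_less_trans\<close>)
    have dle: "(\<integral>x. g n x * \<bar>h n x - v x\<bar> \<partial>S) \<le> e / 2"
      using nn e unfolding nn_integral_eq_integral[OF di AE_I2[OF mult_nonneg_nonneg[OF g(2) abs_ge_zero]]] by simp
    have ghi: "integrable S (\<lambda>x. g n x * h n x)" unfolding h_def by (rule Bil_Iop(1)[OF gL gL])
    have gvi: "integrable S (\<lambda>x. g n x * v x)"
    proof (rule Bochner_Integration.integrable_bound[OF Bochner_Integration.integrable_add[OF ghi di]])
      show "(\<lambda>x. g n x * v x) \<in> borel_measurable S" using Lr_measurable[OF gL] by measurable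
      show "AE x in S. norm (g n x * v x) \<le> norm (g n x * h n x + g n x * \<bar>h n x - v x\<bar>)"
      proof (rule AE_I2)
        fix x
        have "g n x * v x \<le> g n x * (h n x + \<bar>h n x - v x\<bar>)" using g(2) by (intro mult_left_mono) auto
        then show "norm (g n x * v x) \<le> norm (g n x * h n x + g n x * \<bar>h n x - v x\<bar>)"
          using g(2)[of n x] v0[of x] h0[of n x] by (simp add: distrib_left)
      qed
    qed
    have "Lam - e / 2 < Bil (g n) (g n)" using glow[of n] n1 by linarith
    also have "\<dots> = (\<integral>x. g n x * h n x \<partial>S)" unfolding h_def by (rule Bil_Iop(2)[OF gL gL])
    also have "\<dots> \<le> (\<integral>x. g n x * v x + g n x * \<bar>h n x - v x\<bar> \<partial>S)"
    proof (rule integral_mono[OF ghi Bochner_Integration.integrable_add[OF gvi di]])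
      fix x
      have "g n x * h n x \<le> g n x * (v x + \<bar>h n x - v x\<bar>)" using g(2) by (intro mult_left_mono) auto
      then show "g n x * h n x \<le> g n x * v x + g n x * \<bar>h n x - v x\<bar>" by (simp add: distrib_left)
    qed
    also have "\<dots> = (\<integral>x. g n x * v x \<partial>S) + (\<integral>x. g n x * \<bar>h n x - v x\<bar> \<partial>S)" by (rule Bochner_Integration.integral_add[OF gvi di])
    also have "(\<integral>x. g n x * v x \<partial>S) \<le> t" by (rule holder[OF g(1) g(2) v0 vi t[unfolded V_def] gvi])
    finally show "Lam \<le> t + e" using dle by linarith
  qed
  have V: "V = Lam powr p'"
  proof (rule ccontr)
    assume "V \<noteq> Lam powr p'"
    then have lt: "V < Lam powr p'" using Vle by simp
    define a where "a = (V + Lam powr p') / 2"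
    have a: "0 < a" "V \<le> a" "a < Lam powr p'" using lt V0 by (auto simp: a_def)
    have "Lam \<le> a powr (1 / p')" by (rule key) (use a p'0 in \<open>auto simp: powr_powr\<close>)
    then have "Lam powr p' \<le> (a powr (1 / p')) powr p'" using Lam_pos p'0 by (intro powr_mono2) auto
    then show False using a p'0 by (simp add: powr_powr)
  qed
  define u where "u x = Lam powr (- (p' - 1)) * v x powr (p' - 1)" for x
  note U = dual_function[OF v0 vm vi V[unfolded V_def], folded u_def]
  have "(\<integral>\<^sup>+x. ennreal (u x * v x) \<partial>S) \<le> ennreal ((Lam + Bil u u) / 2)"
  proof (rule fatou[of "\<lambda>x y. u x * y"])
    show "continuous_on {0..} (\<lambda>y. u x * y)" for x by (intro continuous_intros)
    show "(\<lambda>x. u x * k x) \<in> borel_measurable S" if "k \<in> borel_measurable S" for k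
      using that Lr_measurable[OF U(1)] by measurable
    show "eventually (\<lambda>i. (\<integral>\<^sup>+x. ennreal (u x * h (r i) x) \<partial>S) \<le> ennreal ((Lam + Bil u u) / 2)) sequentially"
    proof (intro always_eventually allI)
      fix i
      note B = Bil_Iop[OF gL U(1), of "r i"]
      have "2 * (\<integral>x. u x * h (r i) x \<partial>S) \<le> Lam + Bil u u"
        using Bil_le[OF gL U(1) zero_less_one, of "r i"] Bil_le_Lam[OF g(1), of "r i"] unfolding h_def B(2)[symmetric] by simp
      then show "(\<integral>\<^sup>+x. ennreal (u x * h (r i) x) \<partial>S) \<le> ennreal ((Lam + Bil u u) / 2)"
        using B(1) U(2) h0 unfolding h_def[symmetric] by (subst nn_integral_eq_integral) (auto intro!: ennreal_leI)
    qed
  qed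
  note nnu = this
  have ui: "integrable S (\<lambda>x. u x * v x)"
    by (rule integrableI_nonneg) (use nnu U(2) v0 Lr_measurable[OF U(1)] in \<open>auto intro: le_less_trans\<close>)
  have "Lam \<le> (Lam + Bil u u) / 2"
    using nnu U(4) Lam_pos Bil_self_nonneg[OF U(1)]
    unfolding nn_integral_eq_integral[OF ui AE_I2[OF mult_nonneg_nonneg[OF U(2) v0]]] by simp
  then have "Bil u u = Lam" using Bil_le_Lam[OF U(5)] by simp
  from nonneg_maximizerI[OF U(1) U(2) U(3) this] show ?thesis by blast
qed

end

section \<open>Automorphisms of the ball and the Szego kernel\<close>

lemma powser_unique:
  fixes a b :: "nat \<Rightarrow> complex"
  assumes "\<And>t. cmod t < 1 \<Longrightarrow> (\<lambda>k. a k * t ^ k) sums g t" "\<And>t. cmod t < 1 \<Longrightarrow> (\<lambda>k. b k * t ^ k) sums g t"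
  shows "a k = b k"
proof (rule ccontr)
  assume ne: "a k \<noteq> b k"
  have d: "(\<lambda>k. (a k - b k) * t ^ k) sums 0" if "cmod t < 1" for t
    using sums_diff[OF assms(1)[OF that] assms(2)[OF that]] by (simp add: left_diff_distrib)
  show False
  proof (cases k)
    case 0
    then show False using sums_unique2[OF d[of 0] powser_sums_zero] ne by simp
  next
    case (Suc j)
    obtain r :: real where "0 < r" and r: "\<And>z::complex. z \<in> cball 0 r - {0} \<Longrightarrow> (0::complex) \<noteq> 0"
      using powser_0_nonzero[of 1 0 "\<lambda>k. a k - b k" "\<lambda>_. 0" k] d ne Suc by auto
    then show False using r[of "of_real r"] by auto
  qed
qed

text \<open>Termwise integration is used both for the Szego kernel and for the exponential function.\<close>
lemma integral_powser_sums:
  fixes q \<phi> :: "complex ^ 'n::finite \<Rightarrow> complex" and a :: "nat \<Rightarrow> complex"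
  assumes q: "q \<in> borel_measurable surf" "\<And>x. norm x = 1 \<Longrightarrow> cmod (q x) \<le> \<rho>"
    and a: "summable (\<lambda>k. cmod (a k) * \<rho> ^ k)" "\<And>w. cmod w \<le> \<rho> \<Longrightarrow> (\<lambda>k. a k * w ^ k) sums G w"
    and \<phi>: "integrable surf \<phi>"
  shows "(\<lambda>k. a k * (\<integral>x. q x ^ k * \<phi> x \<partial>surf)) sums (\<integral>x. G (q x) * \<phi> x \<partial>surf)"
proof -
  note [measurable] = q(1) borel_measurable_integrable[OF \<phi>]
  have le: "cmod (q x) ^ k \<le> \<rho> ^ k" if "norm x = 1" for x k using q(2)[OF that] by (intro power_mono) auto
  have i: "integrable surf (\<lambda>x. q x ^ k * \<phi> x)" for k
    using integrable_bounded_factor[OF \<phi>, of "\<lambda>x. q x ^ k" "\<rho> ^ k"] le by (simp add: norm_power mult.commute)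
  have i': "integrable surf (\<lambda>x. a k * (q x ^ k * \<phi> x))" for k by (intro integrable_mult_right i)
  have n: "norm (a k * (q x ^ k * \<phi> x)) \<le> cmod (a k) * \<rho> ^ k * cmod (\<phi> x)" if "norm x = 1" for x k
    unfolding norm_mult norm_power using mult_left_mono[OF mult_right_mono[OF le[OF that, of k], of "cmod (\<phi> x)"], of "cmod (a k)"] by (simp add: mult_ac)
  have "AE x in surf. summable (\<lambda>k. norm (a k * (q x ^ k * \<phi> x)))"
    using n by (intro AE_I2 summable_comparison_test'[OF summable_mult2[OF a(1)]]) auto
  moreover have "summable (\<lambda>k. \<integral>x. norm (a k * (q x ^ k * \<phi> x)) \<partial>surf)"
  proof (rule summable_comparison_test')
    show "summable (\<lambda>k. cmod (a k) * \<rho> ^ k * (\<integral>x. cmod (\<phi> x) \<partial>surf))" by (intro summable_mult2 a)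
    fix k :: nat
    have "(\<integral>x. norm (a k * (q x ^ k * \<phi> x)) \<partial>surf) \<le> (\<integral>x. cmod (a k) * \<rho> ^ k * cmod (\<phi> x) \<partial>surf)"
      using i' \<phi> n by (intro integral_mono integrable_norm[OF i'] integrable_mult_right integrable_norm[OF \<phi>]) auto
    then show "norm (\<integral>x. norm (a k * (q x ^ k * \<phi> x)) \<partial>surf) \<le> cmod (a k) * \<rho> ^ k * (\<integral>x. cmod (\<phi> x) \<partial>surf)" by simp
  qed
  ultimately have "(\<lambda>k. \<integral>x. a k * (q x ^ k * \<phi> x) \<partial>surf) sums (\<integral>x. (\<Sum>k. a k * (q x ^ k * \<phi> x)) \<partial>surf)"
    by (intro sums_integral i')
  moreover have "(\<integral>x. (\<Sum>k. a k * (q x ^ k * \<phi> x)) \<partial>surf) = (\<integral>x. G (q x) * \<phi> x \<partial>surf)"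
  proof (rule Bochner_Integration.integral_cong[OF refl])
    fix x :: "complex ^ 'n" assume "x \<in> space surf"
    then have "(\<lambda>k. a k * q x ^ k * \<phi> x) sums (G (q x) * \<phi> x)" by (intro sums_mult2 a q) simp
    then show "(\<Sum>k. a k * (q x ^ k * \<phi> x)) = G (q x) * \<phi> x" by (simp add: sums_iff mult.assoc)
  qed
  ultimately show ?thesis by simp
qed

lemma inverse_power_sums:
  assumes "cmod q < 1"
  shows "(\<lambda>k. of_real (bcoef (real CARD('n)) k) * q ^ k) sums (inverse (1 - q) ^ CARD('n))"
proof -
  have nz: "1 - q \<noteq> 0" using assms by auto
  have "(1 - q) powr (- of_real (real CARD('n))) = inverse ((1 - q) ^ CARD('n))"
    using nz by (simp add: powr_minus powr_nat)
  then show ?thesis using binomial_series_complex[OF assms, of "real CARD('n)"] by (simp add: power_inverse)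
qed

lemma integral_inverse_power_sums:
  fixes q \<phi> :: "complex ^ 'n::finite \<Rightarrow> complex"
  assumes q: "q \<in> borel_measurable surf" "\<And>x. norm x = 1 \<Longrightarrow> cmod (q x) \<le> \<rho>" "\<rho> < 1" "0 \<le> \<rho>"
    and \<phi>: "integrable surf \<phi>"
  shows "(\<lambda>k. of_real (bcoef (real CARD('n)) k) * (\<integral>x. q x ^ k * \<phi> x \<partial>surf)) sums (\<integral>x. inverse (1 - q x) ^ CARD('n) * \<phi> x \<partial>surf)"
proof (rule integral_powser_sums[OF q(1,2) _ _ \<phi>])
  show "summable (\<lambda>k. cmod (complex_of_real (bcoef (real CARD('n)) k)) * \<rho> ^ k)"
    using summable_bcoef[of "real CARD('n)" \<rho>] q(3,4) by (simp add: abs_of_pos bcoef_pos)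
qed (use q(3) inverse_power_sums[where 'n='n] in auto)

lemma bcoef_smom: "bcoef (real CARD('n)) k * smom TYPE('n::finite) k = smom TYPE('n) 0"
proof -
  have "pochhammer (real CARD('n)) k > 0" by (rule pochhammer_pos) simp
  then show ?thesis by (subst smom_eq) (simp add: bcoef_def)
qed

lemma norm_hp_less: "norm x = 1 \<Longrightarrow> cmod (hp x y) \<le> norm y"
  using norm_hp_le[of x y] by simp

lemma measurable_hp_left: "(\<lambda>x. hp x y) \<in> borel_measurable surf"
  by (intro measurable_hp measurable_sphere_borel) simp

lemma continuous_inverse_power:
  fixes y :: "complex ^ 'n::finite"
  assumes "norm y < 1"
  shows "continuous_on (sphere 0 1) (\<lambda>x :: complex ^ 'n. inverse (1 - hp x y) ^ CARD('n))"
proof (intro continuous_intros ballI)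
  fix x :: "complex ^ 'n" assume "x \<in> sphere 0 1"
  then have "cmod (hp x y) < 1" using norm_hp_less[of x y] assms by auto
  then show "1 - hp x y \<noteq> 0" by auto
qed

text \<open>The reproducing property of the Szego kernel: its Taylor coefficients are inverse to the moments (\<open>bcoef_smom\<close>).\<close>
lemma szego:
  fixes y v :: "complex ^ 'n::finite"
  assumes y: "norm y < 1" and v: "norm v < 1"
  shows "(\<integral>x. inverse (1 - hp x y) ^ CARD('n) * cnj (inverse (1 - hp x v) ^ CARD('n)) \<partial>surf)
    = of_real (smom TYPE('n) 0) * inverse (1 - hp v y) ^ CARD('n)"
proof -
  let ?b = "\<lambda>k. bcoef (real CARD('n)) k"
  have \<phi>: "integrable surf (\<lambda>x. cnj (inverse (1 - hp x v) ^ CARD('n)))"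
    by (intro integrable_cnj_integral integrable_sphere_continuous continuous_inverse_power v)
  have inner: "(\<integral>x. hp x y ^ k * cnj (inverse (1 - hp x v) ^ CARD('n)) \<partial>surf) = of_real (smom TYPE('n) 0) * hp v y ^ k" for k
  proof -
    have i: "integrable surf (\<lambda>x. inverse (1 - hp x v) ^ CARD('n) * cnj (hp x y ^ k))"
      by (intro integrable_sphere_continuous continuous_intros continuous_on_mult continuous_inverse_power v)
    have "(\<lambda>l. of_real (?b l) * (\<integral>x. hp x v ^ l * cnj (hp x y ^ k) \<partial>surf)) sums (\<integral>x. inverse (1 - hp x v) ^ CARD('n) * cnj (hp x y ^ k) \<partial>surf)"
      by (rule integral_inverse_power_sums[OF measurable_hp_left norm_hp_less v])
        (auto intro!: integrable_sphere_continuous continuous_intros)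
    moreover have "(\<integral>x. hp x v ^ l * cnj (hp x y ^ k) \<partial>surf) = (if l = k then of_real (smom TYPE('n) k) * hp y v ^ k else 0)" for l
      using moment[of y k v l] by (simp add: cnj_hp mult.commute)
    ultimately have "(\<lambda>l. of_real (?b l) * (if l = k then of_real (smom TYPE('n) k) * hp y v ^ k else 0)) sums (\<integral>x. inverse (1 - hp x v) ^ CARD('n) * cnj (hp x y ^ k) \<partial>surf)"
      by simp
    moreover have "(\<lambda>l. of_real (?b l) * (if l = k then of_real (smom TYPE('n) k) * hp y v ^ k else 0)) sums (of_real (?b k) * (of_real (smom TYPE('n) k) * hp y v ^ k))"
      using sums_single[of k "\<lambda>l. of_real (?b l) * (of_real (smom TYPE('n) k) * hp y v ^ k)"] by (simp add: if_distrib[of "\<lambda>x. _ * x"] cong: if_cong)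
    ultimately have "(\<integral>x. inverse (1 - hp x v) ^ CARD('n) * cnj (hp x y ^ k) \<partial>surf) = of_real (?b k) * (of_real (smom TYPE('n) k) * hp y v ^ k)"
      by (rule sums_unique2)
    also have "\<dots> = of_real (?b k * smom TYPE('n) k) * hp y v ^ k" by simp
    finally have "(\<integral>x. inverse (1 - hp x v) ^ CARD('n) * cnj (hp x y ^ k) \<partial>surf) = of_real (smom TYPE('n) 0) * hp y v ^ k"
      by (simp only: bcoef_smom)
    then have "cnj (\<integral>x. inverse (1 - hp x v) ^ CARD('n) * cnj (hp x y ^ k) \<partial>surf) = of_real (smom TYPE('n) 0) * hp v y ^ k"
      by (simp add: cnj_hp)
    then show ?thesis unfolding integrable_cnj_integral(2)[OF i, symmetric] by (simp add: mult.commute)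
  qed
  have "(\<lambda>k. of_real (?b k) * (of_real (smom TYPE('n) 0) * hp v y ^ k)) sums (\<integral>x. inverse (1 - hp x y) ^ CARD('n) * cnj (inverse (1 - hp x v) ^ CARD('n)) \<partial>surf)"
    using integral_inverse_power_sums[OF measurable_hp_left norm_hp_less y norm_ge_zero \<phi>] unfolding inner .
  moreover have "cmod (hp v y) < 1"
  proof -
    have "cmod (hp v y) \<le> norm v * norm y" by (rule norm_hp_le)
    also have "\<dots> \<le> norm v * 1" using y by (intro mult_left_mono) auto
    finally show ?thesis using v by simp
  qed
  then have "(\<lambda>k. of_real (smom TYPE('n) 0) * (of_real (?b k) * hp v y ^ k)) sums (of_real (smom TYPE('n) 0) * inverse (1 - hp v y) ^ CARD('n))"
    by (intro sums_mult inverse_power_sums)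
  then have "(\<lambda>k. of_real (?b k) * (of_real (smom TYPE('n) 0) * hp v y ^ k)) sums (of_real (smom TYPE('n) 0) * inverse (1 - hp v y) ^ CARD('n))"
    by (simp add: mult.left_commute)
  ultimately show ?thesis by (rule sums_unique2)
qed

text \<open>The automorphism of the ball that moves the origin to \<open>s e\<close>, and its Jacobian on the sphere.\<close>

definition mob :: "complex ^ 'n \<Rightarrow> real \<Rightarrow> complex ^ 'n \<Rightarrow> complex ^ 'n" where
  "mob e s x = inverse (1 + of_real s * hp x e) *s
     ((hp x e + of_real s) *s e + of_real (sqrt (1 - s\<^sup>2)) *s (x - hp x e *s e))"

definition jac :: "complex ^ 'n::finite \<Rightarrow> real \<Rightarrow> complex ^ 'n \<Rightarrow> real" where
  "jac e s x = ((1 - s\<^sup>2) / (cmod (1 + of_real s * hp x e))\<^sup>2) ^ CARD('n)"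

context
  fixes e :: "complex ^ 'n::finite" and s :: real
  assumes e: "norm e = 1" and s: "\<bar>s\<bar> < 1"
begin

lemma hp_unit_self: "hp e e = 1" using e by (simp add: hp_self)

lemma one_minus_sq_pos: "0 < 1 - s\<^sup>2" using s by (simp add: abs_square_less_1)

lemma mob_denominator:
  assumes "norm x \<le> 1" shows "1 + of_real s * hp x e \<noteq> 0" "1 - \<bar>s\<bar> \<le> cmod (1 + of_real s * hp x e)"
proof -
  have "cmod (of_real s * hp x e) \<le> \<bar>s\<bar> * 1"
    unfolding norm_mult using norm_hp_le[of x e] assms e by (intro mult_mono) auto
  moreover have "cmod 1 - cmod (of_real s * hp x e) \<le> cmod (1 + of_real s * hp x e)" by (rule norm_diff_ineq)
  ultimately show 1: "1 - \<bar>s\<bar> \<le> cmod (1 + of_real s * hp x e)" by simp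
  then show "1 + of_real s * hp x e \<noteq> 0" using s by auto
qed

definition mobA :: "complex ^ 'n \<Rightarrow> complex" where "mobA z = 1 - of_real s * hp e z"
definition mobv :: "complex ^ 'n \<Rightarrow> complex ^ 'n" where
  "mobv z = (hp z e - of_real s) *s e + of_real (sqrt (1 - s\<^sup>2)) *s (z - hp z e *s e)"

lemma mob_affine:
  assumes "norm x \<le> 1"
  shows "(1 - hp (mob e s x) z) * (1 + of_real s * hp x e) = mobA z - hp x (mobv z)"
proof -
  define q where "q = 1 + of_real s * hp x e"
  have q: "q \<noteq> 0" using mob_denominator[OF assms] by (simp add: q_def)
  have "hp (mob e s x) z * q = (hp x e + of_real s) * hp e z + of_real (sqrt (1 - s\<^sup>2)) * (hp x z - hp x e * hp e z)"
    unfolding mob_def q_def[symmetric] using q by (simp add: hp_scale_left hp_add_left hp_diff_left field_simps)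
  then have "(1 - hp (mob e s x) z) * q = q - ((hp x e + of_real s) * hp e z + of_real (sqrt (1 - s\<^sup>2)) * (hp x z - hp x e * hp e z))"
    by (simp only: left_diff_distrib mult_1_left)
  moreover have "hp x (mobv z) = (hp e z - of_real s) * hp x e + of_real (sqrt (1 - s\<^sup>2)) * (hp x z - hp e z * hp x e)"
    unfolding mobv_def by (simp add: hp_scale_right hp_add_right hp_diff_right cnj_hp) (simp add: algebra_simps)
  ultimately show ?thesis unfolding q_def[symmetric] by (simp only: q_def mobA_def) (simp add: algebra_simps)
qed

text \<open>The identity behind the invariance of the ball: up to a conjugation, \<open>mobA\<close> and \<open>mobv\<close> are the components of a linear map, restricted to the vectors \<open>(1, z)\<close>, that preserves the indefinite form \<open>a * cnj b - \<langle>v, w\<rangle>\<close> up to the factor \<open>1 - s\<^sup>2\<close>.\<close>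
lemma mobA_mobv: "mobA z * cnj (mobA w) - hp (mobv w) (mobv z) = of_real (1 - s\<^sup>2) * (1 - hp w z)"
proof -
  have sq: "complex_of_real (sqrt (1 - s\<^sup>2)) * complex_of_real (sqrt (1 - s\<^sup>2)) = of_real (1 - s\<^sup>2)"
    unfolding of_real_mult[symmetric] using one_minus_sq_pos by simp
  have "hp (mobv w) (mobv z) = (hp w e - of_real s) * (hp e z - of_real s)
     + (of_real (sqrt (1 - s\<^sup>2)) * of_real (sqrt (1 - s\<^sup>2))) * (hp w z - hp w e * hp e z)"
    unfolding mobv_def
    by (simp add: hp_scale_right hp_add_right hp_diff_right hp_scale_left hp_add_left hp_diff_left cnj_hp hp_unit_self) (simp add: algebra_simps)
  then show ?thesis unfolding sq by (simp add: mobA_def cnj_hp algebra_simps power2_eq_square)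
qed

lemma mobv_less:
  assumes "norm z < 1" shows "norm (mobv z) < cmod (mobA z)"
proof -
  have "complex_of_real ((cmod (mobA z))\<^sup>2 - (norm (mobv z))\<^sup>2) = of_real ((1 - s\<^sup>2) * (1 - (norm z)\<^sup>2))"
    using mobA_mobv[of z z] by (simp only: of_real_diff of_real_mult complex_norm_square[symmetric] hp_self of_real_1 of_real_power)
  then have "(cmod (mobA z))\<^sup>2 - (norm (mobv z))\<^sup>2 = (1 - s\<^sup>2) * (1 - (norm z)\<^sup>2)" by (simp only: of_real_eq_iff)
  moreover have "(norm z)\<^sup>2 < 1" using assms by (simp add: abs_square_less_1)
  then have "(1 - s\<^sup>2) * (1 - (norm z)\<^sup>2) > 0" by (intro mult_pos_pos one_minus_sq_pos) simp
  ultimately have "(norm (mobv z))\<^sup>2 < (cmod (mobA z))\<^sup>2" by linarith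
  then show ?thesis by (rule power_less_imp_less_base) simp
qed

lemma hp_mob:
  assumes "norm x \<le> 1" "norm y \<le> 1"
  shows "1 - hp (mob e s x) (mob e s y) = of_real (1 - s\<^sup>2) * (1 - hp x y) / ((1 + of_real s * hp x e) * cnj (1 + of_real s * hp y e))"
proof -
  define q r where "q = 1 + of_real s * hp x e" and "r = 1 + of_real s * hp y e"
  have qr: "q \<noteq> 0" "r \<noteq> 0" using mob_denominator assms by (auto simp: q_def r_def)
  have sq: "complex_of_real (sqrt (1 - s\<^sup>2)) * complex_of_real (sqrt (1 - s\<^sup>2)) = of_real (1 - s\<^sup>2)"
    unfolding of_real_mult[symmetric] using one_minus_sq_pos by simp
  have "hp (mob e s x) (mob e s y) = inverse q * inverse (cnj r) * ((hp x e + of_real s) * (hp e y + of_real s)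
     + (of_real (sqrt (1 - s\<^sup>2)) * of_real (sqrt (1 - s\<^sup>2))) * (hp x y - hp x e * hp e y))"
    unfolding mob_def q_def[symmetric] r_def[symmetric]
    by (simp add: hp_scale_right hp_add_right hp_diff_right hp_scale_left hp_add_left hp_diff_left cnj_hp hp_unit_self) (simp add: algebra_simps)
  then have "(1 - hp (mob e s x) (mob e s y)) * (q * cnj r) = q * cnj r - ((hp x e + of_real s) * (hp e y + of_real s) + of_real (1 - s\<^sup>2) * (hp x y - hp x e * hp e y))"
    unfolding sq using qr by (simp add: field_simps)
  also have "\<dots> = of_real (1 - s\<^sup>2) * (1 - hp x y)"
    by (simp add: q_def r_def cnj_hp algebra_simps power2_eq_square)
  finally show ?thesis using qr by (simp add: q_def[symmetric] r_def[symmetric] eq_divide_eq)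
qed

lemma norm_mob:
  assumes "norm x = 1" shows "norm (mob e s x) = 1"
proof -
  have "1 - hp (mob e s x) (mob e s x) = 0" using hp_mob[of x x] assms by (simp add: hp_self)
  then have "complex_of_real ((norm (mob e s x))\<^sup>2) = of_real 1" by (simp add: hp_self)
  then have "(norm (mob e s x))\<^sup>2 = 1" by (simp only: of_real_eq_iff)
  then show ?thesis by (simp add: power2_eq_1_iff) (metis norm_ge_zero not_le zero_less_one neg_less_0_iff_less)
qed

lemma one_minus_hp_mob_e:
  assumes "norm x \<le> 1"
  shows "1 - of_real s * hp (mob e s x) e = of_real (1 - s\<^sup>2) / (1 + of_real s * hp x e)"
proof -
  define q where "q = 1 + of_real s * hp x e"
  have q: "q \<noteq> 0" using mob_denominator[OF assms] by (simp add: q_def)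
  have "hp (mob e s x) e = inverse q * (hp x e + of_real s)"
    unfolding mob_def q_def[symmetric] by (simp add: hp_scale_left hp_add_left hp_diff_left hp_unit_self) (simp add: algebra_simps)
  then have "1 - of_real s * hp (mob e s x) e = (q - of_real s * (hp x e + of_real s)) / q"
    unfolding divide_inverse left_diff_distrib right_inverse[OF q] by (simp add: mult_ac)
  also have "q - of_real s * (hp x e + of_real s) = of_real (1 - s\<^sup>2)" by (simp add: q_def algebra_simps power2_eq_square)
  finally show ?thesis by (simp add: q_def)
qed

lemma continuous_on_mob: "continuous_on (sphere 0 1) (mob e s)"
proof -
  have "continuous_on (sphere 0 1) (\<lambda>x. \<chi> i. inverse (1 + of_real s * hp x e) * ((hp x e + of_real s) * e $ i + of_real (sqrt (1 - s\<^sup>2)) * (x $ i - hp x e * e $ i)))"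
    by (intro continuous_intros ballI mob_denominator(1)) auto
  then show ?thesis
    by (rule continuous_on_eq) (simp add: mob_def vec_eq_iff distrib_left right_diff_distrib mult_ac)
qed

lemma jac_pos: "norm x = 1 \<Longrightarrow> 0 < jac e s x"
  unfolding jac_def using one_minus_sq_pos mob_denominator(1)[of x] by (intro zero_less_power divide_pos_pos) auto

lemma continuous_on_jac: "continuous_on (sphere 0 1) (jac e s)"
  unfolding jac_def using mob_denominator(1) by (intro continuous_intros ballI) auto

text \<open>By \<open>mob_affine\<close>, the composition of the Szego kernel with the automorphism is again a Szego kernel, with the pole moved, and the Jacobian cancels the denominators.\<close>
lemma szego_mob:
  fixes z w :: "complex ^ 'n"
  assumes z: "norm z < 1" and w: "norm w < 1"
  shows "(\<integral>x. inverse (1 - hp (mob e s x) z) ^ CARD('n) * cnj (inverse (1 - hp (mob e s x) w) ^ CARD('n)) * of_real (jac e s x) \<partial>surf)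
    = of_real (smom TYPE('n) 0) * inverse (1 - hp w z) ^ CARD('n)"
proof -
  let ?N = "CARD('n)"
  have nz: "mobA z \<noteq> 0" "mobA w \<noteq> 0" using mobv_less[OF z] mobv_less[OF w] by auto
  define y where "y = inverse (cnj (mobA z)) *s mobv z"
  define v where "v = inverse (cnj (mobA w)) *s mobv w"
  have yv: "norm y < 1" "norm v < 1"
    using mobv_less[OF z] mobv_less[OF w] nz
    by (simp_all add: y_def v_def norm_smult norm_inverse inverse_eq_divide norm_divide divide_less_eq)
  have hy: "mobA z - hp x (mobv z) = mobA z * (1 - hp x y)" "mobA w - hp x (mobv w) = mobA w * (1 - hp x v)" for x
    using nz by (simp_all add: y_def v_def hp_scale_right right_diff_distrib)
  have pt: "inverse (1 - hp (mob e s x) z) ^ ?N * cnj (inverse (1 - hp (mob e s x) w) ^ ?N) * of_real (jac e s x)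
     = (of_real (1 - s\<^sup>2) * inverse (mobA z) * inverse (cnj (mobA w))) ^ ?N * (inverse (1 - hp x y) ^ ?N * cnj (inverse (1 - hp x v) ^ ?N))"
    if x: "norm x = 1" for x
  proof -
    define q where "q = 1 + of_real s * hp x e"
    have q: "q \<noteq> 0" using mob_denominator(1)[of x] x by (simp add: q_def)
    have 1: "1 - hp (mob e s x) z = mobA z * (1 - hp x y) / q" "1 - hp (mob e s x) w = mobA w * (1 - hp x v) / q"
      using mob_affine[of x z] mob_affine[of x w] x q unfolding hy q_def[symmetric] by (simp_all add: eq_divide_eq)
    have J: "complex_of_real (jac e s x) = (of_real (1 - s\<^sup>2) / (q * cnj q)) ^ ?N"
      unfolding jac_def q_def[symmetric] complex_norm_square[symmetric] by (simp only: of_real_power of_real_divide)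
    have "inverse (1 - hp (mob e s x) z) * cnj (inverse (1 - hp (mob e s x) w)) * (of_real (1 - s\<^sup>2) / (q * cnj q))
      = of_real (1 - s\<^sup>2) * inverse (mobA z) * inverse (cnj (mobA w)) * (inverse (1 - hp x y) * cnj (inverse (1 - hp x v)))"
    proof -
      have "inverse (A * X / q) * cnj (inverse (B * Y / q)) * (c / (q * cnj q)) = c * inverse A * inverse (cnj B) * (inverse X * cnj (inverse Y))"
        for A B X Y c :: complex using q by (simp add: divide_inverse) (simp add: field_simps)
      then show ?thesis unfolding 1 .
    qed
    then have "(inverse (1 - hp (mob e s x) z) * cnj (inverse (1 - hp (mob e s x) w)) * (of_real (1 - s\<^sup>2) / (q * cnj q))) ^ ?N
      = (of_real (1 - s\<^sup>2) * inverse (mobA z) * inverse (cnj (mobA w)) * (inverse (1 - hp x y) * cnj (inverse (1 - hp x v)))) ^ ?N" by (simp only:)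
    then show ?thesis unfolding J by (simp only: power_mult_distrib complex_cnj_power)
  qed
  have "(\<integral>x. inverse (1 - hp (mob e s x) z) ^ ?N * cnj (inverse (1 - hp (mob e s x) w) ^ ?N) * of_real (jac e s x) \<partial>surf)
    = (\<integral>x. (of_real (1 - s\<^sup>2) * inverse (mobA z) * inverse (cnj (mobA w))) ^ ?N * (inverse (1 - hp x y) ^ ?N * cnj (inverse (1 - hp x v) ^ ?N)) \<partial>surf)"
    by (rule Bochner_Integration.integral_cong[OF refl], rule pt) simp
  also have "\<dots> = (of_real (1 - s\<^sup>2) * inverse (mobA z) * inverse (cnj (mobA w))) ^ ?N * (of_real (smom TYPE('n) 0) * inverse (1 - hp v y) ^ ?N)"
    unfolding integral_mult_right_zero szego[OF yv] ..
  also have "\<dots> = of_real (smom TYPE('n) 0) * (of_real (1 - s\<^sup>2) * inverse (mobA z * cnj (mobA w) * (1 - hp v y))) ^ ?N"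
    by (simp add: power_mult_distrib mult_ac)
  also have "mobA z * cnj (mobA w) * (1 - hp v y) = mobA z * cnj (mobA w) - hp (mobv w) (mobv z)"
    using nz by (simp add: y_def v_def hp_scale_left hp_scale_right right_diff_distrib field_simps)
  also have "\<dots> = of_real (1 - s\<^sup>2) * (1 - hp w z)" by (rule mobA_mobv)
  also have "of_real (1 - s\<^sup>2) * inverse (of_real (1 - s\<^sup>2) * (1 - hp w z)) = inverse (1 - hp w z)"
  proof -
    have "complex_of_real (1 - s\<^sup>2) \<noteq> 0" using one_minus_sq_pos by (simp only: of_real_eq_0_iff)
    then have "c = complex_of_real (1 - s\<^sup>2) \<Longrightarrow> c * inverse (c * X) = inverse X" for c X
      by (simp add: mult.assoc[symmetric])
    then show ?thesis by blast
  qed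
  finally show ?thesis .
qed

end

section \<open>The change of variables formula\<close>

text \<open>A weighted self-map of the sphere is studied through the integrals of products of two Szego
  kernels: these generate all moments, which generate the Laplace transform.\<close>

locale weighted_map =
  fixes \<theta> :: "complex ^ 'n::finite \<Rightarrow> complex ^ 'n" and J :: "complex ^ 'n \<Rightarrow> real"
  assumes cont_map: "continuous_on (sphere 0 1) \<theta>" and cont_weight: "continuous_on (sphere 0 1) J"
    and norm_map: "norm x = 1 \<Longrightarrow> norm (\<theta> x) = 1"
begin

definition Mom :: "complex ^ 'n \<Rightarrow> nat \<Rightarrow> nat \<Rightarrow> complex" where
  "Mom v k l = (\<integral>x. hp (\<theta> x) v ^ k * cnj (hp (\<theta> x) v ^ l) * of_real (J x) \<partial>surf)"

definition Szego :: "complex ^ 'n \<Rightarrow> complex ^ 'n \<Rightarrow> complex" where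
  "Szego z w = (\<integral>x. inverse (1 - hp (\<theta> x) z) ^ CARD('n) * cnj (inverse (1 - hp (\<theta> x) w) ^ CARD('n)) * of_real (J x) \<partial>surf)"

definition Mix :: "complex ^ 'n \<Rightarrow> complex ^ 'n \<Rightarrow> nat \<Rightarrow> complex" where
  "Mix v w k = (\<integral>x. hp (\<theta> x) v ^ k * (cnj (inverse (1 - hp (\<theta> x) w) ^ CARD('n)) * of_real (J x)) \<partial>surf)"

lemma continuous_on_hp_map: "continuous_on (sphere 0 1) (\<lambda>x. hp (\<theta> x) v)"
  by (intro continuous_intros cont_map)

lemma measurable_hp_map: "(\<lambda>x. hp (\<theta> x) v) \<in> borel_measurable surf"
  using borel_measurable_integrable[OF integrable_sphere_continuous[OF continuous_on_hp_map]] .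

lemma norm_hp_map: "norm x = 1 \<Longrightarrow> cmod (hp (\<theta> x) v) \<le> norm v"
  using norm_hp_less[of "\<theta> x" v] norm_map by simp

lemma continuous_on_kernel_map:
  assumes "norm v < 1"
  shows "continuous_on (sphere 0 1) (\<lambda>x. inverse (1 - hp (\<theta> x) v) ^ CARD('n))"
proof (intro continuous_on_power continuous_on_inverse continuous_on_diff continuous_on_const continuous_on_hp_map ballI)
  fix x :: "complex ^ 'n" assume "x \<in> sphere 0 1"
  then have "cmod (hp (\<theta> x) v) < 1" using norm_hp_map[of x v] assms by auto
  then show "1 - hp (\<theta> x) v \<noteq> 0" by auto
qed

lemma scaled_vector: "cmod t < 1 \<Longrightarrow> norm v < 1 \<Longrightarrow> norm (cnj t *s v :: complex ^ 'n) < 1"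
  using mult_strict_mono[of "cmod t" 1 "norm v" 1] by (cases "norm v = 0") (auto simp: norm_smult)

lemma Mix_sums:
  assumes v: "norm v < 1" and w: "norm w < 1" and t: "cmod t < 1"
  shows "(\<lambda>k. of_real (bcoef (real CARD('n)) k) * Mix v w k * t ^ k) sums Szego (cnj t *s v) w"
proof -
  have i: "integrable surf (\<lambda>x. cnj (inverse (1 - hp (\<theta> x) w) ^ CARD('n)) * of_real (J x))"
    by (intro integrable_sphere_continuous continuous_on_mult continuous_on_cnj continuous_on_kernel_map w continuous_on_of_real cont_weight)
  from integral_inverse_power_sums[OF measurable_hp_map norm_hp_map scaled_vector[OF t v] norm_ge_zero i]
  show ?thesis by (simp add: Mix_def Szego_def hp_scale_right power_mult_distrib mult_ac)
qed

lemma Mom_sums: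
  assumes v: "norm v < 1" and t: "cmod t < 1"
  shows "(\<lambda>l. of_real (bcoef (real CARD('n)) l) * Mom v l k * t ^ l) sums cnj (Mix v (cnj t *s v) k)"
proof -
  have i: "integrable surf (\<lambda>x. cnj (hp (\<theta> x) v ^ k) * of_real (J x))"
    by (intro integrable_sphere_continuous continuous_intros continuous_on_hp_map cont_weight)
  have c: "integrable surf (\<lambda>x. hp (\<theta> x) v ^ k * (cnj (inverse (1 - hp (\<theta> x) (cnj t *s v)) ^ CARD('n)) * of_real (J x)))"
    by (intro integrable_sphere_continuous continuous_on_mult continuous_on_cnj continuous_on_kernel_map continuous_on_hp_map continuous_on_power
        scaled_vector t v continuous_on_of_real cont_weight)
  have "cnj (Mix v (cnj t *s v) k) = (\<integral>x. inverse (1 - hp (\<theta> x) (cnj t *s v)) ^ CARD('n) * (cnj (hp (\<theta> x) v ^ k) * of_real (J x)) \<partial>surf)"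
    unfolding Mix_def integrable_cnj_integral(2)[OF c, symmetric] by (simp add: mult_ac)
  then show ?thesis
    using integral_inverse_power_sums[OF measurable_hp_map norm_hp_map scaled_vector[OF t v] norm_ge_zero i]
    by (simp add: Mom_def hp_scale_right power_mult_distrib mult_ac)
qed

lemma Mom_scaleR: "Mom (r *\<^sub>R v) k l = of_real (r ^ (k + l)) * Mom v k l"
  unfolding Mom_def hp_scaleR_right
  by (subst integral_mult_right_zero[symmetric]) (simp add: scaleR_conv_of_real power_mult_distrib power_add mult_ac)

lemma exp_sums:
  assumes i: "integrable surf \<phi>"
  shows "(\<lambda>k. of_real (inverse (fact k)) * (\<integral>x. hp (\<theta> x) v ^ k * \<phi> x \<partial>surf)) sums (\<integral>x. exp (hp (\<theta> x) v) * \<phi> x \<partial>surf)"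
proof (rule integral_powser_sums[OF measurable_hp_map norm_hp_map _ _ i])
  show "summable (\<lambda>k. cmod (complex_of_real (inverse (fact k))) * norm v ^ k)"
    using summable_exp[of "norm v"] by (simp add: norm_inverse)
  show "(\<lambda>k. of_real (inverse (fact k)) * w ^ k) sums exp w" for w :: complex
    using exp_converges[of w] by (simp add: scaleR_conv_of_real)
qed

text \<open>The real exponential is written as \<open>exp h * cnj (exp h)\<close> with \<open>h = \<langle>\<theta> x, v\<rangle> / 2\<close>, so that only mixed moments of one complex linear form occur.\<close>
lemma laplace_Mom:
  "of_real (\<integral>x. exp (inner (\<theta> x) v) * J x \<partial>surf)
    = (\<Sum>k. of_real (inverse (fact k)) * cnj (\<Sum>l. of_real (inverse (fact l)) * Mom (v /\<^sub>R 2) l k))"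
proof -
  define h where "h x = hp (\<theta> x) (v /\<^sub>R 2)" for x
  have cont: "continuous_on (sphere 0 1) h" unfolding h_def by (rule continuous_on_hp_map)
  have i: "integrable surf (\<lambda>x. cnj (h x ^ k) * of_real (J x))" for k
    by (intro integrable_sphere_continuous continuous_intros cont cont_weight)
  have ie: "integrable surf (\<lambda>x. cnj (exp (h x)) * of_real (J x))"
    by (intro integrable_sphere_continuous continuous_intros cont cont_weight)
  have c: "integrable surf (\<lambda>x. exp (h x) * (cnj (h x ^ k) * of_real (J x)))" for k
    by (intro integrable_sphere_continuous continuous_intros cont cont_weight)
  have 1: "(\<integral>x. exp (h x) * (cnj (h x ^ k) * of_real (J x)) \<partial>surf) = (\<Sum>l. of_real (inverse (fact l)) * Mom (v /\<^sub>R 2) l k)" for k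
    using exp_sums[OF i[of k], of "v /\<^sub>R 2"] unfolding h_def[symmetric] by (simp add: sums_iff Mom_def h_def mult.assoc)
  have 2: "(\<integral>x. h x ^ k * (cnj (exp (h x)) * of_real (J x)) \<partial>surf) = cnj (\<integral>x. exp (h x) * (cnj (h x ^ k) * of_real (J x)) \<partial>surf)" for k
    unfolding integrable_cnj_integral(2)[OF c, symmetric] by (simp add: mult_ac)
  have "(\<integral>x. exp (h x) * (cnj (exp (h x)) * of_real (J x)) \<partial>surf) = (\<Sum>k. of_real (inverse (fact k)) * cnj (\<Sum>l. of_real (inverse (fact l)) * Mom (v /\<^sub>R 2) l k))"
    using exp_sums[OF ie, of "v /\<^sub>R 2"] unfolding h_def[symmetric] 2 1 by (simp add: sums_iff)
  moreover have "exp (h x) * (cnj (exp (h x)) * of_real (J x)) = of_real (exp (inner (\<theta> x) v) * J x)" for x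
  proof -
    have "exp (h x) * cnj (exp (h x)) = of_real ((exp (Re (h x)))\<^sup>2)" by (simp only: complex_norm_square[symmetric] norm_exp_eq_Re)
    also have "(exp (Re (h x)))\<^sup>2 = exp (inner (\<theta> x) v)" by (simp add: h_def Re_hp power2_eq_square exp_add[symmetric])
    finally show ?thesis by (simp only: mult.assoc[symmetric] of_real_mult)
  qed
  ultimately show ?thesis by (simp only: integral_complex_of_real)
qed

end

text \<open>Comparing Taylor coefficients in the two arguments \<open>z\<close> and \<open>w\<close> separately, both taken along multiples of a vector \<open>v\<close>, isolates the moments.\<close>
lemma Szego_determines_laplace:
  assumes A: "weighted_map \<theta> J" and B: "weighted_map \<theta>' J'"
    and eq: "\<And>z w. norm z < 1 \<Longrightarrow> norm w < 1 \<Longrightarrow> weighted_map.Szego \<theta> J z w = weighted_map.Szego \<theta>' J' z w"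
  shows "(\<integral>x. exp (inner (\<theta> x) v) * J x \<partial>surf) = (\<integral>x. exp (inner (\<theta>' x) v) * J' x \<partial>surf)"
proof -
  interpret A: weighted_map \<theta> J by fact
  interpret B: weighted_map \<theta>' J' by fact
  have b: "bcoef (real CARD('a)) k \<noteq> 0" for k using bcoef_pos[of "real CARD('a)" k] by simp
  have Mix: "A.Mix v w k = B.Mix v w k" if vw: "norm v < 1" "norm w < 1" for v w k
  proof -
    have "(\<lambda>k. of_real (bcoef (real CARD('a)) k) * B.Mix v w k * t ^ k) sums A.Szego (cnj t *s v) w" if t: "cmod t < 1" for t
      using B.Mix_sums[OF vw t] eq[OF A.scaled_vector[OF t vw(1)] vw(2)] by simp
    from powser_unique[OF A.Mix_sums[OF vw] this, of k] show ?thesis using b[of k] by simp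
  qed
  have Mom1: "A.Mom v l k = B.Mom v l k" if v: "norm v < 1" for v l k
  proof -
    have "(\<lambda>l. of_real (bcoef (real CARD('a)) l) * B.Mom v l k * t ^ l) sums cnj (A.Mix v (cnj t *s v) k)" if t: "cmod t < 1" for t
      using B.Mom_sums[OF v t] Mix[OF v A.scaled_vector[OF t v], of k] by simp
    from powser_unique[OF A.Mom_sums[OF v] this, of l] show ?thesis using b[of l] by simp
  qed
  have Mom: "A.Mom v l k = B.Mom v l k" for v l k
  proof -
    define u where "u = v /\<^sub>R (1 + norm v)"
    have "norm u < 1" by (simp add: u_def divide_less_eq inverse_eq_divide add_pos_nonneg)
    moreover have "1 + norm v \<noteq> 0" using norm_ge_zero[of v] by linarith
    then have "v = (1 + norm v) *\<^sub>R u" by (simp add: u_def)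
    ultimately show ?thesis using Mom1[of u] A.Mom_scaleR B.Mom_scaleR by metis
  qed
  show ?thesis using A.laplace_Mom[of v] B.laplace_Mom[of v] unfolding Mom by (simp only: of_real_eq_iff[where 'a=complex, symmetric])
qed

inductive exp_span :: "('a::real_inner \<Rightarrow> real) \<Rightarrow> bool" where
  exp_span_gen: "exp_span (\<lambda>x. c * exp (inner x v))"
| exp_span_add: "exp_span f \<Longrightarrow> exp_span g \<Longrightarrow> exp_span (\<lambda>x. f x + g x)"

lemma exp_span_continuous: "exp_span f \<Longrightarrow> continuous_on A f"
  by (induction rule: exp_span.induct) (auto intro!: continuous_intros)

lemma exp_span_mult:
  assumes "exp_span f" "exp_span g" shows "exp_span (\<lambda>x. f x * g x)"
  using assms(1)
proof (induction rule: exp_span.induct)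
  case (exp_span_gen c v)
  show ?case using assms(2)
  proof (induction rule: exp_span.induct)
    case (exp_span_gen d w)
    have "(\<lambda>x. c * exp (inner x v) * (d * exp (inner x w))) = (\<lambda>x. c * d * exp (inner x (v + w)))"
      by (simp add: inner_add_right exp_add mult_ac)
    then show ?case using exp_span.exp_span_gen[of "c * d" "v + w"] by simp
  qed (simp add: distrib_left exp_span_add)
qed (simp add: distrib_right exp_span_add)

text \<open>The exponentials are closed under multiplication, so Stone-Weierstrass applies to their span.\<close>

lemma exp_span_dense:
  fixes g :: "'a::real_inner \<Rightarrow> real"
  assumes "compact S" "continuous_on S g" "0 < \<epsilon>"
  shows "\<exists>h. exp_span h \<and> (\<forall>x\<in>S. \<bar>g x - h x\<bar> < \<epsilon>)"
proof (rule Stone_Weierstrass_HOL[OF assms(1) _ exp_span_continuous _ _ _ assms(2,3)])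
  show "exp_span (\<lambda>x::'a. c)" for c using exp_span_gen[of c 0] by simp
  fix x y :: 'a assume "x \<in> S \<and> y \<in> S \<and> x \<noteq> y"
  then have "inner (x - y) (x - y) \<noteq> 0" by simp
  then have "1 * exp (inner x (x - y)) \<noteq> 1 * exp (inner y (x - y))" by (simp add: inner_diff_left)
  then show "\<exists>f. exp_span f \<and> f x \<noteq> f y" using exp_span_gen[of 1 "x - y"] by blast
qed (auto intro: exp_span_add exp_span_mult)

lemma integral_continuous_eq:
  assumes A: "weighted_map \<theta> J" and J: "\<And>x. norm x = 1 \<Longrightarrow> 0 \<le> J x"
    and lap: "\<And>v. (\<integral>x. exp (inner (\<theta> x) v) * J x \<partial>surf) = (\<integral>x. exp (inner x v) \<partial>surf)"
    and g: "continuous_on (sphere 0 1) g"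
  shows "(\<integral>x. g (\<theta> x) * J x \<partial>surf) = (\<integral>x. g x \<partial>surf)"
proof (rule ccontr)
  interpret A: weighted_map \<theta> J by fact
  have i: "integrable surf (\<lambda>x. h (\<theta> x) * J x)" if "continuous_on (sphere 0 1) h" for h :: "complex ^ 'a \<Rightarrow> real"
    using A.norm_map by (intro integrable_sphere_continuous continuous_on_mult A.cont_weight continuous_on_compose2[OF that A.cont_map]) auto
  have sp: "(\<integral>x. h (\<theta> x) * J x \<partial>surf) = (\<integral>x. h x \<partial>surf)" if "exp_span h" for h :: "complex ^ 'a \<Rightarrow> real"
    using that
  proof (induction rule: exp_span.induct)
    case (exp_span_gen c v)
    show ?case using lap[of v] by (simp add: mult.assoc)
  next
    case (exp_span_add f h)
    then show ?case
      using i[OF exp_span_continuous[OF exp_span_add.hyps(1)]] i[OF exp_span_continuous[OF exp_span_add.hyps(2)]]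
        integrable_sphere_continuous[OF exp_span_continuous[OF exp_span_add.hyps(1)]]
        integrable_sphere_continuous[OF exp_span_continuous[OF exp_span_add.hyps(2)]]
      by (simp add: distrib_right)
  qed
  define C where "C = (\<integral>x. J x \<partial>surf) + smom TYPE('a) 0 + 1"
  define d where "d = \<bar> (\<integral>x. g (\<theta> x) * J x \<partial>surf) - (\<integral>x. g x \<partial>surf) \<bar>"
  have "0 \<le> (\<integral>x. J x \<partial>surf)" using J by (intro integral_nonneg_AE AE_I2) auto
  then have C: "0 < C" using smom_pos[where 'n='a, of 0] by (simp add: C_def)
  assume "(\<integral>x. g (\<theta> x) * J x \<partial>surf) \<noteq> (\<integral>x. g x \<partial>surf)"
  then have d: "0 < d" by (simp add: d_def)
  obtain h where h: "exp_span h" and gh: "\<And>x. x \<in> sphere 0 1 \<Longrightarrow> \<bar>g x - h x\<bar> < d / C"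
    using exp_span_dense[OF compact_sphere g, of "d / C"] d C by auto
  note ch = exp_span_continuous[OF h, of "sphere 0 1"]
  have "\<bar> (\<integral>x. g (\<theta> x) * J x \<partial>surf) - (\<integral>x. h (\<theta> x) * J x \<partial>surf) \<bar> \<le> (\<integral>x. d / C * J x \<partial>surf)"
  proof -
    have "(\<integral>x. g (\<theta> x) * J x \<partial>surf) - (\<integral>x. h (\<theta> x) * J x \<partial>surf) = (\<integral>x. g (\<theta> x) * J x - h (\<theta> x) * J x \<partial>surf)"
      using i[OF g] i[OF ch] by simp
    also have "\<bar>\<dots>\<bar> \<le> (\<integral>x. \<bar>g (\<theta> x) * J x - h (\<theta> x) * J x\<bar> \<partial>surf)" by (rule integral_abs_bound)
    also have "\<dots> \<le> (\<integral>x. d / C * J x \<partial>surf)"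
    proof (intro integral_mono integrable_abs Bochner_Integration.integrable_diff i g ch continuous_on_const)
      fix x :: "complex ^ 'a" assume "x \<in> space surf"
      then have "\<bar>g (\<theta> x) - h (\<theta> x)\<bar> * J x \<le> d / C * J x" using gh[of "\<theta> x"] A.norm_map J by (intro mult_right_mono) auto
      moreover have "\<bar>g (\<theta> x) * J x - h (\<theta> x) * J x\<bar> = \<bar>g (\<theta> x) - h (\<theta> x)\<bar> * J x"
        using J[of x] \<open>x \<in> space surf\<close> by (simp add: left_diff_distrib[symmetric] abs_mult)
      ultimately show "\<bar>g (\<theta> x) * J x - h (\<theta> x) * J x\<bar> \<le> d / C * J x" by simp
    qed
    finally show ?thesis .
  qed
  moreover have "\<bar> (\<integral>x. g x \<partial>surf) - (\<integral>x. h x \<partial>surf) \<bar> \<le> (\<integral>x. d / C \<partial>(surf :: (complex ^ 'a) measure))"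
  proof -
    have "(\<integral>x. g x \<partial>surf) - (\<integral>x. h x \<partial>surf) = (\<integral>x. g x - h x \<partial>surf)"
      by (intro Bochner_Integration.integral_diff[symmetric] integrable_sphere_continuous g ch)
    also have "\<bar>\<dots>\<bar> \<le> (\<integral>x. \<bar>g x - h x\<bar> \<partial>surf)" by (rule integral_abs_bound)
    also have "\<dots> \<le> (\<integral>x. d / C \<partial>(surf :: (complex ^ 'a) measure))"
    proof (rule integral_mono)
      show "integrable surf (\<lambda>x. \<bar>g x - h x\<bar>)"
        by (intro integrable_abs Bochner_Integration.integrable_diff integrable_sphere_continuous g ch)
      show "\<bar>g x - h x\<bar> \<le> d / C" if "x \<in> space surf" for x using gh[of x] that by simp
    qed simp
    finally show ?thesis .
  qed
  ultimately have "d \<le> d / C * (\<integral>x. J x \<partial>surf) + d / C * smom TYPE('a) 0"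
    unfolding d_def[symmetric] sp[OF h] by (simp add: d_def smom_0 mult.commute)
  also have "\<dots> = d / C * C - d / C" by (simp add: C_def distrib_left)
  also have "\<dots> = d - d / C" using C by simp
  finally show False using d C by (simp add: divide_le_0_iff)
qed

text \<open>A closed set is the decreasing limit of continuous functions of its distance.\<close>

lemma finite_measure_eqI_continuous:
  fixes M N :: "'a::metric_space measure"
  assumes fin: "finite_measure M" "finite_measure N" and sets: "sets M = sets borel" "sets N = sets borel"
    and eq: "\<And>g::'a \<Rightarrow> real. continuous_on UNIV g \<Longrightarrow> (\<integral>x. g x \<partial>M) = (\<integral>x. g x \<partial>N)"
  shows "M = N"
proof (rule measure_eqI_generator_eq[where \<Omega>=UNIV and E="Collect closed" and A="\<lambda>_. UNIV"])
  interpret M: finite_measure M by fact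
  interpret N: finite_measure N by fact
  show "Int_stable (Collect closed :: 'a set set)" by (auto simp: Int_stable_def)
  have b: "sets borel = sigma_sets UNIV (Collect closed :: 'a set set)" by (simp add: borel_eq_closed)
  show "sets M = sigma_sets UNIV (Collect closed)" "sets N = sigma_sets UNIV (Collect closed)" using sets b by auto
  show "emeasure M UNIV \<noteq> \<infinity>" for i :: nat by simp
  fix X :: "'a set" assume "X \<in> Collect closed"
  then have X: "closed X" by simp
  show "emeasure M X = emeasure N X"
  proof (cases "X = {}")
    case False
    define g where "g k x = max 0 (1 - real k * infdist x X)" for k x
    have cont: "continuous_on UNIV (g k)" for k unfolding g_def by (intro continuous_intros)
    have lim: "(\<lambda>k. \<integral>x. g k x \<partial>L) \<longlonglongrightarrow> measure L X" if L: "finite_measure L" "sets L = sets borel" for L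
    proof -
      interpret L: finite_measure L by fact
      have [measurable]: "X \<in> sets L" using X L by simp
      have "(\<lambda>k. \<integral>x. g k x \<partial>L) \<longlonglongrightarrow> (\<integral>x. indicator X x \<partial>L)"
      proof (rule integral_dominated_convergence[where w="\<lambda>_. 1"])
        show "g k \<in> borel_measurable L" for k using borel_measurable_continuous_onI[OF cont] L by (simp cong: measurable_cong_sets)
        show "AE x in L. (\<lambda>k. g k x) \<longlonglongrightarrow> indicator X x"
        proof (rule AE_I2)
          fix x
          show "(\<lambda>k. g k x) \<longlonglongrightarrow> indicator X x"
          proof (cases "x \<in> X")
            case True then show ?thesis by (simp add: g_def)
          next
            case x: False
            then have pos: "0 < infdist x X" using infdist_pos_not_in_closed[OF X False] by simp
            obtain K where K: "1 < real K * infdist x X" using ex_less_of_nat_mult[OF pos] by auto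
            have "\<forall>k\<ge>K. g k x = 0"
            proof (intro allI impI)
              fix k assume "K \<le> k"
              then have "real K * infdist x X \<le> real k * infdist x X" using pos by (intro mult_right_mono) auto
              then show "g k x = 0" using K by (simp add: g_def)
            qed
            then show ?thesis using x by (intro tendsto_eventually) (auto simp: eventually_sequentially)
          qed
        qed
        show "AE x in L. norm (g k x) \<le> 1" for k by (auto simp: g_def infdist_nonneg)
      qed auto
      then show ?thesis by simp
    qed
    have "measure M X = measure N X"
      using lim[OF fin(1) sets(1)] lim[OF fin(2) sets(2)] unfolding eq[OF cont] by (rule LIMSEQ_unique)
    then show ?thesis by (simp add: M.emeasure_eq_measure N.emeasure_eq_measure)
  qed simp
qed auto

theorem nn_integral_mob:
  fixes e :: "complex ^ 'n::finite"
  assumes e: "norm e = 1" and s: "\<bar>s\<bar> < 1" and G: "G \<in> borel_measurable surf"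
  shows "(\<integral>\<^sup>+x. G (mob e s x) * ennreal (jac e s x) \<partial>surf) = (\<integral>\<^sup>+x. G x \<partial>surf)"
proof -
  let ?S = "surf :: (complex ^ 'n) measure"
  have A: "weighted_map (mob e s) (jac e s)"
    by unfold_locales (use continuous_on_mob[OF e s] continuous_on_jac[OF e s] norm_mob[OF e s] in auto)
  have B: "weighted_map (\<lambda>x :: complex ^ 'n. x) (\<lambda>_. 1)" by unfold_locales auto
  have "weighted_map.Szego (mob e s) (jac e s) z w = weighted_map.Szego (\<lambda>x :: complex ^ 'n. x) (\<lambda>_. 1) z w"
    if "norm z < 1" "norm w < 1" for z w
    unfolding weighted_map.Szego_def[OF A] weighted_map.Szego_def[OF B]
    using szego_mob[OF e s that] szego[OF that] by simp
  then have lap: "(\<integral>x. exp (inner (mob e s x) v) * jac e s x \<partial>?S) = (\<integral>x. exp (inner x v) \<partial>?S)" for v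
    using Szego_determines_laplace[OF A B, of v] by simp
  have J: "norm x = 1 \<Longrightarrow> 0 \<le> jac e s x" for x using jac_pos[OF e s, of x] by simp
  note cont = integral_continuous_eq[OF A J lap]
  have mob_borel: "mob e s \<in> borel_measurable ?S"
    using borel_measurable_continuous_on_restrict[OF continuous_on_mob[OF e s]] by (simp cong: measurable_cong_sets)
  have mob_S [measurable]: "mob e s \<in> measurable ?S ?S"
    unfolding measurable_cong_sets[OF refl sets_sphere_measure]
    by (rule measurable_restrict_space2[OF _ mob_borel]) (use norm_mob[OF e s] in auto)
  have jac_S [measurable]: "jac e s \<in> borel_measurable ?S"
    by (rule borel_measurable_integrable[OF integrable_sphere_continuous[OF continuous_on_jac[OF e s]]])
  define M where "M = distr (density ?S (\<lambda>x. ennreal (jac e s x))) borel (mob e s)"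
  define N where "N = distr ?S borel (\<lambda>x. x)"
  have id: "(\<lambda>x. x) \<in> measurable ?S borel" by (rule measurable_sphere_borel)
  have mob_d: "mob e s \<in> measurable (density ?S (\<lambda>x. ennreal (jac e s x))) borel" using mob_borel by simp
  have "M = N"
  proof (rule finite_measure_eqI_continuous)
    show "finite_measure N" unfolding N_def using id by (rule sph.finite_measure_distr)
    have "finite_measure (density ?S (\<lambda>x. ennreal (jac e s x)))"
    proof (rule finite_measureI)
      have "(\<integral>\<^sup>+x. ennreal (jac e s x) \<partial>?S) = ennreal (\<integral>x. jac e s x \<partial>?S)"
        using J by (intro nn_integral_eq_integral integrable_sphere_continuous continuous_on_jac[OF e s]) auto
      moreover have "emeasure (density ?S (\<lambda>x. ennreal (jac e s x))) (space ?S) = (\<integral>\<^sup>+x. ennreal (jac e s x) \<partial>?S)"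
        using sets.top[of ?S] by (subst emeasure_density) (auto intro!: nn_integral_cong simp del: space_sphere_measure simp: indicator_def)
      ultimately show "emeasure (density ?S (\<lambda>x. ennreal (jac e s x))) (space (density ?S (\<lambda>x. ennreal (jac e s x)))) \<noteq> \<infinity>"
        by simp
    qed
    then show "finite_measure M" unfolding M_def using mob_d by (rule finite_measure.finite_measure_distr)
    fix g :: "complex ^ 'n \<Rightarrow> real" assume g: "continuous_on UNIV g"
    note [measurable] = borel_measurable_continuous_onI[OF g]
    have [measurable]: "(\<lambda>x. g (mob e s x)) \<in> borel_measurable ?S" using measurable_compose[OF mob_borel, of g borel] by simp
    have "(\<integral>x. g x \<partial>M) = (\<integral>x. g (mob e s x) \<partial>density ?S (\<lambda>x. ennreal (jac e s x)))"
      unfolding M_def by (rule integral_distr[OF mob_d]) simp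
    also have "\<dots> = (\<integral>x. g (mob e s x) * jac e s x \<partial>?S)"
      using J by (subst integral_real_density) (auto simp: mult.commute)
    also have "\<dots> = (\<integral>x. g x \<partial>?S)" by (intro cont continuous_on_subset[OF g]) auto
    also have "\<dots> = (\<integral>x. g x \<partial>N)" unfolding N_def by (rule integral_distr[OF id, symmetric]) simp
    finally show "(\<integral>x. g x \<partial>M) = (\<integral>x. g x \<partial>N)" .
  qed (simp_all add: M_def N_def)
  define H where "H x = (if x \<in> sphere 0 1 then G x else 0)" for x
  have H: "H \<in> borel_measurable borel"
    using G unfolding H_def by (subst (asm) measurable_cong_sets[OF sets_sphere_measure refl]) (simp add: borel_measurable_restrict_space_iff_ennreal indicator_def of_bool_def if_distrib cong: if_cong)
  have "(\<integral>\<^sup>+x. G (mob e s x) * ennreal (jac e s x) \<partial>?S) = (\<integral>\<^sup>+x. ennreal (jac e s x) * H (mob e s x) \<partial>?S)"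
    by (rule nn_integral_cong) (simp add: H_def norm_mob[OF e s] mult.commute)
  also have "\<dots> = (\<integral>\<^sup>+x. H (mob e s x) \<partial>density ?S (\<lambda>x. ennreal (jac e s x)))"
    using measurable_compose[OF mob_borel H] by (subst nn_integral_density) auto
  also have "\<dots> = (\<integral>\<^sup>+x. H x \<partial>M)" unfolding M_def by (rule nn_integral_distr[OF mob_d, symmetric]) (simp add: H)
  also have "\<dots> = (\<integral>\<^sup>+x. H x \<partial>N)" by (simp only: \<open>M = N\<close>)
  also have "(\<integral>\<^sup>+x. H x \<partial>N) = (\<integral>\<^sup>+x. H x \<partial>?S)" unfolding N_def by (rule nn_integral_distr[OF id]) (simp add: H)
  also have "\<dots> = (\<integral>\<^sup>+x. G x \<partial>?S)" by (rule nn_integral_cong) (simp add: H_def)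
  finally show ?thesis .
qed

section \<open>Conformal invariance and the moment condition\<close>

definition jac1 :: "complex ^ 'n::finite \<Rightarrow> real \<Rightarrow> complex ^ 'n \<Rightarrow> real" where
  "jac1 e s x = (1 - s\<^sup>2) / (cmod (1 + of_real s * hp x e))\<^sup>2"

definition dil :: "complex ^ 'n::finite \<Rightarrow> real \<Rightarrow> complex ^ 'n \<Rightarrow> real" where
  "dil e s x = (cmod (1 - of_real s * hp x e))\<^sup>2 / (1 - s\<^sup>2)"

lemma jac_jac1: "jac e s x = jac1 e s x ^ CARD('n)" for x :: "complex ^ 'n::finite"
  by (simp add: jac_def jac1_def)

context
  fixes e :: "complex ^ 'n::finite" and s :: real
  assumes e: "norm e = 1" and s: "\<bar>s\<bar> < 1"
begin

lemma jac1_pos: "norm x = 1 \<Longrightarrow> 0 < jac1 e s x"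
  unfolding jac1_def using one_minus_sq_pos[OF e s] mob_denominator(1)[OF e s, of x] by (intro divide_pos_pos) auto

text \<open>The Jacobian in terms of the image point. In the norm of a pulled back function it turns into a weight on the original one.\<close>
lemma jac1_dil: 
  assumes "norm x = 1" shows "jac1 e s x = dil e s (mob e s x)"
proof -
  define r where "r = cmod (1 + of_real s * hp x e)"
  have r: "r \<noteq> 0" using mob_denominator(1)[OF e s, of x] assms by (simp add: r_def)
  have "cmod (1 - of_real s * hp (mob e s x) e) = (1 - s\<^sup>2) / r"
    using one_minus_hp_mob_e[OF e s, of x] assms one_minus_sq_pos[OF e s] by (simp add: norm_divide norm_of_real r_def del: of_real_diff)
  then show ?thesis unfolding dil_def jac1_def r_def[symmetric] using one_minus_sq_pos[OF e s] r by (simp add: power_divide power2_eq_square)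
qed

text \<open>The kernel transforms by a product of powers of the Jacobian at the two points; this is the conformal covariance of the problem.\<close>
lemma kern_mob:
  assumes "norm x = 1" "norm y = 1"
  shows "kern \<alpha> (hp (mob e s x) (mob e s y)) = kern \<alpha> (hp x y) * (jac1 e s x powr (- \<alpha>) * jac1 e s y powr (- \<alpha>))"
proof -
  have c2: "(X powr 2) powr (- a) = X powr (- (2 * a))" for X a :: real by (simp add: powr_powr)
  define q r where "q = cmod (1 + of_real s * hp x e)" and "r = cmod (1 + of_real s * hp y e)"
  have qr: "0 < q" "0 < r" using mob_denominator(1)[OF e s, of x] mob_denominator(1)[OF e s, of y] assms by (auto simp: q_def r_def)
  define X where "X = cmod (1 - hp x y)"
  have c: "cmod (1 - hp (mob e s x) (mob e s y)) = (1 - s\<^sup>2) * X / (q * r)"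
    unfolding hp_mob[OF e s eq_refl[OF assms(1)] eq_refl[OF assms(2)]] norm_divide norm_mult norm_of_real complex_mod_cnj q_def r_def X_def
    using one_minus_sq_pos[OF e s] by simp
  have sq: "v powr (- (2 * \<alpha>)) = (v\<^sup>2) powr (- \<alpha>)" if "0 \<le> v" for v :: real
    using that c2[of v \<alpha>] by (cases "v = 0") (simp_all add: powr_numeral)
  have "kern \<alpha> (hp (mob e s x) (mob e s y)) = (((1 - s\<^sup>2) * X / (q * r))\<^sup>2) powr (- \<alpha>)"
    unfolding kern_def c using qr one_minus_sq_pos[OF e s] by (intro sq) (auto simp: X_def)
  also have "((1 - s\<^sup>2) * X / (q * r))\<^sup>2 = X\<^sup>2 * (jac1 e s x * jac1 e s y)"
    by (simp add: jac1_def q_def r_def power_mult_distrib power_divide) (simp add: power2_eq_square)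
  also have "\<dots> powr (- \<alpha>) = (X\<^sup>2) powr (- \<alpha>) * (jac1 e s x powr (- \<alpha>) * jac1 e s y powr (- \<alpha>))"
    using jac1_pos assms by (simp add: powr_mult)
  also have "(X\<^sup>2) powr (- \<alpha>) = kern \<alpha> (hp x y)" unfolding kern_def X_def[symmetric] by (rule sq[symmetric]) (simp add: X_def)
  finally show ?thesis .
qed

lemma measurable_mob: "mob e s \<in> measurable surf surf"
proof -
  have "mob e s \<in> borel_measurable surf"
    using borel_measurable_continuous_on_restrict[OF continuous_on_mob[OF e s]] by (simp cong: measurable_cong_sets)
  then show ?thesis unfolding measurable_cong_sets[OF refl sets_sphere_measure]
    by (intro measurable_restrict_space2) (use norm_mob[OF e s] in auto)
qed

lemma measurable_jac1: "jac1 e s \<in> borel_measurable surf"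
  unfolding jac1_def[abs_def] using measurable_sphere_borel by measurable

end

lemma exp_le_quadratic:
  fixes z :: real
  assumes "z \<le> 1 / 2" shows "exp z \<le> 1 + z + 2 * z\<^sup>2"
proof -
  have "1 \<le> (1 + z + 2 * z\<^sup>2) * (1 - z)"
  proof -
    have "0 \<le> z\<^sup>2 * (1 - 2 * z)" using assms by simp
    then show ?thesis by (simp add: algebra_simps power2_eq_square)
  qed
  also have "\<dots> \<le> (1 + z + 2 * z\<^sup>2) * exp (- z)"
  proof (rule mult_left_mono)
    show "1 - z \<le> exp (- z)" using exp_ge_add_one_self[of "- z"] by simp
    have "1 + z + 2 * z\<^sup>2 = 7 / 8 + 2 * (z + 1 / 4)\<^sup>2" by (simp add: power2_eq_square algebra_simps)
    then show "0 \<le> 1 + z + 2 * z\<^sup>2" by (simp add: add_nonneg_nonneg)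
  qed
  finally have "1 * exp z \<le> (1 + z + 2 * z\<^sup>2) * exp (- z) * exp z" by (intro mult_right_mono) auto
  then show ?thesis unfolding mult.assoc by (simp add: exp_add[symmetric])
qed

lemma powr_le_quadratic:
  fixes \<gamma> y :: real
  assumes "-1 \<le> y" "0 < \<gamma>" "\<gamma> * y \<le> 1 / 2"
  shows "(1 + y) powr \<gamma> \<le> 1 + \<gamma> * y + 2 * (\<gamma> * y)\<^sup>2"
proof -
  have "(1 + y) powr \<gamma> \<le> exp y powr \<gamma>" using assms exp_ge_add_one_self[of y] by (intro powr_mono2) auto
  also have "\<dots> = exp (\<gamma> * y)" by (simp add: powr_def)
  also have "\<dots> \<le> 1 + \<gamma> * y + 2 * (\<gamma> * y)\<^sup>2" by (rule exp_le_quadratic[OF assms(3)])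
  finally show ?thesis .
qed

text \<open>To first order in \<open>s\<close> the weight is \<open>1 - 2 \<gamma> s \<langle>x, e\<rangle>\<close>. The constants only need to be independent of \<open>x\<close>.\<close>
lemma dil_powr_le:
  fixes e x :: "complex ^ 'n::finite"
  assumes e: "norm e = 1" and x: "norm x = 1" and \<gamma>: "0 < \<gamma>" and s: "\<bar>s\<bar> \<le> 1 / 2" "12 * \<gamma> * \<bar>s\<bar> \<le> 1"
  shows "dil e s x powr \<gamma> \<le> 1 - 2 * \<gamma> * s * inner x e + (4 * \<gamma> + 72 * \<gamma>\<^sup>2) * s\<^sup>2"
proof -
  define t where "t = inner x e"
  have t: "\<bar>t\<bar> \<le> 1" using Cauchy_Schwarz_ineq2[of x e] e x by (simp add: t_def)
  have ss: "s\<^sup>2 \<le> 1 / 4" using power_mono[OF s(1) abs_ge_zero, of 2] by (simp add: power2_eq_square)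
  have ss': "s\<^sup>2 \<le> \<bar>s\<bar>" using mult_left_mono[of "\<bar>s\<bar>" 1 "\<bar>s\<bar>"] s(1) by (simp add: power2_eq_square abs_mult[symmetric])
  have h: "(cmod (hp x e))\<^sup>2 \<le> 1" using norm_hp_le[of x e] e x by (simp add: power_le_one)
  have "(cmod (1 - of_real s * hp x e))\<^sup>2 = 1 - 2 * s * t + s\<^sup>2 * (cmod (hp x e))\<^sup>2"
    unfolding cmod_power2 t_def Re_hp[symmetric] by (simp add: power2_eq_square algebra_simps)
  also have "\<dots> \<le> 1 - 2 * s * t + s\<^sup>2" using mult_left_mono[OF h, of "s\<^sup>2"] by simp
  also have "\<dots> \<le> (1 + (- 2 * s * t + 4 * s\<^sup>2)) * (1 - s\<^sup>2)"
  proof -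
    have "\<bar>s * t\<bar> \<le> 1 / 2" unfolding abs_mult using mult_mono[OF s(1) t] by simp
    then have "0 \<le> s\<^sup>2 * (2 + 2 * (s * t) - 4 * s\<^sup>2)" using ss by (intro mult_nonneg_nonneg) (auto simp: abs_le_iff)
    then show ?thesis by (simp add: algebra_simps power2_eq_square)
  qed
  finally have le: "dil e s x \<le> 1 + (- 2 * s * t + 4 * s\<^sup>2)" unfolding dil_def using ss by (simp add: divide_le_eq)
  define y where "y = - 2 * s * t + 4 * s\<^sup>2"
  have d0: "0 \<le> dil e s x" using ss by (simp add: dil_def)
  have yb: "\<bar>y\<bar> \<le> 6 * \<bar>s\<bar>"
  proof -
    have "\<bar>y\<bar> \<le> \<bar>2 * s * t\<bar> + \<bar>4 * s\<^sup>2\<bar>" unfolding y_def by linarith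
    also have "\<bar>2 * s * t\<bar> = 2 * (\<bar>s\<bar> * \<bar>t\<bar>)" by (simp add: abs_mult)
    also have "\<bar>s\<bar> * \<bar>t\<bar> \<le> \<bar>s\<bar>" using mult_left_mono[OF t, of "\<bar>s\<bar>"] by simp
    finally show ?thesis using ss' by simp
  qed
  have gy: "\<bar>\<gamma> * y\<bar> \<le> \<gamma> * (6 * \<bar>s\<bar>)" unfolding abs_mult using \<gamma> yb by simp
  have "dil e s x powr \<gamma> \<le> (1 + y) powr \<gamma>" using le d0 \<gamma> by (intro powr_mono2) (auto simp: y_def)
  also have "\<dots> \<le> 1 + \<gamma> * y + 2 * (\<gamma> * y)\<^sup>2" using le d0 \<gamma> gy s(2) by (intro powr_le_quadratic) (auto simp: y_def)
  also have "(\<gamma> * y)\<^sup>2 \<le> (\<gamma> * (6 * \<bar>s\<bar>))\<^sup>2" using gy by (intro abs_le_square_iff[THEN iffD1]) (use \<gamma> in auto)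
  also have "1 + \<gamma> * y + 2 * (\<gamma> * (6 * \<bar>s\<bar>))\<^sup>2 = 1 - 2 * \<gamma> * s * t + (4 * \<gamma> + 72 * \<gamma>\<^sup>2) * s\<^sup>2"
    by (simp add: y_def power_mult_distrib algebra_simps)
  finally show ?thesis by (simp add: t_def)
qed

lemma linear_coefficient_nonpos:
  fixes a K :: real
  assumes d: "0 < d" and le: "\<And>s. 0 < s \<Longrightarrow> s \<le> d \<Longrightarrow> a * s \<le> K * s\<^sup>2"
  shows "a \<le> 0"
proof (rule field_le_epsilon)
  fix \<epsilon> :: real assume \<epsilon>: "0 < \<epsilon>"
  define s where "s = min d (\<epsilon> / (\<bar>K\<bar> + 1))"
  have "s \<le> \<epsilon> / (\<bar>K\<bar> + 1)" by (simp add: s_def)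
  then have "s * (\<bar>K\<bar> + 1) \<le> \<epsilon>" by (simp add: pos_le_divide_eq)
  moreover have "0 < s" "s \<le> d" using d \<epsilon> by (simp_all add: s_def)
  ultimately have s: "0 < s" "s \<le> d" "s * (\<bar>K\<bar> + 1) \<le> \<epsilon>" by auto
  have "a * s \<le> K * s * s" using le[OF s(1,2)] by (simp add: power2_eq_square mult.assoc)
  then have "a \<le> K * s" using s by (simp add: mult_le_cancel_right)
  also have "\<dots> \<le> s * (\<bar>K\<bar> + 1)" using s(1) abs_ge_self[of K] by (simp add: mult.commute add_increasing2)
  finally show "a \<le> 0 + \<epsilon>" using s by linarith
qed

lemma linear_coefficient_zero:
  fixes a K :: real
  assumes d: "0 < d" and le: "\<And>s. \<bar>s\<bar> \<le> d \<Longrightarrow> a * s \<le> K * s\<^sup>2"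
  shows "a = 0"
  using linear_coefficient_nonpos[OF d, of a K] linear_coefficient_nonpos[OF d, of "- a" K] le[of "s" for s] le[of "- s" for s]
  by fastforce

context subcritical
begin

definition pull :: "complex ^ 'n \<Rightarrow> real \<Rightarrow> (complex ^ 'n \<Rightarrow> real) \<Rightarrow> complex ^ 'n \<Rightarrow> real" where
  "pull e s w x = w (mob e s x) * jac1 e s x powr (real CARD('n) - \<alpha>)"

definition \<gamma> :: real where "\<gamma> = p * (real CARD('n) - \<alpha>) - real CARD('n)"

lemma \<gamma>_pos: "0 < \<gamma>"
  using pN \<alpha> by (simp add: \<gamma>_def divide_less_eq mult.commute)

lemma Bil_nonneg_integral:
  assumes f: "Lr p f" and f0: "\<And>x. norm x = 1 \<Longrightarrow> 0 \<le> f x"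
  shows "ennreal (Bil f f) = (\<integral>\<^sup>+x. \<integral>\<^sup>+y. ennreal (f x * f y * kern \<alpha> (hp x y)) \<partial>S \<partial>S)"
proof -
  have "ennreal (Bil f f) = (\<integral>\<^sup>+z. ennreal (f (fst z) * f (snd z) * kern \<alpha> (hp (fst z) (snd z))) \<partial>sph2)"
    unfolding Bil_def using f0
    by (intro nn_integral_eq_integral[symmetric] integrable_Bil f AE_I2) (auto simp: space_sph2 kern_def intro!: mult_nonneg_nonneg)
  also have "\<dots> = (\<integral>\<^sup>+x. \<integral>\<^sup>+y. ennreal (f x * f y * kern \<alpha> (hp x y)) \<partial>S \<partial>S)"
    by (subst sph.nn_integral_fst[symmetric]) (use borel_measurable_integrable[OF integrable_Bil[OF f f]] in auto)
  finally show ?thesis .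
qed

context
  fixes w :: "complex ^ 'n \<Rightarrow> real" and e :: "complex ^ 'n" and s :: real
  assumes w: "Lr p w" "\<And>x. 0 \<le> w x" and e: "norm e = 1" and s: "\<bar>s\<bar> < 1"
begin

lemma pull_nn_integral: "(\<integral>\<^sup>+x. ennreal (\<bar>pull e s w x\<bar> powr p) \<partial>S) = (\<integral>\<^sup>+x. ennreal (\<bar>w x\<bar> powr p * dil e s x powr \<gamma>) \<partial>S)"
proof -
  have [measurable]: "dil e s \<in> borel_measurable S" unfolding dil_def[abs_def] using measurable_sphere_borel by measurable
  note [measurable] = Lr_measurable[OF w(1)]
  have "(\<integral>\<^sup>+x. ennreal (\<bar>pull e s w x\<bar> powr p) \<partial>S)
    = (\<integral>\<^sup>+x. ennreal (\<bar>w (mob e s x)\<bar> powr p * dil e s (mob e s x) powr \<gamma>) * ennreal (jac e s x) \<partial>S)"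
  proof (rule nn_integral_cong)
    fix x assume "x \<in> space S"
    then have x: "norm x = 1" by simp
    note j = jac1_pos[OF e s x]
    have "\<bar>pull e s w x\<bar> powr p = \<bar>w (mob e s x)\<bar> powr p * jac1 e s x powr (\<gamma> + real CARD('n))"
      by (simp add: pull_def abs_mult powr_mult powr_powr \<gamma>_def mult.commute)
    also have "\<dots> = \<bar>w (mob e s x)\<bar> powr p * jac1 e s x powr \<gamma> * jac e s x"
      using j by (simp add: powr_add powr_realpow jac_jac1)
    finally show "ennreal (\<bar>pull e s w x\<bar> powr p) = ennreal (\<bar>w (mob e s x)\<bar> powr p * dil e s (mob e s x) powr \<gamma>) * ennreal (jac e s x)"
      using jac_pos[OF e s x] by (simp add: ennreal_mult[symmetric] jac1_dil[OF e s x])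
  qed
  also have "\<dots> = (\<integral>\<^sup>+x. ennreal (\<bar>w x\<bar> powr p * dil e s x powr \<gamma>) \<partial>S)" by (rule nn_integral_mob[OF e s]) measurable
  finally show ?thesis .
qed

lemma integrable_dil: "integrable S (\<lambda>x. \<bar>w x\<bar> powr p * dil e s x powr \<gamma>)"
proof (rule integrable_bounded_factor)
  show "integrable S (\<lambda>x. \<bar>w x\<bar> powr p)" using w by (simp add: Lr_def)
  show "(\<lambda>x. dil e s x powr \<gamma>) \<in> borel_measurable S" unfolding dil_def[abs_def] using measurable_sphere_borel by measurable
  fix x assume "x \<in> space S"
  then have "cmod (of_real s * hp x e) \<le> 1 * 1" unfolding norm_mult using s norm_hp_le[of x e] e by (intro mult_mono) auto
  then have "cmod (1 - of_real s * hp x e) \<le> 2" using norm_triangle_ineq4[of 1 "of_real s * hp x e"] by simp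
  then have "(cmod (1 - of_real s * hp x e))\<^sup>2 \<le> 2\<^sup>2" by (intro power_mono) auto
  then have "dil e s x \<le> 2\<^sup>2 / (1 - s\<^sup>2)" unfolding dil_def using one_minus_sq_pos[OF e s] by (intro divide_right_mono) auto
  then show "norm (dil e s x powr \<gamma>) \<le> (2\<^sup>2 / (1 - s\<^sup>2)) powr \<gamma>"
    using \<gamma>_pos one_minus_sq_pos[OF e s] by (simp add: dil_def powr_mono2)
qed

lemma Lr_pull: "Lr p (pull e s w)" "(\<integral>x. \<bar>pull e s w x\<bar> powr p \<partial>S) = (\<integral>x. \<bar>w x\<bar> powr p * dil e s x powr \<gamma> \<partial>S)"
proof -
  note [measurable] = measurable_compose[OF measurable_mob[OF e s] Lr_measurable[OF w(1)]] measurable_jac1[OF e s]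
  have m: "pull e s w \<in> borel_measurable S" unfolding pull_def[abs_def] by measurable
  note [measurable] = m
  have eq: "(\<integral>\<^sup>+x. ennreal (\<bar>pull e s w x\<bar> powr p) \<partial>S) = ennreal (\<integral>x. \<bar>w x\<bar> powr p * dil e s x powr \<gamma> \<partial>S)"
    unfolding pull_nn_integral by (intro nn_integral_eq_integral integrable_dil) auto
  have "integrable S (\<lambda>x. \<bar>pull e s w x\<bar> powr p)" by (rule integrableI_nonneg) (use eq in auto)
  with m show "Lr p (pull e s w)" by (simp add: Lr_def)
  show "(\<integral>x. \<bar>pull e s w x\<bar> powr p \<partial>S) = (\<integral>x. \<bar>w x\<bar> powr p * dil e s x powr \<gamma> \<partial>S)"
    using eq by (intro integral_eq_nn_integral[THEN trans]) (auto simp: integral_nonneg_AE)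
qed

text \<open>The exponent of the Jacobian is chosen so that the energy does not change.\<close>

lemma Bil_pull: "Bil (pull e s w) (pull e s w) = Bil w w"
proof -
  let ?F = "\<lambda>x y. w x * w y * kern \<alpha> (hp x y)"
  note [measurable] = Lr_measurable[OF w(1)]
  have F[measurable]: "(\<lambda>z. ?F (fst z) (snd z)) \<in> borel_measurable sph2" by (rule borel_measurable_integrable[OF integrable_Bil[OF w(1) w(1)]])
  have pt: "ennreal (pull e s w x * pull e s w y * kern \<alpha> (hp x y)) = ennreal (?F (mob e s x) (mob e s y)) * ennreal (jac e s y) * ennreal (jac e s x)"
    if x: "norm x = 1" and y: "norm y = 1" for x y
  proof -
    have "pull e s w x = w (mob e s x) * (jac1 e s x powr (- \<alpha>) * jac e s x)" if "norm x = 1" for x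
      using jac1_pos[OF e s that] by (simp add: pull_def jac_jac1 powr_realpow[symmetric] powr_add[symmetric])
    then have "pull e s w x * pull e s w y * kern \<alpha> (hp x y) = ?F (mob e s x) (mob e s y) * jac e s y * jac e s x"
      unfolding kern_mob[OF e s x y] using x y by simp
    then show ?thesis using jac_pos[OF e s x] jac_pos[OF e s y] w(2) by (simp add: ennreal_mult[symmetric] kern_def)
  qed
  have in1: "(\<integral>\<^sup>+y. ennreal (?F (mob e s x) (mob e s y)) * ennreal (jac e s y) * ennreal (jac e s x) \<partial>S) = (\<integral>\<^sup>+y. ennreal (?F (mob e s x) y) \<partial>S) * ennreal (jac e s x)"
    if x: "norm x = 1" for x
  proof -
    have m: "(\<lambda>y. ennreal (?F (mob e s x) y)) \<in> borel_measurable S"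
      using measurable_compose[OF measurable_Pair1'[of "mob e s x" S S] F] norm_mob[OF e s x] by simp
    have "(\<integral>\<^sup>+y. ennreal (?F (mob e s x) (mob e s y)) * ennreal (jac e s y) * ennreal (jac e s x) \<partial>S)
      = (\<integral>\<^sup>+y. ennreal (?F (mob e s x) (mob e s y)) * ennreal (jac e s y) \<partial>S) * ennreal (jac e s x)"
    proof (rule nn_integral_multc)
      note [measurable] = measurable_compose[OF measurable_mob[OF e s] m] borel_measurable_integrable[OF integrable_sphere_continuous[OF continuous_on_jac[OF e s]]]
      show "(\<lambda>y. ennreal (?F (mob e s x) (mob e s y)) * ennreal (jac e s y)) \<in> borel_measurable S"
        by (intro borel_measurable_times_ennreal measurable_compose[OF measurable_mob[OF e s] m]) measurable
    qed
    also have "(\<integral>\<^sup>+y. ennreal (?F (mob e s x) (mob e s y)) * ennreal (jac e s y) \<partial>S) = (\<integral>\<^sup>+y. ennreal (?F (mob e s x) y) \<partial>S)"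
      by (rule nn_integral_mob[OF e s m])
    finally show ?thesis .
  qed
  have p0: "0 \<le> pull e s w x" if "norm x = 1" for x using w(2) by (simp add: pull_def)
  have "ennreal (Bil (pull e s w) (pull e s w)) = (\<integral>\<^sup>+x. \<integral>\<^sup>+y. ennreal (pull e s w x * pull e s w y * kern \<alpha> (hp x y)) \<partial>S \<partial>S)"
    by (rule Bil_nonneg_integral[OF Lr_pull(1) p0])
  also have "\<dots> = (\<integral>\<^sup>+x. \<integral>\<^sup>+y. ennreal (?F (mob e s x) (mob e s y)) * ennreal (jac e s y) * ennreal (jac e s x) \<partial>S \<partial>S)"
    by (intro nn_integral_cong pt) auto
  also have "\<dots> = (\<integral>\<^sup>+x. (\<integral>\<^sup>+y. ennreal (?F (mob e s x) y) \<partial>S) * ennreal (jac e s x) \<partial>S)"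
    by (intro nn_integral_cong in1) auto
  also have "\<dots> = (\<integral>\<^sup>+x. \<integral>\<^sup>+y. ennreal (?F x y) \<partial>S \<partial>S)"
  proof (rule nn_integral_mob[OF e s])
    have "(\<lambda>(x, y). ennreal (?F x y)) \<in> borel_measurable (S \<Otimes>\<^sub>M S)" using F by (simp add: case_prod_unfold)
    from sph.borel_measurable_nn_integral[OF this] show "(\<lambda>x. \<integral>\<^sup>+y. ennreal (?F x y) \<partial>S) \<in> borel_measurable S" .
  qed
  also have "\<dots> = ennreal (Bil w w)" by (rule Bil_nonneg_integral[OF w(1) w(2), symmetric])
  finally show ?thesis using Bil_self_nonneg[OF w(1)] Bil_self_nonneg[OF Lr_pull(1)] by simp
qed

end

text \<open>Pulling back a maximizer cannot push its norm below 1, to first order in \<open>s\<close>; both signs of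
  \<open>s\<close> occur.\<close>

lemma moment_condition:
  fixes w :: "complex ^ 'n \<Rightarrow> real"
  assumes w: "Lr p w" "\<And>x. 0 \<le> w x" and n: "(\<integral>x. \<bar>w x\<bar> powr p \<partial>S) = 1" and B: "Bil w w = Lam" and e: "norm e = 1"
  shows "(\<integral>x. \<bar>w x\<bar> powr p * inner x e \<partial>S) = 0"
proof -
  define T where "T = (\<integral>x. \<bar>w x\<bar> powr p * inner x e \<partial>S)"
  have ip: "integrable S (\<lambda>x. \<bar>w x\<bar> powr p)" using w by (simp add: Lr_def)
  have im: "(\<lambda>x. inner x e) \<in> borel_measurable S" using measurable_sphere_borel by measurable
  have it: "integrable S (\<lambda>x. \<bar>w x\<bar> powr p * inner x e)"
    by (rule integrable_bounded_factor[OF ip im, where B=1]) (use e order_trans[OF Cauchy_Schwarz_ineq2[of _ e]] in auto)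
  have ge: "1 \<le> (\<integral>x. \<bar>w x\<bar> powr p * dil e s x powr \<gamma> \<partial>S)" (is "1 \<le> ?I s") if s: "\<bar>s\<bar> < 1" for s
  proof (rule ccontr)
    assume "\<not> 1 \<le> ?I s"
    \<comment> \<open>The maximum keeps \<open>c\<close> positive.\<close>
    define c where "c = max (1 / 2) (?I s)"
    have c: "0 < c" "c < 1" "?I s \<le> c" using \<open>\<not> 1 \<le> ?I s\<close> by (auto simp: c_def)
    have "Lam \<le> Lam * c powr (2 / p)"
      using Bil_le_Lam_scaled[OF Lr_pull(1)[OF w e s] c(1)] c(3) B
      by (simp add: Lr_pull(2)[OF w e s] Bil_pull[OF w e s])
    moreover have "c powr (2 / p) < 1 powr (2 / p)" using c p0 by (intro powr_less_mono2) auto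
    then have "Lam * c powr (2 / p) < Lam * 1" using Lam_pos by (intro mult_strict_left_mono) auto
    ultimately show False by simp
  qed
  define d where "d = min (1 / 2) (1 / (12 * \<gamma>))"
  define K where "K = 4 * \<gamma> + 72 * \<gamma>\<^sup>2"
  have d: "0 < d" using \<gamma>_pos by (simp add: d_def)
  have "(2 * \<gamma> * T) * s \<le> K * s\<^sup>2" if s: "\<bar>s\<bar> \<le> d" for s
  proof -
    have s': "\<bar>s\<bar> \<le> 1 / 2" "12 * \<gamma> * \<bar>s\<bar> \<le> 1" using s \<gamma>_pos by (auto simp: d_def field_simps)
    then have s1: "\<bar>s\<bar> < 1" by simp
    have "1 \<le> ?I s" by (rule ge[OF s1])
    also have "\<dots> \<le> (\<integral>x. (1 + K * s\<^sup>2) * \<bar>w x\<bar> powr p - 2 * \<gamma> * s * (\<bar>w x\<bar> powr p * inner x e) \<partial>S)"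
    proof (rule integral_mono[OF integrable_dil[OF w e s1]])
      show "integrable S (\<lambda>x. (1 + K * s\<^sup>2) * \<bar>w x\<bar> powr p - 2 * \<gamma> * s * (\<bar>w x\<bar> powr p * inner x e))" using ip it by simp
      fix x assume "x \<in> space S"
      then have "dil e s x powr \<gamma> \<le> 1 - 2 * \<gamma> * s * inner x e + K * s\<^sup>2"
        unfolding K_def by (intro dil_powr_le e \<gamma>_pos s') simp
      from mult_left_mono[OF this, of "\<bar>w x\<bar> powr p"]
      show "\<bar>w x\<bar> powr p * dil e s x powr \<gamma> \<le> (1 + K * s\<^sup>2) * \<bar>w x\<bar> powr p - 2 * \<gamma> * s * (\<bar>w x\<bar> powr p * inner x e)"
        by (simp add: algebra_simps)
    qed
    also have "\<dots> = 1 + K * s\<^sup>2 - 2 * \<gamma> * s * T" using ip it n by (simp add: T_def)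
    finally show ?thesis by (simp add: mult_ac)
  qed
  from linear_coefficient_zero[OF d this] show ?thesis using \<gamma>_pos by (simp add: T_def)
qed

end

section \<open>The second variation\<close>

lemma powr_le_cubic:
  fixes p :: real
  obtains C where "0 \<le> C" "\<And>y. \<bar>y\<bar> \<le> 1 / 2 \<Longrightarrow> (1 + y) powr p \<le> 1 + p * y + p * (p - 1) / 2 * y\<^sup>2 + C * \<bar>y\<bar> ^ 3"
proof
  define C where "C = \<bar>p * (p - 1) * (p - 2)\<bar> / 6 * 2 powr \<bar>p - 3\<bar>"
  show "0 \<le> C" by (simp add: C_def)
  define diff where "diff m z = (\<Prod>i<m. p - real i) * z powr (p - real m)" for m and z :: real
  have D: "\<forall>m t. m < 3 \<and> 1 / 2 \<le> t \<and> t \<le> 3 / 2 \<longrightarrow> DERIV (diff m) t :> diff (Suc m) t"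
  proof (intro allI impI)
    fix m :: nat and t :: real assume "m < 3 \<and> 1 / 2 \<le> t \<and> t \<le> 3 / 2"
    then have "0 < t" by simp
    from DERIV_cmult[OF has_real_derivative_powr[OF this, of "p - real m"], of "\<Prod>i<m. p - real i"]
    show "DERIV (diff m) t :> diff (Suc m) t" by (simp add: diff_def[abs_def] mult_ac diff_diff_eq add.commute)
  qed
  fix y :: real assume y: "\<bar>y\<bar> \<le> 1 / 2"
  show "(1 + y) powr p \<le> 1 + p * y + p * (p - 1) / 2 * y\<^sup>2 + C * \<bar>y\<bar> ^ 3"
  proof (cases "y = 0")
    case False
    have "\<exists>t. (if 1 + y < 1 then 1 + y < t \<and> t < 1 else 1 < t \<and> t < 1 + y) \<and>
      (1 + y) powr p = (\<Sum>m<3. (diff m 1 / fact m) * (1 + y - 1) ^ m) + (diff 3 t / fact 3) * (1 + y - 1) ^ 3"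
      using False y by (intro Taylor[OF _ _ D]) (auto simp: diff_def)
    then obtain t where t': "if 1 + y < 1 then 1 + y < t \<and> t < 1 else 1 < t \<and> t < 1 + y"
      and eq: "(1 + y) powr p = (\<Sum>m<3. (diff m 1 / fact m) * y ^ m) + (diff 3 t / fact 3) * y ^ 3"
      by (simp only: add_diff_cancel_left') blast
    have t: "1 / 2 \<le> t" "t \<le> 3 / 2" using y t' by (auto simp: abs_le_iff split: if_splits)
    have "t powr (p - 3) \<le> 2 powr \<bar>p - 3\<bar>"
    proof -
      have "\<bar>ln t\<bar> \<le> ln 2"
      proof -
        have "ln t \<le> ln 2" using t by simp
        moreover have "ln (1 / 2) \<le> ln t" using t by (subst ln_le_cancel_iff) auto
        ultimately show ?thesis by (simp add: ln_div abs_le_iff)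
      qed
      then have "\<bar>p - 3\<bar> * \<bar>ln t\<bar> \<le> \<bar>p - 3\<bar> * ln 2" by (intro mult_left_mono) auto
      then have "(p - 3) * ln t \<le> \<bar>p - 3\<bar> * ln 2" using abs_ge_self[of "(p - 3) * ln t"] by (simp add: abs_mult)
      then show ?thesis using t by (simp add: powr_def)
    qed
    moreover have "diff 3 t = p * (p - 1) * (p - 2) * t powr (p - 3)" by (simp add: diff_def numeral_3_eq_3)
    ultimately have "\<bar>diff 3 t / fact 3\<bar> \<le> C"
      unfolding C_def by (simp add: abs_mult fact_numeral divide_right_mono mult_left_mono)
    then have "\<bar>diff 3 t / fact 3\<bar> * \<bar>y\<bar> ^ 3 \<le> C * \<bar>y\<bar> ^ 3" by (intro mult_right_mono) auto
    then have "(diff 3 t / fact 3) * y ^ 3 \<le> C * \<bar>y\<bar> ^ 3"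
      using abs_ge_self[of "(diff 3 t / fact 3) * y ^ 3"] by (simp add: abs_mult power_abs)
    moreover have "(\<Sum>m<3. (diff m 1 / fact m) * y ^ m) = 1 + p * y + p * (p - 1) / 2 * y\<^sup>2"
      by (simp add: diff_def numeral_3_eq_3 power2_eq_square)
    ultimately show ?thesis unfolding eq by simp
  qed simp
qed

definition crit_exp :: "real \<Rightarrow> real \<Rightarrow> real" where "crit_exp \<alpha> N = N / (N - \<alpha>)"

context subcritical
begin

text \<open>By the moment condition the norm of \<open>w (1 + \<epsilon> \<langle>x, e\<rangle>)\<close> has no linear term in \<open>\<epsilon>\<close>. Adding the inequalities
  for \<open>\<epsilon>\<close> and \<open>-\<epsilon>\<close> removes the linear term of the energy and leaves the terms of second order.\<close>
lemma second_variation: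
  fixes w :: "complex ^ 'n \<Rightarrow> real"
  assumes w: "Lr p w" "\<And>x. 0 \<le> w x" and n: "(\<integral>x. \<bar>w x\<bar> powr p \<partial>S) = 1" and B: "Bil w w = Lam" and e: "norm e = 1"
  defines "v \<equiv> \<lambda>x. w x * inner x e"
  shows "Bil v v \<le> (p - 1) * Lam * (\<integral>x. \<bar>w x\<bar> powr p * (inner x e)\<^sup>2 \<partial>S)"
proof -
  define M where "M = (\<integral>x. \<bar>w x\<bar> powr p * (inner x e)\<^sup>2 \<partial>S)"
  have T: "(\<integral>x. \<bar>w x\<bar> powr p * inner x e \<partial>S) = 0" by (rule moment_condition[OF w n B e])
  have \<psi>: "\<bar>inner x e\<bar> \<le> 1" if "norm x = 1" for x using order_trans[OF Cauchy_Schwarz_ineq2[of x e]] that e by auto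
  have \<psi>m: "(\<lambda>x. inner x e) \<in> borel_measurable S" using measurable_sphere_borel by measurable
  note [measurable] = \<psi>m
  have ip: "integrable S (\<lambda>x. \<bar>w x\<bar> powr p)" using w by (simp add: Lr_def)
  have it: "integrable S (\<lambda>x. \<bar>w x\<bar> powr p * inner x e)"
    by (rule integrable_bounded_factor[OF ip \<psi>m, where B=1]) (use \<psi> in auto)
  have it2: "integrable S (\<lambda>x. \<bar>w x\<bar> powr p * (inner x e)\<^sup>2)"
    by (rule integrable_bounded_factor[OF ip, where B=1]) (use \<psi> in \<open>auto simp: abs_square_le_1\<close>)
  have v: "Lr p v" unfolding v_def by (rule Lr_mult_bounded[OF w(1) \<psi>m \<psi> p0])
  have M0: "0 \<le> M" unfolding M_def by (intro integral_nonneg_AE AE_I2) simp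
  obtain C where C: "0 \<le> C" and cub: "\<And>y. \<bar>y\<bar> \<le> 1 / 2 \<Longrightarrow> (1 + y) powr p \<le> 1 + p * y + p * (p - 1) / 2 * y\<^sup>2 + C * \<bar>y\<bar> ^ 3"
    using powr_le_cubic[of p] by blast
  define K where "K = (p - 1) * M + 2 / p * C"
  define K' where "K' = 2 / p * C + 2 * K\<^sup>2"
  have K: "0 \<le> K" using M0 C p1 by (simp add: K_def)
  \<comment> \<open>For \<open>\<bar>\<epsilon>\<bar> \<le> d\<close> the perturbed norm stays in the range of \<open>powr_le_quadratic\<close>.\<close>
  define d where "d = 1 / (2 * (K + 1))"
  have d: "0 < d" "d \<le> 1 / 2" "K * d \<le> 1 / 2" using K by (auto simp: d_def field_simps)
  have var: "2 * \<epsilon> * Bil w v + \<epsilon>\<^sup>2 * Bil v v \<le> Lam * ((p - 1) * M * \<epsilon>\<^sup>2 + K' * \<bar>\<epsilon>\<bar> ^ 3)" if \<epsilon>: "\<bar>\<epsilon>\<bar> \<le> d" for \<epsilon>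
  proof -
    have \<epsilon>1: "\<bar>\<epsilon>\<bar> \<le> 1 / 2" using \<epsilon> d by simp
    define c where "c = 1 + (p * (p - 1) / 2 * M * \<epsilon>\<^sup>2 + C * \<bar>\<epsilon>\<bar> ^ 3)"
    have c1: "1 \<le> c" using M0 C p1 by (simp add: c_def)
    define f where "f x = w x + \<epsilon> * v x" for x
    have f: "Lr p f" unfolding f_def[abs_def] by (intro Lr_add Lr_scale w v p0)
    have "(\<integral>x. \<bar>f x\<bar> powr p \<partial>S) \<le> (\<integral>x. \<bar>w x\<bar> powr p + (p * \<epsilon>) * (\<bar>w x\<bar> powr p * inner x e) + (p * (p - 1) / 2 * \<epsilon>\<^sup>2) * (\<bar>w x\<bar> powr p * (inner x e)\<^sup>2) + (C * \<bar>\<epsilon>\<bar> ^ 3) * \<bar>w x\<bar> powr p \<partial>S)"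
    proof (rule integral_mono)
      show "integrable S (\<lambda>x. \<bar>f x\<bar> powr p)" using f by (simp add: Lr_def)
      show "integrable S (\<lambda>x. \<bar>w x\<bar> powr p + (p * \<epsilon>) * (\<bar>w x\<bar> powr p * inner x e) + (p * (p - 1) / 2 * \<epsilon>\<^sup>2) * (\<bar>w x\<bar> powr p * (inner x e)\<^sup>2) + (C * \<bar>\<epsilon>\<bar> ^ 3) * \<bar>w x\<bar> powr p)"
        by (intro Bochner_Integration.integrable_add integrable_mult_right ip it it2)
      fix x assume "x \<in> space S"
      then have x: "norm x = 1" by simp
      define y where "y = \<epsilon> * inner x e"
      have ye: "\<bar>y\<bar> \<le> \<bar>\<epsilon>\<bar>" unfolding y_def abs_mult using mult_left_mono[OF \<psi>[OF x], of "\<bar>\<epsilon>\<bar>"] by simp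
      then have y: "\<bar>y\<bar> \<le> 1 / 2" using \<epsilon>1 by simp
      have "f x = w x * (1 + y)" by (simp add: f_def v_def y_def algebra_simps)
      then have "\<bar>f x\<bar> powr p = \<bar>w x\<bar> powr p * (1 + y) powr p" using y by (simp add: abs_mult powr_mult)
      also have "(1 + y) powr p \<le> 1 + p * y + p * (p - 1) / 2 * y\<^sup>2 + C * \<bar>\<epsilon>\<bar> ^ 3"
        using cub[OF y] mult_left_mono[OF power_mono[OF ye abs_ge_zero, of 3] C] by simp
      then have "\<bar>w x\<bar> powr p * (1 + y) powr p \<le> \<bar>w x\<bar> powr p * (1 + p * y + p * (p - 1) / 2 * y\<^sup>2 + C * \<bar>\<epsilon>\<bar> ^ 3)"
        by (intro mult_left_mono) auto
      finally show "\<bar>f x\<bar> powr p \<le> \<bar>w x\<bar> powr p + (p * \<epsilon>) * (\<bar>w x\<bar> powr p * inner x e) + (p * (p - 1) / 2 * \<epsilon>\<^sup>2) * (\<bar>w x\<bar> powr p * (inner x e)\<^sup>2) + (C * \<bar>\<epsilon>\<bar> ^ 3) * \<bar>w x\<bar> powr p"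
        by (simp add: y_def distrib_left power_mult_distrib mult_ac)
    qed
    also have "\<dots> = c"
      using ip it it2 T n by (simp add: c_def M_def[symmetric])
    finally have "Bil f f \<le> Lam * c powr (2 / p)" using c1 by (intro Bil_le_Lam_scaled f) auto
    moreover have "c powr (2 / p) \<le> 1 + ((p - 1) * M * \<epsilon>\<^sup>2 + K' * \<bar>\<epsilon>\<bar> ^ 3)"
    proof -
      define z where "z = 2 / p * (c - 1)"
      have z: "z = (p - 1) * M * \<epsilon>\<^sup>2 + 2 / p * C * \<bar>\<epsilon>\<bar> ^ 3" using p0 by (simp add: z_def c_def distrib_left)
      have e3: "\<bar>\<epsilon>\<bar> ^ 3 \<le> \<epsilon>\<^sup>2" using power_decreasing[of 2 3 "\<bar>\<epsilon>\<bar>"] \<epsilon>1 by simp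
      have e4: "\<epsilon> ^ 4 \<le> \<bar>\<epsilon>\<bar> ^ 3" using power_decreasing[of 3 4 "\<bar>\<epsilon>\<bar>"] \<epsilon>1 by simp
      have zK: "z \<le> K * \<epsilon>\<^sup>2" unfolding z K_def using mult_left_mono[OF e3, of "2 / p * C"] C p0 by (simp add: distrib_right)
      have z0: "0 \<le> z" using c1 p0 by (simp add: z_def)
      have "K * \<epsilon>\<^sup>2 \<le> K * d"
      proof (rule mult_left_mono[OF _ K])
        have "\<epsilon>\<^sup>2 = \<bar>\<epsilon>\<bar> * \<bar>\<epsilon>\<bar>" by (simp add: power2_eq_square)
        also have "\<dots> \<le> \<bar>\<epsilon>\<bar> * 1" using \<epsilon>1 by (intro mult_left_mono) auto
        finally show "\<epsilon>\<^sup>2 \<le> d" using \<epsilon> by simp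
      qed
      then have "z \<le> 1 / 2" using zK d by linarith
      then have "(1 + (c - 1)) powr (2 / p) \<le> 1 + z + 2 * z\<^sup>2"
        using c1 p0 unfolding z_def by (intro powr_le_quadratic) auto
      moreover have "z\<^sup>2 \<le> K\<^sup>2 * \<bar>\<epsilon>\<bar> ^ 3"
      proof -
        have "z\<^sup>2 \<le> (K * \<epsilon>\<^sup>2)\<^sup>2" using zK z0 by (rule power_mono)
        also have "\<dots> = K\<^sup>2 * \<epsilon> ^ 4" by (simp add: power_mult_distrib flip: power_mult)
        also have "\<dots> \<le> K\<^sup>2 * \<bar>\<epsilon>\<bar> ^ 3" using e4 by (intro mult_left_mono) auto
        finally show ?thesis .
      qed
      ultimately have "c powr (2 / p) \<le> 1 + z + 2 * (K\<^sup>2 * \<bar>\<epsilon>\<bar> ^ 3)" by simp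
      then show ?thesis unfolding z K'_def by (simp add: algebra_simps)
    qed
    then have "Lam * c powr (2 / p) \<le> Lam * (1 + ((p - 1) * M * \<epsilon>\<^sup>2 + K' * \<bar>\<epsilon>\<bar> ^ 3))" using Lam_pos by (intro mult_left_mono) auto
    moreover have "Bil f f = Lam + 2 * \<epsilon> * Bil w v + \<epsilon>\<^sup>2 * Bil v v"
      unfolding f_def[abs_def] Bil_quadratic[OF w(1) v] B ..
    ultimately show ?thesis by (simp add: distrib_left)
  qed
  have "Bil v v - (p - 1) * Lam * M \<le> 0"
  proof (rule linear_coefficient_nonpos[OF d(1)])
    fix \<epsilon> :: real assume \<epsilon>: "0 < \<epsilon>" "\<epsilon> \<le> d"
    have "\<epsilon> * ((Bil v v - (p - 1) * Lam * M) * \<epsilon>) \<le> \<epsilon> * (Lam * K' * \<epsilon>\<^sup>2)"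
      using var[of \<epsilon>] var[of "- \<epsilon>"] \<epsilon> by (simp add: power2_eq_square power3_eq_cube algebra_simps)
    then show "(Bil v v - (p - 1) * Lam * M) * \<epsilon> \<le> Lam * K' * \<epsilon>\<^sup>2" using \<epsilon>(1) by (simp only: mult_le_cancel_left_pos)
  qed
  then show ?thesis by (simp add: M_def)
qed

text \<open>Summing over an orthonormal basis turns the products of coordinates into the real part of the
  hermitian product.\<close>

lemma weighted_energy_le:
  fixes w :: "complex ^ 'n \<Rightarrow> real"
  assumes w: "Lr p w" "\<And>x. 0 \<le> w x" and n: "(\<integral>x. \<bar>w x\<bar> powr p \<partial>S) = 1" and B: "Bil w w = Lam"
  shows "kform (\<lambda>w. Re w * kern \<alpha> w) w \<le> (p - 1) * Lam"
proof -
  have \<psi>: "\<bar>inner x e\<bar> \<le> 1" if "norm x = 1" "e \<in> Basis" for x e :: "complex ^ 'n"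
    using order_trans[OF Cauchy_Schwarz_ineq2[of x e]] that by auto
  have \<psi>m: "(\<lambda>x. inner x e) \<in> borel_measurable S" for e using measurable_sphere_borel by measurable
  have ip: "integrable S (\<lambda>x. \<bar>w x\<bar> powr p)" using w by (simp add: Lr_def)
  have it2: "integrable S (\<lambda>x. \<bar>w x\<bar> powr p * (inner x e)\<^sup>2)" if "e \<in> Basis" for e
    using \<psi>m[of e] by (intro integrable_bounded_factor[OF ip, where B=1]) (use \<psi> that in \<open>auto simp: abs_square_le_1\<close>)
  have v: "Lr p (\<lambda>x. w x * inner x e)" if "e \<in> Basis" for e by (rule Lr_mult_bounded[OF w(1) \<psi>m _ p0, where B=1]) (use \<psi> that in auto)
  have "kform (\<lambda>w. Re w * kern \<alpha> w) w = (\<integral>z. (\<Sum>e\<in>Basis. w (fst z) * inner (fst z) e * (w (snd z) * inner (snd z) e) * kern \<alpha> (hp (fst z) (snd z))) \<partial>sph2)"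
    unfolding kform_def
  proof (rule Bochner_Integration.integral_cong[OF refl])
    fix z :: "(complex ^ 'n) \<times> (complex ^ 'n)"
    have "(\<Sum>e\<in>Basis. w (fst z) * inner (fst z) e * (w (snd z) * inner (snd z) e) * kern \<alpha> (hp (fst z) (snd z)))
      = (\<Sum>e\<in>Basis. inner (fst z) e * inner (snd z) e) * (w (fst z) * w (snd z) * kern \<alpha> (hp (fst z) (snd z)))"
      unfolding sum_distrib_right by (simp add: mult_ac)
    also have "\<dots> = w (fst z) * w (snd z) * (Re (hp (fst z) (snd z)) * kern \<alpha> (hp (fst z) (snd z)))"
      unfolding euclidean_inner[symmetric] Re_hp by (simp add: mult_ac)
    finally show "w (fst z) * w (snd z) * (Re (hp (fst z) (snd z)) * kern \<alpha> (hp (fst z) (snd z)))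
      = (\<Sum>e\<in>Basis. w (fst z) * inner (fst z) e * (w (snd z) * inner (snd z) e) * kern \<alpha> (hp (fst z) (snd z)))" ..
  qed
  also have "\<dots> = (\<Sum>e\<in>Basis. Bil (\<lambda>x. w x * inner x e) (\<lambda>x. w x * inner x e))"
    unfolding Bil_def by (intro Bochner_Integration.integral_sum integrable_Bil v)
  also have "\<dots> \<le> (\<Sum>e\<in>Basis. (p - 1) * Lam * (\<integral>x. \<bar>w x\<bar> powr p * (inner x e)\<^sup>2 \<partial>S))"
    by (intro sum_mono second_variation w n B) auto
  also have "\<dots> = (p - 1) * Lam * (\<integral>x. (\<Sum>e\<in>Basis. \<bar>w x\<bar> powr p * (inner x e)\<^sup>2) \<partial>S)"
    by (simp add: sum_distrib_left Bochner_Integration.integral_sum it2)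
  also have "(\<integral>x. (\<Sum>e\<in>Basis. \<bar>w x\<bar> powr p * (inner x e)\<^sup>2) \<partial>S) = (\<integral>x. \<bar>w x\<bar> powr p \<partial>S)"
  proof (rule Bochner_Integration.integral_cong[OF refl])
    fix x :: "complex ^ 'n" assume "x \<in> space S"
    then have "(\<Sum>e\<in>Basis. (inner x e)\<^sup>2) = 1"
      using euclidean_inner[of x x] by (simp add: power2_eq_square norm_eq_1)
    then show "(\<Sum>e\<in>Basis. \<bar>w x\<bar> powr p * (inner x e)\<^sup>2) = \<bar>w x\<bar> powr p" unfolding sum_distrib_left[symmetric] by simp
  qed
  finally show ?thesis using n by simp
qed

context
  fixes u :: "complex ^ 'n \<Rightarrow> real"
  assumes max: "nonneg_maximizer (4 * \<alpha>) p u"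
begin

lemma Lr_abs_maximizer: "Lr p (\<lambda>x. \<bar>u x\<bar>)"
  by (rule Lr_abs[OF nonneg_maximizerD(1)[OF max]])

lemma Bil_abs_maximizer: "Bil (\<lambda>x. \<bar>u x\<bar>) (\<lambda>x. \<bar>u x\<bar>) = Lam"
proof (rule antisym)
  note D = nonneg_maximizerD[OF max]
  show "Lam \<le> Bil (\<lambda>x. \<bar>u x\<bar>) (\<lambda>x. \<bar>u x\<bar>)" using Bil_abs_le[OF D(1) D(1)] D(4) by linarith
  show "Bil (\<lambda>x. \<bar>u x\<bar>) (\<lambda>x. \<bar>u x\<bar>) \<le> Lam"
    using Lr_abs_maximizer D(3) by (intro Bil_le_Lam) (simp add: unit_ball_def)
qed

text \<open>Combine the second variation with the spectral gap, and bound \<open>Lam\<close> from below by the energy of the normalised constant. For \<open>p\<close> far from the critical exponent the left-hand side is negative.\<close>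
lemma mean_lower_bound:
  defines "\<omega> \<equiv> smom TYPE('n) 0" and "g \<equiv> gap \<alpha> (real CARD('n))" and "q \<equiv> crit_exp \<alpha> (real CARD('n))"
  shows "(\<omega> powr (- (1 / p)))\<^sup>2 * (1 - (p - q) / g) \<le> ((\<integral>x. \<bar>u x\<bar> \<partial>S) / \<omega>)\<^sup>2"
proof (cases "p - q < g")
  case True
  let ?w = "\<lambda>x. \<bar>u x\<bar>"
  note D = nonneg_maximizerD[OF max]
  have \<omega>: "0 < \<omega>" unfolding \<omega>_def by (rule smom_pos)
  have g: "0 < g" unfolding g_def by (rule gap_pos[OF \<alpha>])
  define c where "c = (\<integral>x. \<bar>u x\<bar> \<partial>S) / \<omega>"
  define B1 where "B1 = Bil (\<lambda>_. 1) (\<lambda>_. 1)"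
  have B1: "0 < B1" unfolding B1_def by (rule Bil_one_pos)
  have cr: "crit \<alpha> (real CARD('n)) = q - 1" using \<alpha> by (simp add: crit_def q_def crit_exp_def field_simps)
  have "g * (Bil ?w ?w - Bil (\<lambda>_. c) (\<lambda>_. c)) \<le> kform (\<lambda>w. Re w * kern \<alpha> w) ?w - crit \<alpha> (real CARD('n)) * Bil ?w ?w"
    unfolding Bil_kform g_def
  proof (rule spectral_gap)
    show "integrable S ?w" using Lr_integrable(1)[OF D(1)] p1 by simp
    show "integrable sph2 (\<lambda>q. ?w (fst q) * ?w (snd q) * kern \<alpha> (hp (fst q) (snd q)))" by (rule integrable_Bil[OF Lr_abs_maximizer Lr_abs_maximizer])
    show "c * smom TYPE('n) 0 = (\<integral>x. ?w x \<partial>S)" using \<omega> by (simp add: c_def \<omega>_def)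
  qed (use \<alpha> in auto)
  moreover have "kform (\<lambda>w. Re w * kern \<alpha> w) ?w \<le> (p - 1) * Lam"
    using D(3) by (intro weighted_energy_le Lr_abs_maximizer Bil_abs_maximizer) auto
  moreover have bc: "Bil (\<lambda>_. c) (\<lambda>_. c) = c\<^sup>2 * B1"
    using Bil_scale[where c=c and f="\<lambda>_. 1"] by (simp add: B1_def power2_eq_square)
  ultimately have "g * (Lam - c\<^sup>2 * B1) \<le> (p - 1) * Lam - (q - 1) * Lam" unfolding Bil_abs_maximizer cr bc by linarith
  also have "\<dots> = (p - q) * Lam" by (simp add: algebra_simps)
  finally have "g * (Lam - c\<^sup>2 * B1) \<le> (p - q) * Lam" .
  then have "(g - (p - q)) * Lam \<le> g * (c\<^sup>2 * B1)" by (simp add: algebra_simps)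
  moreover have "(g - (p - q)) * ((\<omega> powr (- (1 / p)))\<^sup>2 * B1) \<le> (g - (p - q)) * Lam"
    using Lam_ge_const[OF refl] True unfolding \<omega>_def B1_def by (intro mult_left_mono) auto
  ultimately have "(g - (p - q)) * (\<omega> powr (- (1 / p)))\<^sup>2 * B1 \<le> g * c\<^sup>2 * B1" by (simp add: mult.assoc)
  then have "(g - (p - q)) * (\<omega> powr (- (1 / p)))\<^sup>2 \<le> g * c\<^sup>2" using B1 by (simp only: mult_le_cancel_right_pos)
  then have "g * ((\<omega> powr (- (1 / p)))\<^sup>2 * (1 - (p - q) / g)) \<le> g * c\<^sup>2" 
  proof -
    have "g * (X * (1 - a / g)) = (g - a) * X" for a X using g by (simp add: field_simps)
    then show ?thesis using \<open>(g - (p - q)) * (\<omega> powr (- (1 / p)))\<^sup>2 \<le> g * c\<^sup>2\<close> by metis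
  qed
  then show ?thesis using g unfolding c_def by (simp only: mult_le_cancel_left_pos)
next
  case False
  have g: "0 < g" unfolding g_def by (rule gap_pos[OF \<alpha>])
  have "1 - (p - q) / g \<le> 0" using False g by (simp add: le_divide_eq)
  then have "(\<omega> powr (- (1 / p)))\<^sup>2 * (1 - (p - q) / g) \<le> 0" by (intro mult_nonneg_nonpos) auto
  then show ?thesis using zero_le_power2[of "(\<integral>x. \<bar>u x\<bar> \<partial>S) / \<omega>"] by linarith
qed

text \<open>Holder on a space of finite measure.\<close>
lemma maximizer_power_le:
  assumes q: "1 < q" "q < p"
  defines "\<omega> \<equiv> smom TYPE('n) 0"
  shows "(\<integral>x. \<bar>u x\<bar> powr q \<partial>S) \<le> \<omega> powr (1 - q / p)"
proof -
  note D = nonneg_maximizerD[OF max]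
  have \<omega>: "0 < \<omega>" unfolding \<omega>_def by (rule smom_pos)
  have "\<omega> powr (q / p) * (\<integral>x. \<bar>u x\<bar> powr q \<partial>S) = (\<integral>x. \<omega> powr (q / p) * \<bar>u x\<bar> powr q \<partial>S)" by simp
  also have "\<dots> \<le> (\<integral>x. (q / p * \<omega>) * \<bar>u x\<bar> powr p + (1 - q / p) \<partial>S)"
  proof (rule integral_mono)
    show "integrable S (\<lambda>x. \<omega> powr (q / p) * \<bar>u x\<bar> powr q)" using Lr_integrable_powr(1)[OF D(1)] q by simp
    show "integrable S (\<lambda>x. (q / p * \<omega>) * \<bar>u x\<bar> powr p + (1 - q / p))" using D(1) by (simp add: Lr_def)
    fix x assume "x \<in> space S"
    show "\<omega> powr (q / p) * \<bar>u x\<bar> powr q \<le> (q / p * \<omega>) * \<bar>u x\<bar> powr p + (1 - q / p)"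
    proof (cases "u x = 0")
      case False
      have "(\<omega> * \<bar>u x\<bar> powr p) powr (q / p) * 1 powr (1 - q / p) \<le> q / p * (\<omega> * \<bar>u x\<bar> powr p) + (1 - q / p) * 1"
        using q p0 False \<omega> by (intro Youngs_inequality_0) auto
      then show ?thesis using \<omega> p0 by (simp add: powr_mult powr_powr mult_ac)
    qed (use q p0 in auto)
  qed
  also have "\<dots> = \<omega>" using D(1,3) by (simp add: Lr_def \<omega>_def smom_0) (simp add: algebra_simps)
  finally have "(\<integral>x. \<bar>u x\<bar> powr q \<partial>S) \<le> \<omega> / \<omega> powr (q / p)" using \<omega> by (simp add: pos_le_divide_eq mult.commute)
  also have "\<dots> = \<omega> powr (1 - q / p)" using \<omega> by (simp add: powr_diff)
  finally show ?thesis .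
qed

end

end

section \<open>The critical limit\<close>

text \<open>In terms of \<open>s = t\<^bsup>q/2\<^esup>\<close> the claim is \<open>t \<le> (2/q - 1) s\<^sup>2 + (2 - 2/q) s\<close>, which is the weighted inequality of the means, since \<open>t = s\<^bsup>2/q\<^esup>\<close> and \<open>1 \<le> 2/q \<le> 2\<close>.\<close>
lemma convexity_gap:
  fixes q t :: real
  assumes q: "1 < q" "q \<le> 2" and t: "0 \<le> t"
  shows "(q - 1) * (t powr (q / 2) - 1)\<^sup>2 \<le> t powr q - 1 - q * (t - 1)"
proof (cases "t = 0")
  case False
  then have t: "0 < t" using t by simp
  define s where "s = t powr (q / 2)"
  have s2: "s\<^sup>2 = t powr q" by (simp add: s_def power2_eq_square flip: powr_add)
  have "(t powr q) powr (2 / q - 1) * s powr (1 - (2 / q - 1)) \<le> (2 / q - 1) * t powr q + (1 - (2 / q - 1)) * s"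
    using q t by (intro Youngs_inequality_0) (auto simp: s_def field_simps)
  also have "(t powr q) powr (2 / q - 1) * s powr (1 - (2 / q - 1)) = t powr (q * (2 / q - 1) + q / 2 * (1 - (2 / q - 1)))"
    unfolding s_def powr_powr powr_add ..
  also have "q * (2 / q - 1) + q / 2 * (1 - (2 / q - 1)) = 1" using q by (simp add: field_simps)
  finally have "t \<le> (2 / q - 1) * t powr q + (1 - (2 / q - 1)) * s" using t by simp
  then have "q * t \<le> q * ((2 / q - 1) * t powr q + (1 - (2 / q - 1)) * s)" using q by (intro mult_left_mono) auto
  also have "\<dots> = (2 - q) * t powr q + (2 * q - 2) * s" using q by (simp add: field_simps)
  finally show ?thesis unfolding s_def[symmetric] s2[symmetric] by (simp add: power2_eq_square algebra_simps)
qed (use q in simp)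

text \<open>Quantitative strict convexity of \<open>t\<^sup>q\<close> at 1. Where \<open>t\<close> is far from 1 the gap controls the whole growth of \<open>\<bar>t - 1\<bar>\<^sup>q\<close>.\<close>
lemma powr_distance_le:
  fixes q \<delta> :: real
  assumes q: "1 < q" "q \<le> 2" and \<delta>: "0 < \<delta>"
  obtains C where "0 \<le> C" "\<And>t. 0 \<le> t \<Longrightarrow> \<bar>t - 1\<bar> powr q \<le> \<delta> + C * (t powr q - 1 - q * (t - 1))"
proof -
  have "(\<lambda>s::real. s powr (2 / q)) \<midarrow>1\<rightarrow> 1 powr (2 / q)" by (intro tendsto_intros) auto
  moreover have "0 < \<delta> powr (1 / q)" using \<delta> by simp
  ultimately obtain \<eta> where \<eta>: "0 < \<eta>" and near: "\<And>s. s \<noteq> 1 \<Longrightarrow> \<bar>s - 1\<bar> < \<eta> \<Longrightarrow> \<bar>s powr (2 / q) - 1\<bar> < \<delta> powr (1 / q)"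
    unfolding LIM_eq by (metis powr_one_eq_one real_norm_def)
  define C where "C = 2 powr q * (2 / \<eta> + 1)\<^sup>2 / (q - 1)"
  have C: "0 \<le> C" using q by (simp add: C_def)
  show ?thesis
  proof (rule that[OF C])
    fix t :: real assume t: "0 \<le> t"
    define s where "s = t powr (q / 2)"
    define \<Phi> where "\<Phi> = t powr q - 1 - q * (t - 1)"
    have s2: "s\<^sup>2 = t powr q" by (simp add: s_def power2_eq_square flip: powr_add)
    have s0: "0 \<le> s" by (simp add: s_def)
    have st: "s powr (2 / q) = t" using q t by (simp add: s_def powr_powr)
    have gap: "(q - 1) * (s - 1)\<^sup>2 \<le> \<Phi>" unfolding s_def \<Phi>_def by (rule convexity_gap[OF q t])
    then have \<Phi>: "0 \<le> \<Phi>" using q by (meson mult_nonneg_nonneg order_trans zero_le_power2 diff_ge_0_iff_ge less_imp_le)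
    show "\<bar>t - 1\<bar> powr q \<le> \<delta> + C * (t powr q - 1 - q * (t - 1))"
    proof (cases "\<bar>s - 1\<bar> < \<eta>")
      case True
      have "\<bar>t - 1\<bar> \<le> \<delta> powr (1 / q)"
      proof (cases "s = 1")
        case True then show ?thesis using st by simp
      next
        case False then show ?thesis using near[OF False True] unfolding st by simp
      qed
      then have "\<bar>t - 1\<bar> powr q \<le> (\<delta> powr (1 / q)) powr q" using q by (intro powr_mono2) auto
      also have "\<dots> = \<delta>" using q \<delta> by (simp add: powr_powr)
      finally show ?thesis using mult_nonneg_nonneg[OF C \<Phi>] by (simp add: \<Phi>_def)
    next
      case False
      have "\<bar>t - 1\<bar> powr q \<le> (2 * max 1 t) powr q" using t q by (intro powr_mono2) auto
      also have "\<dots> = 2 powr q * max 1 t powr q" using t by (simp add: powr_mult)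
      also have "max 1 t powr q \<le> 1 + t powr q" by (simp add: max_def)
      also have "1 + t powr q \<le> (1 + s)\<^sup>2" unfolding s2[symmetric] using s0 by (simp add: power2_eq_square algebra_simps)
      also have "(1 + s)\<^sup>2 \<le> ((2 / \<eta> + 1) * \<bar>s - 1\<bar>)\<^sup>2"
      proof (rule power_mono)
        have "2 \<le> 2 / \<eta> * \<bar>s - 1\<bar>" using False \<eta> by (simp add: field_simps)
        then show "1 + s \<le> (2 / \<eta> + 1) * \<bar>s - 1\<bar>" by (simp add: distrib_right)
      qed (use s0 in simp)
      also have "2 powr q * ((2 / \<eta> + 1) * \<bar>s - 1\<bar>)\<^sup>2 = C * ((q - 1) * (s - 1)\<^sup>2)" using q by (simp add: C_def power_mult_distrib)
      also have "\<dots> \<le> C * \<Phi>" by (rule mult_left_mono[OF gap C])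
      finally show ?thesis using \<delta> by (simp add: \<Phi>_def)
    qed
  qed
qed

text \<open>A bound for the integral of \<open>t\<^sup>q - 1 - q (t - 1)\<close> where \<open>t\<close> is the maximizer divided by the limiting constant.\<close>
definition excess :: "real \<Rightarrow> real \<Rightarrow> real \<Rightarrow> real \<Rightarrow> real" where
  "excess \<omega> g q p = \<omega> * \<omega> powr (1 - q / p) - \<omega>
     - q * (\<omega> * sqrt ((\<omega> powr (- (1 / p)))\<^sup>2 * (1 - (p - q) / g)) / \<omega> powr (- (1 / q)) - \<omega>)"

lemma excess_tendsto:
  assumes "0 < \<omega>" "0 < q" "g \<noteq> 0"
  shows "(excess \<omega> g q \<longlongrightarrow> 0) (at_right q)"
proof -
  have "(excess \<omega> g q \<longlongrightarrow> \<omega> * \<omega> powr (1 - q / q) - \<omega>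
     - q * (\<omega> * sqrt ((\<omega> powr (- (1 / q)))\<^sup>2 * (1 - (q - q) / g)) / \<omega> powr (- (1 / q)) - \<omega>)) (at_right q)"
    unfolding excess_def[abs_def] using assms by (intro tendsto_intros) auto
  then show ?thesis using assms by simp
qed

lemma (in subcritical) maximizer_distance:
  defines "\<omega> \<equiv> smom TYPE('n) 0" and "g \<equiv> gap \<alpha> (real CARD('n))" and "q \<equiv> crit_exp \<alpha> (real CARD('n))"
  defines "a \<equiv> \<omega> powr (- (1 / q))"
  assumes max: "nonneg_maximizer (4 * \<alpha>) p u"
    and C: "0 \<le> C" "\<And>t. 0 \<le> t \<Longrightarrow> \<bar>t - 1\<bar> powr q \<le> \<delta> + C * (t powr q - 1 - q * (t - 1))"
    and c: "0 \<le> c" "a powr q * (\<delta> * \<omega> + C * excess \<omega> g q p) \<le> c powr q"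
  shows "Lp_norm S q (\<lambda>x. u x - a) \<le> ennreal c"
proof -
  note D = nonneg_maximizerD[OF max]
  have \<omega>: "0 < \<omega>" unfolding \<omega>_def by (rule smom_pos)
  have q: "1 < q" "q < p" using \<alpha> pN by (auto simp: q_def crit_exp_def less_divide_eq)
  have a: "0 < a" using \<omega> by (simp add: a_def)
  have aq: "a powr q = 1 / \<omega>" using \<omega> q unfolding a_def powr_powr by (simp add: powr_minus_divide)
  have [measurable]: "u \<in> borel_measurable S" by (rule Lr_measurable[OF D(1)])
  define t where "t x = \<bar>u x\<bar> / a" for x
  have t0: "0 \<le> t x" for x using a by (simp add: t_def)
  have tq: "t x powr q = \<omega> * \<bar>u x\<bar> powr q" for x using a \<omega> by (simp add: t_def powr_divide aq)
  have iq: "integrable S (\<lambda>x. \<bar>u x\<bar> powr q)" using Lr_integrable_powr(1)[OF D(1)] q by simp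
  have i1: "integrable S (\<lambda>x. \<bar>u x\<bar>)" using Lr_integrable(1)[OF D(1)] p1 by simp
  have iF: "integrable S (\<lambda>x. a powr q * (\<delta> + C * (t x powr q - 1 - q * (t x - 1))))"
    unfolding tq using iq i1 by (simp add: t_def)
  have pt: "\<bar>\<bar>u x\<bar> - a\<bar> powr q \<le> a powr q * (\<delta> + C * (t x powr q - 1 - q * (t x - 1)))" for x
  proof -
    have "\<bar>\<bar>u x\<bar> - a\<bar> = a * \<bar>t x - 1\<bar>"
    proof -
      have "\<bar>u x\<bar> - a = a * (t x - 1)" using a by (simp add: t_def right_diff_distrib)
      then show ?thesis using a by (simp add: abs_mult)
    qed
    then have "\<bar>\<bar>u x\<bar> - a\<bar> powr q = a powr q * \<bar>t x - 1\<bar> powr q" using a by (simp add: powr_mult)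
    also have "\<dots> \<le> a powr q * (\<delta> + C * (t x powr q - 1 - q * (t x - 1)))" by (intro mult_left_mono C(2) t0) simp
    finally show ?thesis .
  qed
  have mean: "sqrt ((\<omega> powr (- (1 / p)))\<^sup>2 * (1 - (p - q) / g)) \<le> (\<integral>x. \<bar>u x\<bar> \<partial>S) / \<omega>"
  proof -
    have "0 \<le> (\<integral>x. \<bar>u x\<bar> \<partial>S)" by (intro integral_nonneg_AE AE_I2) simp
    then have "sqrt (((\<integral>x. \<bar>u x\<bar> \<partial>S) / \<omega>)\<^sup>2) = (\<integral>x. \<bar>u x\<bar> \<partial>S) / \<omega>" using \<omega> by simp
    moreover have "sqrt ((\<omega> powr (- (1 / p)))\<^sup>2 * (1 - (p - q) / g)) \<le> sqrt (((\<integral>x. \<bar>u x\<bar> \<partial>S) / \<omega>)\<^sup>2)"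
      using mean_lower_bound[OF max] unfolding \<omega>_def g_def q_def by (rule real_sqrt_le_mono)
    ultimately show ?thesis by linarith
  qed
  define m where "m = (\<integral>x. \<bar>u x\<bar> \<partial>S)"
  define r where "r = sqrt ((\<omega> powr (- (1 / p)))\<^sup>2 * (1 - (p - q) / g))"
  have rm: "\<omega> * r \<le> m" using mean \<omega> by (simp add: r_def m_def pos_le_divide_eq mult.commute)
  have "(\<integral>x. a powr q * (\<delta> + C * (t x powr q - 1 - q * (t x - 1))) \<partial>S)
     = a powr q * (\<delta> * \<omega> + C * (\<omega> * (\<integral>x. \<bar>u x\<bar> powr q \<partial>S) - \<omega> - q * (m / a - \<omega>)))"
    unfolding tq using iq i1 by (simp add: t_def m_def \<omega>_def smom_0)
  also have "\<dots> \<le> a powr q * (\<delta> * \<omega> + C * (\<omega> * \<omega> powr (1 - q / p) - \<omega> - q * (\<omega> * r / a - \<omega>)))"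
    using maximizer_power_le[OF max q] rm \<omega> a q C(1) unfolding \<omega>_def[symmetric]
    by (intro mult_left_mono add_left_mono diff_mono diff_right_mono divide_right_mono order_refl) auto
  also have "\<dots> = a powr q * (\<delta> * \<omega> + C * excess \<omega> g q p)" by (simp add: excess_def r_def a_def)
  finally have I: "(\<integral>x. a powr q * (\<delta> + C * (t x powr q - 1 - q * (t x - 1))) \<partial>S) \<le> a powr q * (\<delta> * \<omega> + C * excess \<omega> g q p)" .
  have F0: "0 \<le> a powr q * (\<delta> + C * (t x powr q - 1 - q * (t x - 1)))" for x
    using pt[of x] powr_ge_zero[of "\<bar>\<bar>u x\<bar> - a\<bar>" q] by linarith
  show ?thesis
  proof (rule Lp_norm_le)
    have "(\<integral>\<^sup>+x. ennreal (norm (u x - a) powr q) \<partial>S) \<le> (\<integral>\<^sup>+x. ennreal (a powr q * (\<delta> + C * (t x powr q - 1 - q * (t x - 1)))) \<partial>S)"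
    proof (rule nn_integral_mono_AE)
      show "AE x in S. ennreal (norm (u x - a) powr q) \<le> ennreal (a powr q * (\<delta> + C * (t x powr q - 1 - q * (t x - 1))))"
        using D(2)
      proof eventually_elim
        case (elim x)
        then show ?case using pt[of x] by (intro ennreal_leI) simp
      qed
    qed
    also have "\<dots> = ennreal (\<integral>x. a powr q * (\<delta> + C * (t x powr q - 1 - q * (t x - 1))) \<partial>S)"
      by (rule nn_integral_eq_integral[OF iF]) (simp add: F0)
    also have "\<dots> \<le> ennreal (a powr q * (\<delta> * \<omega> + C * excess \<omega> g q p))" by (rule ennreal_leI[OF I])
    also have "\<dots> \<le> ennreal (c powr q)" by (rule ennreal_leI[OF c(2)])
    finally show "(\<integral>\<^sup>+x. ennreal (norm (u x - a) powr q) \<partial>S) \<le> ennreal (c powr q)" .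
  qed (use q c in auto)
qed

lemma maximizers_tendsto_constant:
  fixes u :: "real \<Rightarrow> complex ^ 'n::finite \<Rightarrow> real"
  assumes \<alpha>: "0 < \<alpha>" "2 * \<alpha> < real CARD('n)"
  defines "q \<equiv> crit_exp \<alpha> (real CARD('n))"
  assumes max: "\<And>p. q < p \<Longrightarrow> nonneg_maximizer (4 * \<alpha>) p (u p)"
  shows "((\<lambda>p. Lp_norm surf q (\<lambda>x. u p x - smom TYPE('n) 0 powr (- (1 / q)))) \<longlongrightarrow> 0) (at_right q)"
proof (rule order_tendstoI)
  define \<omega> where "\<omega> = smom TYPE('n) 0"
  define g where "g = gap \<alpha> (real CARD('n))"
  define a where "a = \<omega> powr (- (1 / q))"
  have \<omega>: "0 < \<omega>" unfolding \<omega>_def by (rule smom_pos)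
  have g: "0 < g" unfolding g_def by (rule gap_pos[OF \<alpha>])
  have q: "1 < q" "q \<le> 2" using \<alpha> by (auto simp: q_def crit_exp_def divide_simps)
  have a: "0 < a" using \<omega> by (simp add: a_def)
  fix E :: ennreal assume "0 < E"
  then obtain \<epsilon> :: real where \<epsilon>: "0 < \<epsilon>" "ennreal \<epsilon> < E"
  proof -
    obtain z where z: "0 < z" "z < E" using dense[OF \<open>0 < E\<close>] by blast
    then show ?thesis using that[of "enn2real z"] by (cases z) auto
  qed
  define \<delta> where "\<delta> = \<epsilon> powr q / (2 * (a powr q * \<omega>))"
  have \<delta>: "0 < \<delta>" using \<epsilon> a \<omega> by (simp add: \<delta>_def)
  obtain C where C: "0 \<le> C" "\<And>t. 0 \<le> t \<Longrightarrow> \<bar>t - 1\<bar> powr q \<le> \<delta> + C * (t powr q - 1 - q * (t - 1))"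
    using powr_distance_le[OF q \<delta>] by blast
  have "((\<lambda>p. a powr q * (\<delta> * \<omega> + C * excess \<omega> g q p)) \<longlongrightarrow> a powr q * (\<delta> * \<omega> + C * 0)) (at_right q)"
    using \<omega> g q by (intro tendsto_intros excess_tendsto) auto
  moreover have "a powr q * (\<delta> * \<omega> + C * 0) < \<epsilon> powr q" using a \<omega> \<epsilon> by (simp add: \<delta>_def)
  ultimately have ev: "\<forall>\<^sub>F p in at_right q. a powr q * (\<delta> * \<omega> + C * excess \<omega> g q p) < \<epsilon> powr q" by (rule order_tendstoD(2))
  show "\<forall>\<^sub>F p in at_right q. Lp_norm surf q (\<lambda>x. u p x - smom TYPE('n) 0 powr (- (1 / q))) < E"
    using ev eventually_at_right_less[of q]
  proof eventually_elim
    case (elim p)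
    interpret subcritical "TYPE('n)" \<alpha> p by unfold_locales (use \<alpha> elim in \<open>auto simp: q_def crit_exp_def\<close>)
    have "Lp_norm surf q (\<lambda>x. u p x - a) \<le> ennreal \<epsilon>"
      using maximizer_distance[OF max[OF elim(2)] C(1), of \<delta> \<epsilon>] C(2) elim(1) \<epsilon>(1)
      unfolding q_def \<omega>_def g_def a_def by simp
    also have "\<dots> < E" by (rule \<epsilon>(2))
    finally show ?case by (simp add: a_def \<omega>_def)
  qed
qed simp

theorem mainTheorem2:
  fixes m :: nat and Q lam p\<^sub>0 :: real
  assumes "m \<ge> 1"
    and "CARD('n::finite) = m + 1"
    and "Q = 2 * real m + 2"
    and "0 < lam" and "lam < Q"
    and "p\<^sub>0 = 2 * Q / (2 * Q - lam)"
  shows "(\<forall>p>p\<^sub>0. I_sup TYPE('n) lam p < \<infinity> \<and>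
                   (\<exists>u :: complex ^ 'n \<Rightarrow> real. nonneg_maximizer lam p u)) \<and>
         (\<forall>u :: real \<Rightarrow> complex ^ 'n \<Rightarrow> real.
            (\<forall>p>p\<^sub>0. nonneg_maximizer lam p (u p)) \<longrightarrow>
            (\<exists>c :: real.
               ((\<lambda>p. Lp_norm sphere_measure p\<^sub>0 (\<lambda>\<xi>. u p \<xi> - c)) \<longlongrightarrow> 0) (at_right p\<^sub>0)))"
proof -
  define \<alpha> where "\<alpha> = lam / 4"
  have lam: "lam = 4 * \<alpha>" by (simp add: \<alpha>_def)
  have N: "real CARD('n) = Q / 2" using assms by simp
  have \<alpha>: "0 < \<alpha>" "2 * \<alpha> < real CARD('n)" unfolding N using assms by (auto simp: \<alpha>_def)
  have p\<^sub>0: "p\<^sub>0 = crit_exp \<alpha> (real CARD('n))"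
  proof -
    have "p\<^sub>0 = (4 * (Q / 2)) / (4 * (Q / 2 - \<alpha>))" by (simp add: assms(6) \<alpha>_def)
    then show ?thesis unfolding N crit_exp_def by (simp only: mult_divide_mult_cancel_left)
  qed
  show ?thesis
  proof (intro conjI allI impI)
    fix p assume "p\<^sub>0 < p"
    then interpret subcritical "TYPE('n)" \<alpha> p by unfold_locales (use \<alpha> in \<open>auto simp: p\<^sub>0 crit_exp_def\<close>)
    show "I_sup TYPE('n) lam p < \<infinity>" unfolding lam I_sup_eq by simp
    show "\<exists>u :: complex ^ 'n \<Rightarrow> real. nonneg_maximizer lam p u" unfolding lam by (rule exists_maximizer)
  next
    fix u :: "real \<Rightarrow> complex ^ 'n \<Rightarrow> real"
    assume "\<forall>p>p\<^sub>0. nonneg_maximizer lam p (u p)"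
    then have "\<And>p. crit_exp \<alpha> (real CARD('n)) < p \<Longrightarrow> nonneg_maximizer (4 * \<alpha>) p (u p)" unfolding lam p\<^sub>0 by blast
    from maximizers_tendsto_constant[OF \<alpha> this]
    show "\<exists>c. ((\<lambda>p. Lp_norm surf p\<^sub>0 (\<lambda>\<xi>. u p \<xi> - c)) \<longlongrightarrow> 0) (at_right p\<^sub>0)" unfolding p\<^sub>0 by blast
  qed
qed

end
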